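(* Let $\kappa \le \infty$ be an uncountable regular cardinal and let $\mathcal{C}$ be a category with pullbacks. Then $$\mathrm{Sind}_\kappa(\mathcal{C}) \simeq \mathrm{Ind}_\kappa(\mathrm{Rec}(\mathcal{C}))$$ via the restricted Yoneda embedding $\mathrm{Sind}_\kappa(\mathcal{C}) \to [\mathrm{Rec}(\mathcal{C})^{op}, \mathrm{Set}]$, $\phi \mapsto \mathrm{Sind}_\kappa(\mathcal{C})(-,\phi)|_{\mathrm{Rec}(\mathcal{C})}$. That is, this functor is full and faithful and its essential image is the full subcategory $\mathrm{Ind}_\kappa(\mathrm{Rec}(\mathcal{C})) \subseteq [\mathrm{Rec}(\mathcal{C})^{op}, \mathrm{Set}]$.
   Context: Categories are locally small by default. Here $\infty$ denotes the bound on the fixed universe of small sets, so "$\infty$-small" means small; for a regular cardinal $\kappa$, "$\kappa$-small" means of size $<\kappa$ (a category is $\kappa$-small if it has fewer than $\kappa$ morphisms). A category is sifted if the category of cocones over any finite (possibly empty) discrete family of objects in it is connected (in particular nonempty). A $\kappa$-small sifted (resp. filtered) colimit is a colimit of a diagram indexed by a $\kappa$-small sifted (resp. filtered) category. A reflexive coequalizer is a coequalizer of a parallel pair $p,q : X \rightrightarrows Y$ with a common section $r : Y \to X$ ($pr=qr=1_Y$). For any category $\mathcal{A}$, $\mathrm{Sind}_\kappa(\mathcal{A})$ (resp. $\mathrm{Ind}_\kappa(\mathcal{A})$, $\mathrm{Rec}(\mathcal{A})$) denotes the free cocompletion of $\mathcal{A}$ under $\kappa$-small sifted colimits (resp. $\kappa$-small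 filtered colimits, reflexive coequalizers), realized explicitly as the smallest replete full subcategory of $[\mathcal{A}^{op}, \mathrm{Set}]$ containing the representables and closed under such colimits. Since reflexive coequalizers are ($\kappa$-small) sifted colimits, $\mathrm{Rec}(\mathcal{C}) \subseteq \mathrm{Sind}_\kappa(\mathcal{C}) \subseteq [\mathcal{C}^{op},\mathrm{Set}]$. *)

theory Defs
  imports Main "HOL-Library.FuncSet"
begin

unbundle cardinal_syntax

section \<open>Categories, functors and natural transformations\<close>

record ('o, 'a) cat =
  Obj :: "'o set"
  Arr :: "'a set"
  Dom :: "'a \<Rightarrow> 'o"
  Cod :: "'a \<Rightarrow> 'o"
  Idn :: "'o \<Rightarrow> 'a"
  Cmp :: "'a \<Rightarrow> 'a \<Rightarrow> 'a"

definition hom :: "('o, 'a) cat \<Rightarrow> 'o \<Rightarrow> 'o \<Rightarrow> 'a set" where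
  "hom C x y = {f \<in> Arr C. Dom C f = x \<and> Cod C f = y}"

locale category =
  fixes C :: "('o, 'a) cat"
  assumes Dom_in_Obj: "f \<in> Arr C \<Longrightarrow> Dom C f \<in> Obj C"
    and Cod_in_Obj: "f \<in> Arr C \<Longrightarrow> Cod C f \<in> Obj C"
    and Idn_in_hom: "x \<in> Obj C \<Longrightarrow> Idn C x \<in> hom C x x"
    and Cmp_in_hom: "\<lbrakk>f \<in> hom C x y; g \<in> hom C y z\<rbrakk> \<Longrightarrow> Cmp C g f \<in> hom C x z"
    and Cmp_Idn_right: "f \<in> hom C x y \<Longrightarrow> Cmp C f (Idn C x) = f"
    and Cmp_Idn_left: "f \<in> hom C x y \<Longrightarrow> Cmp C (Idn C y) f = f"
    and Cmp_assoc: "\<lbrakk>f \<in> hom C w x; g \<in> hom C x y; h \<in> hom C y z\<rbrakk>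
      \<Longrightarrow> Cmp C h (Cmp C g f) = Cmp C (Cmp C h g) f"

definition op_cat :: "('o, 'a) cat \<Rightarrow> ('o, 'a) cat" where
  "op_cat C = \<lparr>Obj = Obj C, Arr = Arr C, Dom = Cod C, Cod = Dom C, Idn = Idn C,
     Cmp = (\<lambda>g f. Cmp C f g)\<rparr>"

definition discrete_cat :: "'i set \<Rightarrow> ('i, 'i) cat" where
  "discrete_cat I = \<lparr>Obj = I, Arr = I, Dom = (\<lambda>i. i), Cod = (\<lambda>i. i), Idn = (\<lambda>i. i),
     Cmp = (\<lambda>g f. f)\<rparr>"

definition full_subcat :: "('o, 'a) cat \<Rightarrow> 'o set \<Rightarrow> ('o, 'a) cat" where
  "full_subcat C S = C\<lparr>Obj := Obj C \<inter> S, Arr := {f \<in> Arr C. Dom C f \<in> S \<and> Cod C f \<in> S}\<rparr>"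

definition isomorphic :: "('o, 'a) cat \<Rightarrow> 'o \<Rightarrow> 'o \<Rightarrow> bool" where
  "isomorphic C x y \<longleftrightarrow> x \<in> Obj C \<and> y \<in> Obj C \<and>
     (\<exists>f \<in> hom C x y. \<exists>g \<in> hom C y x. Cmp C g f = Idn C x \<and> Cmp C f g = Idn C y)"

definition replete :: "('o, 'a) cat \<Rightarrow> 'o set \<Rightarrow> bool" where
  "replete C S \<longleftrightarrow> (\<forall>x \<in> S. \<forall>y. isomorphic C x y \<longrightarrow> y \<in> S)"

record ('o, 'a, 'p, 'b) func =
  FObj :: "'o \<Rightarrow> 'p"
  FArr :: "'a \<Rightarrow> 'b"

text \<open>Functors and natural transformations are required to be extensional, i.e. to take the
  value \<^const>\<open>undefined\<close> outside the source category, so that HOL equality is the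
  mathematical equality.\<close>

definition is_functor ::
    "('o, 'a) cat \<Rightarrow> ('p, 'b) cat \<Rightarrow> ('o, 'a, 'p, 'b) func \<Rightarrow> bool" where
  "is_functor A B F \<longleftrightarrow>
     FObj F \<in> Obj A \<rightarrow>\<^sub>E Obj B \<and>
     FArr F \<in> Arr A \<rightarrow>\<^sub>E Arr B \<and>
     (\<forall>f \<in> Arr A. FArr F f \<in> hom B (FObj F (Dom A f)) (FObj F (Cod A f))) \<and>
     (\<forall>x \<in> Obj A. FArr F (Idn A x) = Idn B (FObj F x)) \<and>
     (\<forall>f \<in> Arr A. \<forall>g \<in> Arr A. Cod A f = Dom A g \<longrightarrow>
        FArr F (Cmp A g f) = Cmp B (FArr F g) (FArr F f))"

definition is_nat_trans ::
    "('o, 'a) cat \<Rightarrow> ('p, 'b) cat \<Rightarrow> ('o, 'a, 'p, 'b) func \<Rightarrow> ('o, 'a, 'p, 'b) func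
      \<Rightarrow> ('o \<Rightarrow> 'b) \<Rightarrow> bool" where
  "is_nat_trans A B F G \<tau> \<longleftrightarrow>
     \<tau> \<in> extensional (Obj A) \<and>
     (\<forall>x \<in> Obj A. \<tau> x \<in> hom B (FObj F x) (FObj G x)) \<and>
     (\<forall>f \<in> Arr A. Cmp B (FArr G f) (\<tau> (Dom A f)) = Cmp B (\<tau> (Cod A f)) (FArr F f))"

definition functor_cat ::
    "('o, 'a) cat \<Rightarrow> ('p, 'b) cat \<Rightarrow>
      (('o, 'a, 'p, 'b) func,
       ('o, 'a, 'p, 'b) func \<times> ('o, 'a, 'p, 'b) func \<times> ('o \<Rightarrow> 'b)) cat" where
  "functor_cat A B =
     \<lparr>Obj = {F. is_functor A B F},
      Arr = {(F, G, \<tau>). is_functor A B F \<and> is_functor A B G \<and> is_nat_trans A B F G \<tau>},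
      Dom = (\<lambda>(F, G, \<tau>). F),
      Cod = (\<lambda>(F, G, \<tau>). G),
      Idn = (\<lambda>F. (F, F, \<lambda>x\<in>Obj A. Idn B (FObj F x))),
      Cmp = (\<lambda>(F', G', \<sigma>) (F, G, \<tau>). (F, G', \<lambda>x\<in>Obj A. Cmp B (\<sigma> x) (\<tau> x)))\<rparr>"

definition full_and_faithful ::
    "('o, 'a) cat \<Rightarrow> ('p, 'b) cat \<Rightarrow> ('o, 'a, 'p, 'b) func \<Rightarrow> bool" where
  "full_and_faithful A B F \<longleftrightarrow>
     (\<forall>x \<in> Obj A. \<forall>y \<in> Obj A. bij_betw (FArr F) (hom A x y) (hom B (FObj F x) (FObj F y)))"

definition essential_image ::
    "('o, 'a) cat \<Rightarrow> ('p, 'b) cat \<Rightarrow> ('o, 'a, 'p, 'b) func \<Rightarrow> ('p, 'b) cat" where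
  "essential_image A B F = full_subcat B {y. \<exists>x \<in> Obj A. isomorphic B (FObj F x) y}"


section \<open>Limits and colimits\<close>

definition is_pullback ::
    "('o, 'a) cat \<Rightarrow> 'a \<Rightarrow> 'a \<Rightarrow> 'o \<Rightarrow> 'a \<Rightarrow> 'a \<Rightarrow> bool" where
  "is_pullback C f g P p q \<longleftrightarrow>
     p \<in> hom C P (Dom C f) \<and> q \<in> hom C P (Dom C g) \<and> Cmp C f p = Cmp C g q \<and>
     (\<forall>Q u v. u \<in> hom C Q (Dom C f) \<longrightarrow> v \<in> hom C Q (Dom C g) \<longrightarrow> Cmp C f u = Cmp C g v \<longrightarrow>
        (\<exists>!h. h \<in> hom C Q P \<and> Cmp C p h = u \<and> Cmp C q h = v))"

definition has_pullbacks :: "('o, 'a) cat \<Rightarrow> bool" where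
  "has_pullbacks C \<longleftrightarrow>
     (\<forall>f \<in> Arr C. \<forall>g \<in> Arr C. Cod C f = Cod C g \<longrightarrow> (\<exists>P p q. is_pullback C f g P p q))"

definition is_cocone ::
    "('i, 'j) cat \<Rightarrow> ('o, 'a) cat \<Rightarrow> ('i, 'j, 'o, 'a) func \<Rightarrow> 'o \<Rightarrow> ('i \<Rightarrow> 'a) \<Rightarrow> bool" where
  "is_cocone J K D X \<mu> \<longleftrightarrow>
     X \<in> Obj K \<and> \<mu> \<in> extensional (Obj J) \<and>
     (\<forall>i \<in> Obj J. \<mu> i \<in> hom K (FObj D i) X) \<and>
     (\<forall>u \<in> Arr J. Cmp K (\<mu> (Cod J u)) (FArr D u) = \<mu> (Dom J u))"

definition is_colimit ::
    "('i, 'j) cat \<Rightarrow> ('o, 'a) cat \<Rightarrow> ('i, 'j, 'o, 'a) func \<Rightarrow> 'o \<Rightarrow> ('i \<Rightarrow> 'a) \<Rightarrow> bool" where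
  "is_colimit J K D X \<mu> \<longleftrightarrow>
     is_cocone J K D X \<mu> \<and>
     (\<forall>Y \<nu>. is_cocone J K D Y \<nu> \<longrightarrow>
        (\<exists>!h. h \<in> hom K X Y \<and> (\<forall>i \<in> Obj J. Cmp K h (\<mu> i) = \<nu> i)))"

definition cocone_cat ::
    "('i, 'j) cat \<Rightarrow> ('o, 'a) cat \<Rightarrow> ('i, 'j, 'o, 'a) func \<Rightarrow>
      ('o \<times> ('i \<Rightarrow> 'a), ('o \<times> ('i \<Rightarrow> 'a)) \<times> ('o \<times> ('i \<Rightarrow> 'a)) \<times> 'a) cat" where
  "cocone_cat J K D =
     \<lparr>Obj = {(X, \<mu>). is_cocone J K D X \<mu>},
      Arr = {((X, \<mu>), (Y, \<nu>), h). is_cocone J K D X \<mu> \<and> is_cocone J K D Y \<nu> \<and>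
               h \<in> hom K X Y \<and> (\<forall>i \<in> Obj J. Cmp K h (\<mu> i) = \<nu> i)},
      Dom = (\<lambda>(c, d, h). c),
      Cod = (\<lambda>(c, d, h). d),
      Idn = (\<lambda>c. (c, c, Idn K (fst c))),
      Cmp = (\<lambda>(c', d', h') (c, d, h). (c, d', Cmp K h' h))\<rparr>"

definition connected_cat :: "('o, 'a) cat \<Rightarrow> bool" where
  "connected_cat C \<longleftrightarrow> Obj C \<noteq> {} \<and>
     (\<forall>x \<in> Obj C. \<forall>y \<in> Obj C.
        (x, y) \<in> {(a, b). hom C a b \<noteq> {} \<or> hom C b a \<noteq> {}}\<^sup>*)"

definition sifted :: "('o, 'a) cat \<Rightarrow> bool" where
  "sifted J \<longleftrightarrow>
     (\<forall>(n::nat) D. is_functor (discrete_cat {..<n}) J D \<longrightarrow>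
        connected_cat (cocone_cat (discrete_cat {..<n}) J D))"

definition filtered :: "('o, 'a) cat \<Rightarrow> bool" where
  "filtered J \<longleftrightarrow>
     Obj J \<noteq> {} \<and>
     (\<forall>x \<in> Obj J. \<forall>y \<in> Obj J. \<exists>z. hom J x z \<noteq> {} \<and> hom J y z \<noteq> {}) \<and>
     (\<forall>f \<in> Arr J. \<forall>g \<in> Arr J. Dom J f = Dom J g \<and> Cod J f = Cod J g \<longrightarrow>
        (\<exists>h \<in> Arr J. Dom J h = Cod J f \<and> Cmp J h f = Cmp J h g))"

definition is_coequalizer :: "('o, 'a) cat \<Rightarrow> 'a \<Rightarrow> 'a \<Rightarrow> 'o \<Rightarrow> 'a \<Rightarrow> bool" where
  "is_coequalizer C p q Z e \<longleftrightarrow>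
     e \<in> hom C (Cod C p) Z \<and> Cmp C e p = Cmp C e q \<and>
     (\<forall>W d. d \<in> hom C (Cod C p) W \<longrightarrow> Cmp C d p = Cmp C d q \<longrightarrow>
        (\<exists>!h. h \<in> hom C Z W \<and> Cmp C h e = d))"

definition reflexive_pair :: "('o, 'a) cat \<Rightarrow> 'o \<Rightarrow> 'o \<Rightarrow> 'a \<Rightarrow> 'a \<Rightarrow> bool" where
  "reflexive_pair C X Y p q \<longleftrightarrow>
     p \<in> hom C X Y \<and> q \<in> hom C X Y \<and>
     (\<exists>r \<in> hom C Y X. Cmp C p r = Idn C Y \<and> Cmp C q r = Idn C Y)"

definition closed_under_colimits ::
    "('i, 'j) cat set \<Rightarrow> ('o, 'a) cat \<Rightarrow> 'o set \<Rightarrow> bool" where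
  "closed_under_colimits \<J> K S \<longleftrightarrow>
     (\<forall>J \<in> \<J>. \<forall>D X \<mu>. is_functor J K D \<and> (\<forall>i \<in> Obj J. FObj D i \<in> S) \<and> is_colimit J K D X \<mu>
        \<longrightarrow> X \<in> S)"

definition closed_under_reflexive_coequalizers :: "('o, 'a) cat \<Rightarrow> 'o set \<Rightarrow> bool" where
  "closed_under_reflexive_coequalizers K S \<longleftrightarrow>
     (\<forall>X \<in> S. \<forall>Y \<in> S. \<forall>p q Z e. reflexive_pair K X Y p q \<and> is_coequalizer K p q Z e \<longrightarrow> Z \<in> S)"


section \<open>Small sets and presheaves\<close>

text \<open>The universe is represented by a cardinal \<open>\<Omega>\<close>, playing the role of the bound written
  \<open>\<infinity>\<close> on paper: a set is small iff its cardinality is less than \<open>\<Omega>\<close>. For a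
  Grothendieck universe \<open>\<Omega>\<close> is inaccessible, but nothing below depends on \<open>\<Omega>\<close> being a strong
  limit, which HOL could not establish for any uncountable regular cardinal. The category of small
  sets is realized by the small subsets of a type \<^typ>\<open>'u\<close>; up to isomorphism this contains all
  small sets as soon as \<^typ>\<open>'u\<close> has at least \<open>\<Omega>\<close> elements. An arrow is a triple consisting
  of source, target, and (extensional) graph.\<close>

type_synonym 'u fn = "'u set \<times> 'u set \<times> ('u \<Rightarrow> 'u)"

definition set_cat :: "'l rel \<Rightarrow> ('u set, 'u fn) cat" where
  "set_cat \<Omega> =
     \<lparr>Obj = {A. |A| <o \<Omega>},
      Arr = {(A, B, f). |A| <o \<Omega> \<and> |B| <o \<Omega> \<and> f \<in> A \<rightarrow>\<^sub>E B},
      Dom = (\<lambda>(A, B, f). A),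
      Cod = (\<lambda>(A, B, f). B),
      Idn = (\<lambda>A. (A, A, \<lambda>x\<in>A. x)),
      Cmp = (\<lambda>(A', B', g) (A, B, f). (A, B', \<lambda>x\<in>A. g (f x)))\<rparr>"

definition fn_app :: "'u fn \<Rightarrow> 'u \<Rightarrow> 'u" where
  "fn_app \<phi> = snd (snd \<phi>)"

definition locally_small :: "'l rel \<Rightarrow> ('o, 'a) cat \<Rightarrow> bool" where
  "locally_small \<Omega> C \<longleftrightarrow> (\<forall>x \<in> Obj C. \<forall>y \<in> Obj C. |hom C x y| <o \<Omega>)"

type_synonym ('o, 'a, 'u) presheaf = "('o, 'a, 'u set, 'u fn) func"
type_synonym ('o, 'a, 'u) presheaf_map =
  "('o, 'a, 'u) presheaf \<times> ('o, 'a, 'u) presheaf \<times> ('o \<Rightarrow> 'u fn)"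

definition psh ::
    "'l rel \<Rightarrow> ('o, 'a) cat \<Rightarrow> (('o, 'a, 'u) presheaf, ('o, 'a, 'u) presheaf_map) cat" where
  "psh \<Omega> A = functor_cat (op_cat A) (set_cat \<Omega>)"

text \<open>Since the elements of the hom-sets of \<open>A\<close> have type \<^typ>\<open>'a\<close> rather than \<^typ>\<open>'u\<close>, a
  representable presheaf is one that is naturally isomorphic to some \<open>A(-, c)\<close>; the family
  \<open>\<theta>\<close> below is such an isomorphism. This class is replete.\<close>

definition representables :: "'l rel \<Rightarrow> ('o, 'a) cat \<Rightarrow> ('o, 'a, 'u) presheaf set" where
  "representables \<Omega> A =
     {F \<in> Obj (psh \<Omega> A). \<exists>c \<in> Obj A. \<exists>\<theta>.
        (\<forall>x \<in> Obj A. bij_betw (\<theta> x) (hom A x c) (FObj F x)) \<and>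
        (\<forall>f \<in> Arr A. \<forall>g \<in> hom A (Cod A f) c.
           \<theta> (Dom A f) (Cmp A g f) = fn_app (FArr F f) (\<theta> (Cod A f) g))}"


section \<open>Free cocompletions\<close>

definition presheaf_closure ::
    "'l rel \<Rightarrow> ('o, 'a) cat \<Rightarrow> (('o, 'a, 'u) presheaf set \<Rightarrow> bool)
      \<Rightarrow> (('o, 'a, 'u) presheaf, ('o, 'a, 'u) presheaf_map) cat" where
  "presheaf_closure \<Omega> A closed =
     full_subcat (psh \<Omega> A)
       (\<Inter>{S. S \<subseteq> Obj (psh \<Omega> A) \<and> replete (psh \<Omega> A) S \<and> representables \<Omega> A \<subseteq> S \<and> closed S})"

text \<open>Index categories of \<open>\<kappa>\<close>-small diagrams have their objects and arrows in the type
  \<^typ>\<open>'u\<close> of elements of small sets. If \<^typ>\<open>'u\<close> has at least \<open>\<kappa>\<close> elements, every \<open>\<kappa>\<close>-small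
  category is isomorphic to one of these.\<close>

definition Sind ::
    "'k rel \<Rightarrow> 'l rel \<Rightarrow> ('o, 'a) cat \<Rightarrow> (('o, 'a, 'u) presheaf, ('o, 'a, 'u) presheaf_map) cat" where
  "Sind \<kappa> \<Omega> A = presheaf_closure \<Omega> A
     (closed_under_colimits {J :: ('u, 'u) cat. category J \<and> |Arr J| <o \<kappa> \<and> sifted J} (psh \<Omega> A))"

definition Ind ::
    "'k rel \<Rightarrow> 'l rel \<Rightarrow> ('o, 'a) cat \<Rightarrow> (('o, 'a, 'u) presheaf, ('o, 'a, 'u) presheaf_map) cat" where
  "Ind \<kappa> \<Omega> A = presheaf_closure \<Omega> A
     (closed_under_colimits {J :: ('u, 'u) cat. category J \<and> |Arr J| <o \<kappa> \<and> filtered J} (psh \<Omega> A))"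

definition Rec ::
    "'l rel \<Rightarrow> ('o, 'a) cat \<Rightarrow> (('o, 'a, 'u) presheaf, ('o, 'a, 'u) presheaf_map) cat" where
  "Rec \<Omega> A = presheaf_closure \<Omega> A (closed_under_reflexive_coequalizers (psh \<Omega> A))"


section \<open>The restricted Yoneda embedding\<close>

definition restricted_hom ::
    "('o, 'a) cat \<Rightarrow> ('o, 'a) cat \<Rightarrow> 'o \<Rightarrow> ('o, 'a, 'a) presheaf" where
  "restricted_hom K A \<phi> =
     \<lparr>FObj = (\<lambda>\<psi>\<in>Obj A. hom K \<psi> \<phi>),
      FArr = (\<lambda>f\<in>Arr A. (hom K (Cod A f) \<phi>, hom K (Dom A f) \<phi>,
                         \<lambda>g\<in>hom K (Cod A f) \<phi>. Cmp K g f))\<rparr>"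

text \<open>For a full subcategory \<open>A\<close> of \<open>K\<close>, the functor
  \<open>K \<rightarrow> [A\<^sup>o\<^sup>p, Set]\<close>, \<open>\<phi> \<mapsto> K(-, \<phi>)|\<^sub>A\<close>.\<close>

definition restricted_yoneda ::
    "('o, 'a) cat \<Rightarrow> ('o, 'a) cat \<Rightarrow>
      ('o, 'a, ('o, 'a, 'a) presheaf, ('o, 'a, 'a) presheaf_map) func" where
  "restricted_yoneda K A =
     \<lparr>FObj = (\<lambda>\<phi>\<in>Obj K. restricted_hom K A \<phi>),
      FArr = (\<lambda>\<alpha>\<in>Arr K. (restricted_hom K A (Dom K \<alpha>), restricted_hom K A (Cod K \<alpha>),
                         \<lambda>\<psi>\<in>Obj A. (hom K \<psi> (Dom K \<alpha>), hom K \<psi> (Cod K \<alpha>),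
                                     \<lambda>g\<in>hom K \<psi> (Dom K \<alpha>). Cmp K \<alpha> g)))\<rparr>"

end

theory Submission
  imports Defs
begin

text \<open>Let \<open>\<phi>\<close> be a presheaf whose category of elements is sifted. Since \<open>C\<close> has pullbacks, so does
  every category of cospans of elements of \<open>\<phi>\<close>; being connected, it is then connected by single
  spans. For elements \<open>f, g : a \<rightrightarrows> b\<close> a span between the cospans \<open>(f, 1)\<close> and
  \<open>(g, 1)\<close> is a reflexive pair \<open>s, t : p \<rightrightarrows> b\<close> through which \<open>f, g\<close> factor, so
  every parallel pair over \<open>\<phi>\<close> is coequalized by a reflexive coequalizer of representables. Hence these
  coequalizers over \<open>\<phi>\<close> form a filtered category with colimit \<open>\<phi>\<close>. If moreover \<open>\<phi>\<close> has a
  presentation with fewer than \<open>\<kappa>\<close> generators and relations, a Loewenheim--Skolem argument, which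
  takes countably many steps and so uses that \<open>\<kappa>\<close> is uncountable, cuts this diagram down to a
  \<open>\<kappa>\<close>-small one. Both conditions on \<open>\<phi>\<close> are stable under \<open>\<kappa>\<close>-small sifted colimits.
  Conversely, the objects of \<open>Rec(C)\<close> are finitely presentable, so the restricted Yoneda embedding
  preserves \<open>\<kappa>\<close>-small filtered colimits.\<close>

section \<open>Categories\<close>

text \<open>The obstacle is that connectedness of a category of cospans yields only zigzags, whereas
  a quotient in Rec(C) needs one reflexive pair. A zigzag from \<open>(f, 1)\<close> to
  \<open>(g, 1)\<close> relates \<open>f\<close> to \<open>g\<close> through changing targets; a
  single span has one apex with two maps to the fixed target, and the two identities supply their
  common section. Pullbacks serve to find a span over a representable and to compose spans; weak
  ones suffice. The category of elements is not formed: its objects become arrows from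
  representables in a category \<open>K\<close> with a separating class \<open>G\<close>. What is
  used of presheaves is that maps out of a representable see colimits as colimits of sets and
  coequalizers as surjections. Smallness is expressed by generators and relations rather than by a
  diagram of representables: a presentation passes directly to \<kappa>-small colimits, and its
  generators and relations tell which arrows a small filtered subdiagram must retain for
  \<open>\<phi>\<close> to remain its colimit.\<close>

lemma hom_memI: "f \<in> Arr C \<Longrightarrow> Dom C f = x \<Longrightarrow> Cod C f = y \<Longrightarrow> f \<in> hom C x y"
  by (simp add: hom_def)

lemma hom_memD:
  assumes "f \<in> hom C x y"
  shows "f \<in> Arr C" and "Dom C f = x" and "Cod C f = y"
  using assms by (auto simp: hom_def)

context category
begin

lemma hom_Obj:
  assumes "f \<in> hom C x y"
  shows "x \<in> Obj C" and "y \<in> Obj C"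
  using assms Dom_in_Obj Cod_in_Obj by (auto simp: hom_def)

lemma assoc: "\<lbrakk>f \<in> hom C w x; g \<in> hom C x y; h \<in> hom C y z\<rbrakk> \<Longrightarrow> Cmp C (Cmp C h g) f = Cmp C h (Cmp C g f)"
  using Cmp_assoc by simp

end

section \<open>Equivalence relations generated by a relation\<close>

definition equivcl :: "'x rel \<Rightarrow> 'x rel" where
  "equivcl R = (R \<union> R\<inverse>)\<^sup>*"

lemma equivcl_refl: "(x, x) \<in> equivcl R"
  by (simp add: equivcl_def)

lemma equivcl_incl: "(x, y) \<in> R \<Longrightarrow> (x, y) \<in> equivcl R"
  by (auto simp: equivcl_def)

lemma equivcl_sym: "(x, y) \<in> equivcl R \<Longrightarrow> (y, x) \<in> equivcl R"
proof -
  have "sym ((R \<union> R\<inverse>)\<^sup>*)"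
    by (intro sym_rtrancl) (auto simp: sym_def)
  then show "(x, y) \<in> equivcl R \<Longrightarrow> (y, x) \<in> equivcl R"
    by (auto simp: equivcl_def dest: symD)
qed

lemma equivcl_trans: "(x, y) \<in> equivcl R \<Longrightarrow> (y, z) \<in> equivcl R \<Longrightarrow> (x, z) \<in> equivcl R"
  by (auto simp: equivcl_def)

lemma equivcl_induct [consumes 1, case_names refl step]:
  assumes "(x, y) \<in> equivcl R"
    and "P x"
    and "\<And>y z. (x, y) \<in> equivcl R \<Longrightarrow> (y, z) \<in> R \<or> (z, y) \<in> R \<Longrightarrow> P y \<Longrightarrow> P z"
  shows "P y"
  using assms(1) unfolding equivcl_def
  by (induction rule: rtrancl_induct) (use assms(2,3) in \<open>auto simp: equivcl_def\<close>)

text \<open>This is how a family compatible with the generating pairs descends to a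
  quotient.\<close>

lemma equivcl_subset:
  assumes "(x, y) \<in> equivcl R" and "\<And>x y. (x, y) \<in> R \<Longrightarrow> h x = h y"
  shows "h x = h y"
  using assms(1) by (induction rule: equivcl_induct) (use assms(2) in auto)

text \<open>Zigzags are transported generator by generator; below \<open>h\<close> pushes elements
  along cospans of indices, swaps coordinates, restricts along an arrow of \<open>C\<close>, or
  passes from elements to maps out of a representable.\<close>

lemma equivcl_map:
  assumes "(x, y) \<in> equivcl R" and "\<And>x y. (x, y) \<in> R \<Longrightarrow> (h x, h y) \<in> R'"
  shows "(h x, h y) \<in> equivcl R'"
  using assms(1)
proof (induction rule: equivcl_induct)
  case refl
  then show ?case by (rule equivcl_refl)
next
  case (step y z)
  then show ?case
    using assms(2) equivcl_trans equivcl_sym equivcl_incl by metis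
qed

lemma is_functor_hom:
  assumes "is_functor J K D" and "\<theta> \<in> hom J i j"
  shows "FArr D \<theta> \<in> hom K (FObj D i) (FObj D j)"
  using assms by (auto simp: is_functor_def hom_def)

lemma is_functor_Obj: "is_functor J K D \<Longrightarrow> i \<in> Obj J \<Longrightarrow> FObj D i \<in> Obj K"
  by (auto simp: is_functor_def)

lemma is_functor_Idn: "is_functor J K D \<Longrightarrow> i \<in> Obj J \<Longrightarrow> FArr D (Idn J i) = Idn K (FObj D i)"
  by (auto simp: is_functor_def)

lemma is_functor_Cmp:
  assumes "is_functor J K D" and "\<theta> \<in> hom J i j" and "\<eta> \<in> hom J j k"
  shows "FArr D (Cmp J \<eta> \<theta>) = Cmp K (FArr D \<eta>) (FArr D \<theta>)"
  using assms by (auto simp: is_functor_def hom_def)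

lemma is_cocone_hom: "is_cocone J K D X \<mu> \<Longrightarrow> i \<in> Obj J \<Longrightarrow> \<mu> i \<in> hom K (FObj D i) X"
  by (auto simp: is_cocone_def)

lemma is_cocone_comm:
  "is_cocone J K D X \<mu> \<Longrightarrow> \<theta> \<in> hom J i j \<Longrightarrow> Cmp K (\<mu> j) (FArr D \<theta>) = \<mu> i"
  by (auto simp: is_cocone_def hom_def)

text \<open>Siftedness as it is used: only nullary and binary families of objects matter.\<close>

definition bsifted :: "('i, 'j) cat \<Rightarrow> bool" where
  "bsifted J \<longleftrightarrow> Obj J \<noteq> {} \<and>
     (\<forall>i \<in> Obj J. \<forall>j \<in> Obj J. (\<exists>k. hom J i k \<noteq> {} \<and> hom J j k \<noteq> {}) \<and>
       (\<forall>k k'. \<forall>\<alpha> \<in> hom J i k. \<forall>\<beta> \<in> hom J j k. \<forall>\<alpha>' \<in> hom J i k'. \<forall>\<beta>' \<in> hom J j k'.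
          ((k, \<alpha>, \<beta>), (k', \<alpha>', \<beta>')) \<in>
            equivcl {((l, \<gamma>, \<delta>), (l', Cmp J \<theta> \<gamma>, Cmp J \<theta> \<delta>)) | l l' \<gamma> \<delta> \<theta>.
              \<gamma> \<in> hom J i l \<and> \<delta> \<in> hom J j l \<and> \<theta> \<in> hom J l l'}))"


section \<open>Weakly sifted objects of a generated category\<close>

text \<open>Presheaf categories are studied through this interface, with \<open>G\<close> the class
  of representables. \<open>G_weak_pullback\<close> omits uniqueness because spans need only exist,
  and \<open>G_projective\<close> is the pointwise surjectivity of a coequalizer map, seen through
  the Yoneda lemma.\<close>

locale generated_category = category K for K :: "('p, 'b) cat" +
  fixes G :: "'p set"
  assumes G_Obj: "g \<in> G \<Longrightarrow> g \<in> Obj K"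
    and G_separating: "\<lbrakk>h \<in> hom K X Y; h' \<in> hom K X Y;
      \<And>g x. g \<in> G \<Longrightarrow> x \<in> hom K g X \<Longrightarrow> Cmp K h x = Cmp K h' x\<rbrakk> \<Longrightarrow> h = h'"
    and G_weak_pullback: "\<lbrakk>a \<in> G; b \<in> G; c \<in> G; f \<in> hom K a c; f' \<in> hom K b c\<rbrakk> \<Longrightarrow>
      \<exists>p \<in> G. \<exists>s \<in> hom K p a. \<exists>t \<in> hom K p b. Cmp K f s = Cmp K f' t \<and>
        (\<forall>d \<in> G. \<forall>u \<in> hom K d a. \<forall>v \<in> hom K d b. Cmp K f u = Cmp K f' v \<longrightarrow>
          (\<exists>h \<in> hom K d p. Cmp K s h = u \<and> Cmp K t h = v))"
    and G_coequalizer: "\<lbrakk>a \<in> G; b \<in> G; p \<in> hom K a b; q \<in> hom K a b\<rbrakk> \<Longrightarrow>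
      \<exists>Z e. is_coequalizer K p q Z e"
    and G_projective: "\<lbrakk>a \<in> G; b \<in> G; c \<in> G; p \<in> hom K a b; q \<in> hom K a b;
      is_coequalizer K p q Z e; x \<in> hom K c Z\<rbrakk> \<Longrightarrow> \<exists>y \<in> hom K c b. Cmp K e y = x"
begin

abbreviation comp :: "'b \<Rightarrow> 'b \<Rightarrow> 'b" (infixr "\<cdot>" 70) where
  "g \<cdot> f \<equiv> Cmp K g f"

text \<open>The colimit of the sets \<open>K(g, D i)\<close> is the quotient of their disjoint union
  by this relation.\<close>

definition zigzag :: "('i, 'j) cat \<Rightarrow> ('i, 'j, 'p, 'b) func \<Rightarrow> 'p \<Rightarrow> ('i \<times> 'b) rel" where
  "zigzag J D g = equivcl {((i, y), (j, FArr D \<theta> \<cdot> y)) | i j \<theta> y.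
     \<theta> \<in> hom J i j \<and> y \<in> hom K g (FObj D i)}"

text \<open>A cocone is tight if it becomes a colimit cocone of sets under each \<open>K(g, -)\<close>.\<close>

definition tight :: "('i, 'j) cat \<Rightarrow> ('i, 'j, 'p, 'b) func \<Rightarrow> 'p \<Rightarrow> ('i \<Rightarrow> 'b) \<Rightarrow> bool" where
  "tight J D X \<mu> \<longleftrightarrow> (\<forall>g \<in> G.
     (\<forall>x \<in> hom K g X. \<exists>i \<in> Obj J. \<exists>y \<in> hom K g (FObj D i). \<mu> i \<cdot> y = x) \<and>
     (\<forall>i \<in> Obj J. \<forall>j \<in> Obj J. \<forall>y \<in> hom K g (FObj D i). \<forall>z \<in> hom K g (FObj D j).
        \<mu> i \<cdot> y = \<mu> j \<cdot> z \<longrightarrow> ((i, y), (j, z)) \<in> zigzag J D g))"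

text \<open>When \<open>z . f = z' . f'\<close> and \<open>z . g = z' . g'\<close>, this is a span
  in the category of cospans from these two fixed elements: its apex \<open>p\<close> carries the
  element \<open>z . s\<close>, and its legs \<open>s\<close>, \<open>t\<close> commute with the
  maps out of \<open>a\<close> and \<open>b\<close>.\<close>

definition spanned :: "'p \<Rightarrow> 'p \<Rightarrow> 'p \<Rightarrow> 'b \<Rightarrow> 'b \<Rightarrow> 'b \<Rightarrow> 'p \<Rightarrow> 'b \<Rightarrow> 'b \<Rightarrow> 'b \<Rightarrow> bool" where
  "spanned a b d z f g d' z' f' g' \<longleftrightarrow>
     (\<exists>p \<in> G. \<exists>u \<in> hom K a p. \<exists>v \<in> hom K b p. \<exists>s \<in> hom K p d. \<exists>t \<in> hom K p d'.
        z \<cdot> s = z' \<cdot> t \<and> s \<cdot> u = f \<and> t \<cdot> u = f' \<and> s \<cdot> v = g \<and> t \<cdot> v = g')"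

text \<open>In the presence of weak pullbacks a connected category of cospans over \<open>\<phi>\<close> is even
  connected by single spans, which is what the last clause asks for.\<close>

definition wsifted :: "'p \<Rightarrow> bool" where
  "wsifted \<phi> \<longleftrightarrow> (\<exists>g \<in> G. hom K g \<phi> \<noteq> {}) \<and>
     (\<forall>a \<in> G. \<forall>b \<in> G. \<forall>x \<in> hom K a \<phi>. \<forall>y \<in> hom K b \<phi>.
        \<exists>d \<in> G. \<exists>z \<in> hom K d \<phi>. \<exists>f \<in> hom K a d. \<exists>g \<in> hom K b d. z \<cdot> f = x \<and> z \<cdot> g = y) \<and>
     (\<forall>a \<in> G. \<forall>b \<in> G. \<forall>d \<in> G. \<forall>d' \<in> G. \<forall>z \<in> hom K d \<phi>. \<forall>z' \<in> hom K d' \<phi>.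
        \<forall>f \<in> hom K a d. \<forall>g \<in> hom K b d. \<forall>f' \<in> hom K a d'. \<forall>g' \<in> hom K b d'.
        z \<cdot> f = z' \<cdot> f' \<longrightarrow> z \<cdot> g = z' \<cdot> g' \<longrightarrow> spanned a b d z f g d' z' f' g')"

lemma wsifted_cospan:
  assumes "wsifted \<phi>" "a \<in> G" "b \<in> G" "x \<in> hom K a \<phi>" "y \<in> hom K b \<phi>"
  obtains d z f g where "d \<in> G" "z \<in> hom K d \<phi>" "f \<in> hom K a d" "g \<in> hom K b d"
    "z \<cdot> f = x" "z \<cdot> g = y"
  using assms unfolding wsifted_def by meson

lemma wsifted_spanned:
  assumes "wsifted \<phi>" "a \<in> G" "b \<in> G" "d \<in> G" "d' \<in> G" "z \<in> hom K d \<phi>" "z' \<in> hom K d' \<phi>"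
    "f \<in> hom K a d" "g \<in> hom K b d" "f' \<in> hom K a d'" "g' \<in> hom K b d'"
    "z \<cdot> f = z' \<cdot> f'" "z \<cdot> g = z' \<cdot> g'"
  shows "spanned a b d z f g d' z' f' g'"
  using assms unfolding wsifted_def by blast

lemma spannedE:
  assumes "spanned a b d z f g d' z' f' g'"
  obtains p u v s t where "p \<in> G" "u \<in> hom K a p" "v \<in> hom K b p" "s \<in> hom K p d" "t \<in> hom K p d'"
    "z \<cdot> s = z' \<cdot> t" "s \<cdot> u = f" "t \<cdot> u = f'" "s \<cdot> v = g" "t \<cdot> v = g'"
  using assms unfolding spanned_def by blast

lemma spannedI:
  assumes "p \<in> G" "u \<in> hom K a p" "v \<in> hom K b p" "s \<in> hom K p d" "t \<in> hom K p d'"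
    "z \<cdot> s = z' \<cdot> t" "s \<cdot> u = f" "t \<cdot> u = f'" "s \<cdot> v = g" "t \<cdot> v = g'"
  shows "spanned a b d z f g d' z' f' g'"
  using assms unfolding spanned_def by blast

lemma spanned_sym: "spanned a b d z f g d' z' f' g' \<Longrightarrow> spanned a b d' z' f' g' d z f g"
  unfolding spanned_def by (elim bexE conjE, intro bexI conjI) (assumption | erule sym)+

lemma weak_pullback:
  assumes "a \<in> G" "b \<in> G" "c \<in> G" "f \<in> hom K a c" "f' \<in> hom K b c"
  obtains p s t where "p \<in> G" "s \<in> hom K p a" "t \<in> hom K p b" "f \<cdot> s = f' \<cdot> t"
    "\<And>d u v. \<lbrakk>d \<in> G; u \<in> hom K d a; v \<in> hom K d b; f \<cdot> u = f' \<cdot> v\<rbrakk> \<Longrightarrow>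
       \<exists>h \<in> hom K d p. s \<cdot> h = u \<and> t \<cdot> h = v"
  using G_weak_pullback[OF assms] by blast

text \<open>The two spans meet in the middle target \<open>d'\<close>, and a weak pullback of
  \<open>t\<close> and \<open>s'\<close> over it is the new apex. The maps from \<open>a\<close> and
  \<open>b\<close> into the apex exist because both spans restrict to the same cospan
  \<open>f', g'\<close>.\<close>

lemma spanned_trans:
  assumes 1: "spanned a b d z f g d' z' f' g'" and 2: "spanned a b d' z' f' g' d'' z'' f'' g''"
    and G: "a \<in> G" "b \<in> G" "d' \<in> G"
    and z: "z \<in> hom K d X" "z' \<in> hom K d' X" "z'' \<in> hom K d'' X"
  shows "spanned a b d z f g d'' z'' f'' g''"
proof -
  obtain p u v s t where p: "p \<in> G" "u \<in> hom K a p" "v \<in> hom K b p" "s \<in> hom K p d" "t \<in> hom K p d'"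
    "z \<cdot> s = z' \<cdot> t" "s \<cdot> u = f" "t \<cdot> u = f'" "s \<cdot> v = g" "t \<cdot> v = g'"
    by (rule spannedE[OF 1])
  obtain p' u' v' s' t' where p': "p' \<in> G" "u' \<in> hom K a p'" "v' \<in> hom K b p'" "s' \<in> hom K p' d'"
    "t' \<in> hom K p' d''" "z' \<cdot> s' = z'' \<cdot> t'" "s' \<cdot> u' = f'" "t' \<cdot> u' = f''" "s' \<cdot> v' = g'" "t' \<cdot> v' = g''"
    by (rule spannedE[OF 2])
  obtain q \<sigma> \<tau> where q: "q \<in> G" "\<sigma> \<in> hom K q p" "\<tau> \<in> hom K q p'" "t \<cdot> \<sigma> = s' \<cdot> \<tau>"
    and univ: "\<And>d u v. \<lbrakk>d \<in> G; u \<in> hom K d p; v \<in> hom K d p'; t \<cdot> u = s' \<cdot> v\<rbrakk> \<Longrightarrow>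
       \<exists>h \<in> hom K d q. \<sigma> \<cdot> h = u \<and> \<tau> \<cdot> h = v"
    by (rule weak_pullback[OF p(1) p'(1) G(3) p(5) p'(4)]) (rule that)
  obtain h where h: "h \<in> hom K a q" "\<sigma> \<cdot> h = u" "\<tau> \<cdot> h = u'"
    using univ[OF G(1) p(2) p'(2)] p p' by metis
  obtain k where k: "k \<in> hom K b q" "\<sigma> \<cdot> k = v" "\<tau> \<cdot> k = v'"
    using univ[OF G(2) p(3) p'(3)] p p' by metis
  show ?thesis
  proof (rule spannedI[OF q(1) h(1) k(1) Cmp_in_hom[OF q(2) p(4)] Cmp_in_hom[OF q(3) p'(5)]])
    have "z \<cdot> (s \<cdot> \<sigma>) = z' \<cdot> (t \<cdot> \<sigma>)"
      using assoc[OF q(2) p(4) z(1)] assoc[OF q(2) p(5) z(2)] p(6) by simp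
    also have "\<dots> = z'' \<cdot> (t' \<cdot> \<tau>)"
      using assoc[OF q(3) p'(4) z(2)] assoc[OF q(3) p'(5) z(3)] p'(6) q(4) by simp
    finally show "z \<cdot> (s \<cdot> \<sigma>) = z'' \<cdot> (t' \<cdot> \<tau>)" .
    show "(s \<cdot> \<sigma>) \<cdot> h = f" "(s \<cdot> \<sigma>) \<cdot> k = g" "(t' \<cdot> \<tau>) \<cdot> h = f''" "(t' \<cdot> \<tau>) \<cdot> k = g''"
      using assoc[OF h(1) q(2) p(4)] assoc[OF k(1) q(2) p(4)] assoc[OF h(1) q(3) p'(5)]
        assoc[OF k(1) q(3) p'(5)] h k p p' by simp_all
  qed
qed

text \<open>The identity is a terminal element of a generator, so it bounds any two elements; a span
  between two cospans over the generator is their weak pullback.\<close>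

lemma wsifted_generator:
  assumes "g \<in> G"
  shows "wsifted g"
  unfolding wsifted_def
proof (intro conjI ballI impI)
  show "\<exists>h\<in>G. hom K h g \<noteq> {}"
    using assms Idn_in_hom G_Obj by blast
next
  fix a b x y
  assume "a \<in> G" "b \<in> G" "x \<in> hom K a g" "y \<in> hom K b g"
  then show "\<exists>d\<in>G. \<exists>z\<in>hom K d g. \<exists>f\<in>hom K a d. \<exists>h\<in>hom K b d. z \<cdot> f = x \<and> z \<cdot> h = y"
    using assms Idn_in_hom[OF G_Obj[OF assms]] Cmp_Idn_left by blast
next
  fix a b d d' z z' f h f' h'
  assume *: "a \<in> G" "b \<in> G" "d \<in> G" "d' \<in> G" "z \<in> hom K d g" "z' \<in> hom K d' g"
    "f \<in> hom K a d" "h \<in> hom K b d" "f' \<in> hom K a d'" "h' \<in> hom K b d'"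
    "z \<cdot> f = z' \<cdot> f'" "z \<cdot> h = z' \<cdot> h'"
  obtain p s t where p: "p \<in> G" "s \<in> hom K p d" "t \<in> hom K p d'" "z \<cdot> s = z' \<cdot> t"
    and univ: "\<And>e u v. \<lbrakk>e \<in> G; u \<in> hom K e d; v \<in> hom K e d'; z \<cdot> u = z' \<cdot> v\<rbrakk> \<Longrightarrow>
       \<exists>h \<in> hom K e p. s \<cdot> h = u \<and> t \<cdot> h = v"
    by (rule weak_pullback[OF *(3,4) assms *(5,6)]) (rule that)
  show "spanned a b d z f h d' z' f' h'"
    using univ[OF *(1) *(7) *(9) *(11)] univ[OF *(2) *(8) *(10) *(12)] p spannedI by metis
qed

end

section \<open>Sifted colimits of weakly sifted objects\<close>

locale diagram = generated_category K G + J: category J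
  for K :: "('p, 'b) cat" and G :: "'p set" and J :: "('i, 'j) cat" +
  fixes D :: "('i, 'j, 'p, 'b) func" and X :: 'p and \<mu> :: "'i \<Rightarrow> 'b"
  assumes D: "is_functor J K D" and cocone: "is_cocone J K D X \<mu>" and tight: "tight J D X \<mu>"
begin

lemmas D_hom = is_functor_hom[OF D] and D_Obj = is_functor_Obj[OF D]
  and D_Idn = is_functor_Idn[OF D] and D_Cmp = is_functor_Cmp[OF D]
  and \<mu>_hom = is_cocone_hom[OF cocone] and \<mu>_comm = is_cocone_comm[OF cocone]

lemma tight_lift:
  assumes "g \<in> G" "x \<in> hom K g X"
  obtains i y where "i \<in> Obj J" "y \<in> hom K g (FObj D i)" "\<mu> i \<cdot> y = x"
  using tight assms unfolding tight_def by meson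

lemma tight_zigzag:
  assumes "g \<in> G" "i \<in> Obj J" "j \<in> Obj J" "y \<in> hom K g (FObj D i)" "z \<in> hom K g (FObj D j)"
    "\<mu> i \<cdot> y = \<mu> j \<cdot> z"
  shows "((i, y), (j, z)) \<in> zigzag J D g"
  using tight assms unfolding tight_def by blast

text \<open>Generates the relation whose quotient is the colimit of
  \<open>K(a, D i) \<times> K(b, D i)\<close>, as in \<open>zigzag\<close> for a single
  factor.\<close>

definition pair_step :: "'p \<Rightarrow> 'p \<Rightarrow> ('i \<times> 'b \<times> 'b) rel" where
  "pair_step a b = {((i, x, y), (j, FArr D \<theta> \<cdot> x, FArr D \<theta> \<cdot> y)) | i j \<theta> x y.
     \<theta> \<in> hom J i j \<and> x \<in> hom K a (FObj D i) \<and> y \<in> hom K b (FObj D i)}"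

text \<open>The comparison from a product of two colimits to the colimit of the products, still
  multivalued: all ways of bringing an element over \<open>i\<close> and one over \<open>k\<close>
  to a common index.\<close>

definition pushed :: "'i \<Rightarrow> 'b \<Rightarrow> 'i \<Rightarrow> 'b \<Rightarrow> ('i \<times> 'b \<times> 'b) set" where
  "pushed i x k y = {(m, FArr D \<alpha> \<cdot> x, FArr D \<beta> \<cdot> y) | m \<alpha> \<beta>. \<alpha> \<in> hom J i m \<and> \<beta> \<in> hom J k m}"

lemma D_Cmp_assoc:
  assumes "\<theta> \<in> hom J i j" "\<eta> \<in> hom J j k" "x \<in> hom K a (FObj D i)"
  shows "FArr D (Cmp J \<eta> \<theta>) \<cdot> x = FArr D \<eta> \<cdot> (FArr D \<theta> \<cdot> x)"
  using D_Cmp[OF assms(1,2)] assoc[OF assms(3) D_hom[OF assms(1)] D_hom[OF assms(2)]] by simp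

text \<open>Connectedness of the category of cospans from \<open>i\<close> and \<open>k\<close>
  makes the comparison single-valued on fixed representatives.\<close>

lemma pushed_related:
  assumes J: "bsifted J" and "i \<in> Obj J" "k \<in> Obj J"
    and x: "x \<in> hom K a (FObj D i)" and y: "y \<in> hom K b (FObj D k)"
    and "p \<in> pushed i x k y" "p' \<in> pushed i x k y"
  shows "(p, p') \<in> equivcl (pair_step a b)"
proof -
  obtain m \<alpha> \<beta> where p: "p = (m, FArr D \<alpha> \<cdot> x, FArr D \<beta> \<cdot> y)" "\<alpha> \<in> hom J i m" "\<beta> \<in> hom J k m"
    using assms by (auto simp: pushed_def)
  obtain m' \<alpha>' \<beta>' where p': "p' = (m', FArr D \<alpha>' \<cdot> x, FArr D \<beta>' \<cdot> y)" "\<alpha>' \<in> hom J i m'" "\<beta>' \<in> hom J k m'"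
    using assms by (auto simp: pushed_def)
  let ?h = "\<lambda>(m, \<alpha>, \<beta>). (m, FArr D \<alpha> \<cdot> x, FArr D \<beta> \<cdot> y)"
  let ?R = "{((l, \<gamma>, \<delta>), (l', Cmp J \<theta> \<gamma>, Cmp J \<theta> \<delta>)) | l l' \<gamma> \<delta> \<theta>.
              \<gamma> \<in> hom J i l \<and> \<delta> \<in> hom J k l \<and> \<theta> \<in> hom J l l'}"
  have "((m, \<alpha>, \<beta>), (m', \<alpha>', \<beta>')) \<in> equivcl ?R"
    using J p p' assms(2,3) unfolding bsifted_def by blast
  then have "(?h (m, \<alpha>, \<beta>), ?h (m', \<alpha>', \<beta>')) \<in> equivcl (pair_step a b)"
  proof (rule equivcl_map)
    fix q q' assume "(q, q') \<in> ?R"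
    then obtain l l' \<gamma> \<delta> \<theta> where *: "q = (l, \<gamma>, \<delta>)" "q' = (l', Cmp J \<theta> \<gamma>, Cmp J \<theta> \<delta>)"
      "\<gamma> \<in> hom J i l" "\<delta> \<in> hom J k l" "\<theta> \<in> hom J l l'"
      by blast
    then show "(?h q, ?h q') \<in> pair_step a b"
      using D_Cmp_assoc[OF *(3,5) x] D_Cmp_assoc[OF *(4,5) y] Cmp_in_hom[OF x D_hom[OF *(3)]]
        Cmp_in_hom[OF y D_hom[OF *(4)]]
      by (auto simp: pair_step_def intro!: exI[of _ \<theta>])
  qed
  then show ?thesis by (simp add: p p')
qed

lemma pushed_nonempty:
  assumes "bsifted J" "i \<in> Obj J" "k \<in> Obj J"
  shows "pushed i x k y \<noteq> {}"
  using assms unfolding bsifted_def pushed_def by blast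

text \<open>A cospan out of \<open>i'\<close> becomes one out of \<open>i\<close> by precomposition
  with \<open>\<theta>\<close>. One inclusion suffices later, since it already makes the two
  nonempty sets meet.\<close>

lemma pushed_step_left:
  assumes "\<theta> \<in> hom J i i'" "x \<in> hom K a (FObj D i)"
  shows "pushed i' (FArr D \<theta> \<cdot> x) k y \<subseteq> pushed i x k y"
proof
  fix p assume "p \<in> pushed i' (FArr D \<theta> \<cdot> x) k y"
  then obtain m \<alpha> \<beta> where "p = (m, FArr D \<alpha> \<cdot> (FArr D \<theta> \<cdot> x), FArr D \<beta> \<cdot> y)"
    "\<alpha> \<in> hom J i' m" "\<beta> \<in> hom J k m"
    by (auto simp: pushed_def)
  then show "p \<in> pushed i x k y"
    unfolding pushed_def using J.Cmp_in_hom[OF assms(1), of \<alpha> m] D_Cmp_assoc[OF assms(1) _ assms(2), of \<alpha> m]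
    by (intro CollectI exI[of _ m] exI[of _ "Cmp J \<alpha> \<theta>"] exI[of _ \<beta>]) auto
qed

text \<open>Across one arrow of \<open>J\<close> the two sets of pushed pairs have a common member,
  and each of them lies in a single class; so the class does not change along the zigzag.\<close>

lemma pushed_zigzag_left:
  assumes J: "bsifted J" and i: "i \<in> Obj J" and k: "k \<in> Obj J"
    and x: "x \<in> hom K a (FObj D i)" and y: "y \<in> hom K b (FObj D k)"
    and z: "((i, x), (j, x')) \<in> zigzag J D a"
    and "p \<in> pushed i x k y" "p' \<in> pushed j x' k y"
  shows "(p, p') \<in> equivcl (pair_step a b)"
proof -
  \<comment> \<open>The comparison concerns actual elements of the diagram, so the induction carries
    this membership along with the claim.\<close>
  have "fst (j, x') \<in> Obj J \<and> snd (j, x') \<in> hom K a (FObj D (fst (j, x'))) \<and>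
    (\<forall>p' \<in> pushed (fst (j, x')) (snd (j, x')) k y. (p, p') \<in> equivcl (pair_step a b))"
    using z unfolding zigzag_def
  proof (induction rule: equivcl_induct)
    case refl
    then show ?case using pushed_related[OF J i k x y assms(7)] i x by auto
  next
    case (step q r)
    obtain \<theta> i1 i2 x1 where \<theta>: "\<theta> \<in> hom J i1 i2" "x1 \<in> hom K a (FObj D i1)"
      and qr: "(q = (i1, x1) \<and> r = (i2, FArr D \<theta> \<cdot> x1)) \<or> (r = (i1, x1) \<and> q = (i2, FArr D \<theta> \<cdot> x1))"
      using step(2) by blast
    let ?x2 = "FArr D \<theta> \<cdot> x1"
    have x2: "?x2 \<in> hom K a (FObj D i2)" and o: "i1 \<in> Obj J" "i2 \<in> Obj J"
      using Cmp_in_hom[OF \<theta>(2) D_hom[OF \<theta>(1)]] J.hom_Obj[OF \<theta>(1)] by auto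
    obtain p0 where p0: "p0 \<in> pushed i2 ?x2 k y" "p0 \<in> pushed i1 x1 k y"
      using pushed_nonempty[OF J o(2) k] pushed_step_left[OF \<theta>] by blast
    have "(p, p0) \<in> equivcl (pair_step a b)"
      using qr step(3) p0 by auto
    moreover have "(p0, p'') \<in> equivcl (pair_step a b)"
      if "p'' \<in> pushed (fst r) (snd r) k y" for p''
      using qr
    proof
      assume "q = (i1, x1) \<and> r = (i2, FArr D \<theta> \<cdot> x1)"
      then show ?thesis using pushed_related[OF J o(2) k x2 y p0(1)] that by simp
    next
      assume "r = (i1, x1) \<and> q = (i2, FArr D \<theta> \<cdot> x1)"
      then show ?thesis using pushed_related[OF J o(1) k \<theta>(2) y p0(2)] that by simp
    qed
    ultimately show ?case
      using qr \<theta> x2 o equivcl_trans by fastforce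
  qed
  then show ?thesis using assms by auto
qed

text \<open>Swapping the two coordinates reduces this to a zigzag in the first one.\<close>

lemma pushed_zigzag_right:
  assumes J: "bsifted J" and i: "i \<in> Obj J" and k: "k \<in> Obj J"
    and x: "x \<in> hom K a (FObj D i)" and y: "y \<in> hom K b (FObj D k)"
    and z: "((k, y), (j, y')) \<in> zigzag J D b"
    and "p \<in> pushed i x k y" "p' \<in> pushed i x j y'"
  shows "(p, p') \<in> equivcl (pair_step a b)"
proof -
  let ?sw = "\<lambda>(m :: 'i, x :: 'b, y :: 'b). (m, y, x)"
  have sw: "?sw q \<in> pushed k y i x" if "q \<in> pushed i x k y" for q i k x y
    using that by (auto simp: pushed_def)
  have "(?sw p, ?sw p') \<in> equivcl (pair_step b a)"
    by (rule pushed_zigzag_left[OF J k i y x z sw sw]) (rule assms)+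
  then have "(?sw (?sw p), ?sw (?sw p')) \<in> equivcl (pair_step a b)"
    by (rule equivcl_map) (auto simp: pair_step_def)
  then show ?thesis by (auto split: prod.splits)
qed

text \<open>Sifted colimits of sets commute with binary products.\<close>

lemma zigzag_pair:
  assumes J: "bsifted J" and i: "i \<in> Obj J" and j: "j \<in> Obj J"
    and x: "x \<in> hom K a (FObj D i)" and y: "y \<in> hom K b (FObj D i)"
    and x': "x' \<in> hom K a (FObj D j)" and y': "y' \<in> hom K b (FObj D j)"
    and "((i, x), (j, x')) \<in> zigzag J D a" "((i, y), (j, y')) \<in> zigzag J D b"
  shows "((i, x, y), (j, x', y')) \<in> equivcl (pair_step a b)"
proof -
  have mem: "(i, x, y) \<in> pushed i x i y" if "i \<in> Obj J" "x \<in> hom K a (FObj D i)" "y \<in> hom K b (FObj D i)" for i x y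
    using J.Idn_in_hom[OF that(1)] D_Idn[OF that(1)] Cmp_Idn_left that by (force simp: pushed_def)
  \<comment> \<open>An intermediate pair: the passage to \<open>p\<close> replaces only the first
    coordinate, and the passage from \<open>p\<close> replaces the second.\<close>
  obtain p where p: "p \<in> pushed j x' i y"
    using pushed_nonempty[OF J j i] by blast
  show ?thesis
    by (rule equivcl_trans[OF pushed_zigzag_left[OF J i i x y assms(8) mem[OF i x y] p]
      pushed_zigzag_right[OF J j i x' y assms(9) p mem[OF j x' y']]])
qed

text \<open>The span property is transported along a zigzag of pairs: across one arrow it comes from
  the span property of a single \<open>D j\<close>, and spans compose by weak pullback.\<close>

lemma pair_zigzag_spanned:
  assumes ws: "\<And>i. i \<in> Obj J \<Longrightarrow> wsifted (FObj D i)" and G: "a \<in> G" "b \<in> G"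
    and "((i, x, y), (j, x', y')) \<in> equivcl (pair_step a b)"
    and i: "i \<in> Obj J" and d: "d \<in> G" "d' \<in> G"
    and z: "z \<in> hom K d (FObj D i)" "f \<in> hom K a d" "g \<in> hom K b d" "z \<cdot> f = x" "z \<cdot> g = y"
    and z': "z' \<in> hom K d' (FObj D j)" "f' \<in> hom K a d'" "g' \<in> hom K b d'" "z' \<cdot> f' = x'" "z' \<cdot> g' = y'"
  shows "spanned a b d (\<mu> i \<cdot> z) f g d' (\<mu> j \<cdot> z') f' g'"
proof -
  define cosp where "cosp i x y d z f g \<longleftrightarrow> d \<in> G \<and> z \<in> hom K d (FObj D i) \<and> f \<in> hom K a d \<and>
    g \<in> hom K b d \<and> z \<cdot> f = x \<and> z \<cdot> g = y" for i x y d z f g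
  define Q where "Q i x y j x' y' \<longleftrightarrow> (\<forall>d z f g d' z' f' g'. cosp i x y d z f g \<longrightarrow> cosp j x' y' d' z' f' g' \<longrightarrow>
    spanned a b d (\<mu> i \<cdot> z) f g d' (\<mu> j \<cdot> z') f' g')" for i x y j x' y'
  define val where "val i x y \<longleftrightarrow> i \<in> Obj J \<and> x \<in> hom K a (FObj D i) \<and> y \<in> hom K b (FObj D i)" for i x y
  have Q_sym: "Q i x y j x' y' \<Longrightarrow> Q j x' y' i x y" for i x y j x' y'
    unfolding Q_def using spanned_sym by blast
  have Q_arrow: "Q i x y j (FArr D \<theta> \<cdot> x) (FArr D \<theta> \<cdot> y)"
    if \<theta>: "\<theta> \<in> hom J i j" and x: "x \<in> hom K a (FObj D i)" and y: "y \<in> hom K b (FObj D i)" for i j x y \<theta>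
    unfolding Q_def
  proof (intro allI impI)
    fix d z f g d' z' f' g'
    assume c: "cosp i x y d z f g" and c': "cosp j (FArr D \<theta> \<cdot> x) (FArr D \<theta> \<cdot> y) d' z' f' g'"
    have o: "i \<in> Obj J" "j \<in> Obj J" using J.hom_Obj[OF \<theta>] by auto
    have z: "z \<in> hom K d (FObj D i)" and z': "z' \<in> hom K d' (FObj D j)"
      using c c' by (auto simp: cosp_def)
    note D\<theta> = D_hom[OF \<theta>]
    have "spanned a b d (FArr D \<theta> \<cdot> z) f g d' z' f' g'"
      by (rule wsifted_spanned[OF ws[OF o(2)] G])
        (use c c' Cmp_in_hom[OF z D\<theta>] assoc[OF _ z D\<theta>] in \<open>auto simp: cosp_def\<close>)
    then obtain p u v s t where p: "p \<in> G" "u \<in> hom K a p" "v \<in> hom K b p" "s \<in> hom K p d" "t \<in> hom K p d'"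
      "(FArr D \<theta> \<cdot> z) \<cdot> s = z' \<cdot> t" "s \<cdot> u = f" "t \<cdot> u = f'" "s \<cdot> v = g" "t \<cdot> v = g'"
      by (rule spannedE)
    have "(\<mu> i \<cdot> z) \<cdot> s = (\<mu> j \<cdot> z') \<cdot> t"
    proof -
      have "(\<mu> i \<cdot> z) \<cdot> s = ((\<mu> j \<cdot> FArr D \<theta>) \<cdot> z) \<cdot> s"
        using \<mu>_comm[OF \<theta>] by simp
      also have "\<dots> = \<mu> j \<cdot> ((FArr D \<theta> \<cdot> z) \<cdot> s)"
        using assoc[OF z D\<theta> \<mu>_hom[OF o(2)]] assoc[OF p(4) Cmp_in_hom[OF z D\<theta>] \<mu>_hom[OF o(2)]] by simp
      also have "\<dots> = (\<mu> j \<cdot> z') \<cdot> t"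
        using assoc[OF p(5) z' \<mu>_hom[OF o(2)]] p(6) by simp
      finally show ?thesis .
    qed
    then show "spanned a b d (\<mu> i \<cdot> z) f g d' (\<mu> j \<cdot> z') f' g'"
      using spannedI p by metis
  qed
  \<comment> \<open>\<open>Q\<close> speaks of all cospans with the given composites. Composing two
    spans needs one actual cospan at the middle pair, which the cospan property of
    \<open>D j\<close> supplies.\<close>
  have Q_trans: "Q i x y k x'' y''" if "Q i x y j x' y'" "Q j x' y' k x'' y''" and v: "val j x' y'" and "i \<in> Obj J" "k \<in> Obj J"
    for i x y j x' y' k x'' y''
    unfolding Q_def
  proof (intro allI impI)
    fix d z f g d'' z'' f'' g''
    assume c: "cosp i x y d z f g" and c'': "cosp k x'' y'' d'' z'' f'' g''"
    obtain d' z' f' g' where c': "cosp j x' y' d' z' f' g'"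
      using wsifted_cospan[OF ws G] v unfolding val_def cosp_def by metis
    show "spanned a b d (\<mu> i \<cdot> z) f g d'' (\<mu> k \<cdot> z'') f'' g''"
    proof (rule spanned_trans[of _ _ _ _ _ _ d' "\<mu> j \<cdot> z'" f' g' _ _ _ _ X])
      show "spanned a b d (\<mu> i \<cdot> z) f g d' (\<mu> j \<cdot> z') f' g'"
        "spanned a b d' (\<mu> j \<cdot> z') f' g' d'' (\<mu> k \<cdot> z'') f'' g''"
        using that(1,2) c c' c'' unfolding Q_def by blast+
    qed (use G c c' c'' that Cmp_in_hom \<mu>_hom in \<open>auto simp: cosp_def val_def\<close>)
  qed
  have v: "val i x y"
    using i z Cmp_in_hom unfolding val_def by blast
  let ?P = "\<lambda>(j, x', y'). val j x' y' \<and> Q i x y j x' y'"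
  have "?P (j, x', y')"
    using assms(4)
  proof (induction rule: equivcl_induct)
    \<comment> \<open>Even over one pair \<open>Q\<close> is not trivial, since the two cospans may
      differ; it is the step along an identity arrow.\<close>
    case refl
    have "FArr D (Idn J i) \<cdot> x = x" "FArr D (Idn J i) \<cdot> y = y"
      using v D_Idn[of i] Cmp_Idn_left by (auto simp: val_def)
    then show ?case
      using v Q_arrow[of "Idn J i" i i x y] J.Idn_in_hom by (auto simp: val_def)
  next
    case (step q r)
    obtain j1 x1 y1 where q: "q = (j1, x1, y1)" by (metis prod_cases3)
    obtain j2 x2 y2 where r: "r = (j2, x2, y2)" by (metis prod_cases3)
    have 1: "val j1 x1 y1" "Q i x y j1 x1 y1"
      using step q by auto
    obtain j3 x3 y3 j4 \<theta> where *: "\<theta> \<in> hom J j3 j4" "x3 \<in> hom K a (FObj D j3)" "y3 \<in> hom K b (FObj D j3)"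
      "(q = (j3, x3, y3) \<and> r = (j4, FArr D \<theta> \<cdot> x3, FArr D \<theta> \<cdot> y3)) \<or>
       (r = (j3, x3, y3) \<and> q = (j4, FArr D \<theta> \<cdot> x3, FArr D \<theta> \<cdot> y3))"
      using step(2) unfolding pair_step_def by blast
    have "Q j1 x1 y1 j2 x2 y2"
      using Q_arrow[OF *(1-3)] Q_sym *(4) q r by auto
    moreover have "val j2 x2 y2"
      using *(4) q r J.hom_Obj[OF *(1)] Cmp_in_hom[OF *(2) D_hom[OF *(1)]] Cmp_in_hom[OF *(3) D_hom[OF *(1)]]
        *(2,3) by (auto simp: val_def)
    ultimately show ?case
      using r Q_trans[OF 1(2) _ 1(1) i] by (auto simp: val_def)
  qed
  then have "Q i x y j x' y'" by simp
  then show ?thesis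
    using d z z' unfolding Q_def cosp_def by blast
qed

text \<open>Elements of the colimit lift to the \<open>D i\<close> by tightness. A cospan of indices
  bounds two of them. For the span condition, two equalities in the colimit give two separate
  zigzags, and siftedness merges them into one zigzag of pairs.\<close>

lemma wsifted_colimit:
  assumes J: "bsifted J" and ws: "\<And>i. i \<in> Obj J \<Longrightarrow> wsifted (FObj D i)"
  shows "wsifted X"
  unfolding wsifted_def
proof (intro conjI ballI impI)
  obtain i where i: "i \<in> Obj J" using J by (auto simp: bsifted_def)
  then obtain g x where "g \<in> G" "x \<in> hom K g (FObj D i)"
    using ws[OF i] unfolding wsifted_def by (elim conjE) blast
  then show "\<exists>g\<in>G. hom K g X \<noteq> {}"
    using Cmp_in_hom[OF _ \<mu>_hom[OF i]] by blast
next
  fix a b x y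
  assume G: "a \<in> G" "b \<in> G" and x: "x \<in> hom K a X" and y: "y \<in> hom K b X"
  obtain i x0 where i: "i \<in> Obj J" "x0 \<in> hom K a (FObj D i)" "\<mu> i \<cdot> x0 = x"
    by (rule tight_lift[OF G(1) x])
  obtain j y0 where j: "j \<in> Obj J" "y0 \<in> hom K b (FObj D j)" "\<mu> j \<cdot> y0 = y"
    by (rule tight_lift[OF G(2) y])
  obtain k \<alpha> \<beta> where k: "\<alpha> \<in> hom J i k" "\<beta> \<in> hom J j k"
    using J i j unfolding bsifted_def by blast
  have ko: "k \<in> Obj J" using J.hom_Obj[OF k(1)] by auto
  obtain d z f g where d: "d \<in> G" "z \<in> hom K d (FObj D k)" "f \<in> hom K a d" "g \<in> hom K b d"
    "z \<cdot> f = FArr D \<alpha> \<cdot> x0" "z \<cdot> g = FArr D \<beta> \<cdot> y0"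
    using wsifted_cospan[OF ws[OF ko] G Cmp_in_hom[OF i(2) D_hom[OF k(1)]] Cmp_in_hom[OF j(2) D_hom[OF k(2)]]] .
  have "(\<mu> k \<cdot> z) \<cdot> f = x" "(\<mu> k \<cdot> z) \<cdot> g = y"
    using assoc[OF d(3,2) \<mu>_hom[OF ko]] assoc[OF d(4,2) \<mu>_hom[OF ko]] d(5,6)
      assoc[OF i(2) D_hom[OF k(1)] \<mu>_hom[OF ko]] assoc[OF j(2) D_hom[OF k(2)] \<mu>_hom[OF ko]]
      \<mu>_comm[OF k(1)] \<mu>_comm[OF k(2)] i j by simp_all
  then show "\<exists>d\<in>G. \<exists>z\<in>hom K d X. \<exists>f\<in>hom K a d. \<exists>g\<in>hom K b d. z \<cdot> f = x \<and> z \<cdot> g = y"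
    using d Cmp_in_hom[OF d(2) \<mu>_hom[OF ko]] by blast
next
  fix a b d d' z z' f g f' g'
  assume G: "a \<in> G" "b \<in> G" and d: "d \<in> G" "d' \<in> G" and z: "z \<in> hom K d X" "z' \<in> hom K d' X"
    and f: "f \<in> hom K a d" "g \<in> hom K b d" "f' \<in> hom K a d'" "g' \<in> hom K b d'"
    and eq: "z \<cdot> f = z' \<cdot> f'" "z \<cdot> g = z' \<cdot> g'"
  obtain i z0 where i: "i \<in> Obj J" "z0 \<in> hom K d (FObj D i)" "\<mu> i \<cdot> z0 = z"
    by (rule tight_lift[OF d(1) z(1)])
  obtain j z0' where j: "j \<in> Obj J" "z0' \<in> hom K d' (FObj D j)" "\<mu> j \<cdot> z0' = z'"
    by (rule tight_lift[OF d(2) z(2)])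
  note m = \<mu>_hom[OF i(1)] \<mu>_hom[OF j(1)]
  note h = Cmp_in_hom[OF f(1) i(2)] Cmp_in_hom[OF f(2) i(2)] Cmp_in_hom[OF f(3) j(2)] Cmp_in_hom[OF f(4) j(2)]
  have "((i, z0 \<cdot> f), (j, z0' \<cdot> f')) \<in> zigzag J D a" "((i, z0 \<cdot> g), (j, z0' \<cdot> g')) \<in> zigzag J D b"
    using tight_zigzag[OF G(1) i(1) j(1) h(1,3)] tight_zigzag[OF G(2) i(1) j(1) h(2,4)] eq
      assoc[OF f(1) i(2) m(1)] assoc[OF f(2) i(2) m(1)] assoc[OF f(3) j(2) m(2)] assoc[OF f(4) j(2) m(2)] i j
    by auto
  then have "((i, z0 \<cdot> f, z0 \<cdot> g), (j, z0' \<cdot> f', z0' \<cdot> g')) \<in> equivcl (pair_step a b)"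
    using zigzag_pair[OF J i(1) j(1) h] by blast
  then show "spanned a b d z f g d' z' f' g'"
    using pair_zigzag_spanned[OF ws G _ i(1) d i(2) f(1,2) _ _ j(2) f(3,4)] i j by blast
qed

end

section \<open>Small filtered subcategories\<close>

text \<open>Instantiated with \<open>\<kappa>\<close> and also with the universe bound
  \<open>\<Omega>\<close>, which inherits uncountability from \<open>\<kappa>\<close>.\<close>

locale regular_uncountable =
  fixes \<kappa> :: "'k rel"
  assumes Card_order: "Card_order \<kappa>" and regular: "regularCard \<kappa>" and uncountable: "natLeq <o \<kappa>"
begin

lemma infinite_Field: "\<not> finite (Field \<kappa>)"
  by (metis uncountable ordLess_imp_ordLeq cinfinite_def cinfinite_mono natLeq_cinfinite)

lemma Cinfinite: "Cinfinite \<kappa>"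
  using Card_order infinite_Field by (simp add: cinfinite_def)

lemma less_UNION:
  assumes "|I| <o \<kappa>" and "\<And>i. i \<in> I \<Longrightarrow> |A i| <o \<kappa>"
  shows "|\<Union>i\<in>I. A i| <o \<kappa>"
  using card_of_UNION_ordLess_infinite_Field_regularCard[OF regular Cinfinite] assms by blast

lemma less_Sigma:
  assumes "|I| <o \<kappa>" and "\<And>i. i \<in> I \<Longrightarrow> |A i| <o \<kappa>"
  shows "|SIGMA i:I. A i| <o \<kappa>"
  using stable_elim[OF regularCard_stable[OF Card_order infinite_Field regular]] assms by blast

lemma less_Times: "|A| <o \<kappa> \<Longrightarrow> |B| <o \<kappa> \<Longrightarrow> |A \<times> B| <o \<kappa>"
  by (rule less_Sigma)

lemma less_subset: "|B| <o \<kappa> \<Longrightarrow> A \<subseteq> B \<Longrightarrow> |A| <o \<kappa>"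
  using card_of_mono1 ordLeq_ordLess_trans by blast

lemma less_image: "|A| <o \<kappa> \<Longrightarrow> |f ` A| <o \<kappa>"
  using card_of_image ordLeq_ordLess_trans by blast

lemma less_Un: "|A| <o \<kappa> \<Longrightarrow> |B| <o \<kappa> \<Longrightarrow> |A \<union> B| <o \<kappa>"
  using card_of_Un_ordLess_infinite_Field[OF infinite_Field Card_order] by blast

lemma less_nat: "|UNIV :: nat set| <o \<kappa>"
  using card_of_nat uncountable ordIso_ordLess_trans by blast

lemma less_finite: "finite A \<Longrightarrow> |A| <o \<kappa>"
  using less_nat
  by (metis finite_iff_ordLess_natLeq ordLess_transitive uncountable)

lemma less_inj_on:
  assumes "inj_on f A" "f ` A \<subseteq> B" "|B| <o \<kappa>"
  shows "|A| <o \<kappa>"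
proof -
  have "|A| \<le>o |B|"
    using assms(1,2) by (intro iffD1[OF card_of_ordLeq] exI[of _ f] conjI)
  then show ?thesis
    using assms(3) ordLeq_ordLess_trans by blast
qed

text \<open>The renaming device: quotients, hom-sets and index categories are moved into a
  prescribed type by such an injection.\<close>

lemma less_embed:
  assumes "|A| <o \<kappa>" and "\<kappa> \<le>o |UNIV :: 'v set|"
  obtains f :: "'x \<Rightarrow> 'v" where "inj_on f A"
  using assms card_of_ordLeq ordLess_ordLeq_trans ordLess_imp_ordLeq by metis

end

definition ends :: "('o, 'a) cat \<Rightarrow> 'a set \<Rightarrow> 'o set" where
  "ends C B = Dom C ` B \<union> Cod C ` B"

definition subcat_of :: "('o, 'a) cat \<Rightarrow> 'a set \<Rightarrow> ('o, 'a) cat" where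
  "subcat_of C B = C\<lparr>Obj := ends C B, Arr := B\<rparr>"

text \<open>A downward Loewenheim--Skolem argument: close up under the finitary operations witnessing
  filteredness, in countably many steps.\<close>

lemma (in regular_uncountable) small_filtered_subcategory:
  fixes E :: "('o, 'a) cat"
  assumes E: "category E" "filtered E"
    and B0: "B0 \<subseteq> Arr E" "B0 \<noteq> {}" "|B0| <o \<kappa>"
    and ext: "\<And>x. x \<in> Obj E \<Longrightarrow> ext x \<subseteq> Arr E" "\<And>x. x \<in> Obj E \<Longrightarrow> |ext x| <o \<kappa>"
  obtains B where "B \<subseteq> Arr E" "B0 \<subseteq> B" "|B| <o \<kappa>"
    "category (subcat_of E B)" "filtered (subcat_of E B)"
    "\<And>x. x \<in> ends E B \<Longrightarrow> ext x \<subseteq> B"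
proof -
  interpret E: category E by (rule E)
  have "\<exists>f g. f \<in> Arr E \<and> g \<in> Arr E \<and> Dom E f = x \<and> Dom E g = y \<and> Cod E f = Cod E g"
    if xy: "x \<in> Obj E" "y \<in> Obj E" for x y
  proof -
    obtain z f g where "f \<in> hom E x z" "g \<in> hom E y z"
      using E(2) xy unfolding filtered_def by blast
    then show ?thesis
      by (intro exI[of _ f] exI[of _ g]) (simp add: hom_def)
  qed
  then obtain c1 c2 where c: "\<And>x y. x \<in> Obj E \<Longrightarrow> y \<in> Obj E \<Longrightarrow> c1 x y \<in> Arr E \<and> c2 x y \<in> Arr E \<and>
      Dom E (c1 x y) = x \<and> Dom E (c2 x y) = y \<and> Cod E (c1 x y) = Cod E (c2 x y)"
    by metis
  obtain q where q: "\<And>f g. \<lbrakk>f \<in> Arr E; g \<in> Arr E; Dom E f = Dom E g; Cod E f = Cod E g\<rbrakk> \<Longrightarrow>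
      q f g \<in> Arr E \<and> Dom E (q f g) = Cod E f \<and> Cmp E (q f g) f = Cmp E (q f g) g"
    using E(2) unfolding filtered_def by metis
  define comps where "comps B = (\<lambda>(g, f). Cmp E g f) ` {(g, f) \<in> B \<times> B. Cod E f = Dom E g}" for B
  define cocs where "cocs B = (\<lambda>(x, y). c1 x y) ` (ends E B \<times> ends E B) \<union>
    (\<lambda>(x, y). c2 x y) ` (ends E B \<times> ends E B)" for B
  define coeqs where "coeqs B = (\<lambda>(f, g). q f g) `
    {(f, g) \<in> B \<times> B. Dom E f = Dom E g \<and> Cod E f = Cod E g}" for B
  \<comment> \<open>Besides identities, composites, upper bounds and coequalizing arrows, a stage
    adds the arrows that the caller attaches through \<open>ext\<close> to each object already
    reached.\<close>
  define step where "step B = B \<union> Idn E ` ends E B \<union> comps B \<union> cocs B \<union> coeqs B \<union>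
    (\<Union>x \<in> ends E B. ext x)" for B
  define S where "S n = (step ^^ n) B0" for n
  have ends_Obj: "ends E B \<subseteq> Obj E" if "B \<subseteq> Arr E" for B
    using that E.Dom_in_Obj E.Cod_in_Obj by (auto simp: ends_def)
  have step_Arr: "step B \<subseteq> Arr E" if B: "B \<subseteq> Arr E" for B
  proof -
    note o = subsetD[OF ends_Obj[OF B]]
    have "comps B \<subseteq> Arr E"
      using B E.Cmp_in_hom by (fastforce simp: comps_def hom_def)
    moreover have "Idn E ` ends E B \<subseteq> Arr E"
      using E.Idn_in_hom o by (auto simp: hom_def)
    moreover have "cocs B \<subseteq> Arr E"
      using c o by (auto simp: cocs_def)
    moreover have "coeqs B \<subseteq> Arr E"
      using q B by (auto simp: coeqs_def)
    ultimately show ?thesis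
      using B ext(1) o unfolding step_def by blast
  qed
  have S_Arr: "S n \<subseteq> Arr E" for n
    by (induction n) (use B0 step_Arr in \<open>auto simp: S_def\<close>)
  have ends_less: "|ends E B| <o \<kappa>" if "|B| <o \<kappa>" for B
    unfolding ends_def using that less_image less_Un by blast
  have "|step B| <o \<kappa>" if "B \<subseteq> Arr E" "|B| <o \<kappa>" for B
    unfolding step_def comps_def cocs_def coeqs_def
    using ends_Obj[OF that(1)]
    by (intro less_Un less_image less_UNION that ends_less less_Times ext(2)
        less_subset[OF less_Times[OF that(2) that(2)]]) auto
  then have S_less: "|S n| <o \<kappa>" for n
    by (induction n) (use B0 S_Arr in \<open>auto simp: S_def\<close>)
  have S_mono: "m \<le> n \<Longrightarrow> S m \<subseteq> S n" for m n
    by (rule lift_Suc_mono_le[of S]) (auto simp: S_def step_def)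
  define B where "B = (\<Union>n. S n)"
  have ends_B: "ends E B = (\<Union>n. ends E (S n))"
    by (auto simp: ends_def B_def)
  have ends_mono: "m \<le> n \<Longrightarrow> ends E (S m) \<subseteq> ends E (S n)" for m n
    using S_mono[of m n] by (auto simp: ends_def)
  have step_B: "step (S n) \<subseteq> B" for n
    unfolding B_def by (rule order_trans[OF _ UN_upper[of "Suc n"]]) (auto simp: S_def)
  have BA: "B \<subseteq> Arr E"
    using S_Arr by (auto simp: B_def)
  have ends_BO: "x \<in> Obj E" if "x \<in> ends E B" for x
    using ends_Obj[OF BA] that by blast
  \<comment> \<open>All closure operations have at most two arguments, so the arguments already
    occur together in one stage of the increasing chain.\<close>
  have two: "\<exists>n. f \<in> S n \<and> g \<in> S n" if fg: "f \<in> B" "g \<in> B" for f g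
  proof -
    from fg obtain m n where "f \<in> S m" "g \<in> S n" unfolding B_def by blast
    then show ?thesis
      using S_mono[of m "max m n"] S_mono[of n "max m n"] by auto
  qed
  have two_ends: "\<exists>n. x \<in> ends E (S n) \<and> y \<in> ends E (S n)" if xy: "x \<in> ends E B" "y \<in> ends E B" for x y
  proof -
    from xy obtain m n where "x \<in> ends E (S m)" "y \<in> ends E (S n)" unfolding ends_B by blast
    then show ?thesis
      using ends_mono[of m "max m n"] ends_mono[of n "max m n"] by auto
  qed
  have Idn_B: "Idn E x \<in> B" if "x \<in> ends E B" for x
    using two_ends[OF that that] step_B unfolding step_def by blast
  have Cmp_B: "Cmp E g f \<in> B" if fg: "f \<in> B" "g \<in> B" "Cod E f = Dom E g" for f g
  proof -
    obtain n where "f \<in> S n" "g \<in> S n" using two[OF fg(1,2)] by blast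
    then have "Cmp E g f \<in> comps (S n)" using fg(3) by (force simp: comps_def)
    then show ?thesis using step_B[of n] unfolding step_def by blast
  qed
  have c_B: "c1 x y \<in> B \<and> c2 x y \<in> B" if xy: "x \<in> ends E B" "y \<in> ends E B" for x y
  proof -
    obtain n where "x \<in> ends E (S n)" "y \<in> ends E (S n)" using two_ends[OF xy] by blast
    then have "c1 x y \<in> cocs (S n)" "c2 x y \<in> cocs (S n)" by (force simp: cocs_def)+
    then show ?thesis using step_B[of n] unfolding step_def by blast
  qed
  have q_B: "q f g \<in> B" if fg: "f \<in> B" "g \<in> B" "Dom E f = Dom E g" "Cod E f = Cod E g" for f g
  proof -
    obtain n where "f \<in> S n" "g \<in> S n" using two[OF fg(1,2)] by blast
    then have "q f g \<in> coeqs (S n)" using fg(3,4) by (force simp: coeqs_def)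
    then show ?thesis using step_B[of n] unfolding step_def by blast
  qed
  have ext_B: "ext x \<subseteq> B" if "x \<in> ends E B" for x
    using two_ends[OF that that] step_B unfolding step_def by blast
  let ?E = "subcat_of E B"
  have hom_sub: "f \<in> hom ?E x y \<longleftrightarrow> f \<in> B \<and> f \<in> hom E x y" for f x y
    using BA by (auto simp: hom_def subcat_of_def)
  have sel: "Obj ?E = ends E B" "Arr ?E = B" "Dom ?E = Dom E" "Cod ?E = Cod E" "Idn ?E = Idn E"
    "Cmp ?E = Cmp E"
    by (auto simp: subcat_of_def)
  have "category ?E"
  proof
    fix f x y g z
    assume "f \<in> hom ?E x y" "g \<in> hom ?E y z"
    then show "Cmp ?E g f \<in> hom ?E x z"
      using Cmp_B E.Cmp_in_hom by (auto simp: hom_sub sel) (auto simp: hom_def)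
  qed (use E.Idn_in_hom Idn_B ends_BO E.Cmp_Idn_left E.Cmp_Idn_right E.Cmp_assoc in
      \<open>auto simp: hom_sub sel ends_def\<close>)
  moreover have "filtered ?E"
    unfolding filtered_def
  proof (intro conjI ballI impI)
    from B0(2) obtain f where "f \<in> S 0" by (auto simp: S_def)
    then have "f \<in> B" unfolding B_def by blast
    then show "Obj ?E \<noteq> {}" by (auto simp: sel ends_def)
  next
    fix x y assume "x \<in> Obj ?E" "y \<in> Obj ?E"
    then have "c1 x y \<in> hom ?E x (Cod E (c1 x y))" "c2 x y \<in> hom ?E y (Cod E (c1 x y))"
      using c[of x y] c_B[of x y] ends_BO by (auto simp: sel hom_def)
    then show "\<exists>z. hom ?E x z \<noteq> {} \<and> hom ?E y z \<noteq> {}" by blast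
  next
    fix f g assume fg: "f \<in> Arr ?E" "g \<in> Arr ?E" "Dom ?E f = Dom ?E g \<and> Cod ?E f = Cod ?E g"
    show "\<exists>h\<in>Arr ?E. Dom ?E h = Cod ?E f \<and> Cmp ?E h f = Cmp ?E h g"
      by (rule bexI[of _ "q f g"]) (use fg q[of f g] q_B[of f g] BA in \<open>auto simp: sel\<close>)
  qed
  moreover have "B0 \<subseteq> B"
    using UN_upper[of 0 UNIV S] by (simp add: B_def S_def)
  \<comment> \<open>A union of countably many stages: this is where \<open>\<kappa>\<close> has to
    exceed the cardinality of the natural numbers.\<close>
  moreover have "|B| <o \<kappa>"
    unfolding B_def using less_UNION[OF less_nat] S_less by blast
  ultimately show ?thesis
    using that BA ext_B by blast
qed


lemma filtered_coequalize:
  assumes "filtered J" "f \<in> hom J x y" "g \<in> hom J x y"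
  obtains h z where "h \<in> hom J y z" "Cmp J h f = Cmp J h g"
proof -
  have *: "\<forall>f \<in> Arr J. \<forall>g \<in> Arr J. Dom J f = Dom J g \<and> Cod J f = Cod J g \<longrightarrow>
        (\<exists>h \<in> Arr J. Dom J h = Cod J f \<and> Cmp J h f = Cmp J h g)"
    using assms(1) unfolding filtered_def by (elim conjE)
  have "\<exists>h\<in>Arr J. Dom J h = Cod J f \<and> Cmp J h f = Cmp J h g"
    using *[rule_format, OF hom_memD(1)[OF assms(2)] hom_memD(1)[OF assms(3)]]
      hom_memD(2,3)[OF assms(2)] hom_memD(2,3)[OF assms(3)] by simp
  then show ?thesis
    using that hom_memD(3)[OF assms(2)] by (auto simp: hom_def)
qed

section \<open>Presentable objects\<close>

context generated_category
begin

text \<open>A relation \<open>(x, f, x', f')\<close> stands for the equation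
  \<open>x . f = x' . f'\<close>, and a generator is an arrow so that it carries its own source.
  Only existence is demanded in the universal property; uniqueness follows from the covering clause
  and separation.\<close>

definition presents :: "'b set \<Rightarrow> ('b \<times> 'b \<times> 'b \<times> 'b) set \<Rightarrow> 'p \<Rightarrow> bool" where
  "presents \<Gamma> Z \<phi> \<longleftrightarrow>
     (\<forall>x \<in> \<Gamma>. Dom K x \<in> G \<and> x \<in> hom K (Dom K x) \<phi>) \<and>
     (\<forall>(x, f, x', f') \<in> Z. x \<in> \<Gamma> \<and> x' \<in> \<Gamma> \<and>
        (\<exists>d \<in> G. f \<in> hom K d (Dom K x) \<and> f' \<in> hom K d (Dom K x')) \<and> x \<cdot> f = x' \<cdot> f') \<and>
     (\<forall>g \<in> G. \<forall>w \<in> hom K g \<phi>. \<exists>x \<in> \<Gamma>. \<exists>h \<in> hom K g (Dom K x). x \<cdot> h = w) \<and>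
     (\<forall>Y \<in> Obj K. \<forall>\<tau>. (\<forall>x \<in> \<Gamma>. \<tau> x \<in> hom K (Dom K x) Y) \<longrightarrow>
        (\<forall>(x, f, x', f') \<in> Z. \<tau> x \<cdot> f = \<tau> x' \<cdot> f') \<longrightarrow> (\<exists>h \<in> hom K \<phi> Y. \<forall>x \<in> \<Gamma>. h \<cdot> x = \<tau> x))"

definition presentable :: "'k rel \<Rightarrow> 'p \<Rightarrow> bool" where
  "presentable \<kappa> \<phi> \<longleftrightarrow> (\<exists>\<Gamma> Z. |\<Gamma>| <o \<kappa> \<and> |Z| <o \<kappa> \<and> presents \<Gamma> Z \<phi>)"

lemma presentsD:
  assumes "presents \<Gamma> Z \<phi>"
  shows "x \<in> \<Gamma> \<Longrightarrow> Dom K x \<in> G" and "x \<in> \<Gamma> \<Longrightarrow> x \<in> hom K (Dom K x) \<phi>"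
    and "(x, f, x', f') \<in> Z \<Longrightarrow> x \<in> \<Gamma> \<and> x' \<in> \<Gamma> \<and>
        (\<exists>d \<in> G. f \<in> hom K d (Dom K x) \<and> f' \<in> hom K d (Dom K x')) \<and> x \<cdot> f = x' \<cdot> f'"
    and "g \<in> G \<Longrightarrow> w \<in> hom K g \<phi> \<Longrightarrow> \<exists>x \<in> \<Gamma>. \<exists>h \<in> hom K g (Dom K x). x \<cdot> h = w"
    and "\<lbrakk>Y \<in> Obj K; \<And>x. x \<in> \<Gamma> \<Longrightarrow> \<tau> x \<in> hom K (Dom K x) Y;
        \<And>x f x' f'. (x, f, x', f') \<in> Z \<Longrightarrow> \<tau> x \<cdot> f = \<tau> x' \<cdot> f'\<rbrakk> \<Longrightarrow> \<exists>h \<in> hom K \<phi> Y. \<forall>x \<in> \<Gamma>. h \<cdot> x = \<tau> x"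
proof -
  note * = assms[unfolded presents_def]
  show "x \<in> \<Gamma> \<Longrightarrow> Dom K x \<in> G" "x \<in> \<Gamma> \<Longrightarrow> x \<in> hom K (Dom K x) \<phi>"
    using * by (elim conjE, blast)+
  show "(x, f, x', f') \<in> Z \<Longrightarrow> x \<in> \<Gamma> \<and> x' \<in> \<Gamma> \<and>
        (\<exists>d \<in> G. f \<in> hom K d (Dom K x) \<and> f' \<in> hom K d (Dom K x')) \<and> x \<cdot> f = x' \<cdot> f'"
    using * by (elim conjE) fast
  show "g \<in> G \<Longrightarrow> w \<in> hom K g \<phi> \<Longrightarrow> \<exists>x \<in> \<Gamma>. \<exists>h \<in> hom K g (Dom K x). x \<cdot> h = w"
    using * by (elim conjE) blast
  assume a: "Y \<in> Obj K" "\<And>x. x \<in> \<Gamma> \<Longrightarrow> \<tau> x \<in> hom K (Dom K x) Y"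
    "\<And>x f x' f'. (x, f, x', f') \<in> Z \<Longrightarrow> \<tau> x \<cdot> f = \<tau> x' \<cdot> f'"
  have "(\<forall>x \<in> \<Gamma>. \<tau> x \<in> hom K (Dom K x) Y) \<longrightarrow>
        (\<forall>(x, f, x', f') \<in> Z. \<tau> x \<cdot> f = \<tau> x' \<cdot> f') \<longrightarrow> (\<exists>h \<in> hom K \<phi> Y. \<forall>x \<in> \<Gamma>. h \<cdot> x = \<tau> x)"
    using * a(1) by (elim conjE) fast
  then show "\<exists>h \<in> hom K \<phi> Y. \<forall>x \<in> \<Gamma>. h \<cdot> x = \<tau> x"
    using a(2,3) by blast
qed

text \<open>Every element factors through some \<open>x\<close> in \<open>\<Gamma>\<close>, so
  agreement on \<open>\<Gamma>\<close> spreads to all elements, which separate arrows.\<close>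

lemma presents_unique:
  assumes P: "presents \<Gamma> Z \<phi>" and h: "h \<in> hom K \<phi> Y" "h' \<in> hom K \<phi> Y" "\<And>x. x \<in> \<Gamma> \<Longrightarrow> h \<cdot> x = h' \<cdot> x"
  shows "h = h'"
proof (rule G_separating[OF h(1,2)])
  fix g w assume "g \<in> G" "w \<in> hom K g \<phi>"
  then obtain x k where x: "x \<in> \<Gamma>" "k \<in> hom K g (Dom K x)" "x \<cdot> k = w"
    using presentsD(4)[OF P] by blast
  then show "h \<cdot> w = h' \<cdot> w"
    using assoc[OF x(2) presentsD(2)[OF P x(1)] h(1)] assoc[OF x(2) presentsD(2)[OF P x(1)] h(2)] h(3)[OF x(1)]
    by simp
qed

lemma presentable_generator:
  assumes \<kappa>: "regular_uncountable \<kappa>" and g: "g \<in> G"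
  shows "presentable \<kappa> g"
proof -
  interpret regular_uncountable \<kappa> by (rule \<kappa>)
  have I: "Idn K g \<in> hom K g g" using Idn_in_hom G_Obj[OF g] by blast
  then have D: "Dom K (Idn K g) = g" by (simp add: hom_def)
  have "presents {Idn K g} {} g"
    unfolding presents_def using I D g Cmp_Idn_left Cmp_Idn_right by auto
  then show ?thesis
    unfolding presentable_def
    by (intro exI[of _ "{Idn K g}"] exI[of _ "{}"] conjI less_finite) auto
qed

section \<open>Reflexive quotients of generators and the slice over an object\<close>

definition reflexive_quotients :: "'p set" where
  "reflexive_quotients = {Z. \<exists>a \<in> G. \<exists>b \<in> G. \<exists>p q e. reflexive_pair K a b p q \<and> is_coequalizer K p q Z e}"

lemma is_coequalizer_epi:
  assumes "is_coequalizer K p q Z e" and p: "p \<in> hom K a b" "q \<in> hom K a b"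
    and h: "h \<in> hom K Z W" "h' \<in> hom K Z W" "h \<cdot> e = h' \<cdot> e"
  shows "h = h'"
proof -
  have e: "e \<in> hom K b Z" "e \<cdot> p = e \<cdot> q"
    and univ: "\<And>d. d \<in> hom K b W \<Longrightarrow> d \<cdot> p = d \<cdot> q \<Longrightarrow> \<exists>!h. h \<in> hom K Z W \<and> h \<cdot> e = d"
  proof -
    have b: "Cod K p = b" using p by (simp add: hom_def)
    note * = assms(1)[unfolded is_coequalizer_def b]
    show "e \<in> hom K b Z" "e \<cdot> p = e \<cdot> q" using * by auto
    show "\<And>d. d \<in> hom K b W \<Longrightarrow> d \<cdot> p = d \<cdot> q \<Longrightarrow> \<exists>!h. h \<in> hom K Z W \<and> h \<cdot> e = d"
      using * by (elim conjE) simp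
  qed
  have "(h \<cdot> e) \<cdot> p = (h \<cdot> e) \<cdot> q"
    using assoc[OF p(1) e(1) h(1)] assoc[OF p(2) e(1) h(1)] e(2) by simp
  then show ?thesis
    using univ[OF Cmp_in_hom[OF e(1) h(1)]] h by metis
qed

lemma is_coequalizerD:
  assumes "is_coequalizer K p q Z e" and p: "p \<in> hom K a b"
  shows "e \<in> hom K b Z" and "e \<cdot> p = e \<cdot> q"
    and "\<And>W d. d \<in> hom K b W \<Longrightarrow> d \<cdot> p = d \<cdot> q \<Longrightarrow> \<exists>h \<in> hom K Z W. h \<cdot> e = d"
proof -
  have b: "Cod K p = b" using p by (simp add: hom_def)
  note * = assms(1)[unfolded is_coequalizer_def b]
  show "e \<in> hom K b Z" "e \<cdot> p = e \<cdot> q" using * by auto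
  show "\<And>W d. d \<in> hom K b W \<Longrightarrow> d \<cdot> p = d \<cdot> q \<Longrightarrow> \<exists>h \<in> hom K Z W. h \<cdot> e = d"
    using * by (elim conjE) blast
qed

lemma reflexive_pairD:
  assumes "reflexive_pair K a b p q"
  shows "p \<in> hom K a b" "q \<in> hom K a b"
  using assms by (auto simp: reflexive_pair_def)

lemma generator_reflexive_quotient:
  assumes "g \<in> G"
  shows "g \<in> reflexive_quotients"
proof -
  have I: "Idn K g \<in> hom K g g" using Idn_in_hom G_Obj[OF assms] by blast
  have "reflexive_pair K g g (Idn K g) (Idn K g)"
    unfolding reflexive_pair_def using I Cmp_Idn_left by blast
  moreover have "is_coequalizer K (Idn K g) (Idn K g) g (Idn K g)"
    unfolding is_coequalizer_def hom_memD(3)[OF I] using I Cmp_Idn_right by auto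
  ultimately show ?thesis
    unfolding reflexive_quotients_def using assms by blast
qed

text \<open>A span between the cospans \<open>(f, 1)\<close> and \<open>(g, 1)\<close> is a reflexive pair
  through which the parallel pair \<open>f, g\<close> factors.\<close>

lemma reflexive_factorization:
  assumes ws: "wsifted \<phi>" and G: "b1 \<in> G" "b2 \<in> G" "c \<in> G" and x: "x \<in> hom K c \<phi>"
    and fg1: "f1 \<in> hom K b1 c" "g1 \<in> hom K b1 c" "x \<cdot> f1 = x \<cdot> g1"
    and fg2: "f2 \<in> hom K b2 c" "g2 \<in> hom K b2 c" "x \<cdot> f2 = x \<cdot> g2"
  obtains p s t u1 u2 where "p \<in> G" "reflexive_pair K p c s t" "x \<cdot> s = x \<cdot> t"
    "u1 \<in> hom K b1 p" "s \<cdot> u1 = f1" "t \<cdot> u1 = g1" "u2 \<in> hom K b2 p" "s \<cdot> u2 = f2" "t \<cdot> u2 = g2"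
proof -
  have I: "Idn K c \<in> hom K c c" using Idn_in_hom G_Obj[OF G(3)] by blast
  obtain p1 u v s1 t1 where p1: "p1 \<in> G" "u \<in> hom K b1 p1" "v \<in> hom K c p1" "s1 \<in> hom K p1 c"
    "t1 \<in> hom K p1 c" "x \<cdot> s1 = x \<cdot> t1" "s1 \<cdot> u = f1" "t1 \<cdot> u = g1" "s1 \<cdot> v = Idn K c" "t1 \<cdot> v = Idn K c"
    by (rule spannedE[OF wsifted_spanned[OF ws G(1,3,3,3) x x fg1(1) I fg1(2) I fg1(3) refl]])
  \<comment> \<open>This span lies between the cospans \<open>(s1, f2)\<close> and
    \<open>(t1, g2)\<close>, so the second pair is absorbed while the first still factors through
    \<open>w\<close>; the section becomes \<open>w . v\<close>. Both pairs are needed at once when a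
    quotient map has to descend along another one.\<close>
  obtain p w u2 s t where p: "p \<in> G" "w \<in> hom K p1 p" "u2 \<in> hom K b2 p" "s \<in> hom K p c"
    "t \<in> hom K p c" "x \<cdot> s = x \<cdot> t" "s \<cdot> w = s1" "t \<cdot> w = t1" "s \<cdot> u2 = f2" "t \<cdot> u2 = g2"
    by (rule spannedE[OF wsifted_spanned[OF ws p1(1) G(2,3,3) x x p1(4) fg2(1) p1(5) fg2(2) p1(6) fg2(3)]])
  have "s \<cdot> (w \<cdot> v) = Idn K c" "t \<cdot> (w \<cdot> v) = Idn K c"
    using assoc[OF p1(3) p(2) p(4)] assoc[OF p1(3) p(2) p(5)] p1 p by simp_all
  then have "reflexive_pair K p c s t"
    unfolding reflexive_pair_def using p Cmp_in_hom[OF p1(3) p(2)] by blast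
  moreover have "s \<cdot> (w \<cdot> u) = f1" "t \<cdot> (w \<cdot> u) = g1"
    using assoc[OF p1(2) p(2) p(4)] assoc[OF p1(2) p(2) p(5)] p1 p by simp_all
  ultimately show ?thesis
    using that[OF p(1) _ p(6) Cmp_in_hom[OF p1(2) p(2)] _ _ p(3) p(9,10)] by blast
qed

text \<open>An arrow records both endpoints, because \<open>\<alpha>\<close> alone does not
  determine \<open>m'\<close>.\<close>

definition slice :: "'p set \<Rightarrow> 'p \<Rightarrow> ('b, 'b \<times> 'b \<times> 'b) cat" where
  "slice R \<phi> = \<lparr>Obj = {m \<in> Arr K. Dom K m \<in> R \<and> Cod K m = \<phi>},
     Arr = {(m, m', \<alpha>). m \<in> Arr K \<and> Dom K m \<in> R \<and> Cod K m = \<phi> \<and>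
       m' \<in> Arr K \<and> Dom K m' \<in> R \<and> Cod K m' = \<phi> \<and> \<alpha> \<in> hom K (Dom K m) (Dom K m') \<and> m' \<cdot> \<alpha> = m},
     Dom = (\<lambda>(m, m', \<alpha>). m), Cod = (\<lambda>(m, m', \<alpha>). m'), Idn = (\<lambda>m. (m, m, Idn K (Dom K m))),
     Cmp = (\<lambda>(m', m'', \<beta>) (m, _, \<alpha>). (m, m'', \<beta> \<cdot> \<alpha>))\<rparr>"

lemma slice_Obj: "m \<in> Obj (slice R \<phi>) \<longleftrightarrow> Dom K m \<in> R \<and> m \<in> hom K (Dom K m) \<phi>"
  by (auto simp: slice_def hom_def)

lemma slice_hom: "a \<in> hom (slice R \<phi>) m m' \<longleftrightarrow> (\<exists>\<alpha>. a = (m, m', \<alpha>) \<and> m \<in> Obj (slice R \<phi>) \<and>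
    m' \<in> Obj (slice R \<phi>) \<and> \<alpha> \<in> hom K (Dom K m) (Dom K m') \<and> m' \<cdot> \<alpha> = m)"
  by (auto simp: slice_def hom_def)

lemma slice_Arr: "(m, m', \<alpha>) \<in> Arr (slice R \<phi>) \<longleftrightarrow> m \<in> Obj (slice R \<phi>) \<and>
    m' \<in> Obj (slice R \<phi>) \<and> \<alpha> \<in> hom K (Dom K m) (Dom K m') \<and> m' \<cdot> \<alpha> = m"
  by (auto simp: slice_def hom_def)

lemma slice_simps [simp]:
  "Dom (slice R \<phi>) (m, m', \<alpha>) = m" "Cod (slice R \<phi>) (m, m', \<alpha>) = m'"
  "Idn (slice R \<phi>) m = (m, m, Idn K (Dom K m))"
  "Cmp (slice R \<phi>) (m1, m2, \<beta>) (m, m', \<alpha>) = (m, m2, \<beta> \<cdot> \<alpha>)"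
  by (auto simp: slice_def)

lemma category_slice: "category (slice R \<phi>)"
proof
  fix f assume f: "f \<in> Arr (slice R \<phi>)"
  obtain m m' \<alpha> where "f = (m, m', \<alpha>)" by (metis prod_cases3)
  then show "Dom (slice R \<phi>) f \<in> Obj (slice R \<phi>)" "Cod (slice R \<phi>) f \<in> Obj (slice R \<phi>)"
    using f by (auto simp: slice_Arr)
next
  fix m assume "m \<in> Obj (slice R \<phi>)"
  then show "Idn (slice R \<phi>) m \<in> hom (slice R \<phi>) m m"
    using Idn_in_hom hom_Obj Cmp_Idn_right by (fastforce simp: slice_hom slice_Obj)
next
  fix f x y g z assume f: "f \<in> hom (slice R \<phi>) x y" and g: "g \<in> hom (slice R \<phi>) y z"
  then show "Cmp (slice R \<phi>) g f \<in> hom (slice R \<phi>) x z"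
    using Cmp_in_hom assoc by (fastforce simp: slice_hom slice_Obj)
next
  fix f x y assume "f \<in> hom (slice R \<phi>) x y"
  then show "Cmp (slice R \<phi>) f (Idn (slice R \<phi>) x) = f" "Cmp (slice R \<phi>) (Idn (slice R \<phi>) y) f = f"
    using Cmp_Idn_left Cmp_Idn_right by (auto simp: slice_hom)
next
  fix f w x g y h z
  assume "f \<in> hom (slice R \<phi>) w x" "g \<in> hom (slice R \<phi>) x y" "h \<in> hom (slice R \<phi>) y z"
  then show "Cmp (slice R \<phi>) h (Cmp (slice R \<phi>) g f) = Cmp (slice R \<phi>) (Cmp (slice R \<phi>) h g) f"
    using Cmp_assoc by (auto simp: slice_hom)
qed

lemma reflexive_quotientE:
  assumes "Z \<in> reflexive_quotients"
  obtains a b p q e where "a \<in> G" "b \<in> G" "reflexive_pair K a b p q" "is_coequalizer K p q Z e"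
    "p \<in> hom K a b" "q \<in> hom K a b" "e \<in> hom K b Z" "e \<cdot> p = e \<cdot> q"
proof -
  obtain a b p q e where *: "a \<in> G" "b \<in> G" "reflexive_pair K a b p q" "is_coequalizer K p q Z e"
    using assms unfolding reflexive_quotients_def by blast
  show ?thesis
    by (rule that[OF * reflexive_pairD[OF *(3)] is_coequalizerD(1,2)[OF *(4) reflexive_pairD(1)[OF *(3)]]])
qed

text \<open>The source of new objects in the slice: an element that identifies the pair extends
  along its coequalizer.\<close>

lemma slice_quotient:
  assumes "a \<in> G" "b \<in> G" "reflexive_pair K a b s t" and x: "x \<in> hom K b \<phi>" "x \<cdot> s = x \<cdot> t"
  obtains m e where "m \<in> Obj (slice reflexive_quotients \<phi>)" "e \<in> hom K b (Dom K m)" "m \<cdot> e = x"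
    "is_coequalizer K s t (Dom K m) e" "e \<cdot> s = e \<cdot> t"
proof -
  note st = reflexive_pairD[OF assms(3)]
  obtain Z e where Z: "is_coequalizer K s t Z e"
    using G_coequalizer[OF assms(1,2) st] by blast
  note e = is_coequalizerD[OF Z st(1)]
  obtain m where m: "m \<in> hom K Z \<phi>" "m \<cdot> e = x" using e(3)[OF x] by blast
  then have D: "Dom K m = Z" by (simp add: hom_def)
  have "Z \<in> reflexive_quotients"
    unfolding reflexive_quotients_def using assms Z by blast
  then show ?thesis
    using that[of m e] m Z e(1,2) by (simp add: slice_Obj D)
qed

text \<open>Everything is done on covers by generators. For two objects, the covering elements are
  bounded by one element \<open>z\<close> at \<open>c\<close>; the relations of both quotients,
  pushed to \<open>c\<close>, are identified by \<open>z\<close>, and coequalizing one reflexive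
  pair through which they factor gives an upper bound. For two parallel arrows, their lifts between
  the covers are coequalized in the same manner.\<close>

lemma filtered_slice:
  assumes ws: "wsifted \<phi>"
  shows "filtered (slice reflexive_quotients \<phi>)" (is "filtered ?S")
  unfolding filtered_def
proof (intro conjI ballI impI)
  obtain g x where "g \<in> G" "x \<in> hom K g \<phi>"
    using ws unfolding wsifted_def by (elim conjE) blast
  then have "x \<in> Obj ?S"
    using generator_reflexive_quotient by (auto simp: slice_Obj hom_def)
  then show "Obj ?S \<noteq> {}" by blast
next
  fix m1 m2 assume m12: "m1 \<in> Obj ?S" "m2 \<in> Obj ?S"
  then have m: "Dom K m1 \<in> reflexive_quotients" "m1 \<in> hom K (Dom K m1) \<phi>"
    "Dom K m2 \<in> reflexive_quotients" "m2 \<in> hom K (Dom K m2) \<phi>"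
    by (auto simp: slice_Obj)
  obtain a1 b1 p1 q1 e1 where 1: "a1 \<in> G" "b1 \<in> G" "reflexive_pair K a1 b1 p1 q1"
    "is_coequalizer K p1 q1 (Dom K m1) e1" "p1 \<in> hom K a1 b1" "q1 \<in> hom K a1 b1"
    "e1 \<in> hom K b1 (Dom K m1)" "e1 \<cdot> p1 = e1 \<cdot> q1"
    by (rule reflexive_quotientE[OF m(1)])
  obtain a2 b2 p2 q2 e2 where 2: "a2 \<in> G" "b2 \<in> G" "reflexive_pair K a2 b2 p2 q2"
    "is_coequalizer K p2 q2 (Dom K m2) e2" "p2 \<in> hom K a2 b2" "q2 \<in> hom K a2 b2"
    "e2 \<in> hom K b2 (Dom K m2)" "e2 \<cdot> p2 = e2 \<cdot> q2"
    by (rule reflexive_quotientE[OF m(3)])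
  obtain c z k1 k2 where c: "c \<in> G" "z \<in> hom K c \<phi>" "k1 \<in> hom K b1 c" "k2 \<in> hom K b2 c"
    "z \<cdot> k1 = m1 \<cdot> e1" "z \<cdot> k2 = m2 \<cdot> e2"
    by (rule wsifted_cospan[OF ws 1(2) 2(2) Cmp_in_hom[OF 1(7) m(2)] Cmp_in_hom[OF 2(7) m(4)]])
  have eq1: "z \<cdot> (k1 \<cdot> p1) = z \<cdot> (k1 \<cdot> q1)"
    using assoc[OF 1(5) c(3) c(2)] assoc[OF 1(6) c(3) c(2)] c(5) 1(8)
      assoc[OF 1(5,7) m(2)] assoc[OF 1(6,7) m(2)] by simp
  have eq2: "z \<cdot> (k2 \<cdot> p2) = z \<cdot> (k2 \<cdot> q2)"
    using assoc[OF 2(5) c(4) c(2)] assoc[OF 2(6) c(4) c(2)] c(6) 2(8)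
      assoc[OF 2(5,7) m(4)] assoc[OF 2(6,7) m(4)] by simp
  obtain p s t u1 u2 where p: "p \<in> G" "reflexive_pair K p c s t" "z \<cdot> s = z \<cdot> t"
    "u1 \<in> hom K a1 p" "s \<cdot> u1 = k1 \<cdot> p1" "t \<cdot> u1 = k1 \<cdot> q1"
    "u2 \<in> hom K a2 p" "s \<cdot> u2 = k2 \<cdot> p2" "t \<cdot> u2 = k2 \<cdot> q2"
    by (rule reflexive_factorization[OF ws 1(1) 2(1) c(1,2) Cmp_in_hom[OF 1(5) c(3)]
      Cmp_in_hom[OF 1(6) c(3)] eq1 Cmp_in_hom[OF 2(5) c(4)] Cmp_in_hom[OF 2(6) c(4)] eq2])
  note st = reflexive_pairD[OF p(2)]
  obtain n e where n: "n \<in> Obj ?S" "e \<in> hom K c (Dom K n)" "n \<cdot> e = z" "e \<cdot> s = e \<cdot> t"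
    by (rule slice_quotient[OF p(1) c(1) p(2) c(2) p(3)])
  have nh: "n \<in> hom K (Dom K n) \<phi>" using n(1) by (simp add: slice_Obj)
  \<comment> \<open>Stated once for both given objects: \<open>e . ki\<close> respects the pair that
    presents the source of \<open>m\<close>, hence descends along \<open>ei\<close>, and the
    descended arrow lies over \<open>\<phi>\<close> because \<open>ei\<close> is epic.\<close>
  have factor: "hom ?S m n \<noteq> {}"
    if m: "m \<in> Obj ?S" and ci: "is_coequalizer K pi qi (Dom K m) ei" and pi: "pi \<in> hom K ai bi" "qi \<in> hom K ai bi"
      and ki: "ki \<in> hom K bi c" "z \<cdot> ki = m \<cdot> ei" and ui: "ui \<in> hom K ai p" "s \<cdot> ui = ki \<cdot> pi" "t \<cdot> ui = ki \<cdot> qi"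
    for m pi qi ei ai bi ki ui
  proof -
    have mh: "m \<in> hom K (Dom K m) \<phi>" using m by (simp add: slice_Obj)
    note ei = is_coequalizerD[OF ci pi(1)]
    have "(e \<cdot> ki) \<cdot> pi = (e \<cdot> ki) \<cdot> qi"
      using assoc[OF pi(1) ki(1) n(2)] assoc[OF pi(2) ki(1) n(2)] ui(2,3)
        assoc[OF ui(1) st(1) n(2)] assoc[OF ui(1) st(2) n(2)] n(4) by simp
    then obtain \<alpha> where \<alpha>: "\<alpha> \<in> hom K (Dom K m) (Dom K n)" "\<alpha> \<cdot> ei = e \<cdot> ki"
      using ei(3)[OF Cmp_in_hom[OF ki(1) n(2)]] by blast
    have "n \<cdot> \<alpha> = m"
    proof (rule is_coequalizer_epi[OF ci pi Cmp_in_hom[OF \<alpha>(1) nh] mh])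
      show "(n \<cdot> \<alpha>) \<cdot> ei = m \<cdot> ei"
        using assoc[OF ei(1) \<alpha>(1) nh] \<alpha>(2) assoc[OF ki(1) n(2) nh] n(3) ki(2) by simp
    qed
    then have "(m, n, \<alpha>) \<in> hom ?S m n"
      using \<alpha>(1) m n(1) by (simp add: slice_hom)
    then show ?thesis by blast
  qed
  show "\<exists>z. hom ?S m1 z \<noteq> {} \<and> hom ?S m2 z \<noteq> {}"
    using factor[OF m12(1) 1(4,5,6) c(3,5) p(4,5,6)] factor[OF m12(2) 2(4,5,6) c(4,6) p(7,8,9)] by blast
next
  fix f g assume f: "f \<in> Arr ?S" and g: "g \<in> Arr ?S" and fg: "Dom ?S f = Dom ?S g \<and> Cod ?S f = Cod ?S g"
  obtain m1 m2 \<alpha> where f': "f = (m1, m2, \<alpha>)" by (metis prod_cases3)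
  obtain \<beta> where g': "g = (m1, m2, \<beta>)" using fg f' by (cases g) auto
  have \<alpha>: "\<alpha> \<in> hom K (Dom K m1) (Dom K m2)" "m2 \<cdot> \<alpha> = m1" and \<beta>: "\<beta> \<in> hom K (Dom K m1) (Dom K m2)" "m2 \<cdot> \<beta> = m1"
    and m12: "m1 \<in> Obj ?S" "m2 \<in> Obj ?S"
    using f g f' g' by (auto simp: slice_Arr)
  have m: "Dom K m1 \<in> reflexive_quotients" "m1 \<in> hom K (Dom K m1) \<phi>"
    "Dom K m2 \<in> reflexive_quotients" "m2 \<in> hom K (Dom K m2) \<phi>"
    using m12 by (auto simp: slice_Obj)
  obtain a1 b1 p1 q1 e1 where 1: "a1 \<in> G" "b1 \<in> G" "reflexive_pair K a1 b1 p1 q1"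
    "is_coequalizer K p1 q1 (Dom K m1) e1" "p1 \<in> hom K a1 b1" "q1 \<in> hom K a1 b1"
    "e1 \<in> hom K b1 (Dom K m1)" "e1 \<cdot> p1 = e1 \<cdot> q1"
    by (rule reflexive_quotientE[OF m(1)])
  obtain a2 b2 p2 q2 e2 where 2: "a2 \<in> G" "b2 \<in> G" "reflexive_pair K a2 b2 p2 q2"
    "is_coequalizer K p2 q2 (Dom K m2) e2" "p2 \<in> hom K a2 b2" "q2 \<in> hom K a2 b2"
    "e2 \<in> hom K b2 (Dom K m2)" "e2 \<cdot> p2 = e2 \<cdot> q2"
    by (rule reflexive_quotientE[OF m(3)])
  \<comment> \<open>By projectivity of generators an arrow between quotients lifts to their covers,
    which turns \<open>\<alpha>\<close>, \<open>\<beta>\<close> into a parallel pair of arrows in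
    \<open>G\<close>.\<close>
  obtain f0 where f0: "f0 \<in> hom K b1 b2" "e2 \<cdot> f0 = \<alpha> \<cdot> e1"
    using G_projective[OF 2(1,2) 1(2) 2(5,6,4) Cmp_in_hom[OF 1(7) \<alpha>(1)]] by blast
  obtain g0 where g0: "g0 \<in> hom K b1 b2" "e2 \<cdot> g0 = \<beta> \<cdot> e1"
    using G_projective[OF 2(1,2) 1(2) 2(5,6,4) Cmp_in_hom[OF 1(7) \<beta>(1)]] by blast
  define x where "x = m2 \<cdot> e2"
  have x: "x \<in> hom K b2 \<phi>" unfolding x_def by (rule Cmp_in_hom[OF 2(7) m(4)])
  have eq1: "x \<cdot> f0 = x \<cdot> g0"
    unfolding x_def using assoc[OF f0(1) 2(7) m(4)] assoc[OF g0(1) 2(7) m(4)] f0 g0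
      assoc[OF 1(7) \<alpha>(1) m(4)] assoc[OF 1(7) \<beta>(1) m(4)] \<alpha>(2) \<beta>(2) by simp
  have eq2: "x \<cdot> p2 = x \<cdot> q2"
    unfolding x_def using assoc[OF 2(5,7) m(4)] assoc[OF 2(6,7) m(4)] 2(8) by simp
  \<comment> \<open>The pair \<open>p2, q2\<close> is included so that the new quotient map of
    \<open>b2\<close> descends along \<open>e2\<close> and yields an arrow out of
    \<open>m2\<close>.\<close>
  obtain p s t u1 u2 where p: "p \<in> G" "reflexive_pair K p b2 s t" "x \<cdot> s = x \<cdot> t"
    "u1 \<in> hom K b1 p" "s \<cdot> u1 = f0" "t \<cdot> u1 = g0"
    "u2 \<in> hom K a2 p" "s \<cdot> u2 = p2" "t \<cdot> u2 = q2"
    by (rule reflexive_factorization[OF ws 1(2) 2(1,2) x f0(1) g0(1) eq1 2(5,6) eq2])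
  note st = reflexive_pairD[OF p(2)]
  obtain n e where n: "n \<in> Obj ?S" "e \<in> hom K b2 (Dom K n)" "n \<cdot> e = x" "e \<cdot> s = e \<cdot> t"
    by (rule slice_quotient[OF p(1) 2(2) p(2) x p(3)])
  have nh: "n \<in> hom K (Dom K n) \<phi>" using n(1) by (simp add: slice_Obj)
  have "e \<cdot> p2 = e \<cdot> q2"
    using assoc[OF p(7) st(1) n(2)] assoc[OF p(7) st(2) n(2)] p(8,9) n(4) by simp
  then obtain h where h: "h \<in> hom K (Dom K m2) (Dom K n)" "h \<cdot> e2 = e"
    using is_coequalizerD(3)[OF 2(4,5) n(2)] by blast
  have "n \<cdot> h = m2"
  proof (rule is_coequalizer_epi[OF 2(4,5,6) Cmp_in_hom[OF h(1) nh] m(4)])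
    show "(n \<cdot> h) \<cdot> e2 = m2 \<cdot> e2"
      using assoc[OF 2(7) h(1) nh] h(2) n(3) x_def by simp
  qed
  then have hS: "(m2, n, h) \<in> Arr ?S"
    using h m12 n(1) by (simp add: slice_Arr)
  have "h \<cdot> \<alpha> = h \<cdot> \<beta>"
  proof (rule is_coequalizer_epi[OF 1(4,5,6) Cmp_in_hom[OF \<alpha>(1) h(1)] Cmp_in_hom[OF \<beta>(1) h(1)]])
    have "(h \<cdot> \<alpha>) \<cdot> e1 = e \<cdot> f0"
      using assoc[OF 1(7) \<alpha>(1) h(1)] f0(2) assoc[OF f0(1) 2(7) h(1)] h(2) by simp
    also have "\<dots> = e \<cdot> g0"
      using assoc[OF p(4) st(1) n(2)] assoc[OF p(4) st(2) n(2)] p(5,6) n(4) by simp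
    also have "\<dots> = (h \<cdot> \<beta>) \<cdot> e1"
      using assoc[OF 1(7) \<beta>(1) h(1)] g0(2) assoc[OF g0(1) 2(7) h(1)] h(2) by simp
    finally show "(h \<cdot> \<alpha>) \<cdot> e1 = (h \<cdot> \<beta>) \<cdot> e1" .
  qed
  then show "\<exists>h\<in>Arr ?S. Dom ?S h = Cod ?S f \<and> Cmp ?S h f = Cmp ?S h g"
    using hS f' g' by (intro bexI[of _ "(m2, n, h)"]) auto
qed

end

section \<open>Presentations of colimits, and finite presentability against a filtered
  colimit\<close>

context diagram
begin

text \<open>The images of all generators of the \<open>D i\<close> generate the colimit. Its
  relations are those of the single \<open>D i\<close>, together with equations forcing the maps
  induced on the \<open>D i\<close> to be compatible with the arrows of \<open>J\<close>.\<close>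

lemma presentable_colimit:
  assumes \<kappa>: "regular_uncountable \<kappa>" and colim: "is_colimit J K D X \<mu>"
    and J: "|Arr J| <o \<kappa>" and P: "\<And>i. i \<in> Obj J \<Longrightarrow> presentable \<kappa> (FObj D i)"
  shows "presentable \<kappa> X"
proof -
  interpret regular_uncountable \<kappa> by (rule \<kappa>)
  have "\<exists>\<Gamma> Z. |\<Gamma>| <o \<kappa> \<and> |Z| <o \<kappa> \<and> presents \<Gamma> Z (FObj D i)" if "i \<in> Obj J" for i
    using P[OF that] unfolding presentable_def .
  then obtain \<Gamma> Z where less: "\<And>i. i \<in> Obj J \<Longrightarrow> |\<Gamma> i| <o \<kappa>" "\<And>i. i \<in> Obj J \<Longrightarrow> |Z i| <o \<kappa>"
    and pres: "\<And>i. i \<in> Obj J \<Longrightarrow> presents (\<Gamma> i) (Z i) (FObj D i)"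
    by metis
  have objJ: "|Obj J| <o \<kappa>"
    by (rule less_subset[OF less_image[OF J, of "Dom J"]]) (use J.Idn_in_hom in \<open>force simp: hom_def\<close>)
  have "\<exists>x' h. x' \<in> \<Gamma> (Cod J \<theta>) \<and> h \<in> hom K (Dom K x) (Dom K x') \<and> x' \<cdot> h = FArr D \<theta> \<cdot> x"
    if \<theta>: "\<theta> \<in> Arr J" and x: "x \<in> \<Gamma> (Dom J \<theta>)" for \<theta> x
  proof -
    have h: "\<theta> \<in> hom J (Dom J \<theta>) (Cod J \<theta>)" using \<theta> by (simp add: hom_def)
    note o = J.hom_Obj[OF h]
    have "FArr D \<theta> \<cdot> x \<in> hom K (Dom K x) (FObj D (Cod J \<theta>))"
      by (rule Cmp_in_hom[OF presentsD(2)[OF pres[OF o(1)] x] D_hom[OF h]])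
    then show ?thesis
      using presentsD(4)[OF pres[OF o(2)] presentsD(1)[OF pres[OF o(1)] x]] by blast
  qed
  then obtain r k where rk: "\<And>\<theta> x. \<theta> \<in> Arr J \<Longrightarrow> x \<in> \<Gamma> (Dom J \<theta>) \<Longrightarrow> r \<theta> x \<in> \<Gamma> (Cod J \<theta>) \<and>
      k \<theta> x \<in> hom K (Dom K x) (Dom K (r \<theta> x)) \<and> r \<theta> x \<cdot> k \<theta> x = FArr D \<theta> \<cdot> x"
    by metis
  define \<Gamma>X where "\<Gamma>X = (\<Union>i \<in> Obj J. (\<lambda>x. \<mu> i \<cdot> x) ` \<Gamma> i)"
  define Z1 where "Z1 = (\<Union>i \<in> Obj J. (\<lambda>(x, f, x', f'). (\<mu> i \<cdot> x, f, \<mu> i \<cdot> x', f')) ` Z i)"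
  \<comment> \<open>For an arrow \<open>\<theta>\<close> of \<open>J\<close>, a generator
    \<open>x\<close> is sent to \<open>r \<theta> x . k \<theta> x\<close>, an expression in the
    generators at the target. The relation equates the two images in \<open>X\<close>; the identity
    stands in for the missing factor on the left.\<close>
  define Z2 where "Z2 = (\<Union>\<theta> \<in> Arr J. (\<lambda>x. (\<mu> (Dom J \<theta>) \<cdot> x, Idn K (Dom K x), \<mu> (Cod J \<theta>) \<cdot> r \<theta> x, k \<theta> x)) ` \<Gamma> (Dom J \<theta>))"
  have gen: "\<mu> i \<cdot> x \<in> \<Gamma>X \<and> Dom K x \<in> G \<and> \<mu> i \<cdot> x \<in> hom K (Dom K x) X \<and> Dom K (\<mu> i \<cdot> x) = Dom K x \<and>
    x \<in> hom K (Dom K x) (FObj D i)" if "i \<in> Obj J" "x \<in> \<Gamma> i" for i x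
  proof -
    note h = Cmp_in_hom[OF presentsD(2)[OF pres[OF that(1)] that(2)] \<mu>_hom[OF that(1)]]
    show ?thesis
      using h presentsD(1,2)[OF pres[OF that(1)] that(2)] that by (auto simp: \<Gamma>X_def hom_memD(2)[OF h])
  qed
  have "presents \<Gamma>X (Z1 \<union> Z2) X"
    unfolding presents_def
  proof (intro conjI ballI allI impI)
    fix x assume "x \<in> \<Gamma>X"
    then obtain i x0 where "i \<in> Obj J" "x0 \<in> \<Gamma> i" "x = \<mu> i \<cdot> x0"
      by (auto simp: \<Gamma>X_def)
    then show "Dom K x \<in> G" "x \<in> hom K (Dom K x) X" using gen by auto
  next
    fix z assume "z \<in> Z1 \<union> Z2"
    then show "case z of (x, f, x', f') \<Rightarrow> x \<in> \<Gamma>X \<and> x' \<in> \<Gamma>X \<and>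
        (\<exists>d \<in> G. f \<in> hom K d (Dom K x) \<and> f' \<in> hom K d (Dom K x')) \<and> x \<cdot> f = x' \<cdot> f'"
    proof
      assume "z \<in> Z1"
      then obtain i x f x' f' where i: "i \<in> Obj J" "(x, f, x', f') \<in> Z i" "z = (\<mu> i \<cdot> x, f, \<mu> i \<cdot> x', f')"
        by (auto simp: Z1_def)
      obtain d where d: "x \<in> \<Gamma> i" "x' \<in> \<Gamma> i" "d \<in> G" "f \<in> hom K d (Dom K x)" "f' \<in> hom K d (Dom K x')" "x \<cdot> f = x' \<cdot> f'"
        using presentsD(3)[OF pres[OF i(1)] i(2)] by blast
      have "(\<mu> i \<cdot> x) \<cdot> f = (\<mu> i \<cdot> x') \<cdot> f'"
        using assoc[OF d(4) _ \<mu>_hom[OF i(1)]] assoc[OF d(5) _ \<mu>_hom[OF i(1)]] gen[OF i(1) d(1)] gen[OF i(1) d(2)] d(6)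
        by simp
      then show ?thesis using gen[OF i(1) d(1)] gen[OF i(1) d(2)] d i(3) by auto
    next
      assume "z \<in> Z2"
      then obtain \<theta> x where \<theta>: "\<theta> \<in> Arr J" "x \<in> \<Gamma> (Dom J \<theta>)"
        "z = (\<mu> (Dom J \<theta>) \<cdot> x, Idn K (Dom K x), \<mu> (Cod J \<theta>) \<cdot> r \<theta> x, k \<theta> x)"
        by (auto simp: Z2_def)
      have h: "\<theta> \<in> hom J (Dom J \<theta>) (Cod J \<theta>)" using \<theta> by (simp add: hom_def)
      note o = J.hom_Obj[OF h]
      note R = rk[OF \<theta>(1,2)] and g = gen[OF o(1) \<theta>(2)]
      note g' = gen[OF o(2) conjunct1[OF R]]
      have "(\<mu> (Dom J \<theta>) \<cdot> x) \<cdot> Idn K (Dom K x) = \<mu> (Dom J \<theta>) \<cdot> x"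
        using g Cmp_Idn_right by blast
      also have "\<dots> = (\<mu> (Cod J \<theta>) \<cdot> r \<theta> x) \<cdot> k \<theta> x"
        using assoc[OF _ _ \<mu>_hom[OF o(2)], of "k \<theta> x" _ _ "r \<theta> x"] R g g' assoc[OF _ D_hom[OF h] \<mu>_hom[OF o(2)], of x]
          \<mu>_comm[OF h] by metis
      finally have "(\<mu> (Dom J \<theta>) \<cdot> x) \<cdot> Idn K (Dom K x) = (\<mu> (Cod J \<theta>) \<cdot> r \<theta> x) \<cdot> k \<theta> x" .
      then show ?thesis
        using \<theta>(3) g g' R Idn_in_hom[OF G_Obj, of "Dom K x"] by auto
    qed
  next
    fix g w assume g: "g \<in> G" and w: "w \<in> hom K g X"
    obtain i y where i: "i \<in> Obj J" "y \<in> hom K g (FObj D i)" "\<mu> i \<cdot> y = w"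
      by (rule tight_lift[OF g w])
    obtain x h where x: "x \<in> \<Gamma> i" "h \<in> hom K g (Dom K x)" "x \<cdot> h = y"
      using presentsD(4)[OF pres[OF i(1)] g i(2)] by blast
    show "\<exists>x\<in>\<Gamma>X. \<exists>h\<in>hom K g (Dom K x). x \<cdot> h = w"
      using gen[OF i(1) x(1)] x i assoc[OF x(2) _ \<mu>_hom[OF i(1)]]
      by (intro bexI[of _ "\<mu> i \<cdot> x"] bexI[of _ h]) auto
  next
    fix Y \<tau> assume Y: "Y \<in> Obj K" and \<tau>: "\<forall>x\<in>\<Gamma>X. \<tau> x \<in> hom K (Dom K x) Y"
      and rel: "\<forall>(x, f, x', f')\<in>Z1 \<union> Z2. \<tau> x \<cdot> f = \<tau> x' \<cdot> f'"
    have "\<exists>h\<in>hom K (FObj D i) Y. \<forall>x\<in>\<Gamma> i. h \<cdot> x = \<tau> (\<mu> i \<cdot> x)" if i: "i \<in> Obj J" for i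
    proof (rule presentsD(5)[OF pres[OF i] Y])
      show "x \<in> \<Gamma> i \<Longrightarrow> \<tau> (\<mu> i \<cdot> x) \<in> hom K (Dom K x) Y" for x
        using gen[OF i, of x] \<tau> by fastforce
      fix x f x' f' assume "(x, f, x', f') \<in> Z i"
      then have "(\<mu> i \<cdot> x, f, \<mu> i \<cdot> x', f') \<in> Z1 \<union> Z2"
        unfolding Z1_def using i by force
      then show "\<tau> (\<mu> i \<cdot> x) \<cdot> f = \<tau> (\<mu> i \<cdot> x') \<cdot> f'"
        using rel by fastforce
    qed
    then obtain h where h: "\<And>i. i \<in> Obj J \<Longrightarrow> h i \<in> hom K (FObj D i) Y"
      and h\<tau>: "\<And>i x. i \<in> Obj J \<Longrightarrow> x \<in> \<Gamma> i \<Longrightarrow> h i \<cdot> x = \<tau> (\<mu> i \<cdot> x)"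
      by metis
    have coc: "is_cocone J K D Y (\<lambda>i\<in>Obj J. h i)"
      unfolding is_cocone_def
    proof (intro conjI ballI)
      fix \<theta> assume \<theta>: "\<theta> \<in> Arr J"
      then have \<theta>h: "\<theta> \<in> hom J (Dom J \<theta>) (Cod J \<theta>)" by (simp add: hom_def)
      note o = J.hom_Obj[OF \<theta>h]
      \<comment> \<open>Compatibility is tested on the generators of the source, where it is one of
        the relations in \<open>Z2\<close>.\<close>
      have "h (Cod J \<theta>) \<cdot> FArr D \<theta> = h (Dom J \<theta>)"
      proof (rule presents_unique[OF pres[OF o(1)] Cmp_in_hom[OF D_hom[OF \<theta>h] h[OF o(2)]] h[OF o(1)]])
        fix x assume x: "x \<in> \<Gamma> (Dom J \<theta>)"
        note R = rk[OF \<theta> x] and g = gen[OF o(1) x]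
        note g' = gen[OF o(2) conjunct1[OF R]]
        have "(\<mu> (Dom J \<theta>) \<cdot> x, Idn K (Dom K x), \<mu> (Cod J \<theta>) \<cdot> r \<theta> x, k \<theta> x) \<in> Z1 \<union> Z2"
          unfolding Z2_def using \<theta> x by force
        then have 1: "\<tau> (\<mu> (Dom J \<theta>) \<cdot> x) \<cdot> Idn K (Dom K x) = \<tau> (\<mu> (Cod J \<theta>) \<cdot> r \<theta> x) \<cdot> k \<theta> x"
          using rel by fastforce
        have "\<tau> (\<mu> (Dom J \<theta>) \<cdot> x) \<in> hom K (Dom K (\<mu> (Dom J \<theta>) \<cdot> x)) Y"
          using \<tau> g by blast
        then have 2: "\<tau> (\<mu> (Dom J \<theta>) \<cdot> x) \<in> hom K (Dom K x) Y"
          using g by metis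
        have "h (Dom J \<theta>) \<cdot> x = (h (Cod J \<theta>) \<cdot> r \<theta> x) \<cdot> k \<theta> x"
          unfolding h\<tau>[OF o(1) x] h\<tau>[OF o(2) conjunct1[OF R]]
          by (rule trans[OF Cmp_Idn_right[OF 2, symmetric] 1])
        also have "\<dots> = h (Cod J \<theta>) \<cdot> (r \<theta> x \<cdot> k \<theta> x)"
          by (rule assoc[OF _ _ h[OF o(2)]]) (use R g' in blast)+
        also have "r \<theta> x \<cdot> k \<theta> x = FArr D \<theta> \<cdot> x"
          using R by blast
        also have "h (Cod J \<theta>) \<cdot> (FArr D \<theta> \<cdot> x) = (h (Cod J \<theta>) \<cdot> FArr D \<theta>) \<cdot> x"
          by (rule assoc[OF _ D_hom[OF \<theta>h] h[OF o(2)], symmetric]) (use g in blast)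
        finally show "(h (Cod J \<theta>) \<cdot> FArr D \<theta>) \<cdot> x = h (Dom J \<theta>) \<cdot> x" by simp
      qed
      then show "(\<lambda>i\<in>Obj J. h i) (Cod J \<theta>) \<cdot> FArr D \<theta> = (\<lambda>i\<in>Obj J. h i) (Dom J \<theta>)"
        using o by simp
    qed (use Y h in auto)
    have "\<exists>H. H \<in> hom K X Y \<and> (\<forall>i \<in> Obj J. H \<cdot> \<mu> i = (\<lambda>i\<in>Obj J. h i) i)"
      using colim coc unfolding is_colimit_def by (elim conjE) blast
    then obtain H where H: "H \<in> hom K X Y" "\<And>i. i \<in> Obj J \<Longrightarrow> H \<cdot> \<mu> i = h i"
      by auto
    show "\<exists>h\<in>hom K X Y. \<forall>x\<in>\<Gamma>X. h \<cdot> x = \<tau> x"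
    proof (intro bexI[of _ H] ballI)
      fix x assume "x \<in> \<Gamma>X"
      then obtain i x0 where i: "i \<in> Obj J" "x0 \<in> \<Gamma> i" "x = \<mu> i \<cdot> x0"
        by (auto simp: \<Gamma>X_def)
      then show "H \<cdot> x = \<tau> x"
        using assoc[OF _ \<mu>_hom[OF i(1)] H(1), of x0 "Dom K x0"] gen[OF i(1,2)] H(2)[OF i(1)] h\<tau>[OF i(1,2)] by simp
    qed (rule H(1))
  qed
  moreover have "|\<Gamma>X| <o \<kappa>" "|Z1 \<union> Z2| <o \<kappa>"
    unfolding \<Gamma>X_def Z1_def Z2_def
    by (intro less_Un less_UNION less_image J objJ less J.Dom_in_Obj; assumption)+
  ultimately show ?thesis
    unfolding presentable_def by blast
qed

text \<open>Finite presentability of \<open>\<psi>\<close>, tested only on the one colimit at hand.\<close>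

definition factors :: "'p \<Rightarrow> bool" where
  "factors \<psi> \<longleftrightarrow>
     (\<forall>h \<in> hom K \<psi> X. \<exists>i \<in> Obj J. \<exists>y \<in> hom K \<psi> (FObj D i). \<mu> i \<cdot> y = h) \<and>
     (\<forall>i \<in> Obj J. \<forall>y \<in> hom K \<psi> (FObj D i). \<forall>z \<in> hom K \<psi> (FObj D i). \<mu> i \<cdot> y = \<mu> i \<cdot> z \<longrightarrow>
        (\<exists>j. \<exists>\<theta> \<in> hom J i j. FArr D \<theta> \<cdot> y = FArr D \<theta> \<cdot> z))"

lemma factors_lift:
  assumes "factors \<psi>" "h \<in> hom K \<psi> X"
  obtains i y where "i \<in> Obj J" "y \<in> hom K \<psi> (FObj D i)" "\<mu> i \<cdot> y = h"
  using assms unfolding factors_def by (elim conjE) blast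

lemma factors_eq:
  assumes "factors \<psi>" "y \<in> hom K \<psi> (FObj D i)" "z \<in> hom K \<psi> (FObj D i)" "\<mu> i \<cdot> y = \<mu> i \<cdot> z" "i \<in> Obj J"
  obtains j \<theta> where "\<theta> \<in> hom J i j" "FArr D \<theta> \<cdot> y = FArr D \<theta> \<cdot> z"
  using assms unfolding factors_def by (elim conjE) blast

lemma filtered_span:
  assumes J: "filtered J" and "\<alpha> \<in> hom J i j" "\<beta> \<in> hom J i k"
  obtains l \<gamma> \<delta> where "\<gamma> \<in> hom J j l" "\<delta> \<in> hom J k l" "Cmp J \<gamma> \<alpha> = Cmp J \<delta> \<beta>"
proof -
  obtain m \<gamma> \<delta> where m: "\<gamma> \<in> hom J j m" "\<delta> \<in> hom J k m"
    using J J.hom_Obj(2)[OF assms(2)] J.hom_Obj(2)[OF assms(3)] unfolding filtered_def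
    by (elim conjE) blast
  note h = J.Cmp_in_hom[OF assms(2) m(1)] J.Cmp_in_hom[OF assms(3) m(2)]
  obtain \<eta> n where \<eta>: "\<eta> \<in> hom J m n" "Cmp J \<eta> (Cmp J \<gamma> \<alpha>) = Cmp J \<eta> (Cmp J \<delta> \<beta>)"
    by (rule filtered_coequalize[OF J h])
  then show ?thesis
    using that[OF J.Cmp_in_hom[OF m(1) \<eta>(1)] J.Cmp_in_hom[OF m(2) \<eta>(1)]]
      J.assoc[OF assms(2) m(1) \<eta>(1)] J.assoc[OF assms(3) m(2) \<eta>(1)] by simp
qed

text \<open>The common target is maintained along the zigzag: a forward step is absorbed by
  completing a span of indices to a commutative square, a backward step by precomposition.\<close>

lemma filtered_zigzag:
  assumes J: "filtered J" and i: "i \<in> Obj J" and y: "y \<in> hom K g (FObj D i)"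
    and "((i, y), (j, z)) \<in> zigzag J D g"
  obtains k \<alpha> \<beta> where "\<alpha> \<in> hom J i k" "\<beta> \<in> hom J j k" "FArr D \<alpha> \<cdot> y = FArr D \<beta> \<cdot> z"
proof -
  let ?P = "\<lambda>(j, z). z \<in> hom K g (FObj D j) \<and> (\<exists>k \<alpha> \<beta>. \<alpha> \<in> hom J i k \<and> \<beta> \<in> hom J j k \<and> FArr D \<alpha> \<cdot> y = FArr D \<beta> \<cdot> z)"
  have "?P (j, z)"
    using assms(4) unfolding zigzag_def
  proof (induction rule: equivcl_induct)
    case refl
    then show ?case using y J.Idn_in_hom[OF i] by blast
  next
    case (step q r)
    obtain j1 z1 where q: "q = (j1, z1)" by fastforce
    obtain k \<alpha> \<beta> where k: "\<alpha> \<in> hom J i k" "\<beta> \<in> hom J j1 k" "FArr D \<alpha> \<cdot> y = FArr D \<beta> \<cdot> z1" "z1 \<in> hom K g (FObj D j1)"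
      using step(3) q by auto
    from step(2) show ?case
    proof
      assume "(q, r) \<in> {((i, y), (j, FArr D \<theta> \<cdot> y)) | i j \<theta> y. \<theta> \<in> hom J i j \<and> y \<in> hom K g (FObj D i)}"
      then obtain j2 \<theta> where \<theta>: "\<theta> \<in> hom J j1 j2" "r = (j2, FArr D \<theta> \<cdot> z1)" using q by blast
      obtain l \<gamma> \<delta> where l: "\<gamma> \<in> hom J k l" "\<delta> \<in> hom J j2 l" "Cmp J \<gamma> \<beta> = Cmp J \<delta> \<theta>"
        by (rule filtered_span[OF J k(2) \<theta>(1)])
      have "FArr D (Cmp J \<gamma> \<alpha>) \<cdot> y = FArr D \<delta> \<cdot> (FArr D \<theta> \<cdot> z1)"
        using D_Cmp_assoc[OF k(1) l(1) y] D_Cmp_assoc[OF k(2) l(1) k(4)] D_Cmp_assoc[OF \<theta>(1) l(2) k(4)] k(3) l(3) by simp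
      then show ?thesis
        using \<theta> l J.Cmp_in_hom[OF k(1) l(1)] Cmp_in_hom[OF k(4) D_hom[OF \<theta>(1)]] by auto
    next
      assume "(r, q) \<in> {((i, y), (j, FArr D \<theta> \<cdot> y)) | i j \<theta> y. \<theta> \<in> hom J i j \<and> y \<in> hom K g (FObj D i)}"
      then obtain j2 z2 \<theta> where \<theta>: "\<theta> \<in> hom J j2 j1" "r = (j2, z2)" "z1 = FArr D \<theta> \<cdot> z2" "z2 \<in> hom K g (FObj D j2)"
        using q by blast
      have "FArr D \<alpha> \<cdot> y = FArr D (Cmp J \<beta> \<theta>) \<cdot> z2"
        using D_Cmp_assoc[OF \<theta>(1) k(2) \<theta>(4)] k(3) \<theta>(3) by simp
      then show ?thesis
        using \<theta> k J.Cmp_in_hom[OF \<theta>(1) k(2)] by auto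
    qed
  qed
  then show ?thesis using that by auto
qed

lemma \<mu>_comm_assoc:
  assumes "\<theta> \<in> hom J i j" "x \<in> hom K a (FObj D i)"
  shows "\<mu> j \<cdot> (FArr D \<theta> \<cdot> x) = \<mu> i \<cdot> x"
  using assoc[OF assms(2) D_hom[OF assms(1)] \<mu>_hom] J.hom_Obj[OF assms(1)] \<mu>_comm[OF assms(1)] by simp

lemma factors_generator:
  assumes J: "filtered J" and g: "g \<in> G"
  shows "factors g"
  unfolding factors_def
proof (intro conjI ballI impI)
  fix h assume "h \<in> hom K g X"
  then show "\<exists>i\<in>Obj J. \<exists>y\<in>hom K g (FObj D i). \<mu> i \<cdot> y = h"
    using tight_lift[OF g] by metis
next
  fix i y z assume i: "i \<in> Obj J" and yz: "y \<in> hom K g (FObj D i)" "z \<in> hom K g (FObj D i)" "\<mu> i \<cdot> y = \<mu> i \<cdot> z"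
  obtain k \<alpha> \<beta> where k: "\<alpha> \<in> hom J i k" "\<beta> \<in> hom J i k" "FArr D \<alpha> \<cdot> y = FArr D \<beta> \<cdot> z"
    by (rule filtered_zigzag[OF J i yz(1) tight_zigzag[OF g i i yz]])
  \<comment> \<open>The elements agree so far only along two different arrows
    \<open>\<alpha>\<close> and \<open>\<beta>\<close>. Completing the square and coequalizing its
    two legs gives \<open>?\<epsilon>\<close> with
    \<open>?\<epsilon> . \<alpha> = ?\<epsilon> . \<beta>\<close>, a single arrow along which both
    agree.\<close>
  obtain l \<gamma> \<delta> where l: "\<gamma> \<in> hom J k l" "\<delta> \<in> hom J k l" "Cmp J \<gamma> \<alpha> = Cmp J \<delta> \<beta>"
    by (rule filtered_span[OF J k(1,2)])
  obtain \<eta> n where \<eta>: "\<eta> \<in> hom J l n" "Cmp J \<eta> \<gamma> = Cmp J \<eta> \<delta>"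
    by (rule filtered_coequalize[OF J l(1,2)])
  let ?\<epsilon> = "Cmp J \<eta> \<gamma>"
  have \<epsilon>: "?\<epsilon> \<in> hom J k n" by (rule J.Cmp_in_hom[OF l(1) \<eta>(1)])
  have "Cmp J ?\<epsilon> \<alpha> = Cmp J ?\<epsilon> \<beta>"
    using J.assoc[OF k(1) l(1) \<eta>(1)] J.assoc[OF k(2) l(2) \<eta>(1)] l(3) \<eta>(2) by simp
  then have "FArr D (Cmp J ?\<epsilon> \<alpha>) \<cdot> y = FArr D (Cmp J ?\<epsilon> \<alpha>) \<cdot> z"
    using D_Cmp_assoc[OF k(1) \<epsilon> yz(1)] D_Cmp_assoc[OF k(2) \<epsilon> yz(2)] k(3) by simp
  then show "\<exists>j. \<exists>\<theta> \<in> hom J i j. FArr D \<theta> \<cdot> y = FArr D \<theta> \<cdot> z"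
    using J.Cmp_in_hom[OF k(1) \<epsilon>] by blast
qed

text \<open>An arrow out of \<open>Z\<close> is an arrow out of \<open>b\<close> that equalizes
  \<open>p\<close> and \<open>q\<close>. After factoring it through some \<open>D i\<close>, the two
  composites with \<open>p\<close> and \<open>q\<close> agree only in \<open>X\<close>; the property
  of \<open>a\<close> makes them agree at a later index.\<close>

lemma factors_coequalizer:
  assumes "factors a" "factors b" and p: "p \<in> hom K a b" "q \<in> hom K a b" and Z: "is_coequalizer K p q Z e"
  shows "factors Z"
  unfolding factors_def
proof (intro conjI ballI impI)
  note e = is_coequalizerD[OF Z p(1)]
  fix h assume h: "h \<in> hom K Z X"
  obtain i y where i: "i \<in> Obj J" "y \<in> hom K b (FObj D i)" "\<mu> i \<cdot> y = h \<cdot> e"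
    by (rule factors_lift[OF assms(2) Cmp_in_hom[OF e(1) h]])
  note m = \<mu>_hom[OF i(1)]
  have "\<mu> i \<cdot> (y \<cdot> p) = \<mu> i \<cdot> (y \<cdot> q)"
    using assoc[OF p(1) i(2) m] assoc[OF p(2) i(2) m] i(3) assoc[OF p(1) e(1) h] assoc[OF p(2) e(1) h] e(2) by simp
  then obtain j \<theta> where \<theta>: "\<theta> \<in> hom J i j" "FArr D \<theta> \<cdot> (y \<cdot> p) = FArr D \<theta> \<cdot> (y \<cdot> q)"
    using factors_eq[OF assms(1) Cmp_in_hom[OF p(1) i(2)] Cmp_in_hom[OF p(2) i(2)] _ i(1)] by blast
  note j = J.hom_Obj(2)[OF \<theta>(1)] and D\<theta> = D_hom[OF \<theta>(1)]
  obtain k where k: "k \<in> hom K Z (FObj D j)" "k \<cdot> e = FArr D \<theta> \<cdot> y"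
    using e(3)[OF Cmp_in_hom[OF i(2) D\<theta>]] assoc[OF p(1) i(2) D\<theta>] assoc[OF p(2) i(2) D\<theta>] \<theta>(2) by auto
  have "\<mu> j \<cdot> k = h"
  proof (rule is_coequalizer_epi[OF Z p Cmp_in_hom[OF k(1) \<mu>_hom[OF j]] h])
    show "(\<mu> j \<cdot> k) \<cdot> e = h \<cdot> e"
      using assoc[OF e(1) k(1) \<mu>_hom[OF j]] k(2) \<mu>_comm_assoc[OF \<theta>(1) i(2)] i(3) by simp
  qed
  then show "\<exists>i\<in>Obj J. \<exists>y\<in>hom K Z (FObj D i). \<mu> i \<cdot> y = h"
    using j k by blast
next
  note e = is_coequalizerD[OF Z p(1)]
  fix i y z assume i: "i \<in> Obj J" and yz: "y \<in> hom K Z (FObj D i)" "z \<in> hom K Z (FObj D i)" "\<mu> i \<cdot> y = \<mu> i \<cdot> z"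
  have "\<mu> i \<cdot> (y \<cdot> e) = \<mu> i \<cdot> (z \<cdot> e)"
    using assoc[OF e(1) yz(1) \<mu>_hom[OF i]] assoc[OF e(1) yz(2) \<mu>_hom[OF i]] yz(3) by simp
  then obtain j \<theta> where \<theta>: "\<theta> \<in> hom J i j" "FArr D \<theta> \<cdot> (y \<cdot> e) = FArr D \<theta> \<cdot> (z \<cdot> e)"
    using factors_eq[OF assms(2) Cmp_in_hom[OF e(1) yz(1)] Cmp_in_hom[OF e(1) yz(2)] _ i] by blast
  note D\<theta> = D_hom[OF \<theta>(1)]
  have "FArr D \<theta> \<cdot> y = FArr D \<theta> \<cdot> z"
    using is_coequalizer_epi[OF Z p Cmp_in_hom[OF yz(1) D\<theta>] Cmp_in_hom[OF yz(2) D\<theta>]]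
      assoc[OF e(1) yz(1) D\<theta>] assoc[OF e(1) yz(2) D\<theta>] \<theta>(2) by simp
  then show "\<exists>j. \<exists>\<theta> \<in> hom J i j. FArr D \<theta> \<cdot> y = FArr D \<theta> \<cdot> z"
    using \<theta>(1) by blast
qed

end

section \<open>Small filtered diagrams of reflexive quotients, and invariance under
  isomorphism\<close>

context generated_category
begin

text \<open>A small subcategory of the slice has colimit \<open>\<phi>\<close> as soon as it
  contains the presentation and ties each of its objects to a generator of the presentation. One
  coequalizer per index is enough; no iterated quotients are needed as values of the
  diagram.\<close>

lemma filtered_presentation:
  assumes \<kappa>: "regular_uncountable \<kappa>" and ws: "wsifted \<phi>" and "presentable \<kappa> \<phi>"
  obtains A :: "('b, 'b \<times> 'b \<times> 'b) cat" and D \<mu>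
  where "category A" "filtered A" "|Arr A| <o \<kappa>" "is_functor A K D"
    "\<And>i. i \<in> Obj A \<Longrightarrow> FObj D i \<in> reflexive_quotients" "is_colimit A K D \<phi> \<mu>"
proof -
  interpret regular_uncountable \<kappa> by (rule \<kappa>)
  obtain \<Gamma> Z where less: "|\<Gamma>| <o \<kappa>" "|Z| <o \<kappa>" and P: "presents \<Gamma> Z \<phi>"
    using assms(3) unfolding presentable_def by blast
  define S where "S = slice reflexive_quotients \<phi>"
  interpret S: category S unfolding S_def by (rule category_slice)
  note S_Obj = slice_Obj[of _ reflexive_quotients \<phi>, folded S_def]
    and S_Arr = slice_Arr[of _ _ _ reflexive_quotients \<phi>, folded S_def]
    and S_simps = slice_simps[of reflexive_quotients \<phi>, folded S_def]
  have gen_Obj: "x \<in> Obj S" "Dom K x = g" if "g \<in> G" "x \<in> hom K g \<phi>" for x g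
    using that generator_reflexive_quotient by (auto simp: S_Obj hom_def)
  have \<Gamma>_Obj: "x \<in> Obj S" if "x \<in> \<Gamma>" for x
    by (rule gen_Obj[OF presentsD(1)[OF P that] presentsD(2)[OF P that]])
  \<comment> \<open>Each object \<open>m\<close> of the slice has an epic cover by a generator
    \<open>c\<close>, and the element obtained by restricting \<open>m\<close> to that cover factors
    through some \<open>x\<close> in \<open>\<Gamma>\<close>.\<close>
  have "\<exists>c e x h. c \<in> G \<and> e \<in> hom K c (Dom K m) \<and> x \<in> \<Gamma> \<and> h \<in> hom K c (Dom K x) \<and> m \<cdot> e = x \<cdot> h \<and>
    (\<forall>W. \<forall>u \<in> hom K (Dom K m) W. \<forall>v \<in> hom K (Dom K m) W. u \<cdot> e = v \<cdot> e \<longrightarrow> u = v)"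
    if m: "m \<in> Obj S" for m
  proof -
    have mh: "Dom K m \<in> reflexive_quotients" "m \<in> hom K (Dom K m) \<phi>"
      using m by (auto simp: S_Obj)
    obtain a b p q e where e: "b \<in> G" "is_coequalizer K p q (Dom K m) e"
      "p \<in> hom K a b" "q \<in> hom K a b" "e \<in> hom K b (Dom K m)"
      by (rule reflexive_quotientE[OF mh(1)])
    have "\<exists>x\<in>\<Gamma>. \<exists>h\<in>hom K b (Dom K x). x \<cdot> h = m \<cdot> e"
      by (rule presentsD(4)[OF P e(1) Cmp_in_hom[OF e(5) mh(2)]])
    then obtain x h where "x \<in> \<Gamma>" "h \<in> hom K b (Dom K x)" "m \<cdot> e = x \<cdot> h" by metis
    then show ?thesis
      using e is_coequalizer_epi[OF e(2,3,4)] by blast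
  qed
  then obtain c e r k where cov: "\<And>m. m \<in> Obj S \<Longrightarrow> c m \<in> G \<and> e m \<in> hom K (c m) (Dom K m) \<and> r m \<in> \<Gamma> \<and>
      k m \<in> hom K (c m) (Dom K (r m)) \<and> m \<cdot> e m = r m \<cdot> k m"
    and epi: "\<And>m W u v. m \<in> Obj S \<Longrightarrow> u \<in> hom K (Dom K m) W \<Longrightarrow> v \<in> hom K (Dom K m) W \<Longrightarrow>
      u \<cdot> e m = v \<cdot> e m \<Longrightarrow> u = v"
    by metis
  \<comment> \<open>The two arrows out of the object \<open>m . e m\<close>: one to \<open>m\<close>
    along the cover, one to the presenting generator \<open>r m\<close>. They link \<open>m\<close>
    to the presentation.\<close>
  define ext where "ext m = {(m \<cdot> e m, m, e m), (m \<cdot> e m, r m, k m)}" for m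
  have ext: "ext m \<subseteq> Arr S" if m: "m \<in> Obj S" for m
  proof -
    note C = cov[OF m]
    have mh: "m \<in> hom K (Dom K m) \<phi>" using m by (auto simp: S_Obj)
    have me: "m \<cdot> e m \<in> hom K (c m) \<phi>"
      using C Cmp_in_hom[OF _ mh] by blast
    have "m \<cdot> e m \<in> Obj S" "Dom K (m \<cdot> e m) = c m"
      using gen_Obj[OF conjunct1[OF C] me] by auto
    then show ?thesis
      using C m \<Gamma>_Obj by (auto simp: ext_def S_Arr)
  qed
  \<comment> \<open>The seeds: identities bring in the generators, and each relation contributes two
    arrows out of the common object \<open>x . f\<close>, which make a cocone respect it.\<close>
  define B0 where "B0 = Idn S ` \<Gamma> \<union> (\<lambda>(x, f, x', f'). (x \<cdot> f, x, f)) ` Z \<union>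
    (\<lambda>(x, f, x', f'). (x \<cdot> f, x', f')) ` Z"
  have B0: "B0 \<subseteq> Arr S"
  proof -
    have "(x \<cdot> f, x, f) \<in> Arr S \<and> (x \<cdot> f, x', f') \<in> Arr S" if z: "(x, f, x', f') \<in> Z" for x f x' f'
    proof -
      obtain d where d: "x \<in> \<Gamma>" "x' \<in> \<Gamma>" "d \<in> G" "f \<in> hom K d (Dom K x)" "f' \<in> hom K d (Dom K x')" "x \<cdot> f = x' \<cdot> f'"
        using presentsD(3)[OF P z] by blast
      show ?thesis
        using d gen_Obj[OF d(3) Cmp_in_hom[OF d(4) presentsD(2)[OF P d(1)]]] \<Gamma>_Obj by (auto simp: S_Arr)
    qed
    moreover have "Idn S ` \<Gamma> \<subseteq> Arr S"
      using S.Idn_in_hom[OF \<Gamma>_Obj] by (auto simp: hom_def)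
    ultimately show ?thesis by (auto simp: B0_def)
  qed
  have "\<Gamma> \<noteq> {}"
  proof -
    obtain g w where "g \<in> G" "w \<in> hom K g \<phi>"
      using ws unfolding wsifted_def by (elim conjE) blast
    then show ?thesis using presentsD(4)[OF P] by blast
  qed
  then have B0_ne: "B0 \<noteq> {}" by (auto simp: B0_def)
  have B0_less: "|B0| <o \<kappa>"
    unfolding B0_def by (intro less_Un less_image less)
  have fS: "filtered S" unfolding S_def by (rule filtered_slice[OF ws])
  have ext_less: "|ext m| <o \<kappa>" if "m \<in> Obj S" for m by (rule less_finite) (simp add: ext_def)
  obtain B where B: "B \<subseteq> Arr S" "B0 \<subseteq> B" "|B| <o \<kappa>"
    "category (subcat_of S B)" "filtered (subcat_of S B)" "\<And>m. m \<in> ends S B \<Longrightarrow> ext m \<subseteq> B"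
    by (rule small_filtered_subcategory[where ext = ext, OF S.category_axioms fS B0 B0_ne B0_less ext ext_less])
      (assumption | rule that)+
  let ?A = "subcat_of S B"
  have sel: "Obj ?A = ends S B" "Arr ?A = B" "Dom ?A = Dom S" "Cod ?A = Cod S" "Idn ?A = Idn S"
    "Cmp ?A = Cmp S"
    by (auto simp: subcat_of_def)
  interpret A: category ?A by (rule B)
  have ends_Obj: "m \<in> Obj S" if "m \<in> ends S B" for m
    using that B(1) S.Dom_in_Obj S.Cod_in_Obj by (auto simp: ends_def)
  have arrow: "m \<in> ends S B \<and> m' \<in> ends S B \<and> \<alpha> \<in> hom K (Dom K m) (Dom K m') \<and> m' \<cdot> \<alpha> = m"
    if "(m, m', \<alpha>) \<in> B" for m m' \<alpha>
  proof -
    have "Dom S (m, m', \<alpha>) \<in> ends S B" "Cod S (m, m', \<alpha>) \<in> ends S B"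
      using that unfolding ends_def by blast+
    then show ?thesis
      using subsetD[OF B(1) that] by (simp add: S_simps S_Arr)
  qed
  define D where "D = \<lparr>FObj = (\<lambda>m\<in>ends S B. Dom K m), FArr = (\<lambda>a\<in>B. snd (snd a))\<rparr>"
  define \<mu> where "\<mu> = (\<lambda>m\<in>ends S B. m)"
  have \<Gamma>_ends: "x \<in> ends S B" if "x \<in> \<Gamma>" for x
  proof -
    have "Idn S x \<in> B" using that B(2) by (auto simp: B0_def)
    then show ?thesis using arrow[of x x "Idn K (Dom K x)"] by (simp add: S_simps)
  qed
  have "is_functor ?A K D"
    unfolding is_functor_def
  proof (intro conjI ballI impI)
    show "FObj D \<in> Obj ?A \<rightarrow>\<^sub>E Obj K"
      using ends_Obj hom_Obj by (fastforce simp: D_def sel S_Obj)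
    show "FArr D \<in> Arr ?A \<rightarrow>\<^sub>E Arr K"
      using arrow by (fastforce simp: D_def sel hom_def)
  next
    fix f assume f: "f \<in> Arr ?A"
    obtain m m' \<alpha> where m: "f = (m, m', \<alpha>)" by (metis prod_cases3)
    show "FArr D f \<in> hom K (FObj D (Dom ?A f)) (FObj D (Cod ?A f))"
      using f arrow[of m m' \<alpha>] by (auto simp: D_def sel m S_simps)
  next
    fix m assume m: "m \<in> Obj ?A"
    then have "Idn S m \<in> B" using A.Idn_in_hom[OF m] by (auto simp: hom_def sel)
    then show "FArr D (Idn ?A m) = Idn K (FObj D m)"
      using m by (auto simp: D_def sel S_simps)
  next
    fix f g assume fg: "f \<in> Arr ?A" "g \<in> Arr ?A" "Cod ?A f = Dom ?A g"
    have "Cmp ?A g f \<in> Arr ?A"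
      using A.Cmp_in_hom[of f "Dom ?A f" "Dom ?A g" g "Cod ?A g"] fg by (auto simp: hom_def)
    moreover obtain m m' \<alpha> where "f = (m, m', \<alpha>)" by (metis prod_cases3)
    moreover obtain n n' \<beta> where "g = (n, n', \<beta>)" by (metis prod_cases3)
    ultimately show "FArr D (Cmp ?A g f) = FArr D g \<cdot> FArr D f"
      using fg by (auto simp: D_def sel S_simps)
  qed
  moreover have "is_colimit ?A K D \<phi> \<mu>"
    unfolding is_colimit_def
  proof (intro conjI allI impI)
    obtain x where "x \<in> \<Gamma>" using \<open>\<Gamma> \<noteq> {}\<close> by blast
    then have "\<phi> \<in> Obj K" using presentsD(2)[OF P] hom_Obj by blast
    moreover have "\<mu> (Cod S f) \<cdot> FArr D f = \<mu> (Dom S f)" if f: "f \<in> B" for f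
    proof -
      obtain m m' \<alpha> where "f = (m, m', \<alpha>)" by (metis prod_cases3)
      then show ?thesis using arrow[of m m' \<alpha>] f by (auto simp: \<mu>_def D_def S_simps)
    qed
    ultimately show "is_cocone ?A K D \<phi> \<mu>"
      unfolding is_cocone_def using ends_Obj by (auto simp: sel \<mu>_def D_def S_Obj)
  next
    fix Y \<nu> assume \<nu>: "is_cocone ?A K D Y \<nu>"
    have Y: "Y \<in> Obj K" using \<nu> by (simp add: is_cocone_def)
    have \<nu>_hom: "\<nu> m \<in> hom K (Dom K m) Y" if "m \<in> ends S B" for m
      using is_cocone_hom[OF \<nu>, of m] that by (simp add: D_def sel)
    have \<nu>_comm: "\<nu> m' \<cdot> \<alpha> = \<nu> m" if "(m, m', \<alpha>) \<in> B" for m m' \<alpha>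
      using \<nu> that unfolding is_cocone_def by (force simp: sel D_def S_simps)
    \<comment> \<open>A cocone restricted to \<open>\<Gamma>\<close> respects the relations since
      both sides equal its component at \<open>x . f\<close>; the presentation then produces the map
      out of \<open>\<phi>\<close>.\<close>
    have "\<exists>h \<in> hom K \<phi> Y. \<forall>x \<in> \<Gamma>. h \<cdot> x = \<nu> x"
    proof (rule presentsD(5)[OF P Y])
      show "x \<in> \<Gamma> \<Longrightarrow> \<nu> x \<in> hom K (Dom K x) Y" for x
        using \<nu>_hom \<Gamma>_ends by blast
      fix x f x' f' assume z: "(x, f, x', f') \<in> Z"
      have "(x \<cdot> f, x, f) \<in> B0" "(x \<cdot> f, x', f') \<in> B0"
        using z by (force simp: B0_def)+
      then show "\<nu> x \<cdot> f = \<nu> x' \<cdot> f'"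
        using \<nu>_comm B(2) subsetD by metis
    qed
    then obtain h where h: "h \<in> hom K \<phi> Y" "\<And>x. x \<in> \<Gamma> \<Longrightarrow> h \<cdot> x = \<nu> x" by blast
    show "\<exists>!h. h \<in> hom K \<phi> Y \<and> (\<forall>i\<in>Obj ?A. h \<cdot> \<mu> i = \<nu> i)"
    proof (intro ex1I[of _ h] conjI ballI)
      fix m assume "m \<in> Obj ?A"
      then have m: "m \<in> ends S B" by (simp add: sel)
      note mS = ends_Obj[OF m]
      note C = cov[OF mS]
      have mh: "m \<in> hom K (Dom K m) \<phi>" using mS by (auto simp: S_Obj)
      have B': "(m \<cdot> e m, m, e m) \<in> B" "(m \<cdot> e m, r m, k m) \<in> B"
        using B(6)[OF m] by (auto simp: ext_def)
      \<comment> \<open>The equation is checked after the epimorphism \<open>e m\<close>, where both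
        arrows of \<open>ext m\<close> reduce it to the equation at the generator
        \<open>r m\<close>.\<close>
      have "h \<cdot> m = \<nu> m"
      proof (rule epi[OF mS Cmp_in_hom[OF mh h(1)] \<nu>_hom[OF m]])
        have "(h \<cdot> m) \<cdot> e m = h \<cdot> (m \<cdot> e m)"
          by (rule assoc[OF _ mh h(1)]) (use C in blast)
        also have "\<dots> = h \<cdot> (r m \<cdot> k m)" using C by simp
        also have "\<dots> = (h \<cdot> r m) \<cdot> k m"
          by (rule assoc[OF _ presentsD(2)[OF P] h(1), symmetric]) (use C in blast)+
        also have "\<dots> = \<nu> (m \<cdot> e m)"
          using h(2)[of "r m"] C \<nu>_comm[OF B'(2)] by simp
        also have "\<dots> = \<nu> m \<cdot> e m"
          using \<nu>_comm[OF B'(1)] by simp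
        finally show "(h \<cdot> m) \<cdot> e m = \<nu> m \<cdot> e m" .
      qed
      then show "h \<cdot> \<mu> m = \<nu> m" using m by (simp add: \<mu>_def)
    next
      fix h' assume h': "h' \<in> hom K \<phi> Y \<and> (\<forall>i\<in>Obj ?A. h' \<cdot> \<mu> i = \<nu> i)"
      show "h' = h"
      proof (rule presents_unique[OF P conjunct1[OF h'] h(1)])
        fix x assume "x \<in> \<Gamma>"
        then show "h' \<cdot> x = h \<cdot> x"
          using h(2)[of x] \<Gamma>_ends[of x] conjunct2[OF h', rule_format, of x] by (simp add: sel \<mu>_def)
      qed
    qed (rule h(1))
  qed
  ultimately show ?thesis
    using that[of ?A D \<mu>] B ends_Obj by (auto simp: sel D_def S_Obj)
qed

lemma wsifted_iso:
  assumes f: "f \<in> hom K \<phi> \<psi>" and g: "g \<in> hom K \<psi> \<phi>" and gf: "g \<cdot> f = Idn K \<phi>" and fg: "f \<cdot> g = Idn K \<psi>"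
    and ws: "wsifted \<phi>"
  shows "wsifted \<psi>"
  unfolding wsifted_def
proof (intro conjI ballI impI)
  obtain h x where "h \<in> G" "x \<in> hom K h \<phi>"
    using ws unfolding wsifted_def by (elim conjE) blast
  then show "\<exists>g\<in>G. hom K g \<psi> \<noteq> {}" using Cmp_in_hom[OF _ f] by blast
next
  fix a b x y assume *: "a \<in> G" "b \<in> G" "x \<in> hom K a \<psi>" "y \<in> hom K b \<psi>"
  obtain d z u v where d: "d \<in> G" "z \<in> hom K d \<phi>" "u \<in> hom K a d" "v \<in> hom K b d" "z \<cdot> u = g \<cdot> x" "z \<cdot> v = g \<cdot> y"
    by (rule wsifted_cospan[OF ws *(1,2) Cmp_in_hom[OF *(3) g] Cmp_in_hom[OF *(4) g]])
  have "(f \<cdot> z) \<cdot> u = x" "(f \<cdot> z) \<cdot> v = y"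
    using assoc[OF d(3,2) f] assoc[OF d(4,2) f] d(5,6) assoc[OF *(3) g f] assoc[OF *(4) g f] fg
      Cmp_Idn_left *(3,4) by simp_all
  then show "\<exists>d\<in>G. \<exists>z\<in>hom K d \<psi>. \<exists>f\<in>hom K a d. \<exists>g\<in>hom K b d. z \<cdot> f = x \<and> z \<cdot> g = y"
    using d Cmp_in_hom[OF d(2) f] by blast
next
  fix a b d d' z z' u v u' v'
  assume *: "a \<in> G" "b \<in> G" "d \<in> G" "d' \<in> G" "z \<in> hom K d \<psi>" "z' \<in> hom K d' \<psi>"
    "u \<in> hom K a d" "v \<in> hom K b d" "u' \<in> hom K a d'" "v' \<in> hom K b d'" "z \<cdot> u = z' \<cdot> u'" "z \<cdot> v = z' \<cdot> v'"
  have retr: "f \<cdot> (g \<cdot> z) = z" "f \<cdot> (g \<cdot> z') = z'"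
    using assoc[OF *(5) g f] assoc[OF *(6) g f] fg Cmp_Idn_left *(5,6) by simp_all
  have "(g \<cdot> z) \<cdot> u = (g \<cdot> z') \<cdot> u'" "(g \<cdot> z) \<cdot> v = (g \<cdot> z') \<cdot> v'"
    using assoc[OF *(7,5) g] assoc[OF *(8,5) g] assoc[OF *(9,6) g] assoc[OF *(10,6) g] *(11,12) by simp_all
  then have "spanned a b d (g \<cdot> z) u v d' (g \<cdot> z') u' v'"
    by (rule wsifted_spanned[OF ws *(1-4) Cmp_in_hom[OF *(5) g] Cmp_in_hom[OF *(6) g] *(7-10)])
  then obtain p h k s t where p: "p \<in> G" "h \<in> hom K a p" "k \<in> hom K b p" "s \<in> hom K p d" "t \<in> hom K p d'"
    "(g \<cdot> z) \<cdot> s = (g \<cdot> z') \<cdot> t" "s \<cdot> h = u" "t \<cdot> h = u'" "s \<cdot> k = v" "t \<cdot> k = v'"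
    by (rule spannedE)
  have "z \<cdot> s = z' \<cdot> t"
    using assoc[OF p(4) Cmp_in_hom[OF *(5) g] f] assoc[OF p(5) Cmp_in_hom[OF *(6) g] f] p(6) retr by simp
  then show "spanned a b d z u v d' z' u' v'"
    using spannedI p by blast
qed

lemma presentable_iso:
  assumes \<kappa>: "regular_uncountable \<kappa>"
    and f: "f \<in> hom K \<phi> \<psi>" and g: "g \<in> hom K \<psi> \<phi>" and gf: "g \<cdot> f = Idn K \<phi>" and fg: "f \<cdot> g = Idn K \<psi>"
    and "presentable \<kappa> \<phi>"
  shows "presentable \<kappa> \<psi>"
proof -
  interpret regular_uncountable \<kappa> by (rule \<kappa>)
  obtain \<Gamma> Z where less: "|\<Gamma>| <o \<kappa>" "|Z| <o \<kappa>" and P: "presents \<Gamma> Z \<phi>"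
    using assms unfolding presentable_def by blast
  have D: "Dom K (f \<cdot> x) = Dom K x" "f \<cdot> x \<in> hom K (Dom K x) \<psi>" if "x \<in> \<Gamma>" for x
    using Cmp_in_hom[OF presentsD(2)[OF P that] f] by (auto simp: hom_def)
  have as: "(f \<cdot> x) \<cdot> k = f \<cdot> (x \<cdot> k)" if "x \<in> \<Gamma>" "k \<in> hom K d (Dom K x)" for x k d
    by (rule assoc[OF that(2) presentsD(2)[OF P that(1)] f])
  have "presents ((\<lambda>x. f \<cdot> x) ` \<Gamma>) ((\<lambda>(x, u, x', u'). (f \<cdot> x, u, f \<cdot> x', u')) ` Z) \<psi>"
    unfolding presents_def
  proof (intro conjI ballI allI impI)
    fix x assume "x \<in> (\<lambda>x. f \<cdot> x) ` \<Gamma>"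
    then show "Dom K x \<in> G" "x \<in> hom K (Dom K x) \<psi>"
      using D presentsD(1)[OF P] by auto
  next
    fix z assume "z \<in> (\<lambda>(x, u, x', u'). (f \<cdot> x, u, f \<cdot> x', u')) ` Z"
    then obtain x u x' u' where z: "(x, u, x', u') \<in> Z" "z = (f \<cdot> x, u, f \<cdot> x', u')" by auto
    obtain d where d: "x \<in> \<Gamma>" "x' \<in> \<Gamma>" "d \<in> G" "u \<in> hom K d (Dom K x)" "u' \<in> hom K d (Dom K x')" "x \<cdot> u = x' \<cdot> u'"
      using presentsD(3)[OF P z(1)] by blast
    show "case z of (x, f', x', f'') \<Rightarrow> x \<in> (\<lambda>x. f \<cdot> x) ` \<Gamma> \<and> x' \<in> (\<lambda>x. f \<cdot> x) ` \<Gamma> \<and>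
        (\<exists>d \<in> G. f' \<in> hom K d (Dom K x) \<and> f'' \<in> hom K d (Dom K x')) \<and> x \<cdot> f' = x' \<cdot> f''"
      using d D(1)[OF d(1)] D(1)[OF d(2)] as[OF d(1,4)] as[OF d(2,5)] by (auto simp: z(2))
  next
    fix c w assume c: "c \<in> G" and w: "w \<in> hom K c \<psi>"
    obtain x h where x: "x \<in> \<Gamma>" "h \<in> hom K c (Dom K x)" "x \<cdot> h = g \<cdot> w"
      using presentsD(4)[OF P c Cmp_in_hom[OF w g]] by blast
    have "(f \<cdot> x) \<cdot> h = w"
      using as[OF x(1,2)] x(3) assoc[OF w g f] fg Cmp_Idn_left[OF w] by simp
    then show "\<exists>x\<in>(\<lambda>x. f \<cdot> x) ` \<Gamma>. \<exists>h\<in>hom K c (Dom K x). x \<cdot> h = w"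
      using x(1,2) D(1)[OF x(1)] by (intro bexI[of _ "f \<cdot> x"] bexI[of _ h]) auto
  next
    fix Y \<tau> assume Y: "Y \<in> Obj K" and \<tau>: "\<forall>x\<in>(\<lambda>x. f \<cdot> x) ` \<Gamma>. \<tau> x \<in> hom K (Dom K x) Y"
      and rel: "\<forall>(x, u, x', u')\<in>(\<lambda>(x, u, x', u'). (f \<cdot> x, u, f \<cdot> x', u')) ` Z. \<tau> x \<cdot> u = \<tau> x' \<cdot> u'"
    have "\<exists>h\<in>hom K \<phi> Y. \<forall>x\<in>\<Gamma>. h \<cdot> x = \<tau> (f \<cdot> x)"
    proof (rule presentsD(5)[OF P Y])
      show "x \<in> \<Gamma> \<Longrightarrow> \<tau> (f \<cdot> x) \<in> hom K (Dom K x) Y" for x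
        using \<tau> D(1)[of x] by (metis imageI)
      show "(x, u, x', u') \<in> Z \<Longrightarrow> \<tau> (f \<cdot> x) \<cdot> u = \<tau> (f \<cdot> x') \<cdot> u'" for x u x' u'
        using rel by fastforce
    qed
    then obtain h where h: "h \<in> hom K \<phi> Y" "\<And>x. x \<in> \<Gamma> \<Longrightarrow> h \<cdot> x = \<tau> (f \<cdot> x)" by blast
    have "(h \<cdot> g) \<cdot> (f \<cdot> x) = \<tau> (f \<cdot> x)" if x: "x \<in> \<Gamma>" for x
      using assoc[OF D(2)[OF x] g h(1)] assoc[OF presentsD(2)[OF P x] f g] gf
        Cmp_Idn_left[OF presentsD(2)[OF P x]] h(2)[OF x] by simp
    then show "\<exists>h\<in>hom K \<psi> Y. \<forall>x\<in>(\<lambda>x. f \<cdot> x) ` \<Gamma>. h \<cdot> x = \<tau> x"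
      using Cmp_in_hom[OF g h(1)] by blast
  qed
  then show ?thesis
    unfolding presentable_def using less_image[OF less(1)] less_image[OF less(2)] by blast
qed

end


section \<open>Sifted categories\<close>

lemma discrete_cocone_iff:
  assumes J: "category J" and D: "is_functor (discrete_cat I) J D"
  shows "is_cocone (discrete_cat I) J D X \<mu> \<longleftrightarrow>
    X \<in> Obj J \<and> \<mu> \<in> extensional I \<and> (\<forall>i \<in> I. \<mu> i \<in> hom J (FObj D i) X)"
proof -
  interpret J: category J by (rule J)
  have "FArr D i = Idn J (FObj D i)" if "i \<in> I" for i
    using is_functor_Idn[OF D, of i] that by (simp add: discrete_cat_def)
  then show ?thesis
    using J.Cmp_Idn_right by (fastforce simp: is_cocone_def discrete_cat_def)
qed

lemma cocone_cat_hom: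
  "hom (cocone_cat I J D) (X, \<mu>) (Y, \<nu>) \<noteq> {} \<longleftrightarrow> is_cocone I J D X \<mu> \<and> is_cocone I J D Y \<nu> \<and>
     (\<exists>h \<in> hom J X Y. \<forall>i \<in> Obj I. Cmp J h (\<mu> i) = \<nu> i)"
  by (auto simp: hom_def cocone_cat_def)

text \<open>A cocone over the empty family is an object, a cocone over a two-element family is a
  cospan; connectedness of these two kinds of cocone categories is what is extracted.\<close>

lemma sifted_imp_bsifted:
  assumes J: "category J" and "sifted J"
  shows "bsifted J"
proof -
  interpret J: category J by (rule J)
  have conn: "connected_cat (cocone_cat (discrete_cat {..<n}) J D)"
    if "is_functor (discrete_cat {..<n}) J D" for n :: nat and D
    using assms(2) that unfolding sifted_def by blast
  \<comment> \<open>The functor out of the empty category, written as a restriction so that it is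
    extensional.\<close>
  define E :: "(nat, nat, 'a, 'b) func" where "E = \<lparr>FObj = (\<lambda>_\<in>{}. undefined), FArr = (\<lambda>_\<in>{}. undefined)\<rparr>"
  have E: "is_functor (discrete_cat {..<0::nat}) J E"
    by (auto simp: is_functor_def discrete_cat_def E_def)
  have "Obj J \<noteq> {}"
    using conn[OF E] by (auto simp: connected_cat_def cocone_cat_def is_cocone_def)
  moreover have "(\<exists>k. hom J i k \<noteq> {} \<and> hom J j k \<noteq> {}) \<and>
       (\<forall>k k'. \<forall>\<alpha> \<in> hom J i k. \<forall>\<beta> \<in> hom J j k. \<forall>\<alpha>' \<in> hom J i k'. \<forall>\<beta>' \<in> hom J j k'.
          ((k, \<alpha>, \<beta>), (k', \<alpha>', \<beta>')) \<in>
            equivcl {((l, \<gamma>, \<delta>), (l', Cmp J \<theta> \<gamma>, Cmp J \<theta> \<delta>)) | l l' \<gamma> \<delta> \<theta>.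
              \<gamma> \<in> hom J i l \<and> \<delta> \<in> hom J j l \<and> \<theta> \<in> hom J l l'})"
    if ij: "i \<in> Obj J" "j \<in> Obj J" for i j
  proof -
    let ?I = "discrete_cat {..<2::nat}"
    let ?R = "{((l, \<gamma>, \<delta>), (l', Cmp J \<theta> \<gamma>, Cmp J \<theta> \<delta>)) | l l' \<gamma> \<delta> \<theta>.
              \<gamma> \<in> hom J i l \<and> \<delta> \<in> hom J j l \<and> \<theta> \<in> hom J l l'}"
    define P where "P = \<lparr>FObj = (\<lambda>k\<in>{..<2::nat}. if k = 0 then i else j),
      FArr = (\<lambda>k\<in>{..<2::nat}. Idn J (if k = 0 then i else j))\<rparr>"
    have P: "is_functor ?I J P"
      unfolding is_functor_def
      using ij J.Idn_in_hom[OF ij(1)] J.Idn_in_hom[OF ij(2)] J.Cmp_Idn_left[OF J.Idn_in_hom[OF ij(1)]]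
        J.Cmp_Idn_left[OF J.Idn_in_hom[OF ij(2)]]
      by (auto simp: discrete_cat_def P_def hom_def)
    have lt2: "k < 2 \<longleftrightarrow> k = 0 \<or> k = 1" for k :: nat by auto
    note coc = discrete_cocone_iff[OF J P]
    have objI: "Obj ?I = {..<2}" by (simp add: discrete_cat_def)
    have mk: "is_cocone ?I J P k (\<lambda>l\<in>{..<2}. if l = 0 then \<alpha> else \<beta>)"
      if "\<alpha> \<in> hom J i k" "\<beta> \<in> hom J j k" for k \<alpha> \<beta>
      using that J.hom_Obj[OF that(1)] unfolding coc by (auto simp: P_def)
    have dest: "\<mu> 0 \<in> hom J i k" "\<mu> 1 \<in> hom J j k" if "is_cocone ?I J P k \<mu>" for k \<mu>
    proof -
      have "\<mu> l \<in> hom J (FObj P l) k" if "l < 2" for l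
        using \<open>is_cocone ?I J P k \<mu>\<close> that by (simp add: coc)
      from this[of 0] this[of 1] show "\<mu> 0 \<in> hom J i k" "\<mu> 1 \<in> hom J j k"
        by (simp_all add: P_def)
    qed
    note C = conn[OF P]
    have "Obj (cocone_cat ?I J P) \<noteq> {}"
      using C by (simp add: connected_cat_def)
    then obtain k \<mu> where "is_cocone ?I J P k \<mu>"
      by (auto simp: cocone_cat_def)
    from dest[OF this] have "\<exists>k. hom J i k \<noteq> {} \<and> hom J j k \<noteq> {}" by blast
    moreover have "((k, \<alpha>, \<beta>), (k', \<alpha>', \<beta>')) \<in> equivcl ?R"
      if *: "\<alpha> \<in> hom J i k" "\<beta> \<in> hom J j k" "\<alpha>' \<in> hom J i k'" "\<beta>' \<in> hom J j k'" for k k' \<alpha> \<beta> \<alpha>' \<beta>'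
    proof -
      let ?m = "\<lambda>\<alpha> \<beta>. (\<lambda>l\<in>{..<2::nat}. if l = 0 then \<alpha> else \<beta>)"
      let ?f = "\<lambda>(k, \<mu>). (k, \<mu> (0::nat), \<mu> 1)"
      let ?T = "{(a, b). hom (cocone_cat ?I J P) a b \<noteq> {} \<or> hom (cocone_cat ?I J P) b a \<noteq> {}}"
      \<comment> \<open>A morphism of cocones over the pair is one generating step between the
        corresponding cospans; both orientations of a connecting path are then covered by symmetry
        of \<open>equivcl\<close>.\<close>
      have arrow: "(?f a, ?f b) \<in> ?R" if ne: "hom (cocone_cat ?I J P) a b \<noteq> {}" for a b
      proof -
        obtain X \<mu> Y \<nu> where ab: "a = (X, \<mu>)" "b = (Y, \<nu>)" by fastforce
        then obtain h where h: "is_cocone ?I J P X \<mu>" "h \<in> hom J X Y" "\<And>l. l < 2 \<Longrightarrow> Cmp J h (\<mu> l) = \<nu> l"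
          using ne by (auto simp: cocone_cat_hom objI)
        have "?f a = (X, \<mu> 0, \<mu> 1)" "?f b = (Y, Cmp J h (\<mu> 0), Cmp J h (\<mu> 1))"
          using h(3)[of 0] h(3)[of 1] by (simp_all add: ab)
        then show ?thesis
          using dest[OF h(1)] h(2) by auto
      qed
      have "((k, ?m \<alpha> \<beta>), (k', ?m \<alpha>' \<beta>')) \<in> ?T\<^sup>*"
        using C mk[OF *(1,2)] mk[OF *(3,4)] unfolding connected_cat_def
        by (auto simp: cocone_cat_def)
      then have "(?f (k, ?m \<alpha> \<beta>), ?f (k', ?m \<alpha>' \<beta>')) \<in> equivcl ?R"
      proof (induction rule: rtrancl_induct)
        case base
        show ?case by (rule equivcl_refl)
      next
        case (step y z)
        from step(2) have "(?f y, ?f z) \<in> equivcl ?R"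
        proof (elim CollectE case_prodE disjE Pair_inject)
          fix a b assume "y = a" "z = b" "hom (cocone_cat ?I J P) a b \<noteq> {}"
          then show ?thesis using equivcl_incl[OF arrow[of y z]] by blast
        next
          fix a b assume "y = a" "z = b" "hom (cocone_cat ?I J P) b a \<noteq> {}"
          then show ?thesis using equivcl_sym[OF equivcl_incl[OF arrow[of z y]]] by blast
        qed
        from equivcl_trans[OF step(3) this] show ?case .
      qed
      then show ?thesis by simp
    qed
    ultimately show ?thesis by blast
  qed
  ultimately show ?thesis
    unfolding bsifted_def by blast
qed

text \<open>In a filtered category any two cocones over a finite family map to a third, so a single
  cospan of cocones already connects them. This is what brings filtered colimits back into
  Sind(C).\<close>

lemma filtered_imp_sifted:
  assumes J: "category J" and F: "filtered J"
  shows "sifted J"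
  unfolding sifted_def
proof (intro allI impI)
  interpret J: category J by (rule J)
  fix n :: nat and D :: "(nat, nat, 'a, 'b) func"
  let ?I = "discrete_cat {..<n}"
  let ?C = "cocone_cat ?I J D"
  assume D: "is_functor ?I J D"
  have objI: "Obj ?I = {..<n}" by (simp add: discrete_cat_def)
  note coc = discrete_cocone_iff[OF J D]
  have D_Obj: "FObj D i \<in> Obj J" if "i < n" for i
    using is_functor_Obj[OF D, of i] that objI by simp
  have cospan: "\<exists>z \<alpha> \<beta>. \<alpha> \<in> hom J x z \<and> \<beta> \<in> hom J y z" if "x \<in> Obj J" "y \<in> Obj J" for x y
    using F that unfolding filtered_def by (elim conjE) blast
  have ex: "\<exists>X \<mu>. X \<in> Obj J \<and> (\<forall>i < m. \<mu> i \<in> hom J (FObj D i) X)" if "m \<le> n" for m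
    using that
  proof (induction m)
    case 0
    then show ?case using F unfolding filtered_def by blast
  next
    case (Suc m)
    then obtain X \<mu> where X: "X \<in> Obj J" "\<And>i. i < m \<Longrightarrow> \<mu> i \<in> hom J (FObj D i) X" by auto
    obtain z \<alpha> \<beta> where z: "\<alpha> \<in> hom J X z" "\<beta> \<in> hom J (FObj D m) z"
      using cospan[OF X(1) D_Obj[of m]] Suc by auto
    let ?\<mu> = "\<lambda>i. if i < m then Cmp J \<alpha> (\<mu> i) else \<beta>"
    have "?\<mu> i \<in> hom J (FObj D i) z" if "i < Suc m" for i
      using that z J.Cmp_in_hom[OF X(2) z(1)] by (cases "i = m") auto
    then show ?case using J.hom_Obj[OF z(1)] by (intro exI[of _ z] exI[of _ ?\<mu>]) auto
  qed
  \<comment> \<open>By induction on the number of members on which the two legs agree: one more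
    member is treated by coequalizing the two composites, which preserves the earlier
    equalities.\<close>
  have join: "\<exists>Z \<alpha> \<beta>. \<alpha> \<in> hom J X Z \<and> \<beta> \<in> hom J Y Z \<and> (\<forall>i < m. Cmp J \<alpha> (\<mu> i) = Cmp J \<beta> (\<nu> i))"
    if "m \<le> n" and X: "X \<in> Obj J" "\<And>i. i < n \<Longrightarrow> \<mu> i \<in> hom J (FObj D i) X"
      and Y: "Y \<in> Obj J" "\<And>i. i < n \<Longrightarrow> \<nu> i \<in> hom J (FObj D i) Y" for m X \<mu> Y \<nu>
    using that(1)
  proof (induction m)
    case 0
    then show ?case using cospan[OF X(1) Y(1)] by auto
  next
    case (Suc m)
    then obtain Z \<alpha> \<beta> where Z: "\<alpha> \<in> hom J X Z" "\<beta> \<in> hom J Y Z" "\<And>i. i < m \<Longrightarrow> Cmp J \<alpha> (\<mu> i) = Cmp J \<beta> (\<nu> i)"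
      by auto
    have mn: "m < n" using Suc by simp
    obtain \<eta> W where \<eta>: "\<eta> \<in> hom J Z W" "Cmp J \<eta> (Cmp J \<alpha> (\<mu> m)) = Cmp J \<eta> (Cmp J \<beta> (\<nu> m))"
      by (rule filtered_coequalize[OF F J.Cmp_in_hom[OF X(2)[OF mn] Z(1)] J.Cmp_in_hom[OF Y(2)[OF mn] Z(2)]])
    have "Cmp J (Cmp J \<eta> \<alpha>) (\<mu> i) = Cmp J (Cmp J \<eta> \<beta>) (\<nu> i)" if "i < Suc m" for i
    proof -
      have i: "i < n" using that mn by simp
      show ?thesis
        using J.assoc[OF X(2)[OF i] Z(1) \<eta>(1)] J.assoc[OF Y(2)[OF i] Z(2) \<eta>(1)] Z(3)[of i] \<eta>(2) that
        by (cases "i = m") auto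
    qed
    then show ?case
      using J.Cmp_in_hom[OF Z(1) \<eta>(1)] J.Cmp_in_hom[OF Z(2) \<eta>(1)] by blast
  qed
  show "connected_cat ?C"
    unfolding connected_cat_def
  proof (intro conjI ballI)
    obtain X \<mu> where "X \<in> Obj J" "\<forall>i < n. \<mu> i \<in> hom J (FObj D i) X" using ex[of n] by auto
    then have "is_cocone ?I J D X (\<lambda>i\<in>{..<n}. \<mu> i)" by (simp add: coc)
    then show "Obj ?C \<noteq> {}" by (auto simp: cocone_cat_def)
  next
    let ?T = "{(a, b). hom ?C a b \<noteq> {} \<or> hom ?C b a \<noteq> {}}"
    fix x y assume xy: "x \<in> Obj ?C" "y \<in> Obj ?C"
    obtain X \<mu> Y \<nu> where [simp]: "x = (X, \<mu>)" "y = (Y, \<nu>)" by fastforce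
    have c: "is_cocone ?I J D X \<mu>" "is_cocone ?I J D Y \<nu>"
      using xy by (auto simp: cocone_cat_def)
    have X: "X \<in> Obj J" "\<And>i. i < n \<Longrightarrow> \<mu> i \<in> hom J (FObj D i) X"
      and Y: "Y \<in> Obj J" "\<And>i. i < n \<Longrightarrow> \<nu> i \<in> hom J (FObj D i) Y"
      using c by (auto simp: coc)
    obtain Z \<alpha> \<beta> where Z: "\<alpha> \<in> hom J X Z" "\<beta> \<in> hom J Y Z" "\<And>i. i < n \<Longrightarrow> Cmp J \<alpha> (\<mu> i) = Cmp J \<beta> (\<nu> i)"
      using join[OF order_refl X Y] by auto
    let ?\<rho> = "\<lambda>i\<in>{..<n}. Cmp J \<alpha> (\<mu> i)"
    have \<rho>: "is_cocone ?I J D Z ?\<rho>"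
      using J.hom_Obj[OF Z(1)] J.Cmp_in_hom[OF X(2) Z(1)] by (auto simp: coc)
    have "hom ?C x (Z, ?\<rho>) \<noteq> {}"
      using c \<rho> Z by (auto simp: cocone_cat_hom objI intro!: bexI[of _ \<alpha>])
    moreover have "hom ?C y (Z, ?\<rho>) \<noteq> {}"
      using c \<rho> Z by (auto simp: cocone_cat_hom objI intro!: bexI[of _ \<beta>])
    ultimately have "(x, (Z, ?\<rho>)) \<in> ?T" "((Z, ?\<rho>), y) \<in> ?T" by blast+
    then show "(x, y) \<in> ?T\<^sup>*"
      by (rule converse_rtrancl_into_rtrancl[OF _ r_into_rtrancl])
  qed
qed

text \<open>The monoid of endomorphisms of the source of a reflexive pair \<open>p, q\<close> with section \<open>r\<close>
  that is generated by \<open>rp\<close> and \<open>rq\<close>. It is sifted, and colimits over it are reflexive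
  coequalizers.\<close>

definition left_absorbing :: "'v \<Rightarrow> 'v \<Rightarrow> 'v \<Rightarrow> ('v, 'v) cat" where
  "left_absorbing o1 a b = \<lparr>Obj = {o1}, Arr = {o1, a, b}, Dom = (\<lambda>_. o1), Cod = (\<lambda>_. o1), Idn = (\<lambda>_. o1),
     Cmp = (\<lambda>g f. if f = o1 then g else f)\<rparr>"

lemma left_absorbing_hom: "f \<in> hom (left_absorbing o1 a b) x y \<longleftrightarrow> f \<in> {o1, a, b} \<and> x = o1 \<and> y = o1"
  by (auto simp: left_absorbing_def hom_def)

lemma category_left_absorbing: "category (left_absorbing o1 a b)"
  by unfold_locales (auto simp: left_absorbing_def hom_def)

text \<open>A cocone over an \<open>n\<close>-element family is a word of length \<open>n\<close> in
  \<open>o1, a, b\<close>, and an arrow \<open>g\<close> fills every entry \<open>o1\<close> of a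
  word with \<open>g\<close>, leaving the others fixed. A word with one entry \<open>o1\<close>
  therefore connects the word having \<open>a\<close> there to the word having \<open>b\<close>
  there, and all words are connected to the constant word \<open>a\<close>.\<close>

lemma sifted_left_absorbing:
  assumes ne: "a \<noteq> o1" "b \<noteq> o1"
  shows "sifted (left_absorbing o1 a b)"
  unfolding sifted_def
proof (intro allI impI)
  fix n :: nat and D
  let ?M = "left_absorbing o1 a b"
  let ?I = "discrete_cat {..<n}"
  let ?C = "cocone_cat ?I ?M D"
  let ?T = "{(x, y). hom ?C x y \<noteq> {} \<or> hom ?C y x \<noteq> {}}"
  assume D: "is_functor ?I ?M D"
  have objI: "Obj ?I = {..<n}" by (simp add: discrete_cat_def)
  have FO: "FObj D i = o1" if "i < n" for i
    using is_functor_Obj[OF D, of i] that by (simp add: objI left_absorbing_def)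
  have coc: "is_cocone ?I ?M D X \<mu> \<longleftrightarrow> X = o1 \<and> \<mu> \<in> extensional {..<n} \<and> (\<forall>i < n. \<mu> i \<in> {o1, a, b})" for X \<mu>
    using discrete_cocone_iff[OF category_left_absorbing D, of X \<mu>] FO
    by (auto simp: left_absorbing_hom) (auto simp: left_absorbing_def)
  have Cmp: "Cmp ?M g f = (if f = o1 then g else f)" for g f by (simp add: left_absorbing_def)
  have T_arrow: "((o1, \<mu>), (o1, \<lambda>i\<in>{..<n}. if \<mu> i = o1 then g else \<mu> i)) \<in> ?T"
    if "is_cocone ?I ?M D o1 \<mu>" "g \<in> {o1, a, b}" for \<mu> g
  proof -
    let ?\<nu> = "\<lambda>i\<in>{..<n}. if \<mu> i = o1 then g else \<mu> i"
    have "is_cocone ?I ?M D o1 ?\<nu>" using that by (auto simp: coc)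
    moreover have "\<exists>h \<in> hom ?M o1 o1. \<forall>i \<in> Obj ?I. Cmp ?M h (\<mu> i) = ?\<nu> i"
      using that(2) by (intro bexI[of _ g]) (auto simp: left_absorbing_hom Cmp objI)
    ultimately have "hom ?C (o1, \<mu>) (o1, ?\<nu>) \<noteq> {}"
      using that(1) by (simp only: cocone_cat_hom)
    then show ?thesis by blast
  qed
  have symT: "sym (?T\<^sup>*)" by (rule sym_rtrancl) (auto simp: sym_def)
  let ?ab = "\<lambda>\<mu>. is_cocone ?I ?M D o1 \<mu> \<and> (\<forall>i < n. \<mu> i \<in> {a, b})"
  have to_const: "((o1, \<mu>), (o1, \<lambda>i\<in>{..<n}. if i < m then a else \<mu> i)) \<in> ?T\<^sup>*" if \<mu>: "?ab \<mu>" for m \<mu>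
  proof (induction m)
    case 0
    have "(\<lambda>i\<in>{..<n}. if i < 0 then a else \<mu> i) = \<mu>"
      using \<mu> by (auto simp: coc extensional_def)
    then show ?case by simp
  next
    case (Suc m)
    let ?\<nu> = "\<lambda>m. \<lambda>i\<in>{..<n}. if i < m then a else \<mu> i"
    show ?case
    proof (cases "m < n \<and> \<mu> m = b")
      case True
      \<comment> \<open>Exactly the entry \<open>m\<close> is \<open>o1\<close>, the others being
        \<open>a\<close> or \<open>b\<close>; filling it with \<open>b\<close> returns the current
        word, filling it with \<open>a\<close> gives the next one.\<close>
      let ?\<rho> = "\<lambda>i\<in>{..<n}. if i = m then o1 else ?\<nu> m i"
      have \<rho>: "is_cocone ?I ?M D o1 ?\<rho>" using \<mu> by (auto simp: coc)
      have "(\<lambda>i\<in>{..<n}. if ?\<rho> i = o1 then b else ?\<rho> i) = ?\<nu> m"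
        using True \<mu> ne by (auto simp: fun_eq_iff)
      then have "((o1, ?\<rho>), (o1, ?\<nu> m)) \<in> ?T"
        using T_arrow[OF \<rho>, of b] by auto
      moreover have "(\<lambda>i\<in>{..<n}. if ?\<rho> i = o1 then a else ?\<rho> i) = ?\<nu> (Suc m)"
        using True \<mu> ne by (auto simp: fun_eq_iff less_Suc_eq)
      then have "((o1, ?\<rho>), (o1, ?\<nu> (Suc m))) \<in> ?T"
        using T_arrow[OF \<rho>, of a] by auto
      ultimately show ?thesis
        using Suc symT by (meson symD r_into_rtrancl rtrancl_trans)
    next
      case False
      then have "?\<nu> (Suc m) = ?\<nu> m"
        using \<mu> by (auto simp: fun_eq_iff less_Suc_eq)
      then show ?thesis using Suc by metis
    qed
  qed
  let ?c = "(o1, \<lambda>i\<in>{..<n}. a)"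
  have to_c: "(x, ?c) \<in> ?T\<^sup>*" if "x \<in> Obj ?C" for x
  proof -
    from that obtain \<mu> where x: "x = (o1, \<mu>)" "is_cocone ?I ?M D o1 \<mu>"
      by (auto simp: cocone_cat_def coc)
    \<comment> \<open>One arrow removes all entries \<open>o1\<close> at once, so that the remaining
      induction deals with words in \<open>a\<close> and \<open>b\<close> only.\<close>
    let ?\<nu> = "\<lambda>i\<in>{..<n}. if \<mu> i = o1 then a else \<mu> i"
    have "?ab ?\<nu>" using x(2) by (auto simp: coc)
    then have "((o1, ?\<nu>), (o1, \<lambda>i\<in>{..<n}. if i < n then a else ?\<nu> i)) \<in> ?T\<^sup>*"
      by (rule to_const)
    moreover have "(\<lambda>i\<in>{..<n}. if i < n then a else ?\<nu> i) = (\<lambda>i\<in>{..<n}. a)"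
      by (auto simp: fun_eq_iff)
    moreover have "(x, (o1, ?\<nu>)) \<in> ?T"
      using T_arrow[OF x(2), of a] x(1) by simp
    ultimately show ?thesis
      by (metis (no_types, lifting) converse_rtrancl_into_rtrancl)
  qed
  show "connected_cat ?C"
    unfolding connected_cat_def
  proof (intro conjI ballI)
    have "is_cocone ?I ?M D o1 (\<lambda>i\<in>{..<n}. a)" by (auto simp: coc)
    then show "Obj ?C \<noteq> {}" by (auto simp: cocone_cat_def)
    fix x y assume "x \<in> Obj ?C" "y \<in> Obj ?C"
    then show "(x, y) \<in> ?T\<^sup>*"
      using to_c symT by (meson symD rtrancl_trans)
  qed
qed

text \<open>A cocone over the monoid is an arrow \<open>n\<close> out of \<open>X\<close> with
  \<open>n r p = n = n r q\<close>. Then \<open>n r\<close> coequalizes \<open>p\<close> and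
  \<open>q\<close>, and \<open>n\<close> is recovered by composing with \<open>p\<close>; conversely
  an arrow \<open>d\<close> coequalizing the pair gives the cocone \<open>d p\<close>.\<close>

lemma (in category) reflexive_coequalizer_colimit:
  assumes ne: "a \<noteq> o1" "b \<noteq> o1" "a \<noteq> b"
    and pq: "reflexive_pair C X Y p q" and Z: "is_coequalizer C p q Z e"
  obtains D \<mu> where "is_functor (left_absorbing o1 a b) C D" "FObj D o1 = X"
    "is_colimit (left_absorbing o1 a b) C D Z \<mu>"
proof -
  let ?M = "left_absorbing o1 a b"
  obtain r where p: "p \<in> hom C X Y" and q: "q \<in> hom C X Y" and r: "r \<in> hom C Y X"
    and pr: "Cmp C p r = Idn C Y" "Cmp C q r = Idn C Y"
    using pq by (auto simp: reflexive_pair_def)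
  have Cp: "Cod C p = Y" using p by (simp add: hom_def)
  have e: "e \<in> hom C Y Z" "Cmp C e p = Cmp C e q"
    and univ: "\<And>W d. d \<in> hom C Y W \<Longrightarrow> Cmp C d p = Cmp C d q \<Longrightarrow> \<exists>!h. h \<in> hom C Z W \<and> Cmp C h e = d"
    using Z[unfolded is_coequalizer_def Cp] by auto
  have sel: "Obj ?M = {o1}" "Arr ?M = {o1, a, b}" "Dom ?M f = o1" "Cod ?M f = o1" "Idn ?M f = o1"
    "Cmp ?M g f = (if f = o1 then g else f)" for f g
    by (auto simp: left_absorbing_def)
  note rp = Cmp_in_hom[OF p r] and rq = Cmp_in_hom[OF q r]
  have X: "X \<in> Obj C" and Y: "Y \<in> Obj C" using hom_Obj[OF p] by auto
  \<comment> \<open>Since \<open>s r = 1\<close>, the composite \<open>(r s)(r t)\<close> collapses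
    to \<open>r t\<close>: this is the composition rule of the index monoid.\<close>
  have absorb: "Cmp C (Cmp C r s) (Cmp C r t) = Cmp C r t"
    if "s \<in> hom C X Y" "Cmp C s r = Idn C Y" "t \<in> hom C X Y" for s t
    using assoc[OF Cmp_in_hom[OF that(3) r] that(1) r] assoc[OF that(3) r that(1)] that Cmp_Idn_left[OF that(3)]
    by simp
  have IX: "Idn C X \<in> hom C X X" by (rule Idn_in_hom[OF X])
  define D where "D = \<lparr>FObj = (\<lambda>x\<in>{o1}. X),
    FArr = (\<lambda>x\<in>{o1, a, b}. if x = o1 then Idn C X else if x = a then Cmp C r p else Cmp C r q)\<rparr>"
  have FA: "FArr D o1 = Idn C X" "FArr D a = Cmp C r p" "FArr D b = Cmp C r q" and FO: "FObj D o1 = X"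
    using ne by (auto simp: D_def)
  have F: "is_functor ?M C D"
    unfolding is_functor_def sel
  proof (intro conjI ballI impI)
    show "FObj D \<in> {o1} \<rightarrow>\<^sub>E Obj C" using X by (simp add: D_def)
    show "FArr D \<in> {o1, a, b} \<rightarrow>\<^sub>E Arr C"
      using rp rq IX by (auto simp: D_def hom_def)
    show "f \<in> {o1, a, b} \<Longrightarrow> FArr D f \<in> hom C (FObj D o1) (FObj D o1)" for f
      using rp rq IX by (auto simp: FA FO)
    show "x \<in> {o1} \<Longrightarrow> FArr D o1 = Idn C (FObj D x)" for x
      by (simp add: FA FO)
    fix f g assume "f \<in> {o1, a, b}" "g \<in> {o1, a, b}"
    then show "FArr D (if f = o1 then g else f) = Cmp C (FArr D g) (FArr D f)"
      using absorb[OF p pr(1) p] absorb[OF p pr(1) q] absorb[OF q pr(2) p] absorb[OF q pr(2) q]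
        Cmp_Idn_left[OF rp] Cmp_Idn_left[OF rq] Cmp_Idn_right[OF rp] Cmp_Idn_right[OF rq] Cmp_Idn_left[OF IX] ne
      by (auto simp: FA)
  qed
  define \<mu> where "\<mu> = (\<lambda>x\<in>{o1}. Cmp C e p)"
  have ep: "Cmp C e p \<in> hom C X Z" by (rule Cmp_in_hom[OF p e(1)])
  have "Cmp C (Cmp C e s) (Cmp C r t) = Cmp C e t"
    if "s \<in> hom C X Y" "Cmp C s r = Idn C Y" "t \<in> hom C X Y" for s t
    using assoc[OF Cmp_in_hom[OF that(3) r] that(1) e(1)] assoc[OF that(3) r that(1)] that Cmp_Idn_left[OF that(3)]
    by simp
  from this[OF p pr(1) p] this[OF p pr(1) q] have coc: "is_cocone ?M C D Z \<mu>"
    unfolding is_cocone_def sel using ep hom_Obj[OF ep] FO FA Cmp_Idn_right[OF ep]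
    by (auto simp: \<mu>_def e(2)[symmetric])
  have "is_colimit ?M C D Z \<mu>"
    unfolding is_colimit_def
  proof (intro conjI allI impI)
    fix W \<nu> assume \<nu>: "is_cocone ?M C D W \<nu>"
    let ?n = "\<nu> o1"
    have n: "?n \<in> hom C X W" "Cmp C ?n (Cmp C r p) = ?n" "Cmp C ?n (Cmp C r q) = ?n"
      using \<nu> unfolding is_cocone_def sel by (auto simp: FO FA)
    let ?d = "Cmp C ?n r"
    have d: "?d \<in> hom C Y W" by (rule Cmp_in_hom[OF r n(1)])
    have dpq: "Cmp C ?d p = ?n" "Cmp C ?d q = ?n"
      using assoc[OF p r n(1)] assoc[OF q r n(1)] n by simp_all
    obtain h where h: "h \<in> hom C Z W" "Cmp C h e = ?d"
      and u: "\<And>h'. h' \<in> hom C Z W \<Longrightarrow> Cmp C h' e = ?d \<Longrightarrow> h' = h"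
      using univ[OF d] dpq by metis
    show "\<exists>!h. h \<in> hom C Z W \<and> (\<forall>i\<in>Obj ?M. Cmp C h (\<mu> i) = \<nu> i)"
    proof (intro ex1I[of _ h] conjI ballI)
      show "Cmp C h (\<mu> i) = \<nu> i" if "i \<in> Obj ?M" for i
        using that assoc[OF p e(1) h(1)] h(2) dpq(1) by (simp add: sel \<mu>_def)
      fix h' assume h': "h' \<in> hom C Z W \<and> (\<forall>i\<in>Obj ?M. Cmp C h' (\<mu> i) = \<nu> i)"
      show "h' = h"
      proof (rule u)
        show "h' \<in> hom C Z W" using h' by blast
        \<comment> \<open>The coequalizer map is recovered from the colimit leg as
          \<open>(e p) r\<close>, so a factorization of the cocone determines its composite with
          \<open>e\<close>.\<close>
        have "Cmp C h' e = Cmp C h' (Cmp C e (Cmp C p r))"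
          using pr(1) Cmp_Idn_right[OF e(1)] by simp
        also have "\<dots> = Cmp C (Cmp C h' (Cmp C e p)) r"
          using assoc[OF r p e(1)] assoc[OF r ep conjunct1[OF h']] by simp
        also have "\<dots> = ?d"
          using h' by (simp add: sel \<mu>_def)
        finally show "Cmp C h' e = ?d" .
      qed
    qed (rule h(1))
  qed (rule coc)
  then show ?thesis using that F FO by blast
qed

section \<open>Change of index category\<close>

definition transport_cat :: "('i \<Rightarrow> 'v) \<Rightarrow> ('j \<Rightarrow> 'w) \<Rightarrow> ('i, 'j) cat \<Rightarrow> ('v, 'w) cat" where
  "transport_cat fo fa J = \<lparr>Obj = fo ` Obj J, Arr = fa ` Arr J,
     Dom = (\<lambda>x. fo (Dom J (inv_into (Arr J) fa x))), Cod = (\<lambda>x. fo (Cod J (inv_into (Arr J) fa x))),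
     Idn = (\<lambda>x. fa (Idn J (inv_into (Obj J) fo x))),
     Cmp = (\<lambda>g f. fa (Cmp J (inv_into (Arr J) fa g) (inv_into (Arr J) fa f)))\<rparr>"

text \<open>The index categories allowed in \<open>Sind\<close> and \<open>Ind\<close> live in
  prescribed types. Slice diagrams are renamed to have presheaf maps as arrows, and index categories
  of presheaf maps are renamed into \<open>'u\<close>. Equality of the two sets of values lets
  membership conditions survive the renaming.\<close>

lemma filtered_transport:
  fixes J :: "('i, 'j) cat" and K :: "('o, 'a) cat"
  assumes J: "category J" "filtered J" "|Arr J| <o \<kappa>" and \<kappa>: "regular_uncountable \<kappa>" "\<kappa> \<le>o |UNIV :: 'v set|"
    and D: "is_functor J K D" and colim: "is_colimit J K D X \<mu>"
  obtains J' :: "('v, 'v) cat" and D' \<mu>' where "category J'" "filtered J'" "|Arr J'| <o \<kappa>"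
    "is_functor J' K D'" "is_colimit J' K D' X \<mu>'" "FObj D' ` Obj J' = FObj D ` Obj J"
proof -
  interpret J: category J by (rule J)
  interpret regular_uncountable \<kappa> by (rule \<kappa>)
  have objJ: "|Obj J| <o \<kappa>"
    by (rule less_subset[OF less_image[OF J(3), of "Dom J"]]) (use J.Idn_in_hom in \<open>force simp: hom_def\<close>)
  obtain fo :: "'i \<Rightarrow> 'v" where fo: "inj_on fo (Obj J)"
    by (rule less_embed[OF objJ \<kappa>(2)])
  obtain fa :: "'j \<Rightarrow> 'v" where fa: "inj_on fa (Arr J)"
    by (rule less_embed[OF J(3) \<kappa>(2)])
  define J' where "J' = transport_cat fo fa J"
  have sel: "Obj J' = fo ` Obj J" "Arr J' = fa ` Arr J"
    "f \<in> Arr J \<Longrightarrow> Dom J' (fa f) = fo (Dom J f)" "f \<in> Arr J \<Longrightarrow> Cod J' (fa f) = fo (Cod J f)"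
    "x \<in> Obj J \<Longrightarrow> Idn J' (fo x) = fa (Idn J x)"
    "f \<in> Arr J \<Longrightarrow> g \<in> Arr J \<Longrightarrow> Cmp J' (fa g) (fa f) = fa (Cmp J g f)" for f g x
    using fo fa by (auto simp: J'_def transport_cat_def)
  have fo_eq: "fo x = fo y \<longleftrightarrow> x = y" if "x \<in> Obj J" "y \<in> Obj J" for x y
    using fo that by (auto simp: inj_on_def)
  have homI: "f \<in> hom J x y \<Longrightarrow> fa f \<in> hom J' (fo x) (fo y)" for f x y
    using sel by (auto simp: hom_def)
  have homD: "\<exists>f x y. f' = fa f \<and> x' = fo x \<and> y' = fo y \<and> f \<in> hom J x y \<and> x \<in> Obj J \<and> y \<in> Obj J"
    if "f' \<in> hom J' x' y'" for f' x' y'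
    using that J.Dom_in_Obj J.Cod_in_Obj by (auto simp: hom_def sel)
  have cJ': "category J'"
  proof
    fix f assume "f \<in> Arr J'"
    then show "Dom J' f \<in> Obj J'" "Cod J' f \<in> Obj J'"
      using J.Dom_in_Obj J.Cod_in_Obj by (auto simp: sel)
  next
    fix x assume "x \<in> Obj J'"
    then show "Idn J' x \<in> hom J' x x"
      using homI[OF J.Idn_in_hom] by (auto simp: sel)
  next
    fix f x y g z assume f: "f \<in> hom J' x y" and g: "g \<in> hom J' y z"
    obtain f0 x0 y0 where 1: "f = fa f0" "x = fo x0" "y = fo y0" "f0 \<in> hom J x0 y0" "y0 \<in> Obj J" using homD[OF f] by blast
    obtain g0 y1 z0 where 2: "g = fa g0" "y = fo y1" "z = fo z0" "g0 \<in> hom J y1 z0" "y1 \<in> Obj J" using homD[OF g] by blast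
    have "y1 = y0" using 1 2 fo_eq by auto
    then show "Cmp J' g f \<in> hom J' x z"
      using homI[OF J.Cmp_in_hom[OF 1(4), of g0 z0]] 1 2 by (simp add: sel hom_memD(1)[OF 1(4)] hom_memD(1)[OF 2(4)])
  next
    fix f x y assume f: "f \<in> hom J' x y"
    obtain f0 x0 y0 where 1: "f = fa f0" "x = fo x0" "y = fo y0" "f0 \<in> hom J x0 y0" "x0 \<in> Obj J" "y0 \<in> Obj J" using homD[OF f] by blast
    show "Cmp J' f (Idn J' x) = f" "Cmp J' (Idn J' y) f = f"
      using 1 J.Cmp_Idn_left[OF 1(4)] J.Cmp_Idn_right[OF 1(4)] J.Idn_in_hom[of x0] J.Idn_in_hom[of y0]
      by (auto simp: sel hom_def)
  next
    fix f w x g y h z assume f: "f \<in> hom J' w x" and g: "g \<in> hom J' x y" and h: "h \<in> hom J' y z"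
    obtain f0 w0 x0 where 1: "f = fa f0" "w = fo w0" "x = fo x0" "f0 \<in> hom J w0 x0" "x0 \<in> Obj J" using homD[OF f] by blast
    obtain g0 x1 y0 where 2: "g = fa g0" "x = fo x1" "y = fo y0" "g0 \<in> hom J x1 y0" "x1 \<in> Obj J" "y0 \<in> Obj J" using homD[OF g] by blast
    obtain h0 y1 z0 where 3: "h = fa h0" "y = fo y1" "z = fo z0" "h0 \<in> hom J y1 z0" "y1 \<in> Obj J" using homD[OF h] by blast
    have eq: "x1 = x0" "y1 = y0" using 1 2 3 fo_eq by auto
    note hs = 1(4) 2(4)[unfolded eq] 3(4)[unfolded eq]
    show "Cmp J' h (Cmp J' g f) = Cmp J' (Cmp J' h g) f"
      using J.Cmp_assoc[OF hs] hom_memD(1)[OF hs(1)] hom_memD(1)[OF hs(2)] hom_memD(1)[OF hs(3)]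
        hom_memD(1)[OF J.Cmp_in_hom[OF hs(1,2)]] hom_memD(1)[OF J.Cmp_in_hom[OF hs(2,3)]]
      by (simp add: 1(1) 2(1) 3(1) sel)
  qed
  have "filtered J'"
    unfolding filtered_def
  proof (intro conjI ballI impI)
    show "Obj J' \<noteq> {}" using J(2) by (auto simp: sel filtered_def)
  next
    fix x y assume "x \<in> Obj J'" "y \<in> Obj J'"
    then obtain x0 y0 where 1: "x = fo x0" "y = fo y0" "x0 \<in> Obj J" "y0 \<in> Obj J" by (auto simp: sel)
    then obtain z f g where "f \<in> hom J x0 z" "g \<in> hom J y0 z"
      using J(2) unfolding filtered_def by (elim conjE) blast
    then show "\<exists>z. hom J' x z \<noteq> {} \<and> hom J' y z \<noteq> {}"
      using homI 1 by blast
  next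
    fix f g assume "f \<in> Arr J'" "g \<in> Arr J'" and eq: "Dom J' f = Dom J' g \<and> Cod J' f = Cod J' g"
    then obtain f0 g0 where 1: "f = fa f0" "g = fa g0" "f0 \<in> Arr J" "g0 \<in> Arr J" by (auto simp: sel)
    have "Dom J f0 = Dom J g0" "Cod J f0 = Cod J g0"
      using eq 1 fo_eq J.Dom_in_Obj J.Cod_in_Obj by (auto simp: sel)
    then have "f0 \<in> hom J (Dom J f0) (Cod J f0)" "g0 \<in> hom J (Dom J f0) (Cod J f0)"
      using 1 by (auto simp: hom_def)
    then obtain h z where h: "h \<in> hom J (Cod J f0) z" "Cmp J h f0 = Cmp J h g0"
      using filtered_coequalize[OF J(2)] by metis
    show "\<exists>h\<in>Arr J'. Dom J' h = Cod J' f \<and> Cmp J' h f = Cmp J' h g"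
      using h 1 by (intro bexI[of _ "fa h"]) (auto simp: sel hom_def)
  qed
  moreover have "|Arr J'| <o \<kappa>"
    unfolding sel by (rule less_image[OF J(3)])
  moreover define D' where "D' = \<lparr>FObj = (\<lambda>x\<in>fo ` Obj J. FObj D (inv_into (Obj J) fo x)),
    FArr = (\<lambda>f\<in>fa ` Arr J. FArr D (inv_into (Arr J) fa f))\<rparr>"
  have FO: "FObj D' (fo x) = FObj D x" if "x \<in> Obj J" for x
    using that fo by (simp add: D'_def)
  have FA: "FArr D' (fa f) = FArr D f" if "f \<in> Arr J" for f
    using that fa by (simp add: D'_def)
  have "is_functor J' K D'"
    unfolding is_functor_def
  proof (intro conjI ballI impI)
    show "FObj D' \<in> Obj J' \<rightarrow>\<^sub>E Obj K"
      using is_functor_Obj[OF D] FO by (auto simp: sel PiE_def extensional_def D'_def inv_into_into)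
    have "FArr D f \<in> Arr K" if "f \<in> Arr J" for f using D that by (auto simp: is_functor_def)
    then show "FArr D' \<in> Arr J' \<rightarrow>\<^sub>E Arr K"
      using FA by (auto simp: sel PiE_def extensional_def D'_def inv_into_into)
  next
    fix f assume "f \<in> Arr J'"
    then obtain f0 where f: "f = fa f0" "f0 \<in> Arr J" by (auto simp: sel)
    have "FArr D f0 \<in> hom K (FObj D (Dom J f0)) (FObj D (Cod J f0))"
      by (rule is_functor_hom[OF D]) (use f in \<open>simp add: hom_def\<close>)
    then show "FArr D' f \<in> hom K (FObj D' (Dom J' f)) (FObj D' (Cod J' f))"
      using f J.Dom_in_Obj J.Cod_in_Obj by (simp add: sel FO FA)
  next
    fix x assume "x \<in> Obj J'"
    then obtain x0 where x: "x = fo x0" "x0 \<in> Obj J" by (auto simp: sel)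
    then show "FArr D' (Idn J' x) = Idn K (FObj D' x)"
      using hom_memD(1)[OF J.Idn_in_hom[OF x(2)]] is_functor_Idn[OF D x(2)] by (simp add: sel FO FA)
  next
    fix f g assume "f \<in> Arr J'" "g \<in> Arr J'" and c: "Cod J' f = Dom J' g"
    then obtain f0 g0 where fg: "f = fa f0" "f0 \<in> Arr J" "g = fa g0" "g0 \<in> Arr J" by (auto simp: sel)
    have c0: "Cod J f0 = Dom J g0" using c fg fo_eq J.Dom_in_Obj J.Cod_in_Obj by (auto simp: sel)
    have h: "f0 \<in> hom J (Dom J f0) (Cod J f0)" "g0 \<in> hom J (Cod J f0) (Cod J g0)"
      using fg c0 by (auto simp: hom_def)
    show "FArr D' (Cmp J' g f) = Cmp K (FArr D' g) (FArr D' f)"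
      using fg is_functor_Cmp[OF D h] hom_memD(1)[OF J.Cmp_in_hom[OF h]] by (simp add: sel FA)
  qed
  moreover define up where "up \<nu> = (\<lambda>x\<in>fo ` Obj J. \<nu> (inv_into (Obj J) fo x))" for \<nu> :: "'i \<Rightarrow> 'a"
  have up: "up \<nu> (fo x) = \<nu> x" if "x \<in> Obj J" for x \<nu>
    using that fo by (simp add: up_def)
  have up_coc: "is_cocone J' K D' Y (up \<nu>)" if "is_cocone J K D Y \<nu>" for Y \<nu>
    unfolding is_cocone_def
  proof (intro conjI ballI)
    show "Y \<in> Obj K" using that by (simp add: is_cocone_def)
    show "up \<nu> \<in> extensional (Obj J')" by (simp add: up_def sel)
    show "up \<nu> i \<in> hom K (FObj D' i) Y" if "i \<in> Obj J'" for i
      using that is_cocone_hom[OF \<open>is_cocone J K D Y \<nu>\<close>] by (auto simp: sel up FO)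
    fix u assume "u \<in> Arr J'"
    then obtain u0 where u: "u = fa u0" "u0 \<in> Arr J" by (auto simp: sel)
    then show "Cmp K (up \<nu> (Cod J' u)) (FArr D' u) = up \<nu> (Dom J' u)"
      using that J.Dom_in_Obj J.Cod_in_Obj by (simp add: sel up FA is_cocone_def)
  qed
  have down_coc: "is_cocone J K D Y (\<lambda>i\<in>Obj J. \<nu> (fo i))" if "is_cocone J' K D' Y \<nu>" for Y \<nu>
    unfolding is_cocone_def
  proof (intro conjI ballI)
    show "Y \<in> Obj K" using that by (simp add: is_cocone_def)
    show "(\<lambda>i\<in>Obj J. \<nu> (fo i)) i \<in> hom K (FObj D i) Y" if "i \<in> Obj J" for i
      using is_cocone_hom[OF \<open>is_cocone J' K D' Y \<nu>\<close>, of "fo i"] that by (simp add: sel FO)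
    fix u assume u: "u \<in> Arr J"
    have "Cmp K (\<nu> (Cod J' (fa u))) (FArr D' (fa u)) = \<nu> (Dom J' (fa u))"
      using that u unfolding is_cocone_def sel by blast
    then show "Cmp K ((\<lambda>i\<in>Obj J. \<nu> (fo i)) (Cod J u)) (FArr D u) = (\<lambda>i\<in>Obj J. \<nu> (fo i)) (Dom J u)"
      using u J.Dom_in_Obj J.Cod_in_Obj by (simp add: sel FA)
  qed simp
  have "is_colimit J' K D' X (up \<mu>)"
    unfolding is_colimit_def
  proof (intro conjI allI impI)
    show "is_cocone J' K D' X (up \<mu>)"
      using up_coc colim by (simp add: is_colimit_def)
    fix Y \<nu> assume "is_cocone J' K D' Y \<nu>"
    then have "\<exists>!h. h \<in> hom K X Y \<and> (\<forall>i \<in> Obj J. Cmp K h (\<mu> i) = (\<lambda>i\<in>Obj J. \<nu> (fo i)) i)"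
      using colim down_coc unfolding is_colimit_def by blast
    moreover have "(\<forall>i \<in> Obj J'. Cmp K h (up \<mu> i) = \<nu> i) \<longleftrightarrow>
        (\<forall>i \<in> Obj J. Cmp K h (\<mu> i) = (\<lambda>i\<in>Obj J. \<nu> (fo i)) i)" for h
      by (auto simp: sel up)
    ultimately show "\<exists>!h. h \<in> hom K X Y \<and> (\<forall>i \<in> Obj J'. Cmp K h (up \<mu> i) = \<nu> i)"
      by simp
  qed
  moreover have "FObj D' ` Obj J' = FObj D ` Obj J"
    by (auto simp: sel FO image_image)
  ultimately show ?thesis
    using that[OF cJ'] by blast
qed

section \<open>Presheaves\<close>

lemma set_cat_hom: "\<phi> \<in> hom (set_cat \<Omega>) A B \<longleftrightarrow>
    (\<exists>f. \<phi> = (A, B, f) \<and> |A| <o \<Omega> \<and> |B| <o \<Omega> \<and> f \<in> A \<rightarrow>\<^sub>E B)"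
  by (auto simp: hom_def set_cat_def)

lemma set_cat_simps:
  "Obj (set_cat \<Omega>) = {A. |A| <o \<Omega>}"
  "Idn (set_cat \<Omega>) A = (A, A, \<lambda>x\<in>A. x)"
  "Cmp (set_cat \<Omega>) (A', B', g) (A, B, f) = (A, B', \<lambda>x\<in>A. g (f x))"
  by (auto simp: set_cat_def)

text \<open>The underlying function of the restriction map; for \<open>f\<close> from
  \<open>c\<close> to \<open>d\<close> it goes from the value at \<open>d\<close> to the value at
  \<open>c\<close>.\<close>

definition act :: "('o, 'a, 'u) presheaf \<Rightarrow> 'a \<Rightarrow> 'u \<Rightarrow> 'u" where
  "act F f = fn_app (FArr F f)"

definition app :: "('o, 'a, 'u) presheaf_map \<Rightarrow> 'o \<Rightarrow> 'u \<Rightarrow> 'u" where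
  "app \<alpha> c = fn_app (snd (snd \<alpha>) c)"

locale presheaves = category C for C :: "('o, 'a) cat" +
  fixes \<Omega> :: "'l rel"
begin

abbreviation P :: "(('o, 'a, 'u) presheaf, ('o, 'a, 'u) presheaf_map) cat" where
  "P \<equiv> psh \<Omega> C"

lemma psh_Obj: "F \<in> Obj P \<longleftrightarrow> is_functor (op_cat C) (set_cat \<Omega>) F"
  by (simp add: psh_def functor_cat_def)

lemma psh_less: "F \<in> Obj P \<Longrightarrow> c \<in> Obj C \<Longrightarrow> |FObj F c| <o \<Omega>"
  by (auto simp: psh_Obj is_functor_def op_cat_def set_cat_simps)

lemma psh_FArr:
  assumes "F \<in> Obj P" "f \<in> hom C c d"
  shows "FArr F f = (FObj F d, FObj F c, act F f)" "act F f \<in> FObj F d \<rightarrow>\<^sub>E FObj F c"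
proof -
  have "FArr F f \<in> hom (set_cat \<Omega>) (FObj F d) (FObj F c)"
    using assms by (auto simp: psh_Obj is_functor_def op_cat_def hom_def)
  then show "FArr F f = (FObj F d, FObj F c, act F f)" "act F f \<in> FObj F d \<rightarrow>\<^sub>E FObj F c"
    by (auto simp: set_cat_hom act_def fn_app_def)
qed

lemma act_in: "\<lbrakk>F \<in> Obj P; f \<in> hom C c d; x \<in> FObj F d\<rbrakk> \<Longrightarrow> act F f x \<in> FObj F c"
  by (rule PiE_mem[OF psh_FArr(2)])

lemma act_Idn:
  assumes "F \<in> Obj P" "c \<in> Obj C" "x \<in> FObj F c"
  shows "act F (Idn C c) x = x"
proof -
  have "FArr F (Idn C c) = Idn (set_cat \<Omega>) (FObj F c)"
    using assms(1,2) by (simp add: psh_Obj is_functor_def op_cat_def)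
  then show ?thesis using assms(3) by (simp add: act_def fn_app_def set_cat_simps)
qed

lemma act_Cmp:
  assumes "F \<in> Obj P" "f \<in> hom C c d" "g \<in> hom C d e" "x \<in> FObj F e"
  shows "act F (Cmp C g f) x = act F f (act F g x)"
proof -
  have "FArr F (Cmp C g f) = Cmp (set_cat \<Omega>) (FArr F f) (FArr F g)"
    using assms(1-3) by (simp add: psh_Obj is_functor_def op_cat_def hom_def)
  then show ?thesis
    using assms(4) psh_FArr[OF assms(1,2)] psh_FArr[OF assms(1,3)]
    by (simp add: act_def[of F "Cmp C g f"] fn_app_def set_cat_simps)
qed

text \<open>Total functions may be supplied as carrier and action; the restrictions provide the
  extensionality that functors into \<open>set_cat\<close> require.\<close>

definition mkpsh :: "('o \<Rightarrow> 'u set) \<Rightarrow> ('a \<Rightarrow> 'u \<Rightarrow> 'u) \<Rightarrow> ('o, 'a, 'u) presheaf" where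
  "mkpsh S r = \<lparr>FObj = (\<lambda>c\<in>Obj C. S c),
     FArr = (\<lambda>f\<in>Arr C. (S (Cod C f), S (Dom C f), \<lambda>x\<in>S (Cod C f). r f x))\<rparr>"

lemma mkpsh_FObj: "c \<in> Obj C \<Longrightarrow> FObj (mkpsh S r) c = S c"
  by (simp add: mkpsh_def)

lemma mkpsh_act: "f \<in> hom C c d \<Longrightarrow> x \<in> S d \<Longrightarrow> act (mkpsh S r) f x = r f x"
  by (auto simp: mkpsh_def act_def fn_app_def hom_def)

lemma mkpsh_Obj:
  assumes "\<And>c. c \<in> Obj C \<Longrightarrow> |S c| <o \<Omega>"
    and "\<And>f c d x. f \<in> hom C c d \<Longrightarrow> x \<in> S d \<Longrightarrow> r f x \<in> S c"
    and "\<And>c x. c \<in> Obj C \<Longrightarrow> x \<in> S c \<Longrightarrow> r (Idn C c) x = x"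
    and "\<And>f g c d e x. f \<in> hom C c d \<Longrightarrow> g \<in> hom C d e \<Longrightarrow> x \<in> S e \<Longrightarrow> r (Cmp C g f) x = r f (r g x)"
  shows "mkpsh S r \<in> Obj P"
  unfolding psh_Obj is_functor_def
proof (intro conjI ballI impI)
  have arr: "(S (Cod C f), S (Dom C f), \<lambda>x\<in>S (Cod C f). r f x) \<in> hom (set_cat \<Omega>) (S (Cod C f)) (S (Dom C f))"
    if "f \<in> Arr C" for f
    using assms(1) assms(2)[OF hom_memI[OF that refl refl]] Dom_in_Obj[OF that] Cod_in_Obj[OF that]
    by (auto simp: set_cat_hom)
  show "FObj (mkpsh S r) \<in> Obj (op_cat C) \<rightarrow>\<^sub>E Obj (set_cat \<Omega>)"
    using assms(1) by (auto simp: mkpsh_def op_cat_def set_cat_simps)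
  show "FArr (mkpsh S r) \<in> Arr (op_cat C) \<rightarrow>\<^sub>E Arr (set_cat \<Omega>)"
    using hom_memD(1)[OF arr] by (auto simp: mkpsh_def op_cat_def)
  show "FArr (mkpsh S r) f \<in> hom (set_cat \<Omega>) (FObj (mkpsh S r) (Dom (op_cat C) f)) (FObj (mkpsh S r) (Cod (op_cat C) f))"
    if "f \<in> Arr (op_cat C)" for f
    using that arr Dom_in_Obj Cod_in_Obj by (simp add: mkpsh_def op_cat_def)
  show "FArr (mkpsh S r) (Idn (op_cat C) c) = Idn (set_cat \<Omega>) (FObj (mkpsh S r) c)" if "c \<in> Obj (op_cat C)" for c
    using that Idn_in_hom[of c] assms(3) by (auto simp: mkpsh_def op_cat_def set_cat_simps hom_def)
  fix f g assume fg: "f \<in> Arr (op_cat C)" "g \<in> Arr (op_cat C)" "Cod (op_cat C) f = Dom (op_cat C) g"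
  then have h: "g \<in> hom C (Dom C g) (Dom C f)" "f \<in> hom C (Dom C f) (Cod C f)"
    by (auto simp: op_cat_def hom_def)
  note c = hom_memD[OF Cmp_in_hom[OF h]]
  show "FArr (mkpsh S r) (Cmp (op_cat C) g f) = Cmp (set_cat \<Omega>) (FArr (mkpsh S r) g) (FArr (mkpsh S r) f)"
    using fg c assms(4)[OF h] assms(2)[OF h(2)] by (auto simp: mkpsh_def op_cat_def set_cat_simps fun_eq_iff)
qed

lemma psh_hom: "\<alpha> \<in> hom P F G \<longleftrightarrow> F \<in> Obj P \<and> G \<in> Obj P \<and> (\<exists>\<tau>. \<alpha> = (F, G, \<tau>) \<and> is_nat_trans (op_cat C) (set_cat \<Omega>) F G \<tau>)"
  by (auto simp: hom_def psh_Obj) (auto simp: psh_def functor_cat_def)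

lemma psh_hom_Obj: "\<alpha> \<in> hom P F G \<Longrightarrow> F \<in> Obj P \<and> G \<in> Obj P"
  by (simp add: psh_hom)

lemma psh_hom_triple:
  assumes "\<alpha> \<in> hom P F G" "c \<in> Obj C"
  shows "snd (snd \<alpha>) c = (FObj F c, FObj G c, app \<alpha> c)" "app \<alpha> c \<in> FObj F c \<rightarrow>\<^sub>E FObj G c"
proof -
  obtain \<tau> where \<tau>: "\<alpha> = (F, G, \<tau>)" "is_nat_trans (op_cat C) (set_cat \<Omega>) F G \<tau>"
    using assms(1) unfolding psh_hom by blast
  then have "\<tau> c \<in> hom (set_cat \<Omega>) (FObj F c) (FObj G c)"
    using assms(2) by (auto simp: is_nat_trans_def op_cat_def)
  then show "snd (snd \<alpha>) c = (FObj F c, FObj G c, app \<alpha> c)" "app \<alpha> c \<in> FObj F c \<rightarrow>\<^sub>E FObj G c"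
    using \<tau>(1) by (auto simp: set_cat_hom app_def fn_app_def)
qed

lemma app_in: "\<alpha> \<in> hom P F G \<Longrightarrow> c \<in> Obj C \<Longrightarrow> x \<in> FObj F c \<Longrightarrow> app \<alpha> c x \<in> FObj G c"
  by (rule PiE_mem[OF psh_hom_triple(2)])

lemma app_act:
  assumes \<alpha>: "\<alpha> \<in> hom P F G" and f: "f \<in> hom C c d" and x: "x \<in> FObj F d"
  shows "app \<alpha> c (act F f x) = act G f (app \<alpha> d x)"
proof -
  obtain \<tau> where \<tau>: "\<alpha> = (F, G, \<tau>)" "is_nat_trans (op_cat C) (set_cat \<Omega>) F G \<tau>"
    using \<alpha> unfolding psh_hom by blast
  note o = hom_Obj[OF f] and FG = psh_hom_Obj[OF \<alpha>]
  have "Cmp (set_cat \<Omega>) (FArr G f) (\<tau> d) = Cmp (set_cat \<Omega>) (\<tau> c) (FArr F f)"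
    using \<tau>(2) f by (auto simp: is_nat_trans_def op_cat_def hom_def)
  moreover have "\<tau> d = (FObj F d, FObj G d, app \<alpha> d)" "\<tau> c = (FObj F c, FObj G c, app \<alpha> c)"
    using psh_hom_triple[OF \<alpha> o(1)] psh_hom_triple[OF \<alpha> o(2)] \<tau>(1) by auto
  ultimately have "(\<lambda>x\<in>FObj F d. act G f (app \<alpha> d x)) = (\<lambda>x\<in>FObj F d. app \<alpha> c (act F f x))"
    using psh_FArr[OF conjunct1[OF FG] f] psh_FArr[OF conjunct2[OF FG] f] by (simp add: set_cat_simps)
  from fun_cong[OF this, of x] show ?thesis using x by simp
qed

lemma psh_ext:
  assumes \<alpha>: "\<alpha> \<in> hom P F G" and \<beta>: "\<beta> \<in> hom P F G"
    and eq: "\<And>c x. c \<in> Obj C \<Longrightarrow> x \<in> FObj F c \<Longrightarrow> app \<alpha> c x = app \<beta> c x"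
  shows "\<alpha> = \<beta>"
proof -
  obtain \<sigma> \<tau> where st: "\<alpha> = (F, G, \<sigma>)" "\<beta> = (F, G, \<tau>)" "\<sigma> \<in> extensional (Obj C)" "\<tau> \<in> extensional (Obj C)"
    using \<alpha> \<beta> unfolding psh_hom is_nat_trans_def by (auto simp: op_cat_def)
  have "\<sigma> c = \<tau> c" if c: "c \<in> Obj C" for c
  proof -
    have "app \<alpha> c = app \<beta> c"
      by (rule extensionalityI[where A = "FObj F c"])
        (use psh_hom_triple(2)[OF \<alpha> c] psh_hom_triple(2)[OF \<beta> c] eq c in \<open>auto simp: PiE_def\<close>)
    then show ?thesis
      using psh_hom_triple(1)[OF \<alpha> c] psh_hom_triple(1)[OF \<beta> c] st by simp
  qed
  then have "\<sigma> = \<tau>" by (rule extensionalityI[OF st(3,4)])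
  then show ?thesis using st by simp
qed

definition mkmap :: "('o, 'a, 'u) presheaf \<Rightarrow> ('o, 'a, 'u) presheaf \<Rightarrow> ('o \<Rightarrow> 'u \<Rightarrow> 'u) \<Rightarrow> ('o, 'a, 'u) presheaf_map" where
  "mkmap F G t = (F, G, \<lambda>c\<in>Obj C. (FObj F c, FObj G c, \<lambda>x\<in>FObj F c. t c x))"

lemma mkmap_app: "c \<in> Obj C \<Longrightarrow> x \<in> FObj F c \<Longrightarrow> app (mkmap F G t) c x = t c x"
  by (simp add: mkmap_def app_def fn_app_def)

lemma mkmap_hom:
  assumes F: "F \<in> Obj P" and G: "G \<in> Obj P"
    and "\<And>c x. c \<in> Obj C \<Longrightarrow> x \<in> FObj F c \<Longrightarrow> t c x \<in> FObj G c"
    and "\<And>f c d x. f \<in> hom C c d \<Longrightarrow> x \<in> FObj F d \<Longrightarrow> t c (act F f x) = act G f (t d x)"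
  shows "mkmap F G t \<in> hom P F G"
proof -
  have "is_nat_trans (op_cat C) (set_cat \<Omega>) F G (\<lambda>c\<in>Obj C. (FObj F c, FObj G c, \<lambda>x\<in>FObj F c. t c x))"
    (is "is_nat_trans _ _ _ _ ?\<tau>")
    unfolding is_nat_trans_def
  proof (intro conjI ballI)
    show "?\<tau> \<in> extensional (Obj (op_cat C))" by (simp add: op_cat_def)
    show "?\<tau> c \<in> hom (set_cat \<Omega>) (FObj F c) (FObj G c)" if "c \<in> Obj (op_cat C)" for c
      using that assms(3) psh_less[OF F] psh_less[OF G] by (auto simp: op_cat_def set_cat_hom)
    fix f assume "f \<in> Arr (op_cat C)"
    then have f: "f \<in> hom C (Dom C f) (Cod C f)" by (simp add: op_cat_def hom_def)
    show "Cmp (set_cat \<Omega>) (FArr G f) (?\<tau> (Dom (op_cat C) f)) = Cmp (set_cat \<Omega>) (?\<tau> (Cod (op_cat C) f)) (FArr F f)"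
      using psh_FArr[OF F f] psh_FArr[OF G f] hom_Obj[OF f] act_in[OF F f] assms(3,4) f
      by (simp add: op_cat_def set_cat_simps fun_eq_iff)
  qed
  then show ?thesis
    using F G by (auto simp: psh_hom mkmap_def)
qed

lemma psh_Cmp_raw: "Cmp P (F', G', \<sigma>) (F, G, \<tau>) = (F, G', \<lambda>x\<in>Obj C. Cmp (set_cat \<Omega>) (\<sigma> x) (\<tau> x))"
  by (simp add: psh_def functor_cat_def op_cat_def)

lemma psh_Cmp_mkmap:
  assumes \<alpha>: "\<alpha> \<in> hom P F G" and \<beta>: "\<beta> \<in> hom P G H"
  shows "Cmp P \<beta> \<alpha> = mkmap F H (\<lambda>c x. app \<beta> c (app \<alpha> c x))"
proof -
  obtain \<sigma> \<tau> where st: "\<alpha> = (F, G, \<sigma>)" "\<beta> = (G, H, \<tau>)"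
    using \<alpha> \<beta> unfolding psh_hom by blast
  have "(\<lambda>c\<in>Obj C. Cmp (set_cat \<Omega>) (\<tau> c) (\<sigma> c)) = (\<lambda>c\<in>Obj C. (FObj F c, FObj H c, \<lambda>x\<in>FObj F c. app \<beta> c (app \<alpha> c x)))"
  proof (rule restrict_ext)
    fix c assume c: "c \<in> Obj C"
    have "\<tau> c = (FObj G c, FObj H c, app \<beta> c)" "\<sigma> c = (FObj F c, FObj G c, app \<alpha> c)"
      using psh_hom_triple(1)[OF \<alpha> c] psh_hom_triple(1)[OF \<beta> c] st by simp_all
    then show "Cmp (set_cat \<Omega>) (\<tau> c) (\<sigma> c) = (FObj F c, FObj H c, \<lambda>x\<in>FObj F c. app \<beta> c (app \<alpha> c x))"
      by (simp add: set_cat_simps)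
  qed
  then show ?thesis
    using st by (simp add: psh_Cmp_raw mkmap_def)
qed

lemma app_Cmp:
  assumes "\<alpha> \<in> hom P F G" "\<beta> \<in> hom P G H" "c \<in> Obj C" "x \<in> FObj F c"
  shows "app (Cmp P \<beta> \<alpha>) c x = app \<beta> c (app \<alpha> c x)"
  using assms by (simp add: psh_Cmp_mkmap mkmap_app)

lemma psh_Idn_mkmap: "Idn P F = mkmap F F (\<lambda>c x. x)"
  by (simp add: psh_def functor_cat_def op_cat_def mkmap_def set_cat_simps)

lemma app_Idn: "c \<in> Obj C \<Longrightarrow> x \<in> FObj F c \<Longrightarrow> app (Idn P F) c x = x"
  by (simp add: psh_Idn_mkmap mkmap_app)

lemma psh_Cmp_in_hom:
  assumes "\<alpha> \<in> hom P F G" "\<beta> \<in> hom P G H"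
  shows "Cmp P \<beta> \<alpha> \<in> hom P F H"
  unfolding psh_Cmp_mkmap[OF assms]
proof (rule mkmap_hom)
  show "F \<in> Obj P" "H \<in> Obj P"
    using psh_hom_Obj[OF assms(1)] psh_hom_Obj[OF assms(2)] by blast+
  show "app \<beta> c (app \<alpha> c x) \<in> FObj H c" if "c \<in> Obj C" "x \<in> FObj F c" for c x
    by (rule app_in[OF assms(2) that(1) app_in[OF assms(1) that]])
  show "app \<beta> c (app \<alpha> c (act F f x)) = act H f (app \<beta> d (app \<alpha> d x))"
    if "f \<in> hom C c d" "x \<in> FObj F d" for f c d x
    using app_act[OF assms(1) that] app_act[OF assms(2) that(1) app_in[OF assms(1) hom_Obj(2)[OF that(1)] that(2)]]
    by simp
qed

lemma psh_Idn_in_hom: "F \<in> Obj P \<Longrightarrow> Idn P F \<in> hom P F F"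
  unfolding psh_Idn_mkmap by (rule mkmap_hom) auto

lemma category_psh: "category (P :: (('o, 'a, 'u) presheaf, ('o, 'a, 'u) presheaf_map) cat)"
  (is "category ?P")
proof
  fix \<alpha> assume "\<alpha> \<in> Arr ?P"
  then show "Dom ?P \<alpha> \<in> Obj ?P" "Cod ?P \<alpha> \<in> Obj ?P"
    by (auto simp: psh_def functor_cat_def)
next
  fix F assume "F \<in> Obj ?P"
  then show "Idn ?P F \<in> hom ?P F F" by (rule psh_Idn_in_hom)
next
  fix \<alpha> F G \<beta> H assume "\<alpha> \<in> hom ?P F G" "\<beta> \<in> hom ?P G H"
  then show "Cmp ?P \<beta> \<alpha> \<in> hom ?P F H" by (rule psh_Cmp_in_hom)
next
  fix \<alpha> F G assume \<alpha>: "\<alpha> \<in> hom ?P F G"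
  note I = psh_Idn_in_hom[OF conjunct1[OF psh_hom_Obj[OF \<alpha>]]] psh_Idn_in_hom[OF conjunct2[OF psh_hom_Obj[OF \<alpha>]]]
  show "Cmp ?P \<alpha> (Idn ?P F) = \<alpha>"
    by (rule psh_ext[OF psh_Cmp_in_hom[OF I(1) \<alpha>] \<alpha>]) (simp add: app_Cmp[OF I(1) \<alpha>] app_Idn)
  show "Cmp ?P (Idn ?P G) \<alpha> = \<alpha>"
    by (rule psh_ext[OF psh_Cmp_in_hom[OF \<alpha> I(2)] \<alpha>]) (simp add: app_Cmp[OF \<alpha> I(2)] app_Idn app_in[OF \<alpha>])
next
  fix \<alpha> F G \<beta> H \<gamma> L assume h: "\<alpha> \<in> hom ?P F G" "\<beta> \<in> hom ?P G H" "\<gamma> \<in> hom ?P H L"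
  note h2 = psh_Cmp_in_hom[OF h(1,2)] psh_Cmp_in_hom[OF h(2,3)]
  show "Cmp ?P \<gamma> (Cmp ?P \<beta> \<alpha>) = Cmp ?P (Cmp ?P \<gamma> \<beta>) \<alpha>"
    by (rule psh_ext[OF psh_Cmp_in_hom[OF h2(1) h(3)] psh_Cmp_in_hom[OF h(1) h2(2)]])
      (simp add: app_Cmp[OF h2(1) h(3)] app_Cmp[OF h(1) h2(2)] app_Cmp[OF h(1,2)] app_Cmp[OF h(2,3)] app_in[OF h(1)])
qed

text \<open>Colimits and coequalizers of presheaves are both quotients of a family of presheaves by the
  equivalence relation generated by pointwise relations \<open>R c\<close> on the disjoint union of the values.\<close>

lemma quotient_universal:
  assumes X: "X \<in> Obj P" and \<mu>: "\<And>i. i \<in> I \<Longrightarrow> \<mu> i \<in> hom P (D i) X"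
    and surj: "\<And>c x. c \<in> Obj C \<Longrightarrow> x \<in> FObj X c \<Longrightarrow> \<exists>i \<in> I. \<exists>y \<in> FObj (D i) c. app (\<mu> i) c y = x"
    and ker: "\<And>c i j y z. \<lbrakk>c \<in> Obj C; i \<in> I; j \<in> I; y \<in> FObj (D i) c; z \<in> FObj (D j) c;
      app (\<mu> i) c y = app (\<mu> j) c z\<rbrakk> \<Longrightarrow> ((i, y), (j, z)) \<in> equivcl (R c)"
    and Y: "Y \<in> Obj P" and \<nu>: "\<And>i. i \<in> I \<Longrightarrow> \<nu> i \<in> hom P (D i) Y"
    and resp: "\<And>c i j y z. c \<in> Obj C \<Longrightarrow> ((i, y), (j, z)) \<in> R c \<Longrightarrow> app (\<nu> i) c y = app (\<nu> j) c z"
  shows "\<exists>!h. h \<in> hom P X Y \<and> (\<forall>i \<in> I. Cmp P h (\<mu> i) = \<nu> i)"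
proof -
  obtain ix el where pick: "\<And>c x. c \<in> Obj C \<Longrightarrow> x \<in> FObj X c \<Longrightarrow>
      ix c x \<in> I \<and> el c x \<in> FObj (D (ix c x)) c \<and> app (\<mu> (ix c x)) c (el c x) = x"
    using surj by metis
  \<comment> \<open>Defined on chosen representatives; \<open>ker\<close> and \<open>resp\<close>
    together make the value independent of the choice.\<close>
  define t where "t c x = app (\<nu> (ix c x)) c (el c x)" for c x
  have t: "t c (app (\<mu> i) c y) = app (\<nu> i) c y" if c: "c \<in> Obj C" "i \<in> I" "y \<in> FObj (D i) c" for c i y
  proof -
    let ?x = "app (\<mu> i) c y"
    have x: "?x \<in> FObj X c" by (rule app_in[OF \<mu> c(1,3)]) (rule c)
    note pk = pick[OF c(1) x]
    have "((ix c ?x, el c ?x), (i, y)) \<in> equivcl (R c)"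
      by (rule ker) (use c pk in auto)
    then have "(\<lambda>(i, y). app (\<nu> i) c y) (ix c ?x, el c ?x) = (\<lambda>(i, y). app (\<nu> i) c y) (i, y)"
      by (rule equivcl_subset) (use resp[OF c(1)] in auto)
    then show ?thesis by (simp add: t_def)
  qed
  have h: "mkmap X Y t \<in> hom P X Y"
  proof (rule mkmap_hom[OF X Y])
    show "t c x \<in> FObj Y c" if "c \<in> Obj C" "x \<in> FObj X c" for c x
      using pick[OF that] app_in[OF \<nu> that(1)] by (simp add: t_def)
    fix f c d x assume f: "f \<in> hom C c d" and x: "x \<in> FObj X d"
    note o = hom_Obj[OF f]
    obtain i y where i: "i \<in> I" "y \<in> FObj (D i) d" "app (\<mu> i) d y = x" using surj[OF o(2) x] by blast
    have y': "act (D i) f y \<in> FObj (D i) c"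
      by (rule act_in[OF _ f i(2)]) (use psh_hom_Obj[OF \<mu>[OF i(1)]] in blast)
    have "t c (act X f x) = app (\<nu> i) c (act (D i) f y)"
      using app_act[OF \<mu>[OF i(1)] f i(2)] i t[OF o(1) i(1) y'] by simp
    also have "\<dots> = act Y f (t d x)"
      using app_act[OF \<nu>[OF i(1)] f i(2)] t[OF o(2) i(1,2)] i by simp
    finally show "t c (act X f x) = act Y f (t d x)" .
  qed
  show ?thesis
  proof (rule ex1I[of _ "mkmap X Y t"], intro conjI ballI)
    fix i assume i: "i \<in> I"
    show "Cmp P (mkmap X Y t) (\<mu> i) = \<nu> i"
    proof (rule psh_ext[OF psh_Cmp_in_hom[OF \<mu>[OF i] h] \<nu>[OF i]])
      fix c y assume c: "c \<in> Obj C" "y \<in> FObj (D i) c"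
      show "app (Cmp P (mkmap X Y t) (\<mu> i)) c y = app (\<nu> i) c y"
        using app_Cmp[OF \<mu>[OF i] h c] mkmap_app[OF c(1) app_in[OF \<mu>[OF i] c]] t[OF c(1) i c(2)] by simp
    qed
  next
    fix h' assume h': "h' \<in> hom P X Y \<and> (\<forall>i\<in>I. Cmp P h' (\<mu> i) = \<nu> i)"
    show "h' = mkmap X Y t"
    proof (rule psh_ext[OF conjunct1[OF h'] h])
      fix c x assume c: "c \<in> Obj C" "x \<in> FObj X c"
      obtain i y where i: "i \<in> I" "y \<in> FObj (D i) c" "app (\<mu> i) c y = x" using surj[OF c] by blast
      have "app h' c x = app (\<nu> i) c y"
        using app_Cmp[OF \<mu>[OF i(1)] conjunct1[OF h'] c(1) i(2)] h' i by auto
      then show "app h' c x = app (mkmap X Y t) c x"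
        using mkmap_app[OF c] t[OF c(1) i(1,2)] i(3) by simp
    qed
  qed (rule h)
qed

text \<open>The relations are stable under restriction, so restriction descends to classes. The
  remaining difficulty is that a class is a set of pairs while the values of a presheaf must be
  subsets of \<open>'u\<close>.\<close>

lemma quotient_exists:
  fixes D :: "'i \<Rightarrow> ('o, 'a, 'u) presheaf"
  assumes \<Omega>: "regular_uncountable \<Omega>" "\<Omega> \<le>o |UNIV :: 'u set|"
    and I: "|I| <o \<Omega>" and D: "\<And>i. i \<in> I \<Longrightarrow> D i \<in> Obj P"
    and R: "\<And>c. c \<in> Obj C \<Longrightarrow> R c \<subseteq> (SIGMA i:I. FObj (D i) c) \<times> (SIGMA i:I. FObj (D i) c)"
    and stable: "\<And>f c d i j y z. f \<in> hom C c d \<Longrightarrow> ((i, y), (j, z)) \<in> R d \<Longrightarrow>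
      ((i, act (D i) f y), (j, act (D j) f z)) \<in> R c"
  obtains X \<mu> where "X \<in> Obj P" "\<And>i. i \<in> I \<Longrightarrow> \<mu> i \<in> hom P (D i) X"
    "\<And>c x. c \<in> Obj C \<Longrightarrow> x \<in> FObj X c \<Longrightarrow> \<exists>i \<in> I. \<exists>y \<in> FObj (D i) c. app (\<mu> i) c y = x"
    "\<And>c i j y z. \<lbrakk>c \<in> Obj C; i \<in> I; j \<in> I; y \<in> FObj (D i) c; z \<in> FObj (D j) c\<rbrakk> \<Longrightarrow>
      app (\<mu> i) c y = app (\<mu> j) c z \<longleftrightarrow> ((i, y), (j, z)) \<in> equivcl (R c)"
proof -
  interpret Om: regular_uncountable \<Omega> by (rule \<Omega>)
  define T where "T c = (SIGMA i:I. FObj (D i) c)" for c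
  define cls where "cls c p = equivcl (R c) `` {p}" for c p
  have T_less: "|T c| <o \<Omega>" if "c \<in> Obj C" for c
    unfolding T_def by (rule Om.less_Sigma[OF I psh_less[OF D that]])
  \<comment> \<open>Classes are coded by elements of \<open>'u\<close>, separately for each object;
    no compatibility between the codings is needed because the action is defined through
    representatives.\<close>
  have "\<exists>\<iota> :: ('i \<times> 'u) set \<Rightarrow> 'u. inj_on \<iota> (cls c ` T c)" if "c \<in> Obj C" for c
    using Om.less_embed[OF Om.less_image[OF T_less[OF that]] \<Omega>(2)] by metis
  then obtain \<iota> :: "'o \<Rightarrow> ('i \<times> 'u) set \<Rightarrow> 'u" where \<iota>: "\<And>c. c \<in> Obj C \<Longrightarrow> inj_on (\<iota> c) (cls c ` T c)"
    by metis
  define q where "q c p = \<iota> c (cls c p)" for c p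
  have cls_eq: "cls c p = cls c p' \<longleftrightarrow> (p, p') \<in> equivcl (R c)" for c p p'
  proof
    assume "cls c p = cls c p'"
    moreover have "p' \<in> cls c p'" by (simp add: cls_def equivcl_refl)
    ultimately have "p' \<in> cls c p" by blast
    then show "(p, p') \<in> equivcl (R c)" by (simp add: cls_def)
  next
    assume *: "(p, p') \<in> equivcl (R c)"
    show "cls c p = cls c p'"
      unfolding cls_def using equivcl_trans[OF *] equivcl_trans[OF equivcl_sym[OF *]] by auto
  qed
  have q_eq: "q c p = q c p' \<longleftrightarrow> (p, p') \<in> equivcl (R c)" if "c \<in> Obj C" "p \<in> T c" "p' \<in> T c" for c p p'
    using \<iota>[OF that(1)] that(2,3) cls_eq unfolding q_def by (metis imageI inj_on_eq_iff)
  define actT where "actT f = (\<lambda>(i, y). (i, act (D i) f y))" for f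
  have actT_in: "actT f p \<in> T c" if "f \<in> hom C c d" "p \<in> T d" for f c d p
    using that act_in[OF D that(1)] by (auto simp: T_def actT_def)
  have actT_eq: "(actT f p, actT f p') \<in> equivcl (R c)" if "f \<in> hom C c d" "(p, p') \<in> equivcl (R d)" for f c d p p'
    using that(2) by (rule equivcl_map) (use stable[OF that(1)] in \<open>auto simp: actT_def\<close>)
  define S where "S c = q c ` T c" for c
  define rep where "rep c = inv_into (T c) (q c)" for c
  have rep: "rep c s \<in> T c \<and> q c (rep c s) = s" if "s \<in> S c" for c s
    using that unfolding rep_def S_def by (simp add: f_inv_into_f inv_into_into)
  \<comment> \<open>Decode to a representative, restrict it, and encode its class again;
    \<open>r_q\<close> shows that the representative does not matter.\<close>
  define r where "r f s = q (Dom C f) (actT f (rep (Cod C f) s))" for f s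
  have r_q: "r f (q d p) = q c (actT f p)" if f: "f \<in> hom C c d" and p: "p \<in> T d" for f c d p
  proof -
    note o = hom_Obj[OF f]
    have qs: "q d p \<in> S d" using p by (simp add: S_def)
    have "(rep d (q d p), p) \<in> equivcl (R d)"
      using rep[OF qs] q_eq[OF o(2)] p by blast
    then have "q c (actT f (rep d (q d p))) = q c (actT f p)"
      using q_eq[OF o(1)] actT_in[OF f] rep[OF qs] p actT_eq[OF f] by blast
    then show ?thesis using f by (simp add: r_def hom_def)
  qed
  have ST: "\<exists>p \<in> T c. s = q c p" if "s \<in> S c" for s c using that by (auto simp: S_def)
  let ?X = "mkpsh S r"
  have X: "?X \<in> Obj P"
  proof (rule mkpsh_Obj)
    show "|S c| <o \<Omega>" if "c \<in> Obj C" for c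
      unfolding S_def by (rule Om.less_image[OF T_less[OF that]])
    show "r f x \<in> S c" if f: "f \<in> hom C c d" and x: "x \<in> S d" for f c d x
      using ST[OF x] r_q[OF f] actT_in[OF f] by (auto simp: S_def)
    show "r (Idn C c) x = x" if c: "c \<in> Obj C" and x: "x \<in> S c" for c x
    proof -
      obtain p where p: "p \<in> T c" "x = q c p" using ST[OF x] by blast
      have "actT (Idn C c) p = p"
        using p(1) act_Idn[OF D c] by (auto simp: T_def actT_def)
      then show ?thesis using r_q[OF Idn_in_hom[OF c] p(1)] p(2) by simp
    qed
    show "r (Cmp C g f) x = r f (r g x)" if f: "f \<in> hom C c d" and g: "g \<in> hom C d e" and x: "x \<in> S e" for f g c d e x
    proof -
      obtain p where p: "p \<in> T e" "x = q e p" using ST[OF x] by blast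
      have "actT (Cmp C g f) p = actT f (actT g p)"
        using p(1) act_Cmp[OF D f g] by (auto simp: T_def actT_def)
      then show ?thesis
        using r_q[OF Cmp_in_hom[OF f g] p(1)] r_q[OF g p(1)] r_q[OF f actT_in[OF g p(1)]] p(2) by simp
    qed
  qed
  define \<mu> where "\<mu> i = mkmap (D i) ?X (\<lambda>c y. q c (i, y))" for i
  have \<mu>_app: "app (\<mu> i) c y = q c (i, y)" if "c \<in> Obj C" "y \<in> FObj (D i) c" for i c y
    using that by (simp add: \<mu>_def mkmap_app)
  have \<mu>: "\<mu> i \<in> hom P (D i) ?X" if i: "i \<in> I" for i
    unfolding \<mu>_def
  proof (rule mkmap_hom[OF D[OF i] X])
    show "q c (i, y) \<in> FObj ?X c" if "c \<in> Obj C" "y \<in> FObj (D i) c" for c y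
      using that i by (auto simp: mkpsh_FObj S_def T_def)
    fix f c d y assume f: "f \<in> hom C c d" and y: "y \<in> FObj (D i) d"
    have iy: "(i, y) \<in> T d" using i y by (simp add: T_def)
    then have "q d (i, y) \<in> S d" by (simp add: S_def)
    then show "q c (i, act (D i) f y) = act ?X f (q d (i, y))"
      using mkpsh_act[OF f, of "q d (i, y)" S r] r_q[OF f iy] by (simp add: actT_def)
  qed
  show ?thesis
  proof (rule that[OF X \<mu>])
    fix c x assume c: "c \<in> Obj C" and x: "x \<in> FObj ?X c"
    then obtain i y where "i \<in> I" "y \<in> FObj (D i) c" "x = q c (i, y)"
      by (auto simp: mkpsh_FObj S_def T_def)
    then show "\<exists>i\<in>I. \<exists>y\<in>FObj (D i) c. app (\<mu> i) c y = x"
      using \<mu>_app[OF c] by metis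
  next
    fix c i j y z assume "c \<in> Obj C" "i \<in> I" "j \<in> I" "y \<in> FObj (D i) c" "z \<in> FObj (D j) c"
    then show "app (\<mu> i) c y = app (\<mu> j) c z \<longleftrightarrow> ((i, y), (j, z)) \<in> equivcl (R c)"
      using q_eq[of c "(i, y)" "(j, z)"] by (simp add: \<mu>_app T_def)
  qed
qed

text \<open>The generating relation only, unlike \<open>zigzag\<close>; its closure is taken where
  it is used, because the quotient construction is stated for generators.\<close>

definition pointwise_zigzag ::
    "('i, 'j) cat \<Rightarrow> ('i, 'j, ('o, 'a, 'u) presheaf, ('o, 'a, 'u) presheaf_map) func \<Rightarrow> 'o \<Rightarrow> ('i \<times> 'u) rel" where
  "pointwise_zigzag J D c = {((i, y), (j, app (FArr D \<theta>) c y)) | i j \<theta> y.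
     \<theta> \<in> hom J i j \<and> y \<in> FObj (FObj D i) c}"

text \<open>Besides building colimits, this criterion later recognizes the image of a filtered
  colimit under the restricted Yoneda embedding as a colimit.\<close>

lemma pointwise_colimit:
  assumes J: "category J" and D: "is_functor J P D" and \<mu>: "is_cocone J P D X \<mu>"
    and surj: "\<And>c x. c \<in> Obj C \<Longrightarrow> x \<in> FObj X c \<Longrightarrow> \<exists>i \<in> Obj J. \<exists>y \<in> FObj (FObj D i) c. app (\<mu> i) c y = x"
    and ker: "\<And>c i j y z. \<lbrakk>c \<in> Obj C; i \<in> Obj J; j \<in> Obj J; y \<in> FObj (FObj D i) c; z \<in> FObj (FObj D j) c;
      app (\<mu> i) c y = app (\<mu> j) c z\<rbrakk> \<Longrightarrow> ((i, y), (j, z)) \<in> equivcl (pointwise_zigzag J D c)"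
  shows "is_colimit J P D X \<mu>"
  unfolding is_colimit_def
proof (intro conjI allI impI)
  interpret J: category J by (rule J)
  fix Y \<nu> assume \<nu>: "is_cocone J P D Y \<nu>"
  show "\<exists>!h. h \<in> hom P X Y \<and> (\<forall>i \<in> Obj J. Cmp P h (\<mu> i) = \<nu> i)"
  proof (rule quotient_universal[OF _ _ surj ker])
    show "X \<in> Obj P" "Y \<in> Obj P" using \<mu> \<nu> by (auto simp: is_cocone_def)
    fix c i j y z assume c: "c \<in> Obj C" and z: "((i, y), (j, z)) \<in> pointwise_zigzag J D c"
    then obtain \<theta> where \<theta>: "\<theta> \<in> hom J i j" "y \<in> FObj (FObj D i) c" "z = app (FArr D \<theta>) c y"
      by (auto simp: pointwise_zigzag_def)
    show "app (\<nu> i) c y = app (\<nu> j) c z"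
      using app_Cmp[OF is_functor_hom[OF D \<theta>(1)] is_cocone_hom[OF \<nu> J.hom_Obj(2)[OF \<theta>(1)]] c \<theta>(2)]
        is_cocone_comm[OF \<nu> \<theta>(1)] \<theta>(3) by simp
  qed (use is_cocone_hom[OF \<mu>] is_cocone_hom[OF \<nu>] in auto)
qed (rule \<mu>)

lemma colimit_pointwise:
  fixes D :: "('i, 'j, ('o, 'a, 'u) presheaf, ('o, 'a, 'u) presheaf_map) func"
  assumes \<Omega>: "regular_uncountable \<Omega>" "\<Omega> \<le>o |UNIV :: 'u set|"
    and J: "category J" "|Obj J| <o \<Omega>" and D: "is_functor J P D"
  obtains X \<mu> where "is_colimit J P D X \<mu>"
    "\<And>c x. c \<in> Obj C \<Longrightarrow> x \<in> FObj X c \<Longrightarrow> \<exists>i \<in> Obj J. \<exists>y \<in> FObj (FObj D i) c. app (\<mu> i) c y = x"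
    "\<And>c i j y z. \<lbrakk>c \<in> Obj C; i \<in> Obj J; j \<in> Obj J; y \<in> FObj (FObj D i) c; z \<in> FObj (FObj D j) c;
      app (\<mu> i) c y = app (\<mu> j) c z\<rbrakk> \<Longrightarrow> ((i, y), (j, z)) \<in> equivcl (pointwise_zigzag J D c)"
proof -
  interpret J: category J by (rule J)
  have R: "pointwise_zigzag J D c \<subseteq> (SIGMA i:Obj J. FObj (FObj D i) c) \<times> (SIGMA i:Obj J. FObj (FObj D i) c)"
    if "c \<in> Obj C" for c
    using that J.hom_Obj app_in[OF is_functor_hom[OF D] that] by (auto simp: pointwise_zigzag_def)
  have st: "((i, act (FObj D i) f y), (j, act (FObj D j) f z)) \<in> pointwise_zigzag J D c"
    if f: "f \<in> hom C c d" and yz: "((i, y), (j, z)) \<in> pointwise_zigzag J D d" for f c d i j y z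
  proof -
    obtain \<theta> where \<theta>: "\<theta> \<in> hom J i j" "y \<in> FObj (FObj D i) d" "z = app (FArr D \<theta>) d y"
      using yz by (auto simp: pointwise_zigzag_def)
    note h = is_functor_hom[OF D \<theta>(1)]
    show ?thesis
      using \<theta> app_act[OF h f \<theta>(2)] act_in[OF conjunct1[OF psh_hom_Obj[OF h]] f \<theta>(2)]
      by (auto simp: pointwise_zigzag_def intro!: exI[of _ \<theta>])
  qed
  obtain X \<mu>0 where X: "X \<in> Obj P" "\<And>i. i \<in> Obj J \<Longrightarrow> \<mu>0 i \<in> hom P (FObj D i) X"
    and surj: "\<And>c x. c \<in> Obj C \<Longrightarrow> x \<in> FObj X c \<Longrightarrow> \<exists>i \<in> Obj J. \<exists>y \<in> FObj (FObj D i) c. app (\<mu>0 i) c y = x"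
    and ker: "\<And>c i j y z. \<lbrakk>c \<in> Obj C; i \<in> Obj J; j \<in> Obj J; y \<in> FObj (FObj D i) c; z \<in> FObj (FObj D j) c\<rbrakk> \<Longrightarrow>
      app (\<mu>0 i) c y = app (\<mu>0 j) c z \<longleftrightarrow> ((i, y), (j, z)) \<in> equivcl (pointwise_zigzag J D c)"
    by (rule quotient_exists[where R = "pointwise_zigzag J D", OF \<Omega> J(2) is_functor_Obj[OF D] R st])
      (assumption | rule that)+
  define \<mu> where "\<mu> = restrict \<mu>0 (Obj J)"
  have \<mu>: "\<mu> i = \<mu>0 i" if "i \<in> Obj J" for i using that by (simp add: \<mu>_def)
  have coc: "is_cocone J P D X \<mu>"
    unfolding is_cocone_def
  proof (intro conjI ballI)
    fix \<theta> assume "\<theta> \<in> Arr J"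
    then have \<theta>: "\<theta> \<in> hom J (Dom J \<theta>) (Cod J \<theta>)" by (simp add: hom_def)
    note o = J.hom_Obj[OF \<theta>] and h = is_functor_hom[OF D \<theta>]
    have "Cmp P (\<mu>0 (Cod J \<theta>)) (FArr D \<theta>) = \<mu>0 (Dom J \<theta>)"
    proof (rule psh_ext[OF psh_Cmp_in_hom[OF h X(2)[OF o(2)]] X(2)[OF o(1)]])
      fix c y assume c: "c \<in> Obj C" "y \<in> FObj (FObj D (Dom J \<theta>)) c"
      have "((Dom J \<theta>, y), (Cod J \<theta>, app (FArr D \<theta>) c y)) \<in> equivcl (pointwise_zigzag J D c)"
        by (rule equivcl_incl) (use \<theta> c in \<open>auto simp: pointwise_zigzag_def\<close>)
      then show "app (Cmp P (\<mu>0 (Cod J \<theta>)) (FArr D \<theta>)) c y = app (\<mu>0 (Dom J \<theta>)) c y"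
        using ker[OF c(1) o c(2) app_in[OF h c]] app_Cmp[OF h X(2)[OF o(2)] c] by simp
    qed
    then show "Cmp P (\<mu> (Cod J \<theta>)) (FArr D \<theta>) = \<mu> (Dom J \<theta>)" using \<mu> o by simp
  qed (use X \<mu> in \<open>auto simp: \<mu>_def\<close>)
  have "is_colimit J P D X \<mu>"
    by (rule pointwise_colimit[OF J(1) D coc]) (use surj ker \<mu> in auto)
  then show ?thesis
    using that surj ker \<mu> by metis
qed

end

lemma is_colimit_hom:
  assumes "is_colimit J K D X \<mu>" "i \<in> Obj J"
  shows "\<mu> i \<in> hom K (FObj D i) X"
proof -
  have "is_cocone J K D X \<mu>" using assms(1) unfolding is_colimit_def by (rule conjunct1)
  then show ?thesis using assms(2) by (rule is_cocone_hom)
qed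

lemma (in category) colimit_unique:
  assumes 1: "is_colimit J C D X \<mu>" and 2: "is_colimit J C D X' \<mu>'"
  obtains h h' where "h \<in> hom C X X'" "h' \<in> hom C X' X" "Cmp C h' h = Idn C X" "Cmp C h h' = Idn C X'"
    "\<And>i. i \<in> Obj J \<Longrightarrow> Cmp C h (\<mu> i) = \<mu>' i" "\<And>i. i \<in> Obj J \<Longrightarrow> Cmp C h' (\<mu>' i) = \<mu> i"
proof -
  have c: "is_cocone J C D X \<mu>" "is_cocone J C D X' \<mu>'"
    and u: "\<And>Y \<nu>. is_cocone J C D Y \<nu> \<Longrightarrow> \<exists>!h. h \<in> hom C X Y \<and> (\<forall>i \<in> Obj J. Cmp C h (\<mu> i) = \<nu> i)"
      "\<And>Y \<nu>. is_cocone J C D Y \<nu> \<Longrightarrow> \<exists>!h. h \<in> hom C X' Y \<and> (\<forall>i \<in> Obj J. Cmp C h (\<mu>' i) = \<nu> i)"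
    using 1 2 by (auto simp: is_colimit_def)
  obtain h where h: "h \<in> hom C X X'" "\<forall>i \<in> Obj J. Cmp C h (\<mu> i) = \<mu>' i" using u(1)[OF c(2)] by blast
  obtain h' where h': "h' \<in> hom C X' X" "\<forall>i \<in> Obj J. Cmp C h' (\<mu>' i) = \<mu> i" using u(2)[OF c(1)] by blast
  note m = is_cocone_hom[OF c(1)] is_cocone_hom[OF c(2)]
  have "Cmp C h' h = Idn C X"
  proof (rule ex1E[OF u(1)[OF c(1)]])
    fix k assume k: "\<forall>y. y \<in> hom C X X \<and> (\<forall>i\<in>Obj J. Cmp C y (\<mu> i) = \<mu> i) \<longrightarrow> y = k"
    have "Cmp C h' h = k"
      using k Cmp_in_hom[OF h(1) h'(1)] assoc[OF m(1) h(1) h'(1)] h(2) h'(2) by simp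
    moreover have "Idn C X = k"
      using k Idn_in_hom hom_Obj[OF h(1)] Cmp_Idn_left[OF m(1)] by simp
    ultimately show ?thesis by simp
  qed
  moreover have "Cmp C h h' = Idn C X'"
  proof (rule ex1E[OF u(2)[OF c(2)]])
    fix k assume k: "\<forall>y. y \<in> hom C X' X' \<and> (\<forall>i\<in>Obj J. Cmp C y (\<mu>' i) = \<mu>' i) \<longrightarrow> y = k"
    have "Cmp C h h' = k"
      using k Cmp_in_hom[OF h'(1) h(1)] assoc[OF m(2) h'(1) h(1)] h(2) h'(2) by simp
    moreover have "Idn C X' = k"
      using k Idn_in_hom hom_Obj[OF h(1)] Cmp_Idn_left[OF m(2)] by simp
    ultimately show ?thesis by simp
  qed
  ultimately show ?thesis using that h h' by blast
qed

context presheaves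
begin

text \<open>An arbitrary colimit is isomorphic to the constructed one compatibly with the legs, and
  the pointwise description is carried across this isomorphism.\<close>

lemma is_colimit_pointwise:
  fixes D :: "('i, 'j, ('o, 'a, 'u) presheaf, ('o, 'a, 'u) presheaf_map) func"
  assumes \<Omega>: "regular_uncountable \<Omega>" "\<Omega> \<le>o |UNIV :: 'u set|"
    and J: "category J" "|Obj J| <o \<Omega>" and D: "is_functor J P D" and X: "is_colimit J P D X \<mu>"
  shows "\<And>c x. c \<in> Obj C \<Longrightarrow> x \<in> FObj X c \<Longrightarrow> \<exists>i \<in> Obj J. \<exists>y \<in> FObj (FObj D i) c. app (\<mu> i) c y = x"
    and "\<And>c i j y z. \<lbrakk>c \<in> Obj C; i \<in> Obj J; j \<in> Obj J; y \<in> FObj (FObj D i) c; z \<in> FObj (FObj D j) c;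
      app (\<mu> i) c y = app (\<mu> j) c z\<rbrakk> \<Longrightarrow> ((i, y), (j, z)) \<in> equivcl (pointwise_zigzag J D c)"
proof -
  interpret P: category "P :: (('o, 'a, 'u) presheaf, ('o, 'a, 'u) presheaf_map) cat" by (rule category_psh)
  obtain Z \<zeta> where Z: "is_colimit J P D Z \<zeta>"
    and surj: "\<And>c x. c \<in> Obj C \<Longrightarrow> x \<in> FObj Z c \<Longrightarrow> \<exists>i \<in> Obj J. \<exists>y \<in> FObj (FObj D i) c. app (\<zeta> i) c y = x"
    and ker: "\<And>c i j y z. \<lbrakk>c \<in> Obj C; i \<in> Obj J; j \<in> Obj J; y \<in> FObj (FObj D i) c; z \<in> FObj (FObj D j) c;
      app (\<zeta> i) c y = app (\<zeta> j) c z\<rbrakk> \<Longrightarrow> ((i, y), (j, z)) \<in> equivcl (pointwise_zigzag J D c)"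
    by (rule colimit_pointwise[OF \<Omega> J D]) (rule that)
  obtain h h' where h: "h \<in> hom P X Z" "h' \<in> hom P Z X" "Cmp P h' h = Idn P X"
    "\<And>i. i \<in> Obj J \<Longrightarrow> Cmp P h (\<mu> i) = \<zeta> i" "\<And>i. i \<in> Obj J \<Longrightarrow> Cmp P h' (\<zeta> i) = \<mu> i"
    by (rule P.colimit_unique[OF X Z]) (rule that)
  have m: "\<mu> i \<in> hom P (FObj D i) X" "\<zeta> i \<in> hom P (FObj D i) Z" if "i \<in> Obj J" for i
    by (rule is_colimit_hom[OF X that], rule is_colimit_hom[OF Z that])
  show "\<exists>i \<in> Obj J. \<exists>y \<in> FObj (FObj D i) c. app (\<mu> i) c y = x" if c: "c \<in> Obj C" "x \<in> FObj X c" for c x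
  proof -
    obtain i y where i: "i \<in> Obj J" "y \<in> FObj (FObj D i) c" "app (\<zeta> i) c y = app h c x"
      using surj[OF c(1) app_in[OF h(1) c]] by blast
    have "app (\<mu> i) c y = app h' c (app h c x)"
      using app_Cmp[OF m(2)[OF i(1)] h(2) c(1) i(2)] h(5)[OF i(1)] i(3) by simp
    also have "\<dots> = x"
      using app_Cmp[OF h(1,2) c] h(3) app_Idn[OF c] by simp
    finally show ?thesis using i by blast
  qed
  show "((i, y), (j, z)) \<in> equivcl (pointwise_zigzag J D c)"
    if c: "c \<in> Obj C" "i \<in> Obj J" "j \<in> Obj J" "y \<in> FObj (FObj D i) c" "z \<in> FObj (FObj D j) c"
      "app (\<mu> i) c y = app (\<mu> j) c z" for c i j y z
  proof (rule ker[OF c(1-5)])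
    show "app (\<zeta> i) c y = app (\<zeta> j) c z"
      using app_Cmp[OF m(1)[OF c(2)] h(1) c(1,4)] app_Cmp[OF m(1)[OF c(3)] h(1) c(1,5)] h(4) c by simp
  qed
qed

section \<open>Coequalizers of presheaves\<close>

lemma coequalizer_exists:
  fixes p :: "('o, 'a, 'u) presheaf_map"
  assumes \<Omega>: "regular_uncountable \<Omega>" "\<Omega> \<le>o |UNIV :: 'u set|"
    and p: "p \<in> hom P A B" "q \<in> hom P A B"
  obtains Z e where "is_coequalizer P p q Z e" "e \<in> hom P B Z"
    "\<And>c x. c \<in> Obj C \<Longrightarrow> x \<in> FObj Z c \<Longrightarrow> \<exists>y \<in> FObj B c. app e c y = x"
proof -
  interpret Om: regular_uncountable \<Omega> by (rule \<Omega>)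
  have AB: "A \<in> Obj P" "B \<in> Obj P" using psh_hom_Obj[OF p(1)] by auto
  \<comment> \<open>A coequalizer is a quotient of a family with the single index \<open>()\<close>,
    generated by the pairs of images of one element of \<open>A\<close>.\<close>
  define R where "R c = {(((), app p c a), ((), app q c a)) | a. a \<in> FObj A c}" for c
  have I: "|{()}| <o \<Omega>" by (rule Om.less_finite) simp
  have R: "R c \<subseteq> (SIGMA i:{()}. FObj B c) \<times> (SIGMA i:{()}. FObj B c)" if "c \<in> Obj C" for c
    using app_in[OF p(1) that] app_in[OF p(2) that] by (auto simp: R_def)
  have st: "((i, act B f y), (j, act B f z)) \<in> R c"
    if f: "f \<in> hom C c d" and yz: "((i, y), (j, z)) \<in> R d" for f c d i j y z
  proof -
    obtain a where a: "a \<in> FObj A d" "y = app p d a" "z = app q d a" using yz by (auto simp: R_def)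
    then show ?thesis
      using app_act[OF p(1) f a(1)] app_act[OF p(2) f a(1)] act_in[OF AB(1) f a(1)] a(2,3)
      by (auto simp: R_def intro!: exI[of _ "act A f a"])
  qed
  obtain Z \<mu> where Z: "Z \<in> Obj P" and \<mu>: "\<And>i. i \<in> {()} \<Longrightarrow> \<mu> i \<in> hom P B Z"
    and surj: "\<And>c x. c \<in> Obj C \<Longrightarrow> x \<in> FObj Z c \<Longrightarrow> \<exists>i \<in> {()}. \<exists>y \<in> FObj B c. app (\<mu> i) c y = x"
    and ker: "\<And>c i j y z. \<lbrakk>c \<in> Obj C; i \<in> {()}; j \<in> {()}; y \<in> FObj B c; z \<in> FObj B c\<rbrakk> \<Longrightarrow>
      app (\<mu> i) c y = app (\<mu> j) c z \<longleftrightarrow> ((i, y), (j, z)) \<in> equivcl (R c)"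
    by (rule quotient_exists[where R = R, OF \<Omega> I AB(2) R st]) (assumption | rule that)+
  define e where "e = \<mu> ()"
  have e: "e \<in> hom P B Z" using \<mu> by (simp add: e_def)
  have "is_coequalizer P p q Z e"
    unfolding is_coequalizer_def hom_memD(3)[OF p(1)]
  proof (intro conjI allI impI)
    show "Cmp P e p = Cmp P e q"
    proof (rule psh_ext[OF psh_Cmp_in_hom[OF p(1) e] psh_Cmp_in_hom[OF p(2) e]])
      fix c a assume c: "c \<in> Obj C" "a \<in> FObj A c"
      have "(((), app p c a), ((), app q c a)) \<in> equivcl (R c)"
        by (rule equivcl_incl) (use c in \<open>auto simp: R_def\<close>)
      then show "app (Cmp P e p) c a = app (Cmp P e q) c a"
        using ker[OF c(1) _ _ app_in[OF p(1) c] app_in[OF p(2) c], of "()" "()"]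
          app_Cmp[OF p(1) e c] app_Cmp[OF p(2) e c] by (simp add: e_def)
    qed
    fix W d assume d: "d \<in> hom P B W" "Cmp P d p = Cmp P d q"
    have "\<exists>!h. h \<in> hom P Z W \<and> (\<forall>i \<in> {()}. Cmp P h (\<mu> i) = (\<lambda>_. d) i)"
    proof (rule quotient_universal[where D = "\<lambda>_. B" and R = R])
      fix c i j y z assume c: "c \<in> Obj C" and "((i, y), (j, z)) \<in> R c"
      then obtain a where "a \<in> FObj A c" "y = app p c a" "z = app q c a" by (auto simp: R_def)
      then show "app d c y = app d c z"
        using app_Cmp[OF p(1) d(1) c] app_Cmp[OF p(2) d(1) c] d(2) by metis
    qed (use Z \<mu> surj ker d(1) psh_hom_Obj[OF d(1)] in auto)
    then show "\<exists>!h. h \<in> hom P Z W \<and> Cmp P h e = d" by (simp add: e_def)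
  qed (rule e)
  then show ?thesis
    using that e surj by (auto simp: e_def)
qed

text \<open>The constructed coequalizer is pointwise surjective, and the comparison maps satisfy
  \<open>k h = 1\<close>, so surjectivity passes to the given coequalizer.\<close>

lemma coequalizer_surj:
  fixes p :: "('o, 'a, 'u) presheaf_map"
  assumes \<Omega>: "regular_uncountable \<Omega>" "\<Omega> \<le>o |UNIV :: 'u set|"
    and p: "p \<in> hom P A B" "q \<in> hom P A B" and Z: "is_coequalizer P p q Z e"
    and c: "c \<in> Obj C" "x \<in> FObj Z c"
  shows "\<exists>y \<in> FObj B c. app e c y = x"
proof -
  interpret P: category "P :: (('o, 'a, 'u) presheaf, ('o, 'a, 'u) presheaf_map) cat" by (rule category_psh)
  obtain Y d where Y: "is_coequalizer P p q Y d" and d: "d \<in> hom P B Y"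
    and surj: "\<And>c x. c \<in> Obj C \<Longrightarrow> x \<in> FObj Y c \<Longrightarrow> \<exists>y \<in> FObj B c. app d c y = x"
    by (rule coequalizer_exists[OF \<Omega> p]) (rule that)
  have e: "e \<in> hom P B Z" and u: "\<And>W d. d \<in> hom P B W \<Longrightarrow> Cmp P d p = Cmp P d q \<Longrightarrow> \<exists>!h. h \<in> hom P Z W \<and> Cmp P h e = d"
    and ep: "Cmp P e p = Cmp P e q"
    using Z unfolding is_coequalizer_def hom_memD(3)[OF p(1)] by (elim conjE, blast)+
  have dp: "Cmp P d p = Cmp P d q" and u': "\<And>W k. k \<in> hom P B W \<Longrightarrow> Cmp P k p = Cmp P k q \<Longrightarrow> \<exists>!h. h \<in> hom P Y W \<and> Cmp P h d = k"
    using Y unfolding is_coequalizer_def hom_memD(3)[OF p(1)] by (elim conjE, blast)+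
  obtain h where h: "h \<in> hom P Z Y" "Cmp P h e = d" using u[OF d dp] by blast
  obtain k where k: "k \<in> hom P Y Z" "Cmp P k d = e" using u'[OF e ep] by blast
  have "Cmp P (Cmp P k h) e = e" using P.assoc[OF e h(1) k(1)] h(2) k(2) by simp
  moreover have "Cmp P (Idn P Z) e = e" by (rule P.Cmp_Idn_left[OF e])
  ultimately have kh: "Cmp P k h = Idn P Z"
    using u[OF e ep] P.Cmp_in_hom[OF h(1) k(1)] P.Idn_in_hom P.hom_Obj[OF h(1)] by blast
  obtain y where y: "y \<in> FObj B c" "app d c y = app h c x"
    using surj[OF c(1) app_in[OF h(1) c]] by blast
  have "app e c y = app k c (app h c x)"
    using app_Cmp[OF d k(1) c(1) y(1)] k(2) y(2) by simp
  also have "\<dots> = x" using app_Cmp[OF h(1) k(1) c] kh app_Idn[OF c] by simp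
  finally show ?thesis using y by blast
qed


section \<open>Representable presheaves\<close>

text \<open>Representability by a universal element, the form in which the Yoneda lemma is applied;
  \<open>u\<close> corresponds to the identity of \<open>c\<close>.\<close>

definition universal :: "('o, 'a, 'u) presheaf \<Rightarrow> 'o \<Rightarrow> 'u \<Rightarrow> bool" where
  "universal F c u \<longleftrightarrow> F \<in> Obj P \<and> c \<in> Obj C \<and> u \<in> FObj F c \<and>
     (\<forall>d \<in> Obj C. \<forall>y \<in> FObj F d. \<exists>!f. f \<in> hom C d c \<and> act F f u = y)"

lemma representable_universal:
  assumes "F \<in> representables \<Omega> C"
  obtains c u where "universal F c u"
proof -
  obtain c \<theta> where F: "F \<in> Obj P" and c: "c \<in> Obj C"
    and bij: "\<And>x. x \<in> Obj C \<Longrightarrow> bij_betw (\<theta> x) (hom C x c) (FObj F x)"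
    and nat: "\<And>f g. f \<in> Arr C \<Longrightarrow> g \<in> hom C (Cod C f) c \<Longrightarrow> \<theta> (Dom C f) (Cmp C g f) = act F f (\<theta> (Cod C f) g)"
    using assms unfolding representables_def act_def by blast
  let ?u = "\<theta> c (Idn C c)"
  have \<theta>: "\<theta> d f = act F f ?u" if f: "f \<in> hom C d c" for d f
    using nat[of f "Idn C c"] f Idn_in_hom[OF c] Cmp_Idn_left[OF f] by (simp add: hom_def)
  have "\<exists>!f. f \<in> hom C d c \<and> act F f ?u = y" if d: "d \<in> Obj C" "y \<in> FObj F d" for d y
  proof -
    have "y \<in> \<theta> d ` hom C d c"
      using bij_betw_imp_surj_on[OF bij[OF d(1)]] d(2) by simp
    then obtain f where f: "f \<in> hom C d c" "\<theta> d f = y" by auto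
    show ?thesis
    proof (rule ex1I[of _ f])
      fix g assume "g \<in> hom C d c \<and> act F g ?u = y"
      then show "g = f"
        using inj_onD[OF bij_betw_imp_inj_on[OF bij[OF d(1)]], of g f] f \<theta>[of g d] by simp
    qed (use f \<theta> in auto)
  qed
  moreover have "?u \<in> FObj F c"
    using bij[OF c] Idn_in_hom[OF c] by (meson bij_betwE)
  ultimately have "universal F c ?u"
    unfolding universal_def using F c by blast
  then show ?thesis by (rule that)
qed

lemma universal_representable:
  assumes "universal F c u"
  shows "F \<in> representables \<Omega> C"
proof -
  have F: "F \<in> Obj P" and c: "c \<in> Obj C" and u: "u \<in> FObj F c"
    and ex: "\<And>d y. d \<in> Obj C \<Longrightarrow> y \<in> FObj F d \<Longrightarrow> \<exists>!f. f \<in> hom C d c \<and> act F f u = y"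
    using assms unfolding universal_def by auto
  have "bij_betw (\<lambda>f. act F f u) (hom C x c) (FObj F x)" if x: "x \<in> Obj C" for x
    unfolding bij_betw_def
  proof
    show "inj_on (\<lambda>f. act F f u) (hom C x c)"
      using ex[OF x] act_in[OF F _ u] by (auto simp: inj_on_def)
    show "(\<lambda>f. act F f u) ` hom C x c = FObj F x"
      using ex[OF x] act_in[OF F _ u] by blast
  qed
  moreover have "act F (Cmp C g f) u = fn_app (FArr F f) (act F g u)" if "f \<in> Arr C" "g \<in> hom C (Cod C f) c" for f g
    using act_Cmp[OF F _ that(2) u, of f "Dom C f"] that(1) by (simp add: hom_def act_def)
  ultimately show ?thesis
    unfolding representables_def using F c
    by (intro CollectI conjI bexI[of _ c] exI[of _ "\<lambda>x f. act F f u"]) auto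
qed

text \<open>Local smallness allows each hom-set into \<open>c\<close> to be coded injectively inside
  \<open>'u\<close>, where the values of a presheaf must lie; composition is transferred through the
  codes.\<close>

lemma representable_exists:
  assumes \<Omega>: "regular_uncountable \<Omega>" "\<Omega> \<le>o |UNIV :: 'u set|" and ls: "locally_small \<Omega> C" and c: "c \<in> Obj C"
  obtains F :: "('o, 'a, 'u) presheaf" and u where "universal F c u"
proof -
  interpret Om: regular_uncountable \<Omega> by (rule \<Omega>)
  have "\<exists>\<iota> :: 'a \<Rightarrow> 'u. inj_on \<iota> (hom C d c)" if "d \<in> Obj C" for d
    using Om.less_embed[OF _ \<Omega>(2)] ls c that unfolding locally_small_def by metis
  then obtain \<iota> :: "'o \<Rightarrow> 'a \<Rightarrow> 'u" where \<iota>: "\<And>d. d \<in> Obj C \<Longrightarrow> inj_on (\<iota> d) (hom C d c)" by metis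
  define S where "S d = \<iota> d ` hom C d c" for d
  define r where "r f s = \<iota> (Dom C f) (Cmp C (inv_into (hom C (Cod C f) c) (\<iota> (Cod C f)) s) f)" for f s
  have r: "r f (\<iota> e g) = \<iota> d (Cmp C g f)" if "f \<in> hom C d e" "g \<in> hom C e c" for f g d e
    using that inv_into_f_f[OF \<iota> that(2)] hom_Obj[OF that(1)] by (simp add: r_def hom_memD[OF that(1)])
  let ?F = "mkpsh S r"
  have F: "?F \<in> Obj P"
  proof (rule mkpsh_Obj)
    show "|S d| <o \<Omega>" if "d \<in> Obj C" for d
      unfolding S_def using Om.less_image ls c that unfolding locally_small_def by blast
    show "r f x \<in> S d" if "f \<in> hom C d e" "x \<in> S e" for f d e x
      using that r[OF that(1)] Cmp_in_hom[OF that(1)] by (auto simp: S_def)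
    show "r (Idn C d) x = x" if "d \<in> Obj C" "x \<in> S d" for d x
      using that r[OF Idn_in_hom[OF that(1)]] Cmp_Idn_right by (auto simp: S_def)
    show "r (Cmp C g f) x = r f (r g x)" if f: "f \<in> hom C b d" and g: "g \<in> hom C d e" and x: "x \<in> S e" for f g b d e x
    proof -
      obtain k where k: "k \<in> hom C e c" "x = \<iota> e k" using x by (auto simp: S_def)
      show ?thesis
        using r[OF Cmp_in_hom[OF f g] k(1)] r[OF g k(1)] r[OF f Cmp_in_hom[OF g k(1)]] Cmp_assoc[OF f g k(1)] k(2)
        by simp
    qed
  qed
  let ?u = "\<iota> c (Idn C c)"
  have uS: "?u \<in> S c" using Idn_in_hom[OF c] by (auto simp: S_def)
  have actu: "act ?F f ?u = \<iota> d f" if "f \<in> hom C d c" for f d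
    using mkpsh_act[where S = S, OF that uS, of r] r[OF that Idn_in_hom[OF c]] Cmp_Idn_left[OF that] by simp
  have "universal ?F c ?u"
    unfolding universal_def
  proof (intro conjI ballI)
    show "?u \<in> FObj ?F c" using uS c by (simp add: mkpsh_FObj)
    fix d y assume d: "d \<in> Obj C" and "y \<in> FObj ?F d"
    then obtain f where f: "f \<in> hom C d c" "y = \<iota> d f" by (auto simp: mkpsh_FObj S_def)
    then show "\<exists>!f. f \<in> hom C d c \<and> act ?F f ?u = y"
      using actu \<iota>[OF d] by (intro ex1I[of _ f]) (auto simp: inj_on_def)
  qed (use F c in auto)
  then show ?thesis by (rule that)
qed

lemma universalD:
  assumes "universal F c u"
  shows "F \<in> Obj P" "c \<in> Obj C" "u \<in> FObj F c"
    "\<And>d y. d \<in> Obj C \<Longrightarrow> y \<in> FObj F d \<Longrightarrow> \<exists>!f. f \<in> hom C d c \<and> act F f u = y"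
  using assms unfolding universal_def by auto

lemma yoneda_ext:
  assumes F: "universal F c u" and "\<alpha> \<in> hom P F X" "\<beta> \<in> hom P F X" "app \<alpha> c u = app \<beta> c u"
  shows "\<alpha> = \<beta>"
proof (rule psh_ext[OF assms(2,3)])
  fix d y assume "d \<in> Obj C" "y \<in> FObj F d"
  then obtain f where "f \<in> hom C d c" "act F f u = y" using universalD(4)[OF F] by blast
  then show "app \<alpha> d y = app \<beta> d y"
    using app_act[OF assms(2) _ universalD(3)[OF F]] app_act[OF assms(3) _ universalD(3)[OF F]] assms(4) by metis
qed

lemma yoneda:
  assumes F: "universal F c u" and X: "X \<in> Obj P" and x: "x \<in> FObj X c"
  obtains \<alpha> where "\<alpha> \<in> hom P F X" "app \<alpha> c u = x"
proof -
  note U = universalD[OF F]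
  obtain k where k: "\<And>d y. d \<in> Obj C \<Longrightarrow> y \<in> FObj F d \<Longrightarrow> k d y \<in> hom C d c \<and> act F (k d y) u = y"
    using U(4) by metis
  have k_eq: "k d (act F f u) = f" if "f \<in> hom C d c" for d f
    using U(4)[OF hom_Obj(1)[OF that] act_in[OF U(1) that U(3)]] k[OF hom_Obj(1)[OF that] act_in[OF U(1) that U(3)]] that
    by blast
  define t where "t d y = act X (k d y) x" for d y
  have "mkmap F X t \<in> hom P F X"
  proof (rule mkmap_hom[OF U(1) X])
    show "t d y \<in> FObj X d" if "d \<in> Obj C" "y \<in> FObj F d" for d y
      using k[OF that] act_in[OF X _ x] by (simp add: t_def)
    fix f d e y assume f: "f \<in> hom C d e" and y: "y \<in> FObj F e"
    note K = k[OF hom_Obj(2)[OF f] y]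
    have "act F f y = act F (Cmp C (k e y) f) u"
      using act_Cmp[OF U(1) f conjunct1[OF K] U(3)] K by simp
    then have "k d (act F f y) = Cmp C (k e y) f"
      using k_eq[OF Cmp_in_hom[OF f conjunct1[OF K]]] by simp
    then show "t d (act F f y) = act X f (t e y)"
      unfolding t_def using act_Cmp[OF X f conjunct1[OF K] x] by simp
  qed
  moreover have "app (mkmap F X t) c u = x"
  proof -
    have "k c u = Idn C c"
      using k_eq[OF Idn_in_hom[OF U(2)]] act_Idn[OF U(1-3)] by simp
    then show ?thesis
      using mkmap_app[OF U(2,3)] act_Idn[OF X U(2) x] by (simp add: t_def)
  qed
  ultimately show ?thesis by (rule that)
qed

text \<open>Representables separate by the Yoneda lemma; a pullback in \<open>C\<close> represents
  the required weak pullback; coequalizers exist pointwise, and their pointwise surjectivity makes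
  representables projective.\<close>

lemma generated_category_psh:
  assumes \<Omega>: "regular_uncountable \<Omega>" "\<Omega> \<le>o |UNIV :: 'u set|" and ls: "locally_small \<Omega> C" and pb: "has_pullbacks C"
  shows "generated_category (P :: (('o, 'a, 'u) presheaf, ('o, 'a, 'u) presheaf_map) cat) (representables \<Omega> C)"
proof -
  interpret K: category "P :: (('o, 'a, 'u) presheaf, ('o, 'a, 'u) presheaf_map) cat" by (rule category_psh)
  show ?thesis
  proof
    fix g :: "('o, 'a, 'u) presheaf" assume "g \<in> representables \<Omega> C"
    then show "g \<in> Obj P" by (simp add: representables_def)
  next
    fix h h' X Y assume h: "h \<in> hom P X Y" "h' \<in> hom P X Y"
      and eq: "\<And>g x :: ('o, 'a, 'u) presheaf_map. g \<in> representables \<Omega> C \<Longrightarrow> x \<in> hom P g X \<Longrightarrow> Cmp P h x = Cmp P h' x"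
    show "h = h'"
    proof (rule psh_ext[OF h])
      fix c x assume c: "c \<in> Obj C" "x \<in> FObj X c"
      obtain F :: "('o, 'a, 'u) presheaf" and u where F: "universal F c u"
        by (rule representable_exists[OF \<Omega> ls c(1)])
      obtain \<alpha> where \<alpha>: "\<alpha> \<in> hom P F X" "app \<alpha> c u = x"
        by (rule yoneda[OF F conjunct1[OF psh_hom_Obj[OF h(1)]] c(2)])
      show "app h c x = app h' c x"
        using app_Cmp[OF \<alpha>(1) h(1) c(1) universalD(3)[OF F]] app_Cmp[OF \<alpha>(1) h(2) c(1) universalD(3)[OF F]] \<alpha>(2)
          eq[OF universal_representable[OF F] \<alpha>(1)] by simp
    qed
  next
    fix A1 A2 A0 :: "('o, 'a, 'u) presheaf" and f f'
    assume A: "A1 \<in> representables \<Omega> C" "A2 \<in> representables \<Omega> C" "A0 \<in> representables \<Omega> C"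
      and f: "f \<in> hom P A1 A0" and f': "f' \<in> hom P A2 A0"
    obtain c1 u1 where U1: "universal A1 c1 u1" by (rule representable_universal[OF A(1)])
    obtain c2 u2 where U2: "universal A2 c2 u2" by (rule representable_universal[OF A(2)])
    obtain c0 u0 where U0: "universal A0 c0 u0" by (rule representable_universal[OF A(3)])
    note u1 = universalD[OF U1] and u2 = universalD[OF U2] and u0 = universalD[OF U0]
    \<comment> \<open>\<open>k1\<close> and \<open>k2\<close> are the arrows of \<open>C\<close>
      that correspond to \<open>f\<close> and \<open>f'\<close> under the Yoneda lemma; their
      pullback is taken in \<open>C\<close>.\<close>
    obtain k1 where k1: "k1 \<in> hom C c1 c0" "act A0 k1 u0 = app f c1 u1"
      using u0(4)[OF u1(2) app_in[OF f u1(2,3)]] by blast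
    obtain k2 where k2: "k2 \<in> hom C c2 c0" "act A0 k2 u0 = app f' c2 u2"
      using u0(4)[OF u2(2) app_in[OF f' u2(2,3)]] by blast
    obtain Q p q where "is_pullback C k1 k2 Q p q"
      using pb k1(1) k2(1) unfolding has_pullbacks_def hom_def by fastforce
    then have pq: "p \<in> hom C Q c1" "q \<in> hom C Q c2" "Cmp C k1 p = Cmp C k2 q"
      and univ: "\<And>R u v. u \<in> hom C R c1 \<Longrightarrow> v \<in> hom C R c2 \<Longrightarrow> Cmp C k1 u = Cmp C k2 v \<Longrightarrow>
        \<exists>!h. h \<in> hom C R Q \<and> Cmp C p h = u \<and> Cmp C q h = v"
      unfolding is_pullback_def hom_memD(2)[OF k1(1)] hom_memD(2)[OF k2(1)] by (elim conjE, blast)+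
    have Q: "Q \<in> Obj C" using hom_Obj[OF pq(1)] by auto
    obtain F :: "('o, 'a, 'u) presheaf" and u where F: "universal F Q u"
      by (rule representable_exists[OF \<Omega> ls Q])
    note U = universalD[OF F]
    obtain s where s: "s \<in> hom P F A1" "app s Q u = act A1 p u1"
      by (rule yoneda[OF F u1(1) act_in[OF u1(1) pq(1) u1(3)]])
    obtain t where t: "t \<in> hom P F A2" "app t Q u = act A2 q u2"
      by (rule yoneda[OF F u2(1) act_in[OF u2(1) pq(2) u2(3)]])
    have eq: "Cmp P f s = Cmp P f' t"
    proof (rule yoneda_ext[OF F K.Cmp_in_hom[OF s(1) f] K.Cmp_in_hom[OF t(1) f']])
      have "app (Cmp P f s) Q u = act A0 (Cmp C k1 p) u0"
        using app_Cmp[OF s(1) f U(2,3)] s(2) app_act[OF f pq(1) u1(3)] k1(2) act_Cmp[OF u0(1) pq(1) k1(1) u0(3)] by simp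
      also have "\<dots> = app (Cmp P f' t) Q u"
        using app_Cmp[OF t(1) f' U(2,3)] t(2) app_act[OF f' pq(2) u2(3)] k2(2) act_Cmp[OF u0(1) pq(2) k2(1) u0(3)] pq(3) by simp
      finally show "app (Cmp P f s) Q u = app (Cmp P f' t) Q u" .
    qed
    have "\<exists>h\<in>hom P G F. Cmp P s h = a \<and> Cmp P t h = b"
      if G: "G \<in> representables \<Omega> C" and a: "a \<in> hom P G A1" and b: "b \<in> hom P G A2" and ab: "Cmp P f a = Cmp P f' b" for G a b
    proof -
      obtain d w where W: "universal G d w" by (rule representable_universal[OF G])
      note w = universalD[OF W]
      obtain m1 where m1: "m1 \<in> hom C d c1" "act A1 m1 u1 = app a d w"
        using u1(4)[OF w(2) app_in[OF a w(2,3)]] by blast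
      obtain m2 where m2: "m2 \<in> hom C d c2" "act A2 m2 u2 = app b d w"
        using u2(4)[OF w(2) app_in[OF b w(2,3)]] by blast
      have "act A0 (Cmp C k1 m1) u0 = app (Cmp P f a) d w"
        using app_Cmp[OF a f w(2,3)] m1(2) app_act[OF f m1(1) u1(3)] k1(2) act_Cmp[OF u0(1) m1(1) k1(1) u0(3)] by simp
      moreover have "act A0 (Cmp C k2 m2) u0 = app (Cmp P f' b) d w"
        using app_Cmp[OF b f' w(2,3)] m2(2) app_act[OF f' m2(1) u2(3)] k2(2) act_Cmp[OF u0(1) m2(1) k2(1) u0(3)] by simp
      ultimately have "Cmp C k1 m1 = Cmp C k2 m2"
        using u0(4)[OF w(2) app_in[OF K.Cmp_in_hom[OF a f] w(2,3)]] Cmp_in_hom[OF m1(1) k1(1)] Cmp_in_hom[OF m2(1) k2(1)] ab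
        by metis
      then obtain h where h: "h \<in> hom C d Q" "Cmp C p h = m1" "Cmp C q h = m2" using univ[OF m1(1) m2(1)] by blast
      obtain \<eta> where \<eta>: "\<eta> \<in> hom P G F" "app \<eta> d w = act F h u"
        by (rule yoneda[OF W U(1) act_in[OF U(1) h(1) U(3)]])
      have "Cmp P s \<eta> = a"
        by (rule yoneda_ext[OF W K.Cmp_in_hom[OF \<eta>(1) s(1)] a])
          (use app_Cmp[OF \<eta>(1) s(1) w(2,3)] \<eta>(2) app_act[OF s(1) h(1) U(3)] s(2) act_Cmp[OF u1(1) h(1) pq(1) u1(3)] h(2) m1(2) in simp)
      moreover have "Cmp P t \<eta> = b"
        by (rule yoneda_ext[OF W K.Cmp_in_hom[OF \<eta>(1) t(1)] b])
          (use app_Cmp[OF \<eta>(1) t(1) w(2,3)] \<eta>(2) app_act[OF t(1) h(1) U(3)] t(2) act_Cmp[OF u2(1) h(1) pq(2) u2(3)] h(3) m2(2) in simp)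
      ultimately show ?thesis using \<eta>(1) by blast
    qed
    then show "\<exists>p\<in>representables \<Omega> C. \<exists>s\<in>hom P p A1. \<exists>t\<in>hom P p A2. Cmp P f s = Cmp P f' t \<and>
        (\<forall>d\<in>representables \<Omega> C. \<forall>u\<in>hom P d A1. \<forall>v\<in>hom P d A2. Cmp P f u = Cmp P f' v \<longrightarrow>
          (\<exists>h\<in>hom P d p. Cmp P s h = u \<and> Cmp P t h = v))"
      using universal_representable[OF F] s(1) t(1) eq by blast
  next
    fix A B :: "('o, 'a, 'u) presheaf" and p q assume "p \<in> hom P A B" "q \<in> hom P A B"
    then show "\<exists>Z e. is_coequalizer P p q Z e"
      using coequalizer_exists[OF \<Omega>] by metis
  next
    fix A B G Z :: "('o, 'a, 'u) presheaf" and p q e x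
    assume G: "G \<in> representables \<Omega> C" and B: "B \<in> representables \<Omega> C" and pq: "p \<in> hom P A B" "q \<in> hom P A B"
      and Z: "is_coequalizer P p q Z e" and x: "x \<in> hom P G Z"
    obtain c u where W: "universal G c u" by (rule representable_universal[OF G])
    note w = universalD[OF W]
    have e: "e \<in> hom P B Z" using Z unfolding is_coequalizer_def hom_memD(3)[OF pq(1)] by blast
    obtain y where y: "y \<in> FObj B c" "app e c y = app x c u"
      using coequalizer_surj[OF \<Omega> pq Z w(2) app_in[OF x w(2,3)]] by blast
    obtain \<eta> where \<eta>: "\<eta> \<in> hom P G B" "app \<eta> c u = y"
      by (rule yoneda[OF W conjunct1[OF psh_hom_Obj[OF e]] y(1)])
    have "Cmp P e \<eta> = x"
      by (rule yoneda_ext[OF W K.Cmp_in_hom[OF \<eta>(1) e] x]) (use app_Cmp[OF \<eta>(1) e w(2,3)] \<eta>(2) y(2) in simp)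
    then show "\<exists>y\<in>hom P G B. Cmp P e y = x" using \<eta>(1) by blast
  qed
qed

text \<open>Evaluation at a universal element identifies maps from a representable with elements, so
  tightness is the pointwise description of colimits read through this identification.\<close>

lemma tight_colimit:
  fixes D :: "('i, 'j, ('o, 'a, 'u) presheaf, ('o, 'a, 'u) presheaf_map) func"
  assumes \<Omega>: "regular_uncountable \<Omega>" "\<Omega> \<le>o |UNIV :: 'u set|" and ls: "locally_small \<Omega> C" and pb: "has_pullbacks C"
    and J: "category J" "|Obj J| <o \<Omega>" and D: "is_functor J P D" and X: "is_colimit J P D X \<mu>"
  shows "generated_category.tight P (representables \<Omega> C) J D X \<mu>"
proof -
  interpret K: generated_category "P :: (('o, 'a, 'u) presheaf, ('o, 'a, 'u) presheaf_map) cat" "representables \<Omega> C"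
    by (rule generated_category_psh[OF \<Omega> ls pb])
  interpret J: category J by (rule J)
  note pw = is_colimit_pointwise[OF \<Omega> J D X]
  have m: "\<mu> i \<in> hom P (FObj D i) X" if "i \<in> Obj J" for i
    by (rule is_colimit_hom[OF X that])
  show ?thesis
    unfolding K.tight_def
  proof (intro ballI conjI impI)
    fix g x assume g: "g \<in> representables \<Omega> C" and x: "x \<in> hom P g X"
    obtain c u where W: "universal g c u" by (rule representable_universal[OF g])
    note w = universalD[OF W]
    obtain i y where i: "i \<in> Obj J" "y \<in> FObj (FObj D i) c" "app (\<mu> i) c y = app x c u"
      using pw(1)[OF w(2) app_in[OF x w(2,3)]] by blast
    obtain \<eta> where \<eta>: "\<eta> \<in> hom P g (FObj D i)" "app \<eta> c u = y"
      by (rule yoneda[OF W is_functor_Obj[OF D i(1)] i(2)])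
    have "Cmp P (\<mu> i) \<eta> = x"
      by (rule yoneda_ext[OF W K.Cmp_in_hom[OF \<eta>(1) m[OF i(1)]] x])
        (use app_Cmp[OF \<eta>(1) m[OF i(1)] w(2,3)] \<eta>(2) i(3) in simp)
    then show "\<exists>i\<in>Obj J. \<exists>y\<in>hom P g (FObj D i). Cmp P (\<mu> i) y = x" using i(1) \<eta>(1) by blast
  next
    fix g i j y z assume g: "g \<in> representables \<Omega> C" and ij: "i \<in> Obj J" "j \<in> Obj J"
      and y: "y \<in> hom P g (FObj D i)" and z: "z \<in> hom P g (FObj D j)" and eq: "Cmp P (\<mu> i) y = Cmp P (\<mu> j) z"
    obtain c u where W: "universal g c u" by (rule representable_universal[OF g])
    note w = universalD[OF W]
    \<comment> \<open>The inverse of evaluation at the universal element \<open>u\<close>; the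
      description is well defined by \<open>yoneda_ext\<close>.\<close>
    define yon where "yon = (\<lambda>(i, w). (i, THE \<alpha>. \<alpha> \<in> hom P g (FObj D i) \<and> app \<alpha> c u = w))"
    have yon: "yon (i, app \<alpha> c u) = (i, \<alpha>)" if "\<alpha> \<in> hom P g (FObj D i)" for i \<alpha>
      unfolding yon_def using that yoneda_ext[OF W _ that] by auto
    have "((i, app y c u), (j, app z c u)) \<in> equivcl (pointwise_zigzag J D c)"
      by (rule pw(2)[OF w(2) ij app_in[OF y w(2,3)] app_in[OF z w(2,3)]])
        (use app_Cmp[OF y m[OF ij(1)] w(2,3)] app_Cmp[OF z m[OF ij(2)] w(2,3)] eq in simp)
    then have "(yon (i, app y c u), yon (j, app z c u)) \<in> K.zigzag J D g"
      unfolding K.zigzag_def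
    proof (rule equivcl_map)
      fix a b assume "(a, b) \<in> pointwise_zigzag J D c"
      then obtain i j \<theta> v where ab: "a = (i, v)" "b = (j, app (FArr D \<theta>) c v)" "\<theta> \<in> hom J i j" "v \<in> FObj (FObj D i) c"
        by (auto simp: pointwise_zigzag_def)
      obtain \<eta> where \<eta>: "\<eta> \<in> hom P g (FObj D i)" "app \<eta> c u = v"
        by (rule yoneda[OF W is_functor_Obj[OF D J.hom_Obj(1)[OF ab(3)]] ab(4)])
      note h = is_functor_hom[OF D ab(3)]
      have "yon a = (i, \<eta>)" using yon[OF \<eta>(1)] \<eta>(2) ab(1) by simp
      moreover have "yon b = (j, Cmp P (FArr D \<theta>) \<eta>)"
        using yon[OF K.Cmp_in_hom[OF \<eta>(1) h]] app_Cmp[OF \<eta>(1) h w(2,3)] \<eta>(2) ab(2) by simp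
      ultimately show "(yon a, yon b) \<in> {((i, y), (j, Cmp P (FArr D \<theta>) y)) | i j \<theta> y.
          \<theta> \<in> hom J i j \<and> y \<in> hom P g (FObj D i)}"
        using ab(3) \<eta>(1) by blast
    qed
    then show "((i, y), (j, z)) \<in> K.zigzag J D g" using yon[OF y] yon[OF z] by simp
  qed
qed

end

section \<open>Density of representables\<close>

context presheaves
begin

text \<open>An element of \<open>X\<close> is a map \<open>hat c x\<close> from a chosen
  representable, and its image is read off from \<open>\<tau>\<close> of that map at the universal
  element. This provides the arrow needed for fullness of the restricted Yoneda embedding.\<close>

lemma density:
  fixes X Y :: "('o, 'a, 'u) presheaf"
  assumes \<Omega>: "regular_uncountable \<Omega>" "\<Omega> \<le>o |UNIV :: 'u set|" and ls: "locally_small \<Omega> C"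
    and X: "X \<in> Obj P" and Y: "Y \<in> Obj P"
    and \<tau>: "\<And>g x. g \<in> representables \<Omega> C \<Longrightarrow> x \<in> hom P g X \<Longrightarrow> \<tau> x \<in> hom P g Y"
    and nat: "\<And>g g' k x. \<lbrakk>g \<in> representables \<Omega> C; g' \<in> representables \<Omega> C; k \<in> hom P g' g; x \<in> hom P g X\<rbrakk> \<Longrightarrow>
      \<tau> (Cmp P x k) = Cmp P (\<tau> x) k"
  obtains h where "h \<in> hom P X Y" "\<And>g x. g \<in> representables \<Omega> C \<Longrightarrow> x \<in> hom P g X \<Longrightarrow> Cmp P h x = \<tau> x"
proof -
  have "\<exists>(F :: ('o, 'a, 'u) presheaf) u. universal F c u" if "c \<in> Obj C" for c
    by (rule representable_exists[OF \<Omega> ls that]) blast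
  then obtain F :: "'o \<Rightarrow> ('o, 'a, 'u) presheaf" and u where F: "\<And>c. c \<in> Obj C \<Longrightarrow> universal (F c) c (u c)"
    by metis
  have FG: "F c \<in> representables \<Omega> C" if "c \<in> Obj C" for c
    by (rule universal_representable[OF F[OF that]])
  have "\<exists>\<alpha>. \<alpha> \<in> hom P (F c) X \<and> app \<alpha> c (u c) = x" if "c \<in> Obj C" "x \<in> FObj X c" for c x
    by (rule yoneda[OF F[OF that(1)] X that(2)]) blast
  then obtain hat where hat: "\<And>c x. c \<in> Obj C \<Longrightarrow> x \<in> FObj X c \<Longrightarrow> hat c x \<in> hom P (F c) X"
    and hat_app: "\<And>c x. c \<in> Obj C \<Longrightarrow> x \<in> FObj X c \<Longrightarrow> app (hat c x) c (u c) = x"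
    by metis
  define t where "t c x = app (\<tau> (hat c x)) c (u c)" for c x
  have \<tau>hat: "\<tau> (hat c x) \<in> hom P (F c) Y" if "c \<in> Obj C" "x \<in> FObj X c" for c x
    by (rule \<tau>[OF FG[OF that(1)] hat[OF that]])
  have h: "mkmap X Y t \<in> hom P X Y"
  proof (rule mkmap_hom[OF X Y])
    show "t c x \<in> FObj Y c" if "c \<in> Obj C" "x \<in> FObj X c" for c x
      unfolding t_def by (rule app_in[OF \<tau>hat[OF that] that(1) universalD(3)[OF F[OF that(1)]]])
    fix f c d x assume f: "f \<in> hom C c d" and x: "x \<in> FObj X d"
    note o = hom_Obj[OF f]
    note Uc = universalD[OF F[OF o(1)]] and Ud = universalD[OF F[OF o(2)]]
    obtain k where k: "k \<in> hom P (F c) (F d)" "app k c (u c) = act (F d) f (u d)"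
      by (rule yoneda[OF F[OF o(1)] Ud(1) act_in[OF Ud(1) f Ud(3)]])
    note fx = act_in[OF X f x]
    note hd = hat[OF o(2) x]
    \<comment> \<open>Restriction of an element is precomposition with the map \<open>k\<close> of
      representables induced by \<open>f\<close>; this turns the naturality of \<open>\<tau>\<close>
      into that of \<open>t\<close>.\<close>
    have "hat c (act X f x) = Cmp P (hat d x) k"
    proof (rule yoneda_ext[OF F[OF o(1)] hat[OF o(1) fx] psh_Cmp_in_hom[OF k(1) hd]])
      show "app (hat c (act X f x)) c (u c) = app (Cmp P (hat d x) k) c (u c)"
        using app_Cmp[OF k(1) hd o(1) Uc(3)] k(2) app_act[OF hd f Ud(3)] hat_app[OF o(1) fx] hat_app[OF o(2) x] by simp
    qed
    then have "\<tau> (hat c (act X f x)) = Cmp P (\<tau> (hat d x)) k"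
      using nat[OF FG[OF o(2)] FG[OF o(1)] k(1) hd] by simp
    then show "t c (act X f x) = act Y f (t d x)"
      unfolding t_def using app_Cmp[OF k(1) \<tau>hat[OF o(2) x] o(1) Uc(3)] k(2) app_act[OF \<tau>hat[OF o(2) x] f Ud(3)] by simp
  qed
  moreover have "Cmp P (mkmap X Y t) x = \<tau> x" if g: "g \<in> representables \<Omega> C" and x: "x \<in> hom P g X" for g x
  proof -
    obtain c w where W: "universal g c w" by (rule representable_universal[OF g])
    note w = universalD[OF W]
    note Uc = universalD[OF F[OF w(2)]]
    note xw = app_in[OF x w(2,3)]
    obtain k where k: "k \<in> hom P (F c) g" "app k c (u c) = w"
      by (rule yoneda[OF F[OF w(2)] w(1,3)])
    have "hat c (app x c w) = Cmp P x k"
      by (rule yoneda_ext[OF F[OF w(2)] hat[OF w(2) xw] psh_Cmp_in_hom[OF k(1) x]])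
        (use app_Cmp[OF k(1) x w(2) Uc(3)] k(2) hat_app[OF w(2) xw] in simp)
    then have "\<tau> (hat c (app x c w)) = Cmp P (\<tau> x) k"
      using nat[OF g FG[OF w(2)] k(1) x] by simp
    then have "t c (app x c w) = app (\<tau> x) c w"
      unfolding t_def using app_Cmp[OF k(1) \<tau>[OF g x] w(2) Uc(3)] k(2) by simp
    then show ?thesis
      using yoneda_ext[OF W psh_Cmp_in_hom[OF x h] \<tau>[OF g x]] app_Cmp[OF x h w(2,3)] mkmap_app[OF w(2) xw] by simp
  qed
  ultimately show ?thesis by (rule that)
qed

end


section \<open>Free cocompletions\<close>

lemma full_subcat_simps:
  "Obj (full_subcat K S) = Obj K \<inter> S" "Idn (full_subcat K S) = Idn K" "Cmp (full_subcat K S) = Cmp K"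
  "Dom (full_subcat K S) = Dom K" "Cod (full_subcat K S) = Cod K"
  "Arr (full_subcat K S) = {f \<in> Arr K. Dom K f \<in> S \<and> Cod K f \<in> S}"
  by (simp_all add: full_subcat_def)

lemma full_subcat_hom: "hom (full_subcat K S) x y = (if x \<in> S \<and> y \<in> S then hom K x y else {})"
  by (auto simp: hom_def full_subcat_def)

lemma category_full_subcat:
  assumes "category K"
  shows "category (full_subcat K S)"
proof -
  interpret category K by (rule assms)
  show ?thesis
    using Dom_in_Obj Cod_in_Obj Idn_in_hom Cmp_in_hom Cmp_Idn_left Cmp_Idn_right Cmp_assoc
    by unfold_locales (auto simp: full_subcat_hom full_subcat_simps split: if_splits)
qed

lemma full_subcat_cong:
  assumes "category K" and "Obj K \<inter> S = Obj K \<inter> T"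
  shows "full_subcat K S = full_subcat K T"
proof -
  interpret category K by (rule assms)
  have "{f \<in> Arr K. Dom K f \<in> S \<and> Cod K f \<in> S} = {f \<in> Arr K. Dom K f \<in> T \<and> Cod K f \<in> T}"
    using assms(2) Dom_in_Obj Cod_in_Obj by blast
  then show ?thesis using assms(2) by (simp add: full_subcat_def)
qed

lemma presheaf_closure_Obj:
  "X \<in> Obj (presheaf_closure \<Omega> A closed) \<longleftrightarrow> X \<in> Obj (psh \<Omega> A) \<and>
     (\<forall>S. S \<subseteq> Obj (psh \<Omega> A) \<and> replete (psh \<Omega> A) S \<and> representables \<Omega> A \<subseteq> S \<and> closed S \<longrightarrow> X \<in> S)"
  by (auto simp: presheaf_closure_def full_subcat_simps)

lemma presheaf_closure_induct:
  assumes "X \<in> Obj (presheaf_closure \<Omega> A closed)"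
    and "replete (psh \<Omega> A) {X \<in> Obj (psh \<Omega> A). Q X}"
    and "\<And>X. X \<in> representables \<Omega> A \<Longrightarrow> Q X"
    and "closed {X \<in> Obj (psh \<Omega> A). Q X}"
  shows "Q X"
proof -
  have "representables \<Omega> A \<subseteq> {X \<in> Obj (psh \<Omega> A). Q X}"
    using assms(3) by (auto simp: representables_def)
  then have "X \<in> {X \<in> Obj (psh \<Omega> A). Q X}"
    using conjunct2[OF assms(1)[unfolded presheaf_closure_Obj], rule_format, of "{X \<in> Obj (psh \<Omega> A). Q X}"] assms(2,4)
    by simp
  then show ?thesis by simp
qed

lemma presheaf_closure_representables:
  "X \<in> representables \<Omega> A \<Longrightarrow> X \<in> Obj (presheaf_closure \<Omega> A closed)"
proof -
  assume X: "X \<in> representables \<Omega> A"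
  then have "X \<in> Obj (psh \<Omega> A)" by (simp add: representables_def)
  then show ?thesis unfolding presheaf_closure_Obj using X by blast
qed

lemma presheaf_closure_hom:
  assumes "x \<in> Obj (presheaf_closure \<Omega> A closed)" "y \<in> Obj (presheaf_closure \<Omega> A closed)"
  shows "hom (presheaf_closure \<Omega> A closed) x y = hom (psh \<Omega> A) x y"
  using assms by (simp add: presheaf_closure_def full_subcat_hom full_subcat_simps)

lemma presheaf_closure_simps:
  "Idn (presheaf_closure \<Omega> A closed) = Idn (psh \<Omega> A)"
  "Cmp (presheaf_closure \<Omega> A closed) = Cmp (psh \<Omega> A)"
  "Dom (presheaf_closure \<Omega> A closed) = Dom (psh \<Omega> A)"
  "Cod (presheaf_closure \<Omega> A closed) = Cod (psh \<Omega> A)"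
  by (simp_all add: presheaf_closure_def full_subcat_simps)

lemma presheaf_closure_homD:
  "f \<in> hom (presheaf_closure \<Omega> A closed) x y \<Longrightarrow> f \<in> hom (psh \<Omega> A) x y"
  by (simp add: presheaf_closure_def full_subcat_hom split: if_splits)

lemma isomorphic_trans:
  assumes "category K" "isomorphic K x y" "isomorphic K y z"
  shows "isomorphic K x z"
proof -
  interpret category K by (rule assms)
  obtain f g where f: "f \<in> hom K x y" "g \<in> hom K y x" "Cmp K g f = Idn K x" "Cmp K f g = Idn K y"
    using assms(2) by (auto simp: isomorphic_def)
  obtain h k where h: "h \<in> hom K y z" "k \<in> hom K z y" "Cmp K k h = Idn K y" "Cmp K h k = Idn K z"
    using assms(3) by (auto simp: isomorphic_def)
  have "Cmp K (Cmp K g k) (Cmp K h f) = Idn K x"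
    using assoc[OF Cmp_in_hom[OF f(1) h(1)] h(2) f(2)] assoc[OF f(1) h(1) h(2)] h(3) Cmp_Idn_left[OF f(1)] f(3) by simp
  moreover have "Cmp K (Cmp K h f) (Cmp K g k) = Idn K z"
    using assoc[OF Cmp_in_hom[OF h(2) f(2)] f(1) h(1)] assoc[OF h(2) f(2) f(1)] f(4) Cmp_Idn_left[OF h(2)] h(4) by simp
  ultimately show ?thesis
    unfolding isomorphic_def
    using hom_Obj[OF f(1)] hom_Obj[OF h(1)] Cmp_in_hom[OF f(1) h(1)] Cmp_in_hom[OF h(2) f(2)] by blast
qed

lemma isomorphicE:
  assumes "isomorphic K x y"
  obtains f g where "f \<in> hom K x y" "g \<in> hom K y x" "Cmp K g f = Idn K x" "Cmp K f g = Idn K y"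
  using assms by (auto simp: isomorphic_def)

lemma (in regular_uncountable) less_Obj:
  assumes "category J" "|Arr J| <o \<kappa>"
  shows "|Obj J| <o \<kappa>"
proof -
  interpret category J by (rule assms)
  have "Dom J (Idn J x) = x" "Idn J x \<in> Arr J" if "x \<in> Obj J" for x
    using Idn_in_hom[OF that] by (auto simp: hom_def)
  then have "Obj J \<subseteq> Dom J ` Arr J" by (metis imageI subsetI)
  then show ?thesis by (rule less_subset[OF less_image[OF assms(2)]])
qed

section \<open>Sind and Rec of a category with pullbacks\<close>

type_synonym ('o, 'a, 'u) presheaf2 =
  "(('o, 'a, 'u) presheaf, ('o, 'a, 'u) presheaf_map, ('o, 'a, 'u) presheaf_map) presheaf"
type_synonym ('o, 'a, 'u) presheaf2_map =
  "(('o, 'a, 'u) presheaf, ('o, 'a, 'u) presheaf_map, ('o, 'a, 'u) presheaf_map) presheaf_map"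

text \<open>The parameter \<open>u\<close> fixes the type of elements of small sets, which the types
  of \<open>C\<close>, \<open>\<Omega>\<close> and \<open>\<kappa>\<close> do not mention.\<close>

locale pullback_presheaves = presheaves C \<Omega>
  for C :: "('o, 'a) cat" and \<Omega> :: "'l rel" +
  fixes \<kappa> :: "'k rel" and u :: "'u itself"
  assumes reg_\<Omega>: "regular_uncountable \<Omega>" and reg_\<kappa>: "regular_uncountable \<kappa>" and \<kappa>_le: "\<kappa> \<le>o \<Omega>"
    and \<Omega>_le: "\<Omega> \<le>o |UNIV :: 'u set|" and ls: "locally_small \<Omega> C" and pb: "has_pullbacks C"
begin

abbreviation K :: "(('o, 'a, 'u) presheaf, ('o, 'a, 'u) presheaf_map) cat" where
  "K \<equiv> psh \<Omega> C"

abbreviation Sc :: "(('o, 'a, 'u) presheaf, ('o, 'a, 'u) presheaf_map) cat" where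
  "Sc \<equiv> Sind \<kappa> \<Omega> C"

abbreviation Rc :: "(('o, 'a, 'u) presheaf, ('o, 'a, 'u) presheaf_map) cat" where
  "Rc \<equiv> Rec \<Omega> C"

sublocale K: generated_category K "representables \<Omega> C"
  by (rule generated_category_psh[OF reg_\<Omega> \<Omega>_le ls pb])

sublocale kap: regular_uncountable \<kappa>
  by (rule reg_\<kappa>)

lemma \<kappa>_less_\<Omega>: "|A| <o \<kappa> \<Longrightarrow> |A| <o \<Omega>"
  using \<kappa>_le ordLess_ordLeq_trans by blast

lemma category_Sc: "category Sc"
  unfolding Sind_def presheaf_closure_def by (rule category_full_subcat[OF K.category_axioms])

lemma category_Rc: "category Rc"
  unfolding Rec_def presheaf_closure_def by (rule category_full_subcat[OF K.category_axioms])

lemmas Sc_hom = presheaf_closure_hom[of _ \<Omega> C "closed_under_colimits {J :: ('u, 'u) cat. category J \<and> |Arr J| <o \<kappa> \<and> sifted J} K", folded Sind_def]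
lemmas Sc_simps = presheaf_closure_simps[of \<Omega> C "closed_under_colimits {J :: ('u, 'u) cat. category J \<and> |Arr J| <o \<kappa> \<and> sifted J} K", folded Sind_def]
lemmas Rc_hom = presheaf_closure_hom[of _ \<Omega> C "closed_under_reflexive_coequalizers K", folded Rec_def]
lemmas Rc_simps = presheaf_closure_simps[of \<Omega> C "closed_under_reflexive_coequalizers K", folded Rec_def]

lemma Sc_Obj: "\<phi> \<in> Obj Sc \<Longrightarrow> \<phi> \<in> Obj K"
  unfolding Sind_def presheaf_closure_Obj by blast

lemma Rc_Obj: "\<psi> \<in> Obj Rc \<Longrightarrow> \<psi> \<in> Obj K"
  unfolding Rec_def presheaf_closure_Obj by blast

lemma Sc_homD: "f \<in> hom Sc x y \<Longrightarrow> f \<in> hom K x y"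
  unfolding Sind_def by (rule presheaf_closure_homD)

lemma Rc_homD: "f \<in> hom Rc x y \<Longrightarrow> f \<in> hom K x y"
  unfolding Rec_def by (rule presheaf_closure_homD)

lemma Rc_generator: "g \<in> representables \<Omega> C \<Longrightarrow> g \<in> Obj Rc"
  unfolding Rec_def by (rule presheaf_closure_representables)

lemma tight_K:
  fixes D :: "('i, 'j, ('o, 'a, 'u) presheaf, ('o, 'a, 'u) presheaf_map) func"
  assumes "category J" "|Arr J| <o \<kappa>" "is_functor J K D" "is_colimit J K D X \<mu>"
  shows "diagram K (representables \<Omega> C) J D X \<mu>"
proof -
  interpret J: category J by (rule assms)
  have "is_cocone J K D X \<mu>" using assms(4) unfolding is_colimit_def by (rule conjunct1)
  moreover have "K.tight J D X \<mu>"
    by (rule tight_colimit[OF reg_\<Omega> \<Omega>_le ls pb assms(1) \<kappa>_less_\<Omega>[OF kap.less_Obj[OF assms(1,2)]] assms(3,4)])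
  ultimately show ?thesis
    using assms(3) by unfold_locales
qed

lemma Sc_colimit:
  fixes J :: "('u, 'u) cat"
  assumes "category J" "|Arr J| <o \<kappa>" "sifted J" "is_functor J K D"
    and "\<And>i. i \<in> Obj J \<Longrightarrow> FObj D i \<in> Obj Sc" and "is_colimit J K D X \<mu>"
  shows "X \<in> Obj Sc"
  unfolding Sind_def presheaf_closure_Obj
proof (intro conjI allI impI)
  show "X \<in> Obj K" using assms(6) by (simp add: is_colimit_def is_cocone_def)
  fix S assume S: "S \<subseteq> Obj K \<and> replete K S \<and> representables \<Omega> C \<subseteq> S \<and>
    closed_under_colimits {J :: ('u, 'u) cat. category J \<and> |Arr J| <o \<kappa> \<and> sifted J} K S"
  have "FObj D i \<in> S" if "i \<in> Obj J" for i
    using assms(5)[OF that] S unfolding Sind_def presheaf_closure_Obj by blast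
  then show "X \<in> S"
    using S assms(1-4,6) unfolding closed_under_colimits_def by blast
qed

text \<open>The pair of conditions is the invariant preserved along the generation of Sind(C), and
  it is exactly what \<open>filtered_presentation\<close> takes as input.\<close>

lemma Sc_wsifted_presentable:
  assumes "\<phi> \<in> Obj Sc"
  shows "K.wsifted \<phi> \<and> K.presentable \<kappa> \<phi>"
  using assms unfolding Sind_def
proof (rule presheaf_closure_induct)
  show "replete K {X \<in> Obj K. K.wsifted X \<and> K.presentable \<kappa> X}"
    unfolding replete_def
  proof (intro ballI allI impI)
    fix X Y assume X: "X \<in> {X \<in> Obj K. K.wsifted X \<and> K.presentable \<kappa> X}" and iso: "isomorphic K X Y"
    obtain f g where f: "f \<in> hom K X Y" "g \<in> hom K Y X" "Cmp K g f = Idn K X" "Cmp K f g = Idn K Y"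
      by (rule isomorphicE[OF iso])
    show "Y \<in> {X \<in> Obj K. K.wsifted X \<and> K.presentable \<kappa> X}"
      using X K.wsifted_iso[OF f] K.presentable_iso[OF reg_\<kappa> f] K.hom_Obj[OF f(1)] by blast
  qed
  show "K.wsifted X \<and> K.presentable \<kappa> X" if "X \<in> representables \<Omega> C" for X
    using K.wsifted_generator[OF that] K.presentable_generator[OF reg_\<kappa> that] by blast
  show "closed_under_colimits {J :: ('u, 'u) cat. category J \<and> |Arr J| <o \<kappa> \<and> sifted J} K
      {X \<in> Obj K. K.wsifted X \<and> K.presentable \<kappa> X}"
    unfolding closed_under_colimits_def
  proof (intro ballI allI impI)
    fix J :: "('u, 'u) cat" and D X \<mu>
    assume J: "J \<in> {J. category J \<and> |Arr J| <o \<kappa> \<and> sifted J}"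
      and asm: "is_functor J K D \<and> (\<forall>i\<in>Obj J. FObj D i \<in> {X \<in> Obj K. K.wsifted X \<and> K.presentable \<kappa> X}) \<and>
        is_colimit J K D X \<mu>"
    interpret diagram K "representables \<Omega> C" J D X \<mu>
      using J asm by (intro tight_K) auto
    have P: "K.wsifted (FObj D i)" "K.presentable \<kappa> (FObj D i)" if "i \<in> Obj J" for i
      using asm that by blast+
    have "K.wsifted X"
      by (rule wsifted_colimit[OF sifted_imp_bsifted P(1)]) (use J in auto)
    moreover have "K.presentable \<kappa> X"
      by (rule presentable_colimit[OF reg_\<kappa> _ _ P(2)]) (use J asm in auto)
    moreover have "X \<in> Obj K" using cocone by (simp add: is_cocone_def)
    ultimately show "X \<in> {X \<in> Obj K. K.wsifted X \<and> K.presentable \<kappa> X}" by blast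
  qed
qed

lemma Rc_coequalizer:
  assumes "X \<in> Obj Rc" "Y \<in> Obj Rc" "reflexive_pair K X Y p q" and Z: "is_coequalizer K p q Z e"
  shows "Z \<in> Obj Rc"
  unfolding Rec_def presheaf_closure_Obj
proof (intro conjI allI impI)
  have "e \<in> hom K (Cod K p) Z" using Z unfolding is_coequalizer_def by (rule conjunct1)
  then show "Z \<in> Obj K" using K.hom_Obj by blast
  fix S assume S: "S \<subseteq> Obj K \<and> replete K S \<and> representables \<Omega> C \<subseteq> S \<and> closed_under_reflexive_coequalizers K S"
  have "X \<in> S" "Y \<in> S"
    using assms(1,2) S unfolding Rec_def presheaf_closure_Obj by blast+
  then show "Z \<in> S"
    using S assms(3,4) unfolding closed_under_reflexive_coequalizers_def by blast
qed

lemma reflexive_quotients_Rc: "K.reflexive_quotients \<subseteq> Obj Rc"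
  unfolding K.reflexive_quotients_def using Rc_coequalizer Rc_generator by blast

lemma infinite_u: "infinite (UNIV :: 'u set)"
proof
  assume "finite (UNIV :: 'u set)"
  then have "|UNIV :: 'u set| <o \<Omega>" by (rule \<kappa>_less_\<Omega>[OF kap.less_finite])
  then show False using \<Omega>_le not_ordLess_ordLeq by blast
qed

text \<open>A reflexive coequalizer is a colimit over a three-element sifted monoid, so every class
  closed under \<kappa>-small sifted colimits is closed under reflexive coequalizers. The three
  arrows must be distinct elements of \<open>'u\<close>.\<close>

lemma Rc_sub_Sc: "\<psi> \<in> Obj Rc \<Longrightarrow> \<psi> \<in> Obj Sc"
proof -
  assume \<psi>: "\<psi> \<in> Obj Rc"
  obtain B :: "'u set" where "card B = 3"
    using infinite_arbitrarily_large[OF infinite_u] by blast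
  then obtain o1 a b :: 'u where ne: "a \<noteq> o1" "b \<noteq> o1" "a \<noteq> b"
    unfolding card_3_iff by blast
  let ?M = "left_absorbing o1 a b"
  have M: "category ?M" "|Arr ?M| <o \<kappa>" "sifted ?M"
    using category_left_absorbing sifted_left_absorbing[OF ne(1,2)]
    by (auto simp: left_absorbing_def intro: kap.less_finite)
  show ?thesis
    unfolding Sind_def presheaf_closure_Obj
  proof (intro conjI allI impI)
    show "\<psi> \<in> Obj K" by (rule Rc_Obj[OF \<psi>])
    fix S assume S: "S \<subseteq> Obj K \<and> replete K S \<and> representables \<Omega> C \<subseteq> S \<and>
      closed_under_colimits {J :: ('u, 'u) cat. category J \<and> |Arr J| <o \<kappa> \<and> sifted J} K S"
    have "closed_under_reflexive_coequalizers K S"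
      unfolding closed_under_reflexive_coequalizers_def
    proof (intro ballI allI impI)
      fix X Y p q Z e
      assume XY: "X \<in> S" "Y \<in> S" and pq: "reflexive_pair K X Y p q \<and> is_coequalizer K p q Z e"
      obtain D \<mu> where D: "is_functor ?M K D" "FObj D o1 = X" "is_colimit ?M K D Z \<mu>"
        by (rule K.reflexive_coequalizer_colimit[OF ne conjunct1[OF pq] conjunct2[OF pq]])
      have "\<forall>i \<in> Obj ?M. FObj D i \<in> S"
        using D(2) XY(1) by (simp add: left_absorbing_def)
      then show "Z \<in> S"
        using S M D(1,3) unfolding closed_under_colimits_def by blast
    qed
    then show "\<psi> \<in> S"
      using \<psi> S unfolding Rec_def presheaf_closure_Obj by blast
  qed
qed

lemma Rc_induct:
  assumes \<psi>: "\<psi> \<in> Obj Rc"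
    and iso: "\<And>X Y f g. \<lbrakk>f \<in> hom K X Y; g \<in> hom K Y X; Cmp K g f = Idn K X; Cmp K f g = Idn K Y; Q X\<rbrakk> \<Longrightarrow> Q Y"
    and gen: "\<And>X. X \<in> representables \<Omega> C \<Longrightarrow> Q X"
    and coeq: "\<And>X Y p q Z e. \<lbrakk>p \<in> hom K X Y; q \<in> hom K X Y; is_coequalizer K p q Z e; Q X; Q Y\<rbrakk> \<Longrightarrow> Q Z"
  shows "Q \<psi>"
  using \<psi> unfolding Rec_def
proof (rule presheaf_closure_induct)
  show "replete K {X \<in> Obj K. Q X}"
    unfolding replete_def
  proof (intro ballI allI impI)
    fix X Y assume X: "X \<in> {X \<in> Obj K. Q X}" and XY: "isomorphic K X Y"
    obtain f g where f: "f \<in> hom K X Y" "g \<in> hom K Y X" "Cmp K g f = Idn K X" "Cmp K f g = Idn K Y"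
      by (rule isomorphicE[OF XY])
    show "Y \<in> {X \<in> Obj K. Q X}"
      using X iso[OF f] K.hom_Obj[OF f(1)] by blast
  qed
  show "closed_under_reflexive_coequalizers K {X \<in> Obj K. Q X}"
    unfolding closed_under_reflexive_coequalizers_def
  proof (intro ballI allI impI)
    fix X Y p q Z e
    assume XY: "X \<in> {X \<in> Obj K. Q X}" "Y \<in> {X \<in> Obj K. Q X}" and pq: "reflexive_pair K X Y p q \<and> is_coequalizer K p q Z e"
    note h = K.reflexive_pairD[OF conjunct1[OF pq]]
    have "Q Z" by (rule coeq[OF h conjunct2[OF pq]]) (use XY in auto)
    then show "Z \<in> {X \<in> Obj K. Q X}"
      using K.hom_Obj[OF K.is_coequalizerD(1)[OF conjunct2[OF pq] h(1)]] by blast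
  qed
qed (rule gen)

text \<open>This makes the values of the restricted Yoneda embedding small. A map out of a
  coequalizer is determined by its composite with the quotient map, and a map out of a representable
  by its value at the universal element.\<close>

lemma Rc_hom_less:
  assumes "\<psi> \<in> Obj Rc" and \<phi>: "\<phi> \<in> Obj K"
  shows "|hom K \<psi> \<phi>| <o \<Omega>"
  using assms(1)
proof (rule Rc_induct)
  interpret Om: regular_uncountable \<Omega> by (rule reg_\<Omega>)
  fix X Y f g assume f: "f \<in> hom K X Y" and g: "g \<in> hom K Y X" and fg: "Cmp K f g = Idn K Y" and X: "|hom K X \<phi>| <o \<Omega>"
  have "inj_on (\<lambda>h. Cmp K h f) (hom K Y \<phi>)"
  proof (rule inj_onI)
    fix h k assume h: "h \<in> hom K Y \<phi>" "k \<in> hom K Y \<phi>" and eq: "Cmp K h f = Cmp K k f"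
    have "Cmp K (Cmp K v f) g = v" if v: "v \<in> hom K Y \<phi>" for v
      using K.assoc[OF g f v] fg K.Cmp_Idn_right[OF v] by simp
    from this[OF h(1)] this[OF h(2)] show "h = k" unfolding eq by simp
  qed
  then show "|hom K Y \<phi>| <o \<Omega>"
    by (rule Om.less_inj_on[OF _ _ X]) (use K.Cmp_in_hom[OF f] in auto)
next
  interpret Om: regular_uncountable \<Omega> by (rule reg_\<Omega>)
  fix X :: "('o, 'a, 'u) presheaf" assume X: "X \<in> representables \<Omega> C"
  obtain c w where W: "universal X c w" by (rule representable_universal[OF X])
  note w = universalD[OF W]
  have "inj_on (\<lambda>\<alpha>. app \<alpha> c w) (hom K X \<phi>)"
    using yoneda_ext[OF W] by (auto intro: inj_onI)
  then show "|hom K X \<phi>| <o \<Omega>"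
    by (rule Om.less_inj_on[OF _ _ psh_less[OF \<phi> w(2)]]) (use app_in[OF _ w(2,3)] in auto)
next
  interpret Om: regular_uncountable \<Omega> by (rule reg_\<Omega>)
  fix X Y p q Z e assume p: "p \<in> hom K X Y" "q \<in> hom K X Y" and Z: "is_coequalizer K p q Z e" and Y: "|hom K Y \<phi>| <o \<Omega>"
  have "inj_on (\<lambda>h. Cmp K h e) (hom K Z \<phi>)"
    using K.is_coequalizer_epi[OF Z p] by (auto intro: inj_onI)
  then show "|hom K Z \<phi>| <o \<Omega>"
    by (rule Om.less_inj_on[OF _ _ Y]) (use K.Cmp_in_hom[OF K.is_coequalizerD(1)[OF Z p(1)]] in auto)
qed

text \<open>Induction over the generation of Rec(C) handles iterated coequalizers without describing
  them explicitly.\<close>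

lemma Rc_factors:
  fixes D :: "('i, 'j, ('o, 'a, 'u) presheaf, ('o, 'a, 'u) presheaf_map) func"
  assumes \<psi>: "\<psi> \<in> Obj Rc" and J: "category J" "|Arr J| <o \<kappa>" "filtered J"
    and D: "is_functor J K D" "is_colimit J K D X \<mu>"
  shows "diagram.factors K J D X \<mu> \<psi>"
proof -
  interpret diagram K "representables \<Omega> C" J D X \<mu>
    by (rule tight_K[OF J(1,2) D])
  show ?thesis
    using \<psi>
  proof (rule Rc_induct)
    fix A B f g assume f: "f \<in> hom K A B" and g: "g \<in> hom K B A" and fg: "Cmp K f g = Idn K B" and A: "factors A"
    show "factors B"
      unfolding factors_def
    proof (intro conjI ballI impI)
      fix h assume h: "h \<in> hom K B X"
      obtain i y where i: "i \<in> Obj J" "y \<in> hom K A (FObj D i)" "Cmp K (\<mu> i) y = Cmp K h f"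
        by (rule factors_lift[OF A K.Cmp_in_hom[OF f h]])
      have "Cmp K (\<mu> i) (Cmp K y g) = h"
        using K.assoc[OF g i(2) \<mu>_hom[OF i(1)]] i(3) K.assoc[OF g f h] fg K.Cmp_Idn_right[OF h] by simp
      then show "\<exists>i\<in>Obj J. \<exists>y\<in>hom K B (FObj D i). Cmp K (\<mu> i) y = h"
        using i(1) K.Cmp_in_hom[OF g i(2)] by blast
    next
      fix i y z assume i: "i \<in> Obj J" and y: "y \<in> hom K B (FObj D i)" and z: "z \<in> hom K B (FObj D i)"
        and eq: "Cmp K (\<mu> i) y = Cmp K (\<mu> i) z"
      have eqf: "Cmp K (\<mu> i) (Cmp K y f) = Cmp K (\<mu> i) (Cmp K z f)"
        using K.assoc[OF f y \<mu>_hom[OF i]] K.assoc[OF f z \<mu>_hom[OF i]] eq by simp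
      obtain j \<theta> where \<theta>: "\<theta> \<in> hom J i j" "Cmp K (FArr D \<theta>) (Cmp K y f) = Cmp K (FArr D \<theta>) (Cmp K z f)"
        by (rule factors_eq[OF A K.Cmp_in_hom[OF f y] K.Cmp_in_hom[OF f z] eqf i])
      have retr: "Cmp K (Cmp K (FArr D \<theta>) (Cmp K v f)) g = Cmp K (FArr D \<theta>) v" if v: "v \<in> hom K B (FObj D i)" for v
        using K.assoc[OF g K.Cmp_in_hom[OF f v] D_hom[OF \<theta>(1)]] K.assoc[OF g f v] fg K.Cmp_Idn_right[OF v] by simp
      have "Cmp K (FArr D \<theta>) y = Cmp K (FArr D \<theta>) z"
        using retr[OF y] retr[OF z] \<theta>(2) by simp
      then show "\<exists>j. \<exists>\<theta>\<in>hom J i j. Cmp K (FArr D \<theta>) y = Cmp K (FArr D \<theta>) z"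
        using \<theta>(1) by blast
    qed
  next
    fix A :: "('o, 'a, 'u) presheaf" assume "A \<in> representables \<Omega> C"
    then show "factors A" by (rule factors_generator[OF J(3)])
  next
    fix A B p q Z e assume "p \<in> hom K A B" "q \<in> hom K A B" "is_coequalizer K p q Z e" "factors A" "factors B"
    then show "factors Z" using factors_coequalizer by blast
  qed
qed

section \<open>The restricted Yoneda embedding of Sind(C) into presheaves on Rec(C)\<close>

sublocale R: presheaves Rc \<Omega>
  using category_Rc by (simp add: presheaves_def)

abbreviation T :: "(('o, 'a, 'u) presheaf2, ('o, 'a, 'u) presheaf2_map) cat" where
  "T \<equiv> psh \<Omega> Rc"

abbreviation N where "N \<equiv> restricted_yoneda Sc Rc"

sublocale T: category "psh \<Omega> Rc :: (('o, 'a, 'u) presheaf2,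
    ('o, 'a, 'u) presheaf2_map) cat"
  by (rule R.category_psh)

lemma N_FObj: "\<phi> \<in> Obj Sc \<Longrightarrow> FObj N \<phi> = R.mkpsh (\<lambda>\<psi>. hom Sc \<psi> \<phi>) (\<lambda>f g. Cmp K g f)"
  by (simp add: restricted_yoneda_def restricted_hom_def R.mkpsh_def Sc_simps)

lemma N_FObj_FObj: "\<phi> \<in> Obj Sc \<Longrightarrow> \<psi> \<in> Obj Rc \<Longrightarrow> FObj (FObj N \<phi>) \<psi> = hom K \<psi> \<phi>"
  by (simp add: N_FObj R.mkpsh_FObj Sc_hom Rc_sub_Sc)

lemma N_act:
  assumes "\<phi> \<in> Obj Sc" "f \<in> hom Rc \<psi> \<psi>'" "x \<in> hom K \<psi>' \<phi>"
  shows "act (FObj N \<phi>) f x = Cmp K x f"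
proof -
  have "\<psi>' \<in> Obj Rc" using category.hom_Obj[OF category_Rc assms(2)] by blast
  then have "x \<in> hom Sc \<psi>' \<phi>" using assms Sc_hom Rc_sub_Sc by blast
  then show ?thesis
    using R.mkpsh_act[where S = "\<lambda>\<psi>. hom Sc \<psi> \<phi>" and r = "\<lambda>f g. Cmp K g f", OF assms(2)] assms(1) by (simp add: N_FObj)
qed

lemma N_Obj:
  assumes \<phi>: "\<phi> \<in> Obj Sc"
  shows "FObj N \<phi> \<in> Obj T"
  unfolding N_FObj[OF \<phi>]
proof (rule R.mkpsh_Obj)
  have h: "hom Sc \<psi> \<phi> = hom K \<psi> \<phi>" if "\<psi> \<in> Obj Rc" for \<psi>
    using Sc_hom Rc_sub_Sc[OF that] \<phi> by blast
  have o: "c \<in> Obj Rc" "d \<in> Obj Rc" if "f \<in> hom Rc c d" for f c d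
    using category.hom_Obj[OF category_Rc that] by auto
  show "|hom Sc \<psi> \<phi>| <o \<Omega>" if "\<psi> \<in> Obj Rc" for \<psi>
    using Rc_hom_less[OF that Sc_Obj[OF \<phi>]] h[OF that] by simp
  show "Cmp K x f \<in> hom Sc c \<phi>" if "f \<in> hom Rc c d" "x \<in> hom Sc d \<phi>" for f c d x
    using K.Cmp_in_hom[OF Rc_homD[OF that(1)] Sc_homD[OF that(2)]] h o[OF that(1)] by simp
  show "Cmp K x (Idn Rc c) = x" if "c \<in> Obj Rc" "x \<in> hom Sc c \<phi>" for c x
    using K.Cmp_Idn_right[OF Sc_homD[OF that(2)]] by (simp add: Rc_simps)
  show "Cmp K x (Cmp Rc g f) = Cmp K (Cmp K x g) f"
    if "f \<in> hom Rc c d" "g \<in> hom Rc d e" "x \<in> hom Sc e \<phi>" for f g c d e x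
    using K.Cmp_assoc[OF Rc_homD[OF that(1)] Rc_homD[OF that(2)] Sc_homD[OF that(3)]] by (simp add: Rc_simps)
qed

lemma N_FArr:
  assumes "\<alpha> \<in> hom Sc \<phi> \<phi>'"
  shows "FArr N \<alpha> = R.mkmap (FObj N \<phi>) (FObj N \<phi>') (\<lambda>\<psi> g. Cmp K \<alpha> g)"
proof -
  have o: "\<phi> \<in> Obj Sc" "\<phi>' \<in> Obj Sc" using category.hom_Obj[OF category_Sc assms] by auto
  have "(\<lambda>\<psi>\<in>Obj Rc. (hom Sc \<psi> \<phi>, hom Sc \<psi> \<phi>', \<lambda>g\<in>hom Sc \<psi> \<phi>. Cmp Sc \<alpha> g)) =
    (\<lambda>\<psi>\<in>Obj Rc. (FObj (FObj N \<phi>) \<psi>, FObj (FObj N \<phi>') \<psi>, \<lambda>g\<in>FObj (FObj N \<phi>) \<psi>. Cmp K \<alpha> g))"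
    by (rule restrict_ext) (simp add: N_FObj_FObj o Sc_hom Rc_sub_Sc Sc_simps)
  moreover have "FObj N \<phi> = restricted_hom Sc Rc \<phi>" "FObj N \<phi>' = restricted_hom Sc Rc \<phi>'"
    using o by (simp_all add: restricted_yoneda_def)
  ultimately show ?thesis
    using assms by (simp add: restricted_yoneda_def R.mkmap_def hom_def)
qed

lemma N_app:
  assumes "\<alpha> \<in> hom Sc \<phi> \<phi>'" "\<psi> \<in> Obj Rc" "g \<in> hom K \<psi> \<phi>"
  shows "app (FArr N \<alpha>) \<psi> g = Cmp K \<alpha> g"
  using assms category.hom_Obj[OF category_Sc assms(1)]
  by (simp add: N_FArr[OF assms(1)] R.mkmap_app N_FObj_FObj)

lemma N_hom:
  assumes \<alpha>: "\<alpha> \<in> hom Sc \<phi> \<phi>'"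
  shows "FArr N \<alpha> \<in> hom T (FObj N \<phi>) (FObj N \<phi>')"
  unfolding N_FArr[OF \<alpha>]
proof (rule R.mkmap_hom)
  have o: "\<phi> \<in> Obj Sc" "\<phi>' \<in> Obj Sc" using category.hom_Obj[OF category_Sc \<alpha>] by auto
  show "FObj N \<phi> \<in> Obj T" "FObj N \<phi>' \<in> Obj T" using N_Obj o by auto
  show "Cmp K \<alpha> x \<in> FObj (FObj N \<phi>') c" if "c \<in> Obj Rc" "x \<in> FObj (FObj N \<phi>) c" for c x
    using that K.Cmp_in_hom[OF _ Sc_homD[OF \<alpha>]] by (simp add: N_FObj_FObj o)
  fix f c d x assume f: "f \<in> hom Rc c d" and x: "x \<in> FObj (FObj N \<phi>) d"
  have cd: "c \<in> Obj Rc" "d \<in> Obj Rc" using category.hom_Obj[OF category_Rc f] by auto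
  have x': "x \<in> hom K d \<phi>" using x cd o by (simp add: N_FObj_FObj)
  show "Cmp K \<alpha> (act (FObj N \<phi>) f x) = act (FObj N \<phi>') f (Cmp K \<alpha> x)"
    using N_act[OF o(1) f x'] N_act[OF o(2) f K.Cmp_in_hom[OF x' Sc_homD[OF \<alpha>]]]
      K.Cmp_assoc[OF Rc_homD[OF f] x' Sc_homD[OF \<alpha>]] by simp
qed

lemma N_ext:
  assumes "s \<in> hom T (FObj N \<phi>) Y" "t \<in> hom T (FObj N \<phi>) Y" and \<phi>: "\<phi> \<in> Obj Sc"
    and "\<And>\<psi> g. \<psi> \<in> Obj Rc \<Longrightarrow> g \<in> hom K \<psi> \<phi> \<Longrightarrow> app s \<psi> g = app t \<psi> g"
  shows "s = t"
  by (rule R.psh_ext[OF assms(1,2)]) (use assms(4) \<phi> in \<open>auto simp: N_FObj_FObj\<close>)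

lemma N_Idn:
  assumes \<phi>: "\<phi> \<in> Obj Sc"
  shows "FArr N (Idn K \<phi>) = Idn T (FObj N \<phi>)"
proof -
  have I: "Idn K \<phi> \<in> hom Sc \<phi> \<phi>"
    using category.Idn_in_hom[OF category_Sc \<phi>] by (simp add: Sc_simps)
  show ?thesis
  proof (rule N_ext[OF N_hom[OF I] T.Idn_in_hom[OF N_Obj[OF \<phi>]] \<phi>])
    fix \<psi> g assume \<psi>: "\<psi> \<in> Obj Rc" and g: "g \<in> hom K \<psi> \<phi>"
    show "app (FArr N (Idn K \<phi>)) \<psi> g = app (Idn T (FObj N \<phi>)) \<psi> g"
      using N_app[OF I \<psi> g] K.Cmp_Idn_left[OF g] R.app_Idn[OF \<psi>, of g "FObj N \<phi>"] \<phi> \<psi> g by (simp add: N_FObj_FObj)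
  qed
qed

lemma N_Cmp:
  assumes \<alpha>: "\<alpha> \<in> hom Sc \<phi> \<phi>'" and \<beta>: "\<beta> \<in> hom Sc \<phi>' \<phi>''"
  shows "FArr N (Cmp K \<beta> \<alpha>) = Cmp T (FArr N \<beta>) (FArr N \<alpha>)"
proof -
  have \<phi>: "\<phi> \<in> Obj Sc" using category.hom_Obj[OF category_Sc \<alpha>] by auto
  have \<beta>\<alpha>: "Cmp K \<beta> \<alpha> \<in> hom Sc \<phi> \<phi>''"
    using category.Cmp_in_hom[OF category_Sc \<alpha> \<beta>] by (simp add: Sc_simps)
  show ?thesis
  proof (rule N_ext[OF N_hom[OF \<beta>\<alpha>] T.Cmp_in_hom[OF N_hom[OF \<alpha>] N_hom[OF \<beta>]] \<phi>])
    fix \<psi> g assume \<psi>: "\<psi> \<in> Obj Rc" and g: "g \<in> hom K \<psi> \<phi>"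
    then have g': "g \<in> FObj (FObj N \<phi>) \<psi>" using \<phi> by (simp add: N_FObj_FObj)
    show "app (FArr N (Cmp K \<beta> \<alpha>)) \<psi> g = app (Cmp T (FArr N \<beta>) (FArr N \<alpha>)) \<psi> g"
      using N_app[OF \<beta>\<alpha> \<psi> g] N_app[OF \<alpha> \<psi> g] N_app[OF \<beta> \<psi> K.Cmp_in_hom[OF g Sc_homD[OF \<alpha>]]]
        R.app_Cmp[OF N_hom[OF \<alpha>] N_hom[OF \<beta>] \<psi> g'] K.assoc[OF g Sc_homD[OF \<alpha>] Sc_homD[OF \<beta>]] by simp
  qed
qed

lemma N_functor: "is_functor Sc T N"
  unfolding is_functor_def
proof (intro conjI ballI impI)
  show "FObj N \<in> Obj Sc \<rightarrow>\<^sub>E Obj T"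
    using N_Obj by (auto simp: restricted_yoneda_def)
  have "FArr N \<alpha> \<in> Arr T" if "\<alpha> \<in> Arr Sc" for \<alpha>
    using N_hom[of \<alpha> "Dom Sc \<alpha>" "Cod Sc \<alpha>"] that by (auto simp: hom_def)
  then show "FArr N \<in> Arr Sc \<rightarrow>\<^sub>E Arr T"
    by (auto simp: restricted_yoneda_def)
  show "FArr N f \<in> hom T (FObj N (Dom Sc f)) (FObj N (Cod Sc f))" if "f \<in> Arr Sc" for f
    by (rule N_hom) (use that in \<open>simp add: hom_def\<close>)
  show "FArr N (Idn Sc x) = Idn T (FObj N x)" if "x \<in> Obj Sc" for x
    using N_Idn[OF that] by (simp add: Sc_simps)
  show "FArr N (Cmp Sc g f) = Cmp T (FArr N g) (FArr N f)"
    if "f \<in> Arr Sc" "g \<in> Arr Sc" "Cod Sc f = Dom Sc g" for f g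
    using N_Cmp[of f "Dom Sc f" "Cod Sc f" g "Cod Sc g"] that by (simp add: hom_def Sc_simps)
qed

text \<open>Faithfulness holds because Rec(C) contains the representables, which separate arrows.
  For fullness, density produces \<open>\<alpha>\<close> from the components of \<open>t\<close> at
  representables; agreement at any other object of Rec(C) is again tested on representables, by
  naturality of \<open>t\<close>.\<close>

lemma N_full_and_faithful: "full_and_faithful Sc T N"
  unfolding full_and_faithful_def
proof (intro ballI)
  fix \<phi> \<phi>' assume \<phi>: "\<phi> \<in> Obj Sc" and \<phi>': "\<phi>' \<in> Obj Sc"
  note homS = Sc_hom[OF \<phi> \<phi>']
  show "bij_betw (FArr N) (hom Sc \<phi> \<phi>') (hom T (FObj N \<phi>) (FObj N \<phi>'))"
    unfolding bij_betw_def
  proof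
    show "inj_on (FArr N) (hom Sc \<phi> \<phi>')"
    proof (rule inj_onI)
      fix \<alpha> \<beta> assume \<alpha>: "\<alpha> \<in> hom Sc \<phi> \<phi>'" and \<beta>: "\<beta> \<in> hom Sc \<phi> \<phi>'" and eq: "FArr N \<alpha> = FArr N \<beta>"
      show "\<alpha> = \<beta>"
      proof (rule K.G_separating[OF Sc_homD[OF \<alpha>] Sc_homD[OF \<beta>]])
        fix g x assume g: "g \<in> representables \<Omega> C" and x: "x \<in> hom K g \<phi>"
        show "Cmp K \<alpha> x = Cmp K \<beta> x"
          using N_app[OF \<alpha> Rc_generator[OF g] x] N_app[OF \<beta> Rc_generator[OF g] x] eq by simp
      qed
    qed
    show "FArr N ` hom Sc \<phi> \<phi>' = hom T (FObj N \<phi>) (FObj N \<phi>')"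
    proof
      show "FArr N ` hom Sc \<phi> \<phi>' \<subseteq> hom T (FObj N \<phi>) (FObj N \<phi>')" using N_hom by blast
      show "hom T (FObj N \<phi>) (FObj N \<phi>') \<subseteq> FArr N ` hom Sc \<phi> \<phi>'"
      proof
        fix t assume t: "t \<in> hom T (FObj N \<phi>) (FObj N \<phi>')"
        have t_in: "app t \<psi> x \<in> hom K \<psi> \<phi>'" if "\<psi> \<in> Obj Rc" "x \<in> hom K \<psi> \<phi>" for \<psi> x
          using R.app_in[OF t that(1)] that \<phi> \<phi>' by (simp add: N_FObj_FObj)
        have t_nat: "app t \<psi> (Cmp K x k) = Cmp K (app t \<psi>' x) k"
          if "\<psi> \<in> Obj Rc" "\<psi>' \<in> Obj Rc" "k \<in> hom K \<psi> \<psi>'" "x \<in> hom K \<psi>' \<phi>" for \<psi> \<psi>' k x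
        proof -
          have k: "k \<in> hom Rc \<psi> \<psi>'" using that Rc_hom by blast
          show ?thesis
            using R.app_act[OF t k, of x] N_act[OF \<phi> k that(4)] N_act[OF \<phi>' k t_in[OF that(2,4)]] that \<phi>
            by (simp add: N_FObj_FObj)
        qed
        \<comment> \<open>Density takes one function on all maps out of representables, so the
          component of \<open>t\<close> is selected by the source of the map.\<close>
        obtain \<alpha> where \<alpha>: "\<alpha> \<in> hom K \<phi> \<phi>'"
          and eq: "\<And>g x. g \<in> representables \<Omega> C \<Longrightarrow> x \<in> hom K g \<phi> \<Longrightarrow> Cmp K \<alpha> x = app t (Dom K x) x"
        proof (rule density[OF reg_\<Omega> \<Omega>_le ls Sc_Obj[OF \<phi>] Sc_Obj[OF \<phi>'], of "\<lambda>x. app t (Dom K x) x"])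
          show "app t (Dom K x) x \<in> hom K g \<phi>'" if "g \<in> representables \<Omega> C" "x \<in> hom K g \<phi>" for g x
            using t_in[OF Rc_generator[OF that(1)] that(2)] that(2) by (simp add: hom_def)
          show "app t (Dom K (Cmp K x k)) (Cmp K x k) = Cmp K (app t (Dom K x) x) k"
            if "g \<in> representables \<Omega> C" "g' \<in> representables \<Omega> C" "k \<in> hom K g' g" "x \<in> hom K g \<phi>" for g g' k x
            using t_nat[OF Rc_generator[OF that(2)] Rc_generator[OF that(1)] that(3,4)]
              hom_memD(2)[OF K.Cmp_in_hom[OF that(3,4)]] hom_memD(2)[OF that(4)] by simp
        qed (rule that)
        have \<alpha>S: "\<alpha> \<in> hom Sc \<phi> \<phi>'" using \<alpha> homS by simp
        have "FArr N \<alpha> = t"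
        proof (rule N_ext[OF N_hom[OF \<alpha>S] t \<phi>])
          fix \<psi> g assume \<psi>: "\<psi> \<in> Obj Rc" and g: "g \<in> hom K \<psi> \<phi>"
          have "Cmp K \<alpha> g = app t \<psi> g"
          proof (rule K.G_separating[OF K.Cmp_in_hom[OF g \<alpha>] t_in[OF \<psi> g]])
            fix a x assume a: "a \<in> representables \<Omega> C" and x: "x \<in> hom K a \<psi>"
            show "Cmp K (Cmp K \<alpha> g) x = Cmp K (app t \<psi> g) x"
              using K.assoc[OF x g \<alpha>] eq[OF a K.Cmp_in_hom[OF x g]] t_nat[OF Rc_generator[OF a] \<psi> x g]
                hom_memD(2)[OF K.Cmp_in_hom[OF x g]] by simp
          qed
          then show "app (FArr N \<alpha>) \<psi> g = app t \<psi> g" using N_app[OF \<alpha>S \<psi> g] by simp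
        qed
        then show "t \<in> FArr N ` hom Sc \<phi> \<phi>'" using \<alpha>S by blast
      qed
    qed
  qed
qed

section \<open>Preservation of filtered colimits by the restricted Yoneda embedding\<close>

definition ND :: "('i, 'j) cat \<Rightarrow> ('i, 'j, ('o, 'a, 'u) presheaf, ('o, 'a, 'u) presheaf_map) func \<Rightarrow>
    ('i, 'j, ('o, 'a, 'u) presheaf2,
    ('o, 'a, 'u) presheaf2_map) func" where
  "ND J D = \<lparr>FObj = (\<lambda>i\<in>Obj J. FObj N (FObj D i)), FArr = (\<lambda>\<theta>\<in>Arr J. FArr N (FArr D \<theta>))\<rparr>"

lemma ND_functor:
  assumes J: "category J" and D: "is_functor J K D" and DS: "\<And>i. i \<in> Obj J \<Longrightarrow> FObj D i \<in> Obj Sc"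
  shows "is_functor J T (ND J D)"
proof -
  interpret J: category J by (rule J)
  have DSc: "FArr D \<theta> \<in> hom Sc (FObj D i) (FObj D j)" if "\<theta> \<in> hom J i j" for \<theta> i j
    using is_functor_hom[OF D that] Sc_hom[OF DS DS] J.hom_Obj[OF that] by simp
  have arr: "\<theta> \<in> hom J (Dom J \<theta>) (Cod J \<theta>)" if "\<theta> \<in> Arr J" for \<theta> using that by (simp add: hom_def)
  show ?thesis
    unfolding is_functor_def
  proof (intro conjI ballI impI)
    show "FObj (ND J D) \<in> Obj J \<rightarrow>\<^sub>E Obj T" using N_Obj DS by (auto simp: ND_def)
    show "FArr (ND J D) \<in> Arr J \<rightarrow>\<^sub>E Arr T"
      using hom_memD(1)[OF N_hom[OF DSc[OF arr]]] by (auto simp: ND_def)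
    show "FArr (ND J D) f \<in> hom T (FObj (ND J D) (Dom J f)) (FObj (ND J D) (Cod J f))" if "f \<in> Arr J" for f
      using N_hom[OF DSc[OF arr[OF that]]] J.hom_Obj[OF arr[OF that]] that by (simp add: ND_def)
    show "FArr (ND J D) (Idn J x) = Idn T (FObj (ND J D) x)" if "x \<in> Obj J" for x
      using hom_memD(1)[OF J.Idn_in_hom[OF that]] is_functor_Idn[OF D that] N_Idn[OF DS[OF that]] that by (simp add: ND_def)
    fix f g assume fg: "f \<in> Arr J" "g \<in> Arr J" "Cod J f = Dom J g"
    have h: "f \<in> hom J (Dom J f) (Cod J f)" "g \<in> hom J (Cod J f) (Cod J g)" using fg by (auto simp: hom_def)
    show "FArr (ND J D) (Cmp J g f) = Cmp T (FArr (ND J D) g) (FArr (ND J D) f)"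
      using hom_memD(1)[OF J.Cmp_in_hom[OF h]] is_functor_Cmp[OF D h] N_Cmp[OF DSc[OF h(1)] DSc[OF h(2)]] fg by (simp add: ND_def)
  qed
qed

text \<open>At an object \<open>\<psi>\<close> of Rec(C) the two halves of \<open>factors\<close>
  give the surjectivity and the kernel condition of a pointwise colimit. The diagram is kept in
  \<open>K\<close>, where its colimit is formed, although its values lie in Sind(C).\<close>

lemma N_filtered_colimit:
  fixes D :: "('i, 'j, ('o, 'a, 'u) presheaf, ('o, 'a, 'u) presheaf_map) func"
  assumes J: "category J" "|Arr J| <o \<kappa>" "filtered J" and D: "is_functor J K D" and X: "is_colimit J K D X \<mu>"
    and DS: "\<And>i. i \<in> Obj J \<Longrightarrow> FObj D i \<in> Obj Sc" and XS: "X \<in> Obj Sc"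
  shows "is_colimit J T (ND J D) (FObj N X) (\<lambda>i\<in>Obj J. FArr N (\<mu> i))"
proof -
  interpret D: diagram K "representables \<Omega> C" J D X \<mu> by (rule tight_K[OF J(1,2) D X])
  have \<mu>S: "\<mu> i \<in> hom Sc (FObj D i) X" if "i \<in> Obj J" for i
    using D.\<mu>_hom[OF that] Sc_hom[OF DS[OF that] XS] by simp
  have DSc: "FArr D \<theta> \<in> hom Sc (FObj D i) (FObj D j)" if "\<theta> \<in> hom J i j" for \<theta> i j
    using D.D_hom[OF that] Sc_hom[OF DS DS] D.J.hom_Obj[OF that] by simp
  have FO: "FObj (FObj (ND J D) i) \<psi> = hom K \<psi> (FObj D i)" if "i \<in> Obj J" "\<psi> \<in> Obj Rc" for i \<psi>
    using that DS N_FObj_FObj by (simp add: ND_def)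
  show ?thesis
  proof (rule R.pointwise_colimit[OF J(1) ND_functor[OF J(1) D DS]])
    show "is_cocone J T (ND J D) (FObj N X) (\<lambda>i\<in>Obj J. FArr N (\<mu> i))"
      unfolding is_cocone_def
    proof (intro conjI ballI)
      show "FObj N X \<in> Obj T" by (rule N_Obj[OF XS])
      show "(\<lambda>i\<in>Obj J. FArr N (\<mu> i)) i \<in> hom T (FObj (ND J D) i) (FObj N X)" if "i \<in> Obj J" for i
        using N_hom[OF \<mu>S[OF that]] that by (simp add: ND_def)
      fix \<theta> assume \<theta>: "\<theta> \<in> Arr J"
      then have h: "\<theta> \<in> hom J (Dom J \<theta>) (Cod J \<theta>)" by (simp add: hom_def)
      show "Cmp T ((\<lambda>i\<in>Obj J. FArr N (\<mu> i)) (Cod J \<theta>)) (FArr (ND J D) \<theta>) = (\<lambda>i\<in>Obj J. FArr N (\<mu> i)) (Dom J \<theta>)"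
        using N_Cmp[OF DSc[OF h] \<mu>S] D.J.hom_Obj[OF h] D.\<mu>_comm[OF h] \<theta> by (simp add: ND_def)
    qed simp
  next
    fix \<psi> h assume \<psi>: "\<psi> \<in> Obj Rc" and h: "h \<in> FObj (FObj N X) \<psi>"
    then have hK: "h \<in> hom K \<psi> X" using XS by (simp add: N_FObj_FObj)
    obtain i y where i: "i \<in> Obj J" "y \<in> hom K \<psi> (FObj D i)" "Cmp K (\<mu> i) y = h"
      by (rule D.factors_lift[OF Rc_factors[OF \<psi> J D X] hK])
    show "\<exists>i\<in>Obj J. \<exists>y\<in>FObj (FObj (ND J D) i) \<psi>. app ((\<lambda>i\<in>Obj J. FArr N (\<mu> i)) i) \<psi> y = h"
      using i N_app[OF \<mu>S[OF i(1)] \<psi> i(2)] FO[OF i(1) \<psi>] by (intro bexI[of _ i] bexI[of _ y]) simp_all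
  next
    fix \<psi> i j y z
    assume \<psi>: "\<psi> \<in> Obj Rc" and ij: "i \<in> Obj J" "j \<in> Obj J"
      and y: "y \<in> FObj (FObj (ND J D) i) \<psi>" and z: "z \<in> FObj (FObj (ND J D) j) \<psi>"
      and eq: "app ((\<lambda>i\<in>Obj J. FArr N (\<mu> i)) i) \<psi> y = app ((\<lambda>i\<in>Obj J. FArr N (\<mu> i)) j) \<psi> z"
    have yK: "y \<in> hom K \<psi> (FObj D i)" and zK: "z \<in> hom K \<psi> (FObj D j)"
      using y z FO \<psi> ij by auto
    have eqK: "Cmp K (\<mu> i) y = Cmp K (\<mu> j) z"
      using eq N_app[OF \<mu>S[OF ij(1)] \<psi> yK] N_app[OF \<mu>S[OF ij(2)] \<psi> zK] ij by simp
    \<comment> \<open>The two elements are brought to the common index \<open>k\<close> and, by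
      \<open>factors\<close>, become equal at a later index \<open>l\<close>; each is linked to that
      common value by one arrow, so the zigzag has two steps.\<close>
    obtain k \<alpha> \<beta> where k: "\<alpha> \<in> hom J i k" "\<beta> \<in> hom J j k"
      using J(3) ij unfolding filtered_def by (elim conjE) blast
    note Dy = K.Cmp_in_hom[OF yK D.D_hom[OF k(1)]] and Dz = K.Cmp_in_hom[OF zK D.D_hom[OF k(2)]]
    have eqk: "Cmp K (\<mu> k) (Cmp K (FArr D \<alpha>) y) = Cmp K (\<mu> k) (Cmp K (FArr D \<beta>) z)"
      using D.\<mu>_comm_assoc[OF k(1) yK] D.\<mu>_comm_assoc[OF k(2) zK] eqK by simp
    obtain l \<gamma> where l: "\<gamma> \<in> hom J k l" "Cmp K (FArr D \<gamma>) (Cmp K (FArr D \<alpha>) y) = Cmp K (FArr D \<gamma>) (Cmp K (FArr D \<beta>) z)"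
      by (rule D.factors_eq[OF Rc_factors[OF \<psi> J D X] Dy Dz eqk D.J.hom_Obj(2)[OF k(1)]])
    have step: "((i', w), (l, Cmp K (FArr D \<gamma>) (Cmp K (FArr D \<theta>) w))) \<in> equivcl (R.pointwise_zigzag J (ND J D) \<psi>)"
      if \<theta>: "\<theta> \<in> hom J i' k" and w: "w \<in> hom K \<psi> (FObj D i')" for i' \<theta> w
    proof (rule equivcl_incl)
      note \<gamma>\<theta> = D.J.Cmp_in_hom[OF \<theta> l(1)]
      have "app (FArr (ND J D) (Cmp J \<gamma> \<theta>)) \<psi> w = Cmp K (FArr D \<gamma>) (Cmp K (FArr D \<theta>) w)"
        using N_app[OF DSc[OF \<gamma>\<theta>] \<psi> w] D.D_Cmp_assoc[OF \<theta> l(1) w] hom_memD(1)[OF \<gamma>\<theta>] by (simp add: ND_def)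
      then show "((i', w), (l, Cmp K (FArr D \<gamma>) (Cmp K (FArr D \<theta>) w))) \<in> R.pointwise_zigzag J (ND J D) \<psi>"
        unfolding R.pointwise_zigzag_def
        using \<gamma>\<theta> w FO[OF D.J.hom_Obj(1)[OF \<theta>] \<psi>] by (intro CollectI exI[of _ i'] exI[of _ l] exI[of _ "Cmp J \<gamma> \<theta>"] exI[of _ w]) simp
    qed
    show "((i, y), (j, z)) \<in> equivcl (R.pointwise_zigzag J (ND J D) \<psi>)"
      using equivcl_trans[OF step[OF k(1) yK] equivcl_sym[OF step[OF k(2) zK, folded l(2)]]] .
  qed
qed

text \<open>On Rec(C) itself the functor is the ordinary Yoneda embedding, with the identity as
  universal element.\<close>

lemma N_universal:
  assumes \<psi>: "\<psi> \<in> Obj Rc"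
  shows "R.universal (FObj N \<psi>) \<psi> (Idn K \<psi>)"
  unfolding R.universal_def
proof (intro conjI ballI)
  note \<psi>S = Rc_sub_Sc[OF \<psi>]
  show "FObj N \<psi> \<in> Obj T" by (rule N_Obj[OF \<psi>S])
  have I: "Idn K \<psi> \<in> hom K \<psi> \<psi>" by (rule K.Idn_in_hom[OF Rc_Obj[OF \<psi>]])
  then show "Idn K \<psi> \<in> FObj (FObj N \<psi>) \<psi>" using \<psi> \<psi>S by (simp add: N_FObj_FObj)
  fix d y assume d: "d \<in> Obj Rc" and "y \<in> FObj (FObj N \<psi>) d"
  then have y: "y \<in> hom K d \<psi>" using \<psi>S by (simp add: N_FObj_FObj)
  have actI: "act (FObj N \<psi>) f (Idn K \<psi>) = f" if "f \<in> hom Rc d \<psi>" for f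
    using N_act[OF \<psi>S that I] K.Cmp_Idn_left[OF Rc_homD[OF that]] by simp
  have "y \<in> hom Rc d \<psi>" using y d \<psi> Rc_hom by blast
  then show "\<exists>!f. f \<in> hom Rc d \<psi> \<and> act (FObj N \<psi>) f (Idn K \<psi>) = y"
    using actI by (intro ex1I[of _ y]) (simp, metis)
qed (rule \<psi>)

section \<open>The essential image\<close>

lemma \<kappa>_le_presheaf_map: "\<kappa> \<le>o |UNIV :: ('o, 'a, 'u) presheaf_map set|"
proof -
  \<comment> \<open>An element of \<open>'u\<close> is stored as the constant value of a component,
    with arbitrary data elsewhere. The result is not meant to be a natural transformation; only the
    size of the type matters.\<close>
  let ?f = "\<lambda>x :: 'u. (undefined, undefined, \<lambda>_. ({}, {}, \<lambda>_. x)) :: ('o, 'a, 'u) presheaf_map"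
  have "inj ?f" by (rule injI) (auto dest: fun_cong)
  then have "|UNIV :: 'u set| \<le>o |UNIV :: ('o, 'a, 'u) presheaf_map set|"
    by (intro iffD1[OF card_of_ordLeq] exI[of _ ?f]) auto
  then show ?thesis
    by (rule ordLeq_transitive[OF ordLeq_transitive[OF \<kappa>_le \<Omega>_le]])
qed

text \<open>The filtered diagram of reflexive quotients for \<open>\<phi>\<close> is renamed to an
  index category of presheaf maps; its image consists of representables and has colimit
  \<open>N \<phi>\<close>.\<close>

lemma N_Ind:
  assumes \<phi>: "\<phi> \<in> Obj Sc"
  shows "FObj N \<phi> \<in> Obj (Ind \<kappa> \<Omega> Rc)"
  unfolding Ind_def presheaf_closure_Obj
proof (intro conjI allI impI)
  show "FObj N \<phi> \<in> Obj T" by (rule N_Obj[OF \<phi>])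
  fix S assume S: "S \<subseteq> Obj T \<and> replete T S \<and> representables \<Omega> Rc \<subseteq> S \<and>
    closed_under_colimits {J :: (('o, 'a, 'u) presheaf_map, ('o, 'a, 'u) presheaf_map) cat.
      category J \<and> |Arr J| <o \<kappa> \<and> filtered J} T S"
  obtain A :: "(('o, 'a, 'u) presheaf_map, ('o, 'a, 'u) presheaf_map \<times> ('o, 'a, 'u) presheaf_map \<times> ('o, 'a, 'u) presheaf_map) cat"
    and D \<mu> where A: "category A" "filtered A" "|Arr A| <o \<kappa>" and D: "is_functor A K D"
    and DR: "\<And>i. i \<in> Obj A \<Longrightarrow> FObj D i \<in> K.reflexive_quotients" and colim: "is_colimit A K D \<phi> \<mu>"
    by (rule K.filtered_presentation[OF reg_\<kappa> conjunct1[OF Sc_wsifted_presentable[OF \<phi>]]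
      conjunct2[OF Sc_wsifted_presentable[OF \<phi>]]]) (rule that)
  obtain J :: "(('o, 'a, 'u) presheaf_map, ('o, 'a, 'u) presheaf_map) cat" and D' \<mu>'
    where J: "category J" "filtered J" "|Arr J| <o \<kappa>" and D': "is_functor J K D'" "is_colimit J K D' \<phi> \<mu>'"
      "FObj D' ` Obj J = FObj D ` Obj A"
    by (rule filtered_transport[OF A reg_\<kappa> \<kappa>_le_presheaf_map D colim])
  have R: "FObj D' i \<in> Obj Rc" if "i \<in> Obj J" for i
  proof -
    have "FObj D' i \<in> FObj D ` Obj A" using that D'(3) by blast
    then show ?thesis using DR reflexive_quotients_Rc by auto
  qed
  have "is_colimit J T (ND J D') (FObj N \<phi>) (\<lambda>i\<in>Obj J. FArr N (\<mu>' i))"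
    by (rule N_filtered_colimit[OF J(1,3,2) D'(1,2) Rc_sub_Sc[OF R] \<phi>])
  moreover have "is_functor J T (ND J D')"
    by (rule ND_functor[OF J(1) D'(1) Rc_sub_Sc[OF R]])
  moreover have "FObj (ND J D') i \<in> S" if "i \<in> Obj J" for i
    using R.universal_representable[OF N_universal[OF R[OF that]]] S that by (auto simp: ND_def)
  ultimately show "FObj N \<phi> \<in> S"
    using S J unfolding closed_under_colimits_def by blast
qed

text \<open>A diagram with values only isomorphic to values of \<open>N\<close> is straightened:
  conjugation by chosen isomorphisms makes it a diagram of objects \<open>N (\<Phi> i)\<close>, full
  faithfulness lifts that to Sind(C), and the colimit formed there is preserved by
  \<open>N\<close>.\<close>

lemma iso_diagram_colimit:
  fixes J :: "('u, 'u) cat"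
  assumes J: "category J" "|Arr J| <o \<kappa>" "filtered J" and D: "is_functor J T D"
    and iso: "\<And>i. i \<in> Obj J \<Longrightarrow> \<exists>\<phi> \<in> Obj Sc. isomorphic T (FObj N \<phi>) (FObj D i)"
    and Y: "is_colimit J T D Y \<nu>"
  shows "\<exists>\<phi> \<in> Obj Sc. isomorphic T (FObj N \<phi>) Y"
proof -
  interpret J: category J by (rule J)
  let ?Q = "\<lambda>i (\<phi>, a, b). \<phi> \<in> Obj Sc \<and> a \<in> hom T (FObj N \<phi>) (FObj D i) \<and> b \<in> hom T (FObj D i) (FObj N \<phi>) \<and>
    Cmp T b a = Idn T (FObj N \<phi>) \<and> Cmp T a b = Idn T (FObj D i)"
  have "\<forall>i \<in> Obj J. \<exists>q. ?Q i q"
    using iso unfolding isomorphic_def by fast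
  then obtain q where q: "\<forall>i \<in> Obj J. ?Q i (q i)"
    using bchoice[of "Obj J" ?Q] by blast
  define \<Phi> a b where "\<Phi> i = fst (q i)" and "a i = fst (snd (q i))" and "b i = snd (snd (q i))" for i
  have \<Phi>: "\<Phi> i \<in> Obj Sc" and a: "a i \<in> hom T (FObj N (\<Phi> i)) (FObj D i)"
    and b: "b i \<in> hom T (FObj D i) (FObj N (\<Phi> i))"
    and ba: "Cmp T (b i) (a i) = Idn T (FObj N (\<Phi> i))"
    and ab: "Cmp T (a i) (b i) = Idn T (FObj D i)" if "i \<in> Obj J" for i
    using q[rule_format, OF that] by (simp_all add: \<Phi>_def a_def b_def case_prod_beta)
  have ff: "bij_betw (FArr N) (hom Sc \<phi> \<phi>') (hom T (FObj N \<phi>) (FObj N \<phi>'))"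
    if "\<phi> \<in> Obj Sc" "\<phi>' \<in> Obj Sc" for \<phi> \<phi>'
    using N_full_and_faithful that unfolding full_and_faithful_def by blast
  \<comment> \<open>The arrow of the diagram conjugated by the isomorphisms \<open>a\<close> and
    \<open>b\<close>; it runs between values of \<open>N\<close> and thus has a unique lift.\<close>
  define c where "c \<theta> = Cmp T (b (Cod J \<theta>)) (Cmp T (FArr D \<theta>) (a (Dom J \<theta>)))" for \<theta>
  have c: "c \<theta> \<in> hom T (FObj N (\<Phi> i)) (FObj N (\<Phi> j))" if "\<theta> \<in> hom J i j" for \<theta> i j
    using that J.hom_Obj[OF that] T.Cmp_in_hom[OF T.Cmp_in_hom[OF a is_functor_hom[OF D that]] b]
    unfolding c_def hom_memD[OF that] by blast
  have full: "\<exists>f \<in> hom Sc (\<Phi> i) (\<Phi> j). FArr N f = c \<theta>" if "\<theta> \<in> hom J i j" for \<theta> i j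
  proof -
    have "c \<theta> \<in> FArr N ` hom Sc (\<Phi> i) (\<Phi> j)"
      unfolding bij_betw_imp_surj_on[OF ff[OF \<Phi>[OF J.hom_Obj(1)[OF that]] \<Phi>[OF J.hom_Obj(2)[OF that]]]]
      by (rule c[OF that])
    then show ?thesis by auto
  qed
  have "\<exists>f. f \<in> hom Sc (\<Phi> (Dom J \<theta>)) (\<Phi> (Cod J \<theta>)) \<and> FArr N f = c \<theta>" if "\<theta> \<in> Arr J" for \<theta>
    using full[OF hom_memI[OF that refl refl]] by blast
  then obtain f where f0: "\<And>\<theta>. \<theta> \<in> Arr J \<Longrightarrow> f \<theta> \<in> hom Sc (\<Phi> (Dom J \<theta>)) (\<Phi> (Cod J \<theta>)) \<and> FArr N (f \<theta>) = c \<theta>"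
    by metis
  have f: "f \<theta> \<in> hom Sc (\<Phi> i) (\<Phi> j)" "FArr N (f \<theta>) = c \<theta>" if "\<theta> \<in> hom J i j" for \<theta> i j
    using f0[OF hom_memD(1)[OF that]] hom_memD[OF that] by auto
  have faithful: "x = y" if "x \<in> hom Sc (\<Phi> i) (\<Phi> j)" "y \<in> hom Sc (\<Phi> i) (\<Phi> j)" "FArr N x = FArr N y" "i \<in> Obj J" "j \<in> Obj J"
    for x y i j
    using inj_onD[OF bij_betw_imp_inj_on[OF ff[OF \<Phi>[OF that(4)] \<Phi>[OF that(5)]]] that(3,1,2)] .
  define E where "E = \<lparr>FObj = (\<lambda>i\<in>Obj J. \<Phi> i), FArr = (\<lambda>\<theta>\<in>Arr J. f \<theta>)\<rparr>"
  have E: "is_functor J K E"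
    unfolding is_functor_def
  proof (intro conjI ballI impI)
    show "FObj E \<in> Obj J \<rightarrow>\<^sub>E Obj K" using \<Phi> Sc_Obj by (auto simp: E_def)
    have fK: "f \<theta> \<in> hom K (\<Phi> (Dom J \<theta>)) (\<Phi> (Cod J \<theta>))" if "\<theta> \<in> Arr J" for \<theta>
      using f0[OF that] Sc_homD by blast
    show "FArr E \<in> Arr J \<rightarrow>\<^sub>E Arr K" using hom_memD(1)[OF fK] by (auto simp: E_def)
    show "FArr E \<theta> \<in> hom K (FObj E (Dom J \<theta>)) (FObj E (Cod J \<theta>))" if "\<theta> \<in> Arr J" for \<theta>
      using fK[OF that] J.Dom_in_Obj[OF that] J.Cod_in_Obj[OF that] that by (simp add: E_def)
    show "FArr E (Idn J i) = Idn K (FObj E i)" if i: "i \<in> Obj J" for i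
    proof -
      note I = J.Idn_in_hom[OF i]
      have "f (Idn J i) = Idn Sc (\<Phi> i)"
      proof (rule faithful[OF f(1)[OF I] category.Idn_in_hom[OF category_Sc \<Phi>[OF i]] _ i i])
        have "FArr N (f (Idn J i)) = Cmp T (b i) (Cmp T (Idn T (FObj D i)) (a i))"
          using f(2)[OF I] is_functor_Idn[OF D i] by (simp add: c_def hom_memD[OF I])
        also have "\<dots> = Idn T (FObj N (\<Phi> i))" using T.Cmp_Idn_left[OF a[OF i]] ba[OF i] by simp
        also have "\<dots> = FArr N (Idn Sc (\<Phi> i))" using N_Idn[OF \<Phi>[OF i]] by (simp add: Sc_simps)
        finally show "FArr N (f (Idn J i)) = FArr N (Idn Sc (\<Phi> i))" .
      qed
      then show ?thesis using i hom_memD(1)[OF I] by (simp add: E_def Sc_simps)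
    qed
    fix \<theta> \<eta> assume te: "\<theta> \<in> Arr J" "\<eta> \<in> Arr J" "Cod J \<theta> = Dom J \<eta>"
    have h: "\<theta> \<in> hom J (Dom J \<theta>) (Cod J \<theta>)" "\<eta> \<in> hom J (Cod J \<theta>) (Cod J \<eta>)" using te by (auto simp: hom_def)
    note o = J.hom_Obj[OF h(1)] J.hom_Obj(2)[OF h(2)]
    note he = J.Cmp_in_hom[OF h]
    note D\<theta> = is_functor_hom[OF D h(1)] and D\<eta> = is_functor_hom[OF D h(2)]
    have fe: "Cmp K (f \<eta>) (f \<theta>) \<in> hom Sc (\<Phi> (Dom J \<theta>)) (\<Phi> (Cod J \<eta>))"
      using category.Cmp_in_hom[OF category_Sc f(1)[OF h(1)] f(1)[OF h(2)]] by (simp add: Sc_simps)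
    have "f (Cmp J \<eta> \<theta>) = Cmp K (f \<eta>) (f \<theta>)"
    proof (rule faithful[OF f(1)[OF he] fe _ o(1,3)])
      let ?x = "Cmp T (FArr D \<theta>) (a (Dom J \<theta>))"
      have x: "?x \<in> hom T (FObj N (\<Phi> (Dom J \<theta>))) (FObj D (Cod J \<theta>))" by (rule T.Cmp_in_hom[OF a[OF o(1)] D\<theta>])
      have "FArr N (Cmp K (f \<eta>) (f \<theta>)) = Cmp T (c \<eta>) (c \<theta>)"
        using N_Cmp[OF f(1)[OF h(1)] f(1)[OF h(2)]] f(2)[OF h(1)] f(2)[OF h(2)] by simp
      also have "\<dots> = Cmp T (Cmp T (b (Cod J \<eta>)) (Cmp T (FArr D \<eta>) (a (Cod J \<theta>)))) (Cmp T (b (Cod J \<theta>)) ?x)"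
        by (simp add: c_def te(3))
      also have "\<dots> = Cmp T (b (Cod J \<eta>)) (Cmp T (Cmp T (FArr D \<eta>) (a (Cod J \<theta>))) (Cmp T (b (Cod J \<theta>)) ?x))"
        by (rule T.assoc[OF T.Cmp_in_hom[OF x b[OF o(2)]] T.Cmp_in_hom[OF a[OF o(2)] D\<eta>] b[OF o(3)]])
      also have "Cmp T (Cmp T (FArr D \<eta>) (a (Cod J \<theta>))) (Cmp T (b (Cod J \<theta>)) ?x) =
          Cmp T (FArr D \<eta>) (Cmp T (a (Cod J \<theta>)) (Cmp T (b (Cod J \<theta>)) ?x))"
        by (rule T.assoc[OF T.Cmp_in_hom[OF x b[OF o(2)]] a[OF o(2)] D\<eta>])
      also have "Cmp T (a (Cod J \<theta>)) (Cmp T (b (Cod J \<theta>)) ?x) = ?x"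
        using T.assoc[OF x b[OF o(2)] a[OF o(2)]] ab[OF o(2)] T.Cmp_Idn_left[OF x] by simp
      also have "Cmp T (FArr D \<eta>) ?x = Cmp T (Cmp T (FArr D \<eta>) (FArr D \<theta>)) (a (Dom J \<theta>))"
        using T.assoc[OF a[OF o(1)] D\<theta> D\<eta>] by simp
      also have "Cmp T (b (Cod J \<eta>)) \<dots> = c (Cmp J \<eta> \<theta>)"
        using is_functor_Cmp[OF D h] by (simp add: c_def hom_memD[OF he])
      finally show "FArr N (f (Cmp J \<eta> \<theta>)) = FArr N (Cmp K (f \<eta>) (f \<theta>))" using f(2)[OF he] by simp
    qed
    then show "FArr E (Cmp J \<eta> \<theta>) = Cmp K (FArr E \<eta>) (FArr E \<theta>)"
      using te hom_memD(1)[OF he] by (simp add: E_def)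
  qed
  have ES: "FObj E i \<in> Obj Sc" if "i \<in> Obj J" for i using \<Phi> that by (simp add: E_def)
  \<comment> \<open>The colimit is formed in all presheaves on \<open>C\<close>. It belongs to
    Sind(C) because a filtered category is sifted.\<close>
  obtain X \<mu> where X: "is_colimit J K E X \<mu>"
    by (rule colimit_pointwise[OF reg_\<Omega> \<Omega>_le J(1) \<kappa>_less_\<Omega>[OF kap.less_Obj[OF J(1,2)]] E]) blast
  have XS: "X \<in> Obj Sc"
    by (rule Sc_colimit[OF J(1,2) filtered_imp_sifted[OF J(1,3)] E ES X])
  define \<rho> where "\<rho> = (\<lambda>i\<in>Obj J. FArr N (\<mu> i))"
  have NX: "is_colimit J T (ND J E) (FObj N X) \<rho>"
    unfolding \<rho>_def by (rule N_filtered_colimit[OF J E X ES XS])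
  have NE: "FObj (ND J E) i = FObj N (\<Phi> i)" if "i \<in> Obj J" for i using that by (simp add: ND_def E_def)
  have NEa: "FArr (ND J E) \<theta> = c \<theta>" if "\<theta> \<in> hom J i j" for \<theta> i j
    using f(2)[OF that] hom_memD(1)[OF that] by (simp add: ND_def E_def)
  have \<rho>: "\<rho> i \<in> hom T (FObj N (\<Phi> i)) (FObj N X)" if "i \<in> Obj J" for i
    using is_colimit_hom[OF NX that] NE[OF that] by simp
  have ac: "Cmp T (a j) (c \<theta>) = Cmp T (FArr D \<theta>) (a i)" "Cmp T (c \<theta>) (b i) = Cmp T (b j) (FArr D \<theta>)"
    if \<theta>: "\<theta> \<in> hom J i j" for \<theta> i j
  proof -
    note o = J.hom_Obj[OF \<theta>] and D\<theta> = is_functor_hom[OF D \<theta>]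
    note x = T.Cmp_in_hom[OF a[OF o(1)] D\<theta>]
    show "Cmp T (a j) (c \<theta>) = Cmp T (FArr D \<theta>) (a i)"
      unfolding c_def hom_memD[OF \<theta>] using T.assoc[OF x b[OF o(2)] a[OF o(2)]] ab[OF o(2)] T.Cmp_Idn_left[OF x] by simp
    show "Cmp T (c \<theta>) (b i) = Cmp T (b j) (FArr D \<theta>)"
      unfolding c_def hom_memD[OF \<theta>]
      using T.assoc[OF b[OF o(1)] x b[OF o(2)]] T.assoc[OF b[OF o(1)] a[OF o(1)] D\<theta>] ab[OF o(1)] T.Cmp_Idn_right[OF D\<theta>] by simp
  qed
  \<comment> \<open>Cocones on the conjugated diagram and on the original one correspond by
    composition with \<open>a\<close> and \<open>b\<close>, so \<open>N X\<close> is also a colimit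
    of the original diagram.\<close>
  have NXD: "is_colimit J T D (FObj N X) (\<lambda>i\<in>Obj J. Cmp T (\<rho> i) (b i))"
    unfolding is_colimit_def
  proof (intro conjI allI impI)
    show "is_cocone J T D (FObj N X) (\<lambda>i\<in>Obj J. Cmp T (\<rho> i) (b i))"
      unfolding is_cocone_def
    proof (intro conjI ballI)
      show "FObj N X \<in> Obj T" by (rule N_Obj[OF XS])
      show "(\<lambda>i\<in>Obj J. Cmp T (\<rho> i) (b i)) i \<in> hom T (FObj D i) (FObj N X)" if "i \<in> Obj J" for i
        using T.Cmp_in_hom[OF b[OF that] \<rho>[OF that]] that by simp
      fix \<theta> assume "\<theta> \<in> Arr J"
      then have \<theta>: "\<theta> \<in> hom J (Dom J \<theta>) (Cod J \<theta>)" by (simp add: hom_def)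
      note o = J.hom_Obj[OF \<theta>] and D\<theta> = is_functor_hom[OF D \<theta>]
      have "is_cocone J T (ND J E) (FObj N X) \<rho>" using NX unfolding is_colimit_def by (rule conjunct1)
      then have "Cmp T (\<rho> (Cod J \<theta>)) (c \<theta>) = \<rho> (Dom J \<theta>)" using is_cocone_comm[OF _ \<theta>] NEa[OF \<theta>] by metis
      then have "Cmp T (Cmp T (\<rho> (Cod J \<theta>)) (b (Cod J \<theta>))) (FArr D \<theta>) = Cmp T (\<rho> (Dom J \<theta>)) (b (Dom J \<theta>))"
        using T.assoc[OF D\<theta> b[OF o(2)] \<rho>[OF o(2)]] ac(2)[OF \<theta>] T.assoc[OF b[OF o(1)] c[OF \<theta>] \<rho>[OF o(2)]] by simp
      then show "Cmp T ((\<lambda>i\<in>Obj J. Cmp T (\<rho> i) (b i)) (Cod J \<theta>)) (FArr D \<theta>) = (\<lambda>i\<in>Obj J. Cmp T (\<rho> i) (b i)) (Dom J \<theta>)"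
        using o by simp
    qed simp
    fix Z \<zeta> assume \<zeta>: "is_cocone J T D Z \<zeta>"
    note \<zeta>h = is_cocone_hom[OF \<zeta>]
    have coc: "is_cocone J T (ND J E) Z (\<lambda>i\<in>Obj J. Cmp T (\<zeta> i) (a i))"
      unfolding is_cocone_def
    proof (intro conjI ballI)
      show "Z \<in> Obj T" using \<zeta> by (simp add: is_cocone_def)
      show "(\<lambda>i\<in>Obj J. Cmp T (\<zeta> i) (a i)) i \<in> hom T (FObj (ND J E) i) Z" if "i \<in> Obj J" for i
        using T.Cmp_in_hom[OF a[OF that] \<zeta>h[OF that]] that NE by simp
      fix \<theta> assume "\<theta> \<in> Arr J"
      then have \<theta>: "\<theta> \<in> hom J (Dom J \<theta>) (Cod J \<theta>)" by (simp add: hom_def)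
      note o = J.hom_Obj[OF \<theta>] and D\<theta> = is_functor_hom[OF D \<theta>]
      have "Cmp T (Cmp T (\<zeta> (Cod J \<theta>)) (a (Cod J \<theta>))) (c \<theta>) = Cmp T (\<zeta> (Dom J \<theta>)) (a (Dom J \<theta>))"
        using T.assoc[OF c[OF \<theta>] a[OF o(2)] \<zeta>h[OF o(2)]] ac(1)[OF \<theta>] T.assoc[OF a[OF o(1)] D\<theta> \<zeta>h[OF o(2)]]
          is_cocone_comm[OF \<zeta> \<theta>] by simp
      then show "Cmp T ((\<lambda>i\<in>Obj J. Cmp T (\<zeta> i) (a i)) (Cod J \<theta>)) (FArr (ND J E) \<theta>) = (\<lambda>i\<in>Obj J. Cmp T (\<zeta> i) (a i)) (Dom J \<theta>)"
        using o NEa[OF \<theta>] by simp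
    qed simp
    have "\<exists>!h. h \<in> hom T (FObj N X) Z \<and> (\<forall>i\<in>Obj J. Cmp T h (\<rho> i) = (\<lambda>i\<in>Obj J. Cmp T (\<zeta> i) (a i)) i)"
      using NX coc unfolding is_colimit_def by blast
    moreover have "(\<forall>i\<in>Obj J. Cmp T h (\<rho> i) = (\<lambda>i\<in>Obj J. Cmp T (\<zeta> i) (a i)) i) \<longleftrightarrow>
        (\<forall>i\<in>Obj J. Cmp T h ((\<lambda>i\<in>Obj J. Cmp T (\<rho> i) (b i)) i) = \<zeta> i)" if h: "h \<in> hom T (FObj N X) Z" for h
    proof (rule ball_cong[OF refl])
      fix i assume i: "i \<in> Obj J"
      note hr = T.Cmp_in_hom[OF \<rho>[OF i] h]
      have 1: "Cmp T h (Cmp T (\<rho> i) (b i)) = Cmp T (Cmp T h (\<rho> i)) (b i)"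
        using T.assoc[OF b[OF i] \<rho>[OF i] h] by simp
      have "Cmp T h (\<rho> i) = Cmp T (\<zeta> i) (a i) \<longleftrightarrow> Cmp T h (Cmp T (\<rho> i) (b i)) = \<zeta> i"
      proof
        assume "Cmp T h (\<rho> i) = Cmp T (\<zeta> i) (a i)"
        then show "Cmp T h (Cmp T (\<rho> i) (b i)) = \<zeta> i"
          using 1 T.assoc[OF b[OF i] a[OF i] \<zeta>h[OF i]] ab[OF i] T.Cmp_Idn_right[OF \<zeta>h[OF i]] by simp
      next
        assume "Cmp T h (Cmp T (\<rho> i) (b i)) = \<zeta> i"
        then have "Cmp T (\<zeta> i) (a i) = Cmp T (Cmp T (Cmp T h (\<rho> i)) (b i)) (a i)" using 1 by simp
        also have "\<dots> = Cmp T h (\<rho> i)"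
          using T.assoc[OF a[OF i] b[OF i] hr] ba[OF i] T.Cmp_Idn_right[OF hr] by simp
        finally show "Cmp T h (\<rho> i) = Cmp T (\<zeta> i) (a i)" by simp
      qed
      then show "Cmp T h (\<rho> i) = (\<lambda>i\<in>Obj J. Cmp T (\<zeta> i) (a i)) i \<longleftrightarrow>
          Cmp T h ((\<lambda>i\<in>Obj J. Cmp T (\<rho> i) (b i)) i) = \<zeta> i"
        using i by simp
    qed
    ultimately show "\<exists>!h. h \<in> hom T (FObj N X) Z \<and> (\<forall>i\<in>Obj J. Cmp T h ((\<lambda>i\<in>Obj J. Cmp T (\<rho> i) (b i)) i) = \<zeta> i)"
      by (metis (no_types, lifting))
  qed
  obtain h h' where h: "h \<in> hom T (FObj N X) Y" "h' \<in> hom T Y (FObj N X)"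
    "Cmp T h' h = Idn T (FObj N X)" "Cmp T h h' = Idn T Y"
    by (rule T.colimit_unique[OF NXD Y])
  have "isomorphic T (FObj N X) Y"
    unfolding isomorphic_def using h T.hom_Obj[OF h(1)] by blast
  then show ?thesis using XS by blast
qed

text \<open>The class of presheaves isomorphic to a value of \<open>N\<close> is replete, contains
  the representables of Rec(C), and is closed under \<kappa>-small filtered colimits; Ind is the
  least such class.\<close>

lemma Ind_essential:
  assumes "Y \<in> Obj (Ind \<kappa> \<Omega> Rc)"
  shows "\<exists>\<phi> \<in> Obj Sc. isomorphic T (FObj N \<phi>) Y"
  using assms unfolding Ind_def
proof (rule presheaf_closure_induct)
  show "replete T {Y \<in> Obj T. \<exists>\<phi> \<in> Obj Sc. isomorphic T (FObj N \<phi>) Y}"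
    unfolding replete_def
  proof (intro ballI allI impI)
    fix X Y assume X: "X \<in> {Y \<in> Obj T. \<exists>\<phi> \<in> Obj Sc. isomorphic T (FObj N \<phi>) Y}" and XY: "isomorphic T X Y"
    then have "Y \<in> Obj T" by (simp add: isomorphic_def)
    then show "Y \<in> {Y \<in> Obj T. \<exists>\<phi> \<in> Obj Sc. isomorphic T (FObj N \<phi>) Y}"
      using X isomorphic_trans[OF T.category_axioms _ XY] by blast
  qed
next
  fix F :: "('o, 'a, 'u) presheaf2"
  assume F: "F \<in> representables \<Omega> Rc"
  obtain \<psi> w where W: "R.universal F \<psi> w" by (rule R.representable_universal[OF F])
  note w = R.universalD[OF W]
  note V = N_universal[OF w(2)]
  note v = R.universalD[OF V]
  \<comment> \<open>Two presheaves with universal elements at the same object are isomorphic, by the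
    maps that exchange these elements.\<close>
  obtain \<alpha> where \<alpha>: "\<alpha> \<in> hom T (FObj N \<psi>) F" "app \<alpha> \<psi> (Idn K \<psi>) = w" by (rule R.yoneda[OF V w(1,3)])
  obtain \<beta> where \<beta>: "\<beta> \<in> hom T F (FObj N \<psi>)" "app \<beta> \<psi> w = Idn K \<psi>" by (rule R.yoneda[OF W v(1,3)])
  have "Cmp T \<beta> \<alpha> = Idn T (FObj N \<psi>)"
    by (rule R.yoneda_ext[OF V T.Cmp_in_hom[OF \<alpha>(1) \<beta>(1)] T.Idn_in_hom[OF v(1)]])
      (use R.app_Cmp[OF \<alpha>(1) \<beta>(1) v(2,3)] \<alpha>(2) \<beta>(2) R.app_Idn[OF v(2,3)] in simp)
  moreover have "Cmp T \<alpha> \<beta> = Idn T F"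
    by (rule R.yoneda_ext[OF W T.Cmp_in_hom[OF \<beta>(1) \<alpha>(1)] T.Idn_in_hom[OF w(1)]])
      (use R.app_Cmp[OF \<beta>(1) \<alpha>(1) w(2,3)] \<alpha>(2) \<beta>(2) R.app_Idn[OF w(2,3)] in simp)
  ultimately have "isomorphic T (FObj N \<psi>) F"
    unfolding isomorphic_def using \<alpha>(1) \<beta>(1) v(1) w(1) by blast
  then show "\<exists>\<phi> \<in> Obj Sc. isomorphic T (FObj N \<phi>) F"
    using Rc_sub_Sc[OF w(2)] by blast
next
  show "closed_under_colimits {J :: (('o, 'a, 'u) presheaf_map, ('o, 'a, 'u) presheaf_map) cat.
      category J \<and> |Arr J| <o \<kappa> \<and> filtered J} T {Y \<in> Obj T. \<exists>\<phi> \<in> Obj Sc. isomorphic T (FObj N \<phi>) Y}"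
    unfolding closed_under_colimits_def
  proof (intro ballI allI impI)
    fix J :: "(('o, 'a, 'u) presheaf_map, ('o, 'a, 'u) presheaf_map) cat" and D Y \<nu>
    assume "J \<in> {J. category J \<and> |Arr J| <o \<kappa> \<and> filtered J}"
      and D: "is_functor J T D \<and> (\<forall>i\<in>Obj J. FObj D i \<in> {Y \<in> Obj T. \<exists>\<phi> \<in> Obj Sc. isomorphic T (FObj N \<phi>) Y}) \<and>
        is_colimit J T D Y \<nu>"
    then have J: "category J" "filtered J" "|Arr J| <o \<kappa>" by auto
    \<comment> \<open>The index category is renamed into \<open>'u\<close>, because closure of
      Sind(C) is available for index categories in that type.\<close>
    obtain J' :: "('u, 'u) cat" and D' \<nu>' where J': "category J'" "filtered J'" "|Arr J'| <o \<kappa>"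
      and D': "is_functor J' T D'" "is_colimit J' T D' Y \<nu>'" "FObj D' ` Obj J' = FObj D ` Obj J"
      by (rule filtered_transport[OF J reg_\<kappa> ordLeq_transitive[OF \<kappa>_le \<Omega>_le] conjunct1[OF D] conjunct2[OF conjunct2[OF D]]])
    have "\<exists>\<phi> \<in> Obj Sc. isomorphic T (FObj N \<phi>) (FObj D' i)" if "i \<in> Obj J'" for i
    proof -
      have "FObj D' i \<in> FObj D ` Obj J" using D'(3) that by blast
      then show ?thesis using D by auto
    qed
    then have "\<exists>\<phi> \<in> Obj Sc. isomorphic T (FObj N \<phi>) Y"
      by (rule iso_diagram_colimit[OF J'(1,3,2) D'(1) _ D'(2)])
    moreover have "Y \<in> Obj T"
      using D by (simp add: is_colimit_def is_cocone_def)
    ultimately show "Y \<in> {Y \<in> Obj T. \<exists>\<phi> \<in> Obj Sc. isomorphic T (FObj N \<phi>) Y}" by blast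
  qed
qed

text \<open>Both sides are full subcategories of the same presheaf category, so equality reduces to
  equality of their classes of objects; repleteness passes from the values of \<open>N\<close> to
  all objects isomorphic to them.\<close>

lemma essential_image_N: "essential_image Sc T N = Ind \<kappa> \<Omega> Rc"
  unfolding essential_image_def Ind_def presheaf_closure_def
proof (rule full_subcat_cong[OF T.category_axioms])
  let ?cl = "closed_under_colimits {J :: (('o, 'a, 'u) presheaf_map, ('o, 'a, 'u) presheaf_map) cat.
      category J \<and> |Arr J| <o \<kappa> \<and> filtered J} T"
  let ?I = "\<Inter>{S. S \<subseteq> Obj T \<and> replete T S \<and> representables \<Omega> Rc \<subseteq> S \<and> ?cl S}"
  have Ind: "Y \<in> Obj (Ind \<kappa> \<Omega> Rc) \<longleftrightarrow> Y \<in> Obj T \<inter> ?I" for Y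
    by (simp add: Ind_def presheaf_closure_def full_subcat_simps)
  show "Obj T \<inter> {y. \<exists>x\<in>Obj Sc. isomorphic T (FObj N x) y} = Obj T \<inter> ?I"
  proof
    show "Obj T \<inter> {y. \<exists>x\<in>Obj Sc. isomorphic T (FObj N x) y} \<subseteq> Obj T \<inter> ?I"
    proof
      fix Y assume "Y \<in> Obj T \<inter> {y. \<exists>x\<in>Obj Sc. isomorphic T (FObj N x) y}"
      then obtain \<phi> where Y: "Y \<in> Obj T" "\<phi> \<in> Obj Sc" "isomorphic T (FObj N \<phi>) Y" by blast
      have "FObj N \<phi> \<in> ?I" using N_Ind[OF Y(2)] unfolding Ind by blast
      then show "Y \<in> Obj T \<inter> ?I"
        using Y(1,3) unfolding replete_def by blast
    qed
    show "Obj T \<inter> ?I \<subseteq> Obj T \<inter> {y. \<exists>x\<in>Obj Sc. isomorphic T (FObj N x) y}"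
      using Ind_essential unfolding Ind by blast
  qed
qed

end

theorem theorem5p1:
  fixes \<kappa> :: "'k rel" and \<Omega> :: "'l rel" and C :: "('o, 'a) cat"
    and SindC RecC :: "(('o, 'a, 'u) presheaf, ('o, 'a, 'u) presheaf_map) cat"
  defines "SindC \<equiv> Sind \<kappa> \<Omega> C" and "RecC \<equiv> Rec \<Omega> C"
  assumes "Card_order \<Omega>" and "regularCard \<Omega>" and "\<Omega> \<le>o |UNIV :: 'u set|"
    and "Card_order \<kappa>" and "regularCard \<kappa>" and "natLeq <o \<kappa>" and "\<kappa> \<le>o \<Omega>"
    and "category C" and "locally_small \<Omega> C" and "has_pullbacks C"
  shows "is_functor SindC (psh \<Omega> RecC) (restricted_yoneda SindC RecC) \<and>
    full_and_faithful SindC (psh \<Omega> RecC) (restricted_yoneda SindC RecC) \<and>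
    essential_image SindC (psh \<Omega> RecC) (restricted_yoneda SindC RecC) = Ind \<kappa> \<Omega> RecC"
proof -
  \<comment> \<open>Uncountability of \<open>\<Omega>\<close> comes from
    \<open>\<kappa> \<le>o \<Omega>\<close>.\<close>
  have "regular_uncountable \<Omega>" "regular_uncountable \<kappa>"
    using assms ordLess_ordLeq_trans by (auto simp: regular_uncountable_def)
  then interpret pullback_presheaves C \<Omega> \<kappa> "TYPE('u)"
    using assms by (simp add: pullback_presheaves_def presheaves_def pullback_presheaves_axioms_def)
  show ?thesis
    unfolding SindC_def RecC_def using N_functor N_full_and_faithful essential_image_N by blast
qed

end
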